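(* Let $R$ be a commutative ring. Let $\mathscr C_R$ be the dg category of bounded complexes of finitely generated free $R$-modules, $\mathrm{quis}$ its set of quasi-isomorphisms, and let $$\mathrm{Cone}:\mathrm{Fun}([1],\mathscr C_R^{[-1]})\to\mathscr C_R^{[0]}$$ be the cone dg form functor. Let $w$ be the set of morphisms $f$ in $\mathrm{Fun}([1],\mathscr C_R^{[-1]})$ for which $\mathrm{Cone}(f)$ is a quasi-isomorphism. Then: (1) The cone functor induces an equivalence of triangulated categories $w^{-1}\mathrm{Fun}([1],\mathscr C_R^{[-1]})\xrightarrow{\simeq}\mathrm{quis}^{-1}\mathscr C_R^{[0]}$. (2) If $2$ is not a unit in $R$, then the map $GW_0(\mathrm{Fun}([1],\mathscr C_R^{[-1]}),w)\to GW_0(\mathscr C_R^{[0]},\mathrm{quis})$ induced by the cone functor is not surjective.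
   Context: Complexes are cohomologically graded with Koszul signs, $[M,N]$ is the Hom complex, and $R[n]$ is $R$ placed in degree $-n$. For a dg category $\mathcal A$, $Z^0\mathcal A$ has the same objects and as morphisms the degree $0$ cocycles of the mapping complexes. A sequence $A\xrightarrow{f}B\xrightarrow{g}C$ in $Z^0\mathcal A$ with $gf=0$ is exact if there are (not necessarily closed) degree $0$ maps $r,s$ with $rf=1$, $fr+sg=1$, $gs=1$ (for $\mathscr C_R$: degreewise split exact sequences of complexes). A dg category with duality has a dg functor $\vee:\mathcal A^{op}\to\mathcal A$ and a natural transformation $\mathrm{can}:1\to\vee\vee$ with $\mathrm{can}_A^\vee\,\mathrm{can}_{A^\vee}=1$. A dg form functor $(F,\varphi)$ is a dg functor $F$ with a natural transformation $\varphi:F\vee\to\vee F$ such that $\varphi_{A^\vee}F(\mathrm{can}_A)=\varphi_A^\vee\mathrm{can}_{FA}$. $\mathscr C_R^{[n]}$ is $\mathscr C_R$ with the duality $X\mapsto[X,R[n]]$ and $\mathrm{can}_X(x)(f)=(-1)^{|x||f|}f(x)$. $[1]$ is the category $0\to1$ with its unique duality $0\leftrightarrow1$; $\mathrm{Fun}([1],\mathcal A)$ is the dg category of closed degree $0$ maps $X\to Y$ in $\mathcal A$ with duality $(f:X\to Y)\mapsto(f^\vee:Y^\vee\to X^\vee)$. Cone functor: let $C=R[e]/e^2$ with $|e|=-1$, $de=1$, and $T=C/R=R[1]$. The exact sequence $\Gamma=(R\to C\to T)$ has a symmetric isomorphism $\gamma:\Gamma\to[\Gamma,T]$ with middle component $C\to[C,T]$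 adjoint to $C\otimes C\to C\to T$ (multiplication, projection) and outer components the canonical maps $R\cong[T,T]$, $T\cong[R,T]$. For $\mathcal B=\mathscr C_R^{[m]}$, write $\mathcal B^{[1]}=\mathscr C_R^{[1]}\otimes\mathcal B\simeq\mathscr C_R^{[m+1]}$ (equivalence given by tensor product). The dg form functor $\mathrm{Cone}:\mathrm{Fun}([1],\mathcal B)\to\mathcal B^{[1]}$, $(f:X\to Y)\mapsto(C\otimes X)\sqcup_XY$, is the composite of $(\Gamma,\gamma)\otimes-:\mathrm{Fun}([1],\mathcal B)\to\mathrm{Fun}([1],\mathrm{Ex}(\mathcal B^{[1]}))$ ($\mathrm{Ex}$ = dg category with duality of exact sequences), an inverse of the equivalence of dg categories with duality $\mathcal M\to\mathrm{Fun}([1],\mathrm{Ex}(\mathcal B^{[1]}))$, $(g_0,g_1)\mapsto g_1g_0$, and the functor $\mathcal M\to\mathcal B^{[1]}$ taking the middle term of $E^1$; here $\mathcal M$ is the dg category of composable maps of exact sequences $E^0\xrightarrow{g_0}E^1\xrightarrow{g_1}E^2$ with $g_0$ the identity on third terms and $g_1$ the identity on first terms. Grothendieck-Witt group: let $(\mathcal A,w)$ be either the pretriangulated dg category with duality $\mathscr C_R^{[0]}$ with set of weak equivalences $\mathrm{quis}$ (the quasi-isomorphisms), or the pretriangulated dg category with duality $\mathrm{Fun}([1],\mathscr C_R^{[-1]})$ with set of weak equivalences the morphisms $f$ for which $\mathrm{Cone}(f)$ is a quasi-isomorphism. Then $GW_0(\mathcal A,w)$ is the abelian group generated by symbols $[X,\varphi]$,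 where $\varphi:X\to X^\vee$ is a morphism of $Z^0\mathcal A$ lying in $w$ with $\varphi^\vee\mathrm{can}_X=\varphi$, subject to: (i) $[X,\varphi]+[Y,\psi]=[X\oplus Y,\varphi\oplus\psi]$; (ii) $[Y,\psi]=[X,g^\vee\psi g]$ for $g:X\to Y$ in $w$; (iii) if $E_\bullet=(E_{-1}\to E_0\to E_1)$ is an exact sequence in $Z^0\mathcal A$ and $(\varphi_{-1},\varphi_0,\varphi_1):E_\bullet\to E_\bullet^\vee=(E_1^\vee\to E_0^\vee\to E_{-1}^\vee)$ is a map of exact sequences with components in $w$ and $(\varphi_{-1},\varphi_0,\varphi_1)=(\varphi_1^\vee\mathrm{can},\varphi_0^\vee\mathrm{can},\varphi_{-1}^\vee\mathrm{can})$, then $[E_0,\varphi_0]=\left[E_{-1}\oplus E_1,\begin{pmatrix}0&\varphi_1\\\varphi_{-1}&0\end{pmatrix}\right]$. *)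

theory Defs
  imports "HOL-Algebra.Free_Abelian_Groups" "Jordan_Normal_Form.Matrix"
begin

section \<open>Categories, localization, triangulated equivalences\<close>

record ('o, 'm) cat =
  Ob :: "'o set"
  Hom :: "'o \<Rightarrow> 'o \<Rightarrow> 'm set"
  Comp :: "'o \<Rightarrow> 'o \<Rightarrow> 'o \<Rightarrow> 'm \<Rightarrow> 'm \<Rightarrow> 'm"  \<comment> \<open>\<open>Comp C X Y Z g f\<close> is \<open>g \<circ> f\<close> for \<open>f : X \<rightarrow> Y\<close>, \<open>g : Y \<rightarrow> Z\<close>\<close>
  Ident :: "'o \<Rightarrow> 'm"

definition cat_iso :: "('o, 'm, 'z) cat_scheme \<Rightarrow> 'o \<Rightarrow> 'o \<Rightarrow> 'm \<Rightarrow> bool" where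
  "cat_iso C X Y f \<longleftrightarrow> f \<in> Hom C X Y \<and>
     (\<exists>g \<in> Hom C Y X. Comp C X Y X g f = Ident C X \<and> Comp C Y X Y f g = Ident C Y)"

definition is_functor ::
  "('o, 'm, 'y) cat_scheme \<Rightarrow> ('p, 'n, 'z) cat_scheme \<Rightarrow> ('o \<Rightarrow> 'p) \<Rightarrow> ('o \<Rightarrow> 'o \<Rightarrow> 'm \<Rightarrow> 'n) \<Rightarrow> bool" where
  "is_functor C D FO FM \<longleftrightarrow>
     (\<forall>X \<in> Ob C. FO X \<in> Ob D \<and> FM X X (Ident C X) = Ident D (FO X)) \<and>
     (\<forall>X \<in> Ob C. \<forall>Y \<in> Ob C. \<forall>f \<in> Hom C X Y. FM X Y f \<in> Hom D (FO X) (FO Y)) \<and>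
     (\<forall>X \<in> Ob C. \<forall>Y \<in> Ob C. \<forall>Z \<in> Ob C. \<forall>f \<in> Hom C X Y. \<forall>g \<in> Hom C Y Z.
        FM X Z (Comp C X Y Z g f) = Comp D (FO X) (FO Y) (FO Z) (FM Y Z g) (FM X Y f))"

definition fully_faithful ::
  "('o, 'm, 'y) cat_scheme \<Rightarrow> ('p, 'n, 'z) cat_scheme \<Rightarrow> ('o \<Rightarrow> 'p) \<Rightarrow> ('o \<Rightarrow> 'o \<Rightarrow> 'm \<Rightarrow> 'n) \<Rightarrow> bool" where
  "fully_faithful C D FO FM \<longleftrightarrow>
     (\<forall>X \<in> Ob C. \<forall>Y \<in> Ob C. bij_betw (FM X Y) (Hom C X Y) (Hom D (FO X) (FO Y)))"

definition essentially_surjective ::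
  "('o, 'm, 'y) cat_scheme \<Rightarrow> ('p, 'n, 'z) cat_scheme \<Rightarrow> ('o \<Rightarrow> 'p) \<Rightarrow> bool" where
  "essentially_surjective C D FO \<longleftrightarrow> (\<forall>Z \<in> Ob D. \<exists>X \<in> Ob C. \<exists>e. cat_iso D (FO X) Z e)"

text \<open>
  The localization of a category \<open>C\<close> at a class \<open>W\<close> of morphisms (\<open>W X Y\<close> are those from \<open>X\<close> to \<open>Y\<close>)
  is the Gabriel--Zisman one: morphisms are zigzags, written in the order in which they are
  traversed, modulo the congruence generated by the relations \<open>zz_rel\<close>.
\<close>

datatype 'm leg = Fwd 'm | Bwd 'm

type_synonym ('o, 'm) zigzag = "('o \<times> 'm leg \<times> 'o) list"

fun is_zigzag ::
  "('o, 'm, 'z) cat_scheme \<Rightarrow> ('o \<Rightarrow> 'o \<Rightarrow> 'm set) \<Rightarrow> 'o \<Rightarrow> ('o, 'm) zigzag \<Rightarrow> 'o \<Rightarrow> bool" where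
  "is_zigzag C W X [] Y \<longleftrightarrow> X \<in> Ob C \<and> X = Y"
| "is_zigzag C W X ((A, Fwd f, B) # p) Y \<longleftrightarrow> X \<in> Ob C \<and> X = A \<and> f \<in> Hom C A B \<and> is_zigzag C W B p Y"
| "is_zigzag C W X ((A, Bwd f, B) # p) Y \<longleftrightarrow> X \<in> Ob C \<and> X = A \<and> f \<in> W B A \<and> is_zigzag C W B p Y"

inductive zz_rel ::
  "('o, 'm, 'z) cat_scheme \<Rightarrow> ('o \<Rightarrow> 'o \<Rightarrow> 'm set) \<Rightarrow> 'o \<Rightarrow> 'o \<Rightarrow> ('o, 'm) zigzag \<Rightarrow> ('o, 'm) zigzag \<Rightarrow> bool"
  for C W where
  zz_id: "X \<in> Ob C \<Longrightarrow> zz_rel C W X X [(X, Fwd (Ident C X), X)] []"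
| zz_comp: "\<lbrakk>X \<in> Ob C; Y \<in> Ob C; Z \<in> Ob C; f \<in> Hom C X Y; g \<in> Hom C Y Z\<rbrakk> \<Longrightarrow>
    zz_rel C W X Z [(X, Fwd f, Y), (Y, Fwd g, Z)] [(X, Fwd (Comp C X Y Z g f), Z)]"
| zz_fwd_bwd: "\<lbrakk>X \<in> Ob C; Y \<in> Ob C; f \<in> W X Y\<rbrakk> \<Longrightarrow> zz_rel C W X X [(X, Fwd f, Y), (Y, Bwd f, X)] []"
| zz_bwd_fwd: "\<lbrakk>X \<in> Ob C; Y \<in> Ob C; f \<in> W X Y\<rbrakk> \<Longrightarrow> zz_rel C W Y Y [(Y, Bwd f, X), (X, Fwd f, Y)] []"

inductive zz_eq ::
  "('o, 'm, 'z) cat_scheme \<Rightarrow> ('o \<Rightarrow> 'o \<Rightarrow> 'm set) \<Rightarrow> 'o \<Rightarrow> 'o \<Rightarrow> ('o, 'm) zigzag \<Rightarrow> ('o, 'm) zigzag \<Rightarrow> bool"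
  for C W where
  zz_refl: "is_zigzag C W X p Y \<Longrightarrow> zz_eq C W X Y p p"
| zz_sym: "zz_eq C W X Y p q \<Longrightarrow> zz_eq C W X Y q p"
| zz_trans: "\<lbrakk>zz_eq C W X Y p q; zz_eq C W X Y q r\<rbrakk> \<Longrightarrow> zz_eq C W X Y p r"
| zz_step: "\<lbrakk>is_zigzag C W X a A; zz_rel C W A B p q; is_zigzag C W B b Y\<rbrakk> \<Longrightarrow>
    zz_eq C W X Y (a @ p @ b) (a @ q @ b)"

definition zz_class where
  "zz_class C W X Y p = {q. zz_eq C W X Y p q}"

definition localization ::
  "('o, 'm, 'z) cat_scheme \<Rightarrow> ('o \<Rightarrow> 'o \<Rightarrow> 'm set) \<Rightarrow> ('o, ('o, 'm) zigzag set) cat" where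
  "localization C W =
     \<lparr>Ob = Ob C,
      Hom = (\<lambda>X Y. {zz_class C W X Y p | p. is_zigzag C W X p Y}),
      Comp = (\<lambda>X Y Z g f. {r. \<exists>p \<in> f. \<exists>q \<in> g. zz_eq C W X Z (p @ q) r}),
      Ident = (\<lambda>X. zz_class C W X X [])\<rparr>"

definition loc_of where  \<comment> \<open>the localization functor on morphisms\<close>
  "loc_of C W X Y f = zz_class C W X Y [(X, Fwd f, Y)]"

text \<open>
  The functor between localizations induced by a functor \<open>(FO, FM) : C \<rightarrow> D\<close> with \<open>FM W \<subseteq> V\<close>
  is \<open>FO\<close> on objects and applies \<open>FM\<close> to every leg of a zigzag.
\<close>

fun map_leg where
  "map_leg FO FM (A, Fwd f, B) = (FO A, Fwd (FM A B f), FO B)"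
| "map_leg FO FM (A, Bwd f, B) = (FO A, Bwd (FM B A f), FO B)"

definition loc_map ::
  "('p, 'n, 'z) cat_scheme \<Rightarrow> ('p \<Rightarrow> 'p \<Rightarrow> 'n set) \<Rightarrow> ('o \<Rightarrow> 'p) \<Rightarrow> ('o \<Rightarrow> 'o \<Rightarrow> 'm \<Rightarrow> 'n) \<Rightarrow>
   'o \<Rightarrow> 'o \<Rightarrow> ('o, 'm) zigzag set \<Rightarrow> ('p, 'n) zigzag set" where
  "loc_map D V FO FM X Y c = {q. \<exists>p \<in> c. zz_eq D V (FO X) (FO Y) (map (map_leg FO FM) p) q}"

text \<open>
  \<open>Tri\<close> is the class of distinguished triangles \<open>X \<rightarrow> Y \<rightarrow> Z \<rightarrow> X[1]\<close>, a triangle being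
  the tuple \<open>(X, Y, Z, u, v, w)\<close>.
\<close>

record ('o, 'm) tricat = "('o, 'm) cat" +
  Sh_ob :: "'o \<Rightarrow> 'o"
  Sh_hom :: "'o \<Rightarrow> 'o \<Rightarrow> 'm \<Rightarrow> 'm"
  Tri :: "('o \<times> 'o \<times> 'o \<times> 'm \<times> 'm \<times> 'm) set"

text \<open>
  An equivalence of triangulated categories is an equivalence of categories which admits a natural
  isomorphism \<open>\<eta> : F[1] \<rightarrow> [1]F\<close> for which it preserves distinguished triangles.  (Additivity
  and exactness of a quasi-inverse are then automatic.)
\<close>

definition triangulated_equivalence ::
  "('o, 'm) tricat \<Rightarrow> ('p, 'n) tricat \<Rightarrow> ('o \<Rightarrow> 'p) \<Rightarrow> ('o \<Rightarrow> 'o \<Rightarrow> 'm \<Rightarrow> 'n) \<Rightarrow> bool" where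
  "triangulated_equivalence C D FO FM \<longleftrightarrow>
     is_functor C D FO FM \<and> fully_faithful C D FO FM \<and> essentially_surjective C D FO \<and>
     (\<exists>\<eta>. (\<forall>X \<in> Ob C. cat_iso D (FO (Sh_ob C X)) (Sh_ob D (FO X)) (\<eta> X)) \<and>
          (\<forall>X \<in> Ob C. \<forall>Y \<in> Ob C. \<forall>f \<in> Hom C X Y.
             Comp D (FO (Sh_ob C X)) (Sh_ob D (FO X)) (Sh_ob D (FO Y))
               (Sh_hom D (FO X) (FO Y) (FM X Y f)) (\<eta> X) =
             Comp D (FO (Sh_ob C X)) (FO (Sh_ob C Y)) (Sh_ob D (FO Y))
               (\<eta> Y) (FM (Sh_ob C X) (Sh_ob C Y) (Sh_hom C X Y f))) \<and>
          (\<forall>X Y Z u v w. (X, Y, Z, u, v, w) \<in> Tri C \<longrightarrow>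
             (FO X, FO Y, FO Z, FM X Y u, FM Y Z v,
              Comp D (FO Z) (FO (Sh_ob C X)) (Sh_ob D (FO X)) (\<eta> X) (FM Z (Sh_ob C X) w)) \<in> Tri D))"


section \<open>Dg categories with shift and duality\<close>

text \<open>
  \<open>dg_hom A X Y n\<close> is the degree \<open>n\<close> part of the mapping complex.
  \<open>dg_sus X : X \<rightarrow> X[1]\<close> is the closed isomorphism of degree \<open>-1\<close> that exhibits the shift, and
  \<open>dg_can X : X \<rightarrow> X\<^sup>\<or>\<^sup>\<or>\<close>.
\<close>

record ('o, 'm) dgcat =
  dg_ob :: "'o set"
  dg_hom :: "'o \<Rightarrow> 'o \<Rightarrow> int \<Rightarrow> 'm set"
  dg_zero :: "'o \<Rightarrow> 'o \<Rightarrow> int \<Rightarrow> 'm"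
  dg_add :: "'m \<Rightarrow> 'm \<Rightarrow> 'm"
  dg_d :: "'o \<Rightarrow> 'o \<Rightarrow> 'm \<Rightarrow> 'm"
  dg_comp :: "'m \<Rightarrow> 'm \<Rightarrow> 'm"
  dg_id :: "'o \<Rightarrow> 'm"
  dg_shift :: "'o \<Rightarrow> 'o"
  dg_shift_hom :: "'m \<Rightarrow> 'm"
  dg_sus :: "'o \<Rightarrow> 'm"
  dg_dual :: "'o \<Rightarrow> 'o"
  dg_dual_hom :: "'m \<Rightarrow> 'm"
  dg_can :: "'o \<Rightarrow> 'm"

definition Z0_hom :: "('o, 'm) dgcat \<Rightarrow> 'o \<Rightarrow> 'o \<Rightarrow> 'm set" where
  "Z0_hom A X Y = {f \<in> dg_hom A X Y 0. dg_d A X Y f = dg_zero A X Y 1}"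

definition Z0 :: "('o, 'm) dgcat \<Rightarrow> ('o, 'm) cat" where
  "Z0 A = \<lparr>Ob = dg_ob A, Hom = Z0_hom A, Comp = (\<lambda>X Y Z. dg_comp A), Ident = dg_id A\<rparr>"

definition split_by :: "('o, 'm) dgcat \<Rightarrow> 'o \<times> 'm \<times> 'o \<times> 'm \<times> 'o \<Rightarrow> 'm \<Rightarrow> 'm \<Rightarrow> bool" where
  "split_by A = (\<lambda>(X, f, Y, g, Z) r s.
     r \<in> dg_hom A Y X 0 \<and> s \<in> dg_hom A Z Y 0 \<and> dg_comp A r f = dg_id A X \<and>
     dg_add A (dg_comp A f r) (dg_comp A s g) = dg_id A Y \<and> dg_comp A g s = dg_id A Z)"

definition exact_seq :: "('o, 'm) dgcat \<Rightarrow> 'o \<times> 'm \<times> 'o \<times> 'm \<times> 'o \<Rightarrow> bool" where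
  "exact_seq A = (\<lambda>(X, f, Y, g, Z).
     X \<in> dg_ob A \<and> Y \<in> dg_ob A \<and> Z \<in> dg_ob A \<and> f \<in> Z0_hom A X Y \<and> g \<in> Z0_hom A Y Z \<and>
     dg_comp A g f = dg_zero A X Z 0 \<and> (\<exists>r s. split_by A (X, f, Y, g, Z) r s))"

definition exact_seq_map ::
  "('o, 'm) dgcat \<Rightarrow> 'o \<times> 'm \<times> 'o \<times> 'm \<times> 'o \<Rightarrow> 'o \<times> 'm \<times> 'o \<times> 'm \<times> 'o \<Rightarrow> 'm \<times> 'm \<times> 'm \<Rightarrow> bool" where
  "exact_seq_map A = (\<lambda>(X, f, Y, g, Z) (X', f', Y', g', Z') (a, b, c).
     a \<in> Z0_hom A X X' \<and> b \<in> Z0_hom A Y Y' \<and> c \<in> Z0_hom A Z Z' \<and>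
     dg_comp A b f = dg_comp A f' a \<and> dg_comp A c g = dg_comp A g' b)"

definition dual_seq :: "('o, 'm) dgcat \<Rightarrow> 'o \<times> 'm \<times> 'o \<times> 'm \<times> 'o \<Rightarrow> 'o \<times> 'm \<times> 'o \<times> 'm \<times> 'o" where
  "dual_seq A = (\<lambda>(X, f, Y, g, Z).
     (dg_dual A Z, dg_dual_hom A g, dg_dual A Y, dg_dual_hom A f, dg_dual A X))"

text \<open>
  A standard triangle \<open>X \<rightarrow>u Y \<rightarrow>v Z \<rightarrow>w X[1]\<close> exhibits \<open>Z\<close> as a cone of \<open>u\<close>: the sequence
  \<open>Y \<rightarrow> Z \<rightarrow> X[1]\<close> is exact, split in degree \<open>0\<close> by some \<open>s : X[1] \<rightarrow> Z\<close> such that the degree \<open>-1\<close>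
  map \<open>s \<circ> dg_sus X : X \<rightarrow> Z\<close> is a null homotopy of \<open>v \<circ> u\<close>.
\<close>

definition std_triangle :: "('o, 'm) dgcat \<Rightarrow> ('o \<times> 'o \<times> 'o \<times> 'm \<times> 'm \<times> 'm) \<Rightarrow> bool" where
  "std_triangle A = (\<lambda>(X, Y, Z, u, v, w).
     X \<in> dg_ob A \<and> u \<in> Z0_hom A X Y \<and> exact_seq A (Y, v, Z, w, dg_shift A X) \<and>
     (\<exists>r s. split_by A (Y, v, Z, w, dg_shift A X) r s \<and>
            dg_d A X Z (dg_comp A s (dg_sus A X)) = dg_comp A v u))"

text \<open>
  The triangulated category \<open>w\<^sup>-\<^sup>1A\<close>: localization of \<open>Z\<^sup>0A\<close> with the triangles isomorphic there
  to a standard one.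
\<close>

definition derived_cat ::
  "('o, 'm) dgcat \<Rightarrow> ('o \<Rightarrow> 'o \<Rightarrow> 'm set) \<Rightarrow> ('o, ('o, 'm) zigzag set) tricat" where
  "derived_cat A W =
     (let L = localization (Z0 A) W; Q = loc_of (Z0 A) W; sh = dg_shift A;
          shm = loc_map (Z0 A) W sh (\<lambda>X Y. dg_shift_hom A)
      in \<lparr>Ob = Ob L, Hom = Hom L, Comp = Comp L, Ident = Ident L, Sh_ob = sh, Sh_hom = shm,
          Tri = {(X, Y, Z, u, v, w). X \<in> Ob L \<and> Y \<in> Ob L \<and> Z \<in> Ob L \<and>
            u \<in> Hom L X Y \<and> v \<in> Hom L Y Z \<and> w \<in> Hom L Z (sh X) \<and>
            (\<exists>X' Y' Z' u' v' w' a b c. std_triangle A (X', Y', Z', u', v', w') \<and>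
               cat_iso L X X' a \<and> cat_iso L Y Y' b \<and> cat_iso L Z Z' c \<and>
               Comp L X Y Y' b u = Comp L X X' Y' (Q X' Y' u') a \<and>
               Comp L Y Z Z' c v = Comp L Y Y' Z' (Q Y' Z' v') b \<and>
               Comp L Z (sh X) (sh X') (shm X X' a) w = Comp L Z Z' (sh X') (Q Z' (sh X') w') c)}\<rparr>)"

text \<open>\<open>Fun([1], A)\<close>: an object \<open>(X, f, Y)\<close> is the closed degree \<open>0\<close> map \<open>f : X \<rightarrow> Y\<close>.\<close>

definition Fun1 :: "('o, 'm) dgcat \<Rightarrow> ('o \<times> 'm \<times> 'o, 'm \<times> 'm) dgcat" where
  "Fun1 A =
     \<lparr>dg_ob = {(X, f, Y). X \<in> dg_ob A \<and> Y \<in> dg_ob A \<and> f \<in> Z0_hom A X Y},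
      dg_hom = (\<lambda>(X, f, Y) (X', f', Y') n.
        {(a, b). a \<in> dg_hom A X X' n \<and> b \<in> dg_hom A Y Y' n \<and> dg_comp A b f = dg_comp A f' a}),
      dg_zero = (\<lambda>(X, f, Y) (X', f', Y') n. (dg_zero A X X' n, dg_zero A Y Y' n)),
      dg_add = (\<lambda>(a, b) (a', b'). (dg_add A a a', dg_add A b b')),
      dg_d = (\<lambda>(X, f, Y) (X', f', Y') (a, b). (dg_d A X X' a, dg_d A Y Y' b)),
      dg_comp = (\<lambda>(a', b') (a, b). (dg_comp A a' a, dg_comp A b' b)),
      dg_id = (\<lambda>(X, f, Y). (dg_id A X, dg_id A Y)),
      dg_shift = (\<lambda>(X, f, Y). (dg_shift A X, dg_shift_hom A f, dg_shift A Y)),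
      dg_shift_hom = (\<lambda>(a, b). (dg_shift_hom A a, dg_shift_hom A b)),
      dg_sus = (\<lambda>(X, f, Y). (dg_sus A X, dg_sus A Y)),
      dg_dual = (\<lambda>(X, f, Y). (dg_dual A Y, dg_dual_hom A f, dg_dual A X)),
      dg_dual_hom = (\<lambda>(a, b). (dg_dual_hom A b, dg_dual_hom A a)),
      dg_can = (\<lambda>(X, f, Y). (dg_can A X, dg_can A Y))\<rparr>"


section \<open>Grothendieck--Witt groups\<close>

definition sym_spaces :: "('o, 'm) dgcat \<Rightarrow> ('o \<Rightarrow> 'o \<Rightarrow> 'm set) \<Rightarrow> ('o \<times> 'm) set" where
  "sym_spaces A W = {(X, \<phi>). X \<in> dg_ob A \<and> \<phi> \<in> Z0_hom A X (dg_dual A X) \<and>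
     \<phi> \<in> W X (dg_dual A X) \<and> dg_comp A (dg_dual_hom A \<phi>) (dg_can A X) = \<phi>}"

definition biproduct :: "('o, 'm) dgcat \<Rightarrow> 'o \<Rightarrow> 'o \<Rightarrow> 'o \<Rightarrow> 'm \<Rightarrow> 'm \<Rightarrow> 'm \<Rightarrow> 'm \<Rightarrow> bool" where
  "biproduct A X Y S i j p q \<longleftrightarrow> X \<in> dg_ob A \<and> Y \<in> dg_ob A \<and> S \<in> dg_ob A \<and>
     i \<in> Z0_hom A X S \<and> j \<in> Z0_hom A Y S \<and> p \<in> Z0_hom A S X \<and> q \<in> Z0_hom A S Y \<and>
     dg_comp A p i = dg_id A X \<and> dg_comp A q j = dg_id A Y \<and>
     dg_comp A q i = dg_zero A X Y 0 \<and> dg_comp A p j = dg_zero A Y X 0 \<and>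
     dg_add A (dg_comp A i p) (dg_comp A j q) = dg_id A S"

definition pull_form :: "('o, 'm) dgcat \<Rightarrow> 'm \<Rightarrow> 'm \<Rightarrow> 'm \<Rightarrow> 'm" where  \<comment> \<open>\<open>g\<^sup>\<or> \<psi> h\<close>\<close>
  "pull_form A g \<psi> h = dg_comp A (dg_dual_hom A g) (dg_comp A \<psi> h)"

text \<open>
  For a biproduct \<open>S\<close> of \<open>X\<close> and \<open>Y\<close> with projections \<open>p\<close>, \<open>q\<close>, the diagonal form
  \<open>\<phi> \<oplus> \<psi>\<close> is \<open>p\<^sup>\<or>\<phi>p + q\<^sup>\<or>\<psi>q\<close>.  In \<open>gw_exact\<close>, \<open>S\<close> is a biproduct of \<open>E\<^sub>-\<^sub>1\<close> and \<open>E\<^sub>1\<close>, and the matrix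
  with rows \<open>(0, \<phi>\<^sub>1)\<close> and \<open>(\<phi>\<^sub>-\<^sub>1, 0)\<close> is \<open>p\<^sup>\<or>\<phi>\<^sub>1q + q\<^sup>\<or>\<phi>\<^sub>-\<^sub>1p\<close>.  All biproducts are allowed; they agree by
  \<open>gw_isometry\<close>.
\<close>

inductive_set gw_relators :: "('o, 'm) dgcat \<Rightarrow> ('o \<Rightarrow> 'o \<Rightarrow> 'm set) \<Rightarrow> ('o \<times> 'm \<Rightarrow>\<^sub>0 int) set"
  for A W where
  gw_sum: "\<lbrakk>(X, \<phi>) \<in> sym_spaces A W; (Y, \<psi>) \<in> sym_spaces A W; biproduct A X Y S i j p q;
      \<omega> = dg_add A (pull_form A p \<phi> p) (pull_form A q \<psi> q); (S, \<omega>) \<in> sym_spaces A W\<rbrakk> \<Longrightarrow>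
    frag_of (X, \<phi>) + frag_of (Y, \<psi>) - frag_of (S, \<omega>) \<in> gw_relators A W"
| gw_isometry: "\<lbrakk>(Y, \<psi>) \<in> sym_spaces A W; X \<in> dg_ob A; g \<in> Z0_hom A X Y; g \<in> W X Y;
      (X, pull_form A g \<psi> g) \<in> sym_spaces A W\<rbrakk> \<Longrightarrow>
    frag_of (Y, \<psi>) - frag_of (X, pull_form A g \<psi> g) \<in> gw_relators A W"
| gw_exact: "\<lbrakk>exact_seq A (E\<^sub>m, f, E\<^sub>0, g, E\<^sub>p);
      exact_seq_map A (E\<^sub>m, f, E\<^sub>0, g, E\<^sub>p) (dual_seq A (E\<^sub>m, f, E\<^sub>0, g, E\<^sub>p)) (\<phi>\<^sub>m, \<phi>\<^sub>0, \<phi>\<^sub>p);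
      \<phi>\<^sub>m \<in> W E\<^sub>m (dg_dual A E\<^sub>p); \<phi>\<^sub>0 \<in> W E\<^sub>0 (dg_dual A E\<^sub>0); \<phi>\<^sub>p \<in> W E\<^sub>p (dg_dual A E\<^sub>m);
      \<phi>\<^sub>m = dg_comp A (dg_dual_hom A \<phi>\<^sub>p) (dg_can A E\<^sub>m);
      \<phi>\<^sub>0 = dg_comp A (dg_dual_hom A \<phi>\<^sub>0) (dg_can A E\<^sub>0);
      \<phi>\<^sub>p = dg_comp A (dg_dual_hom A \<phi>\<^sub>m) (dg_can A E\<^sub>p);
      biproduct A E\<^sub>m E\<^sub>p S i j p q;
      \<omega> = dg_add A (pull_form A p \<phi>\<^sub>p q) (pull_form A q \<phi>\<^sub>m p); (S, \<omega>) \<in> sym_spaces A W\<rbrakk> \<Longrightarrow>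
    frag_of (E\<^sub>0, \<phi>\<^sub>0) - frag_of (S, \<omega>) \<in> gw_relators A W"

definition GW0_rel where
  "GW0_rel A W = generate (free_Abelian_group (sym_spaces A W)) (gw_relators A W)"

definition GW0 :: "('o, 'm) dgcat \<Rightarrow> ('o \<Rightarrow> 'o \<Rightarrow> 'm set) \<Rightarrow> ('o \<times> 'm \<Rightarrow>\<^sub>0 int) set monoid" where
  "GW0 A W = free_Abelian_group (sym_spaces A W) Mod GW0_rel A W"

definition gw_class :: "('o, 'm) dgcat \<Rightarrow> ('o \<Rightarrow> 'o \<Rightarrow> 'm set) \<Rightarrow> 'o \<Rightarrow> 'm \<Rightarrow> ('o \<times> 'm \<Rightarrow>\<^sub>0 int) set" where
  "gw_class A W X \<phi> = GW0_rel A W #>\<^bsub>free_Abelian_group (sym_spaces A W)\<^esub> frag_of (X, \<phi>)"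

text \<open>\<open>h\<close> is the homomorphism induced on \<open>GW\<^sub>0\<close> by the form functor \<open>(F, \<Phi>)\<close>.\<close>

definition GW0_induced ::
  "('o, 'm) dgcat \<Rightarrow> ('o \<Rightarrow> 'o \<Rightarrow> 'm set) \<Rightarrow> ('p, 'n) dgcat \<Rightarrow> ('p \<Rightarrow> 'p \<Rightarrow> 'n set) \<Rightarrow>
   ('o \<Rightarrow> 'p) \<Rightarrow> ('m \<Rightarrow> 'n) \<Rightarrow> ('o \<Rightarrow> 'n) \<Rightarrow>
   (('o \<times> 'm \<Rightarrow>\<^sub>0 int) set \<Rightarrow> ('p \<times> 'n \<Rightarrow>\<^sub>0 int) set) \<Rightarrow> bool" where
  "GW0_induced A W B V FO FM \<Phi> h \<longleftrightarrow> h \<in> hom (GW0 A W) (GW0 B V) \<and>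
     (\<forall>(X, \<phi>) \<in> sym_spaces A W.
        h (gw_class A W X \<phi>) = gw_class B V (FO X) (dg_comp B (\<Phi> X) (FM \<phi>)))"


section \<open>Bounded complexes of finitely generated free modules\<close>

text \<open>
  The ground ring is a type of sort \<open>{comm_ring, comm_monoid_mult}\<close>: a commutative ring with unit,
  the zero ring included (which \<open>comm_ring_1\<close> would exclude).  Free modules are the standard ones
  \<open>R\<^sup>n\<close>, and linear maps are matrices acting on columns; \<open>rk X i\<close> is the rank of \<open>X\<^sup>i\<close> and \<open>df X i\<close> the
  matrix of \<open>X\<^sup>i \<rightarrow> X\<^sup>i\<^sup>+\<^sup>1\<close>.  A map of degree \<open>n\<close> is stored as \<open>(n, f)\<close> with \<open>f i\<close> the matrix of
  \<open>X\<^sup>i \<rightarrow> Y\<^sup>i\<^sup>+\<^sup>n\<close>.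
\<close>

record 'a cpx =
  rk :: "int \<Rightarrow> nat"
  df :: "int \<Rightarrow> 'a mat"

type_synonym 'a gmap = "int \<times> (int \<Rightarrow> 'a mat)"

definition ksign :: "int \<Rightarrow> 'a::{comm_ring, comm_monoid_mult}" where
  "ksign n = (if even n then 1 else - 1)"

definition is_cpx :: "'a::{comm_ring, comm_monoid_mult} cpx \<Rightarrow> bool" where
  "is_cpx X \<longleftrightarrow> finite {i. rk X i \<noteq> 0} \<and>
     (\<forall>i. df X i \<in> carrier_mat (rk X (i + 1)) (rk X i)) \<and>
     (\<forall>i. df X (i + 1) * df X i = 0\<^sub>m (rk X (i + 2)) (rk X i))"

definition shift_cpx :: "'a::{comm_ring, comm_monoid_mult} cpx \<Rightarrow> 'a cpx" where  \<comment> \<open>\<open>R[1] \<otimes> X\<close>\<close>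
  "shift_cpx X = \<lparr>rk = (\<lambda>i. rk X (i + 1)), df = (\<lambda>i. - df X (i + 1))\<rparr>"

text \<open>
  \<open>[X, R[m]]\<^sup>j = Hom (X\<^sup>-\<^sup>m\<^sup>-\<^sup>j, R)\<close> in the dual basis, with differential \<open>\<xi> \<mapsto> -(-1)\<^sup>j \<xi> \<circ> d\<close>.  The dual of a map
  \<open>f\<close> of degree \<open>n\<close> is \<open>\<xi> \<mapsto> (-1)\<^sup>n\<^sup>j \<xi> \<circ> f\<close>.
\<close>

definition dual_cpx :: "int \<Rightarrow> 'a::{comm_ring, comm_monoid_mult} cpx \<Rightarrow> 'a cpx" where
  "dual_cpx m X = \<lparr>rk = (\<lambda>j. rk X (- m - j)),
                   df = (\<lambda>j. ksign (j + 1) \<cdot>\<^sub>m transpose_mat (df X (- m - j - 1)))\<rparr>"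

definition Cpx :: "int \<Rightarrow> ('a::{comm_ring, comm_monoid_mult} cpx, 'a gmap) dgcat" where  \<comment> \<open>\<open>C\<^sub>R\<^sup>[\<^sup>m\<^sup>]\<close>\<close>
  "Cpx m =
     \<lparr>dg_ob = {X. is_cpx X},
      dg_hom = (\<lambda>X Y n. {(n, f) | f. \<forall>i. f i \<in> carrier_mat (rk Y (i + n)) (rk X i)}),
      dg_zero = (\<lambda>X Y n. (n, \<lambda>i. 0\<^sub>m (rk Y (i + n)) (rk X i))),
      dg_add = (\<lambda>(n, f) (_, g). (n, \<lambda>i. f i + g i)),
      dg_d = (\<lambda>X Y (n, f). (n + 1, \<lambda>i. df Y (i + n) * f i - ksign n \<cdot>\<^sub>m (f (i + 1) * df X i))),
      dg_comp = (\<lambda>(k, g) (n, f). (k + n, \<lambda>i. g (i + n) * f i)),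
      dg_id = (\<lambda>X. (0, \<lambda>i. 1\<^sub>m (rk X i))),
      dg_shift = shift_cpx,
      dg_shift_hom = (\<lambda>(n, f). (n, \<lambda>i. ksign n \<cdot>\<^sub>m f (i + 1))),
      dg_sus = (\<lambda>X. (- 1, \<lambda>i. 1\<^sub>m (rk X i))),
      dg_dual = dual_cpx m,
      dg_dual_hom = (\<lambda>(n, f). (n, \<lambda>j. ksign (n * j) \<cdot>\<^sub>m transpose_mat (f (- m - j - n)))),
      dg_can = (\<lambda>X. (0, \<lambda>i. ksign (i * (- m - i)) \<cdot>\<^sub>m 1\<^sub>m (rk X i)))\<rparr>"

definition cocycles :: "'a::{comm_ring, comm_monoid_mult} cpx \<Rightarrow> int \<Rightarrow> 'a vec set" where
  "cocycles X n = {x \<in> carrier_vec (rk X n). df X n *\<^sub>v x = 0\<^sub>v (rk X (n + 1))}"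

definition coboundaries :: "'a::{comm_ring, comm_monoid_mult} cpx \<Rightarrow> int \<Rightarrow> 'a vec set" where
  "coboundaries X n = (\<lambda>x. df X (n - 1) *\<^sub>v x) ` carrier_vec (rk X (n - 1))"

definition cohomologous :: "'a::{comm_ring, comm_monoid_mult} cpx \<Rightarrow> int \<Rightarrow> ('a vec \<times> 'a vec) set" where
  "cohomologous X n = {(x, y). x \<in> cocycles X n \<and> y \<in> cocycles X n \<and> x - y \<in> coboundaries X n}"

definition cohomology :: "'a::{comm_ring, comm_monoid_mult} cpx \<Rightarrow> int \<Rightarrow> 'a vec set set" where
  "cohomology X n = cocycles X n // cohomologous X n"

definition cohomology_map :: "'a::{comm_ring, comm_monoid_mult} cpx \<Rightarrow> 'a gmap \<Rightarrow> int \<Rightarrow> 'a vec set \<Rightarrow> 'a vec set" where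
  "cohomology_map Y f n c = cohomologous Y n `` ((\<lambda>x. snd f n *\<^sub>v x) ` c)"

definition quis :: "'a::{comm_ring, comm_monoid_mult} cpx \<Rightarrow> 'a cpx \<Rightarrow> 'a gmap set" where
  "quis X Y = {f \<in> Z0_hom (Cpx 0) X Y. \<forall>n. bij_betw (cohomology_map Y f n) (cohomology X n) (cohomology Y n)}"


section \<open>The cone form functor\<close>

text \<open>
  With \<open>C = R1 \<oplus> Re\<close> and \<open>T = Rt\<close>, \<open>|t| = -1\<close>, the degree \<open>i\<close> part of \<open>C \<otimes> X\<close> is
  \<open>1 \<otimes> X\<^sup>i \<oplus> e \<otimes> X\<^sup>i\<^sup>+\<^sup>1\<close> with \<open>d(e \<otimes> x) = 1 \<otimes> x - e \<otimes> dx\<close>, that of \<open>T \<otimes> X\<close> is \<open>t \<otimes> X\<^sup>i\<^sup>+\<^sup>1\<close>, and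
  a map \<open>a\<close> of degree \<open>n\<close> acts by \<open>e \<otimes> x \<mapsto> (-1)\<^sup>n e \<otimes> a x\<close>.  Block matrices below are written with
  respect to such decompositions; \<open>blk_unit X Y\<close> and \<open>blk_proj X Y\<close> are the inclusion of \<open>Y\<close> in and
  the projection to \<open>X[1]\<close> of a complex with underlying graded module \<open>Y \<oplus> X[1]\<close>.
\<close>

definition C_tensor :: "'a::{comm_ring, comm_monoid_mult} cpx \<Rightarrow> 'a cpx" where
  "C_tensor X = \<lparr>rk = (\<lambda>i. rk X i + rk X (i + 1)),
     df = (\<lambda>i. four_block_mat (df X i) (1\<^sub>m (rk X (i + 1)))
                 (0\<^sub>m (rk X (i + 2)) (rk X i)) (- df X (i + 1)))\<rparr>"

definition blk_unit :: "'a::{comm_ring, comm_monoid_mult} cpx \<Rightarrow> 'a cpx \<Rightarrow> 'a gmap" where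
  "blk_unit X Y = (0, \<lambda>i. four_block_mat (1\<^sub>m (rk Y i)) (0\<^sub>m (rk Y i) 0) (0\<^sub>m (rk X (i + 1)) (rk Y i)) (0\<^sub>m (rk X (i + 1)) 0))"

definition blk_proj :: "'a::{comm_ring, comm_monoid_mult} cpx \<Rightarrow> 'a cpx \<Rightarrow> 'a gmap" where
  "blk_proj X Y = (0, \<lambda>i. four_block_mat (0\<^sub>m (rk X (i + 1)) (rk Y i)) (1\<^sub>m (rk X (i + 1)))
     (0\<^sub>m 0 (rk Y i)) (0\<^sub>m 0 (rk X (i + 1))))"

definition blk_diag where
  "blk_diag A B = four_block_mat A (0\<^sub>m (dim_row A) (dim_col B)) (0\<^sub>m (dim_row B) (dim_col A)) B"

text \<open>\<open>\<Gamma> \<otimes> X = (R \<otimes> X \<rightarrow> C \<otimes> X \<rightarrow> T \<otimes> X)\<close>, with \<open>R \<otimes> X = X\<close>.\<close>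

definition gamma_tensor :: "'a::{comm_ring, comm_monoid_mult} cpx \<Rightarrow> 'a cpx \<times> 'a gmap \<times> 'a cpx \<times> 'a gmap \<times> 'a cpx" where
  "gamma_tensor X = (X, blk_unit X X, C_tensor X, blk_proj X X, shift_cpx X)"

definition gamma_tensor_hom :: "'a::{comm_ring, comm_monoid_mult} gmap \<Rightarrow> 'a gmap \<times> 'a gmap \<times> 'a gmap" where
  "gamma_tensor_hom = (\<lambda>(n, a). ((n, a), (n, \<lambda>i. blk_diag (a i) (ksign n \<cdot>\<^sub>m a (i + 1))), (n, \<lambda>i. ksign n \<cdot>\<^sub>m a (i + 1))))"

text \<open>
  \<open>(\<Gamma>, \<gamma>) \<otimes> X : \<Gamma> \<otimes> [X, R[m]] \<rightarrow> [\<Gamma> \<otimes> X, R[m + 1]]\<close>, where \<open>T \<otimes> R[m] = R[m + 1]\<close> by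
  \<open>t \<otimes> 1 \<mapsto> 1\<close>.  On elements, with \<open>p : C \<rightarrow> T\<close>, \<open>p(e) = t\<close>, the projection, the middle component is
  \<open>a \<otimes> \<xi> \<mapsto> (b \<otimes> x \<mapsto> (-1)\<^sup>|\<^sup>\<xi>\<^sup>|\<^sup>|\<^sup>b\<^sup>| p(ab) \<otimes> \<xi>(x))\<close>, the first one is \<open>\<xi> \<mapsto> (t \<otimes> x \<mapsto> (-1)\<^sup>|\<^sup>\<xi>\<^sup>| t \<otimes> \<xi>(x))\<close> and the last one
  is \<open>t \<otimes> \<xi> \<mapsto> (x \<mapsto> t \<otimes> \<xi>(x))\<close>.
\<close>

definition gamma_form :: "int \<Rightarrow> 'a::{comm_ring, comm_monoid_mult} cpx \<Rightarrow> 'a gmap \<times> 'a gmap \<times> 'a gmap" where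
  "gamma_form m X =
    ((0, \<lambda>i. ksign i \<cdot>\<^sub>m 1\<^sub>m (rk X (- m - i))),
     (0, \<lambda>i. four_block_mat
       (0\<^sub>m (rk X (- m - 1 - i)) (rk X (- m - i))) (1\<^sub>m (rk X (- m - 1 - i)))
       (ksign i \<cdot>\<^sub>m 1\<^sub>m (rk X (- m - i))) (0\<^sub>m (rk X (- m - i)) (rk X (- m - 1 - i)))),
     (0, \<lambda>i. 1\<^sub>m (rk X (- m - 1 - i))))"

text \<open>
  The cone of \<open>f : X \<rightarrow> Y\<close> is \<open>(C \<otimes> X) \<squnion>\<^sub>X Y = Y \<oplus> e \<otimes> X\<close> with \<open>d(e \<otimes> x) = f x - e \<otimes> dx\<close>; a map \<open>(a, b)\<close>
  of degree \<open>n\<close> acts by \<open>y \<mapsto> b y\<close> and \<open>e \<otimes> x \<mapsto> (-1)\<^sup>n e \<otimes> a x\<close>.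
\<close>

fun cone_ob :: "'a::{comm_ring, comm_monoid_mult} cpx \<times> 'a gmap \<times> 'a cpx \<Rightarrow> 'a cpx" where
  "cone_ob (X, f, Y) = \<lparr>rk = (\<lambda>i. rk Y i + rk X (i + 1)),
     df = (\<lambda>i. four_block_mat (df Y i) (snd f (i + 1))
                 (0\<^sub>m (rk X (i + 2)) (rk Y i)) (- df X (i + 1)))\<rparr>"

fun cone_hom :: "'a::{comm_ring, comm_monoid_mult} gmap \<times> 'a gmap \<Rightarrow> 'a gmap" where
  "cone_hom ((n, a), (_, b)) = (n, \<lambda>i. four_block_mat (b i)
     (0\<^sub>m (dim_row (b i)) (dim_col (a (i + 1)))) (0\<^sub>m (dim_row (a (i + 1))) (dim_col (b i)))
     (ksign n \<cdot>\<^sub>m a (i + 1)))"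

text \<open>
  The duality transformation \<open>cone (f\<^sup>\<or>) \<rightarrow> (cone f)\<^sup>\<or>\<close>, from the duality of \<open>C\<^sub>R\<^sup>[\<^sup>m\<^sup>]\<close> to that of
  \<open>C\<^sub>R\<^sup>[\<^sup>m\<^sup>+\<^sup>1\<^sup>]\<close>: for \<open>\<xi> \<in> X\<^sup>\<or>\<close> of degree \<open>i\<close> and \<open>\<eta> \<in> Y\<^sup>\<or>\<close> of degree \<open>i + 1\<close> it sends \<open>\<xi>\<close> to
  \<open>(y \<mapsto> 0, e \<otimes> x \<mapsto> (-1)\<^sup>i \<xi>(x))\<close> and \<open>e \<otimes> \<eta>\<close> to \<open>(y \<mapsto> \<eta>(y), e \<otimes> x \<mapsto> 0)\<close>.
\<close>

fun cone_phi :: "int \<Rightarrow> 'a::{comm_ring, comm_monoid_mult} cpx \<times> 'a gmap \<times> 'a cpx \<Rightarrow> 'a gmap" where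
  "cone_phi m (X, f, Y) = (0, \<lambda>i. four_block_mat
     (0\<^sub>m (rk Y (- m - 1 - i)) (rk X (- m - i))) (1\<^sub>m (rk Y (- m - 1 - i)))
     (ksign i \<cdot>\<^sub>m 1\<^sub>m (rk X (- m - i))) (0\<^sub>m (rk X (- m - i)) (rk Y (- m - 1 - i))))"

definition w_cone ::
  "'a::{comm_ring, comm_monoid_mult} cpx \<times> 'a gmap \<times> 'a cpx \<Rightarrow> 'a cpx \<times> 'a gmap \<times> 'a cpx \<Rightarrow>
   ('a gmap \<times> 'a gmap) set" where
  "w_cone F G = {h \<in> Z0_hom (Fun1 (Cpx (- 1))) F G. cone_hom h \<in> quis (cone_ob F) (cone_ob G)}"

subsection \<open>The cone form functor as a composite\<close>

text \<open>
  \<open>M\<close> is the dg category of composable maps \<open>E\<^sup>0 \<rightarrow> E\<^sup>1 \<rightarrow> E\<^sup>2\<close> of exact sequences, the first one the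
  identity on third terms and the second one the identity on first terms.  The results of this
  subsection say that \<open>cone_lift f\<close> is an object of \<open>M\<close> over \<open>\<Gamma> \<otimes> f\<close>, that \<open>(a, b)\<close> and the duality lift
  with middle components \<open>cone_hom (a, b)\<close> and \<open>cone_phi m f\<close>, and that lifts are unique.  Hence
  \<open>(cone_ob, cone_hom, cone_phi)\<close> is the composite of \<open>(\<Gamma>, \<gamma>) \<otimes> -\<close>, the inverse \<open>cone_lift\<close> of
  \<open>M \<rightarrow> Fun([1], Ex)\<close>, and the functor taking the middle term of \<open>E\<^sup>1\<close>.
\<close>

definition exact_seq_hom ::
  "('o, 'm) dgcat \<Rightarrow> 'o \<times> 'm \<times> 'o \<times> 'm \<times> 'o \<Rightarrow> 'o \<times> 'm \<times> 'o \<times> 'm \<times> 'o \<Rightarrow> int \<Rightarrow> ('m \<times> 'm \<times> 'm) set" where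
  "exact_seq_hom A = (\<lambda>(X, f, Y, g, Z) (X', f', Y', g', Z') n. {(a, b, c).
     a \<in> dg_hom A X X' n \<and> b \<in> dg_hom A Y Y' n \<and> c \<in> dg_hom A Z Z' n \<and>
     dg_comp A b f = dg_comp A f' a \<and> dg_comp A c g = dg_comp A g' b})"

type_synonym ('o, 'm) comp_seqs =
  "('o \<times> 'm \<times> 'o \<times> 'm \<times> 'o) \<times> ('m \<times> 'm \<times> 'm) \<times> ('o \<times> 'm \<times> 'o \<times> 'm \<times> 'o) \<times> ('m \<times> 'm \<times> 'm) \<times> ('o \<times> 'm \<times> 'o \<times> 'm \<times> 'o)"

definition M_ob :: "('o, 'm) dgcat \<Rightarrow> ('o, 'm) comp_seqs set" where
  "M_ob A = {(E0, g0, E1, g1, E2). exact_seq A E0 \<and> exact_seq A E1 \<and> exact_seq A E2 \<and>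
     exact_seq_map A E0 E1 g0 \<and> exact_seq_map A E1 E2 g1 \<and>
     (case (E0, g0) of ((_, _, _, _, Z), (_, _, c)) \<Rightarrow> c = dg_id A Z) \<and>
     (case (E1, g1) of ((X, _, _, _, _), (a, _, _)) \<Rightarrow> a = dg_id A X)}"

definition seq_map_comp :: "('o, 'm) dgcat \<Rightarrow> 'm \<times> 'm \<times> 'm \<Rightarrow> 'm \<times> 'm \<times> 'm \<Rightarrow> 'm \<times> 'm \<times> 'm" where
  "seq_map_comp A = (\<lambda>(a', b', c') (a, b, c). (dg_comp A a' a, dg_comp A b' b, dg_comp A c' c))"

definition M_hom where
  "M_hom A = (\<lambda>(E0, g0, E1, g1, E2) (E0', g0', E1', g1', E2') n. {(h0, h1, h2).
     h0 \<in> exact_seq_hom A E0 E0' n \<and> h1 \<in> exact_seq_hom A E1 E1' n \<and> h2 \<in> exact_seq_hom A E2 E2' n \<and>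
     seq_map_comp A h1 g0 = seq_map_comp A g0' h0 \<and> seq_map_comp A h2 g1 = seq_map_comp A g1' h1})"

definition M_dual where
  "M_dual A = (\<lambda>(E0, g0, E1, g1, E2). let dl = (\<lambda>(a, b, c). (dg_dual_hom A c, dg_dual_hom A b, dg_dual_hom A a))
     in (dual_seq A E2, dl g1, dual_seq A E1, dl g0, dual_seq A E0))"

fun cone_lift :: "'a::{comm_ring, comm_monoid_mult} cpx \<times> 'a gmap \<times> 'a cpx \<Rightarrow> ('a cpx, 'a gmap) comp_seqs" where
  "cone_lift (X, f, Y) =
     (gamma_tensor X,
      (f, (0, \<lambda>i. blk_diag (snd f i) (1\<^sub>m (rk X (i + 1)))), (0, \<lambda>i. 1\<^sub>m (rk X (i + 1)))),
      (Y, blk_unit X Y, cone_ob (X, f, Y), blk_proj X Y, shift_cpx X),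
      ((0, \<lambda>i. 1\<^sub>m (rk Y i)), (0, \<lambda>i. blk_diag (1\<^sub>m (rk Y i)) (snd f (i + 1))), (0, \<lambda>i. snd f (i + 1))),
      gamma_tensor Y)"

lemma one_mult: "dim_row (A::'a::{comm_ring, comm_monoid_mult} mat) = n \<Longrightarrow> 1\<^sub>m n * A = A"
  by (intro eq_matI) (auto simp: scalar_prod_def if_distrib[of "\<lambda>x. x * _"] row_def col_def cong: if_cong)

lemma mult_one: "dim_col (A::'a::{comm_ring, comm_monoid_mult} mat) = n \<Longrightarrow> A * 1\<^sub>m n = A"
  by (intro eq_matI) (auto simp: scalar_prod_def if_distrib[of "\<lambda>x. _ * x"] row_def col_def cong: if_cong)

lemma zero_mult: "dim_row (A::'a::{comm_ring, comm_monoid_mult} mat) = n \<Longrightarrow> 0\<^sub>m k n * A = 0\<^sub>m k (dim_col A)"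
  by (intro eq_matI) (auto simp: scalar_prod_def row_def col_def)

lemma mult_zero: "dim_col (A::'a::{comm_ring, comm_monoid_mult} mat) = n \<Longrightarrow> A * 0\<^sub>m n k = 0\<^sub>m (dim_row A) k"
  by (intro eq_matI) (auto simp: scalar_prod_def row_def col_def)

lemma add_zero: "dim_row (A::'a::{comm_ring, comm_monoid_mult} mat) = n \<Longrightarrow> dim_col A = k \<Longrightarrow> A + 0\<^sub>m n k = A"
  "dim_row A = n \<Longrightarrow> dim_col A = k \<Longrightarrow> 0\<^sub>m n k + A = A"
  by (auto intro!: eq_matI)

lemma minus_mats: "dim_row (A::'a::{comm_ring, comm_monoid_mult} mat) = n \<Longrightarrow> dim_col A = k \<Longrightarrow> A - 0\<^sub>m n k = A"
  "dim_row A = n \<Longrightarrow> dim_col A = k \<Longrightarrow> 0\<^sub>m n k - A = - A"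
  "A - A = 0\<^sub>m (dim_row A) (dim_col A)"
  "- A + A = 0\<^sub>m (dim_row A) (dim_col A)"
  "A + - A = 0\<^sub>m (dim_row A) (dim_col A)"
  "1 \<cdot>\<^sub>m A = A" "- (0\<^sub>m n k :: 'a mat) = 0\<^sub>m n k"
  "- (- A) = A" "- 1 \<cdot>\<^sub>m A = - A"
  by (auto intro!: eq_matI)

lemma uminus_mult:  "dim_row (A::'a::{comm_ring, comm_monoid_mult} mat) = dim_col B \<Longrightarrow> B * (- A) = - (B * A)"
  "dim_row (A::'a::{comm_ring, comm_monoid_mult} mat) = dim_col B \<Longrightarrow> (- B) * A = - (B * A)"
  by (auto intro!: eq_matI simp: scalar_prod_def sum_negf)

lemma blk_mult:
  "\<lbrakk>dim_row B1 = dim_row A1; dim_col C1 = dim_col A1; dim_row D1 = dim_row C1; dim_col D1 = dim_col B1;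
    dim_row A2 = dim_col A1; dim_row B2 = dim_col A1; dim_row C2 = dim_col B1; dim_row D2 = dim_col B1;
    dim_col C2 = dim_col A2; dim_col D2 = dim_col B2\<rbrakk> \<Longrightarrow>
   four_block_mat A1 B1 C1 D1 * four_block_mat A2 B2 C2 D2 =
    four_block_mat (A1 * A2 + B1 * C2) (A1 * B2 + B1 * D2) (C1 * A2 + D1 * C2) (C1 * B2 + D1 * D2)"
  by (rule mult_four_block_mat) auto

lemma blk_add: "\<lbrakk>dim_row B1 = dim_row A1; dim_col C1 = dim_col A1; dim_row D1 = dim_row C1; dim_col D1 = dim_col B1;
    dim_row A2 = dim_row A1; dim_col A2 = dim_col A1; dim_row B2 = dim_row B1; dim_col B2 = dim_col B1;
    dim_row C2 = dim_row C1; dim_col C2 = dim_col C1; dim_row D2 = dim_row D1; dim_col D2 = dim_col D1\<rbrakk> \<Longrightarrow>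
   four_block_mat A1 B1 C1 D1 + four_block_mat A2 B2 C2 D2 = four_block_mat (A1 + A2) (B1 + B2) (C1 + C2) (D1 + D2)"
  by (rule add_four_block_mat) auto

lemma blk_minus: "\<lbrakk>dim_row B1 = dim_row A1; dim_col C1 = dim_col A1; dim_row D1 = dim_row C1; dim_col D1 = dim_col B1;
    dim_row A2 = dim_row A1; dim_col A2 = dim_col A1; dim_row B2 = dim_row B1; dim_col B2 = dim_col B1;
    dim_row C2 = dim_row C1; dim_col C2 = dim_col C1; dim_row D2 = dim_row D1; dim_col D2 = dim_col D1\<rbrakk> \<Longrightarrow>
   four_block_mat A1 B1 C1 D1 - four_block_mat A2 B2 C2 D2 = four_block_mat (A1 - A2) (B1 - B2) (C1 - C2) (D1 - (D2::'a::{comm_ring, comm_monoid_mult} mat))"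
  by (rule eq_matI) auto

lemma blk_transpose: "\<lbrakk>dim_row B1 = dim_row A1; dim_col C1 = dim_col A1; dim_row D1 = dim_row C1; dim_col D1 = dim_col B1\<rbrakk> \<Longrightarrow>
   transpose_mat (four_block_mat A1 B1 C1 D1) = four_block_mat (transpose_mat A1) (transpose_mat C1) (transpose_mat B1) (transpose_mat D1)"
  by (rule transpose_four_block_mat) auto

lemma blk_smult: "\<lbrakk>dim_row B1 = dim_row A1; dim_col C1 = dim_col A1; dim_row D1 = dim_row C1; dim_col D1 = dim_col B1\<rbrakk> \<Longrightarrow>
   (k::'a::{comm_ring, comm_monoid_mult}) \<cdot>\<^sub>m (four_block_mat A1 B1 C1 D1) = four_block_mat (k \<cdot>\<^sub>m A1) (k \<cdot>\<^sub>m B1) (k \<cdot>\<^sub>m C1) (k \<cdot>\<^sub>m D1)"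
  by (rule eq_matI) auto

lemmas mat_simps = one_mult mult_one zero_mult mult_zero add_zero minus_mats uminus_mult blk_mult blk_add blk_minus blk_transpose blk_smult

lemma is_cpx_simps:
  assumes "is_cpx X"
  shows "dim_row (df X i) = rk X (i+1)" "dim_col (df X i) = rk X i" "df X (i + 1) * df X i = 0\<^sub>m (rk X (i + 2)) (rk X i)"
    "finite {i. rk X i \<noteq> 0}" "df X (i + 2) * df X (i + 1) = 0\<^sub>m (rk X (i + 3)) (rk X (i + 1))"
proof -
  show "dim_row (df X i) = rk X (i+1)" "dim_col (df X i) = rk X i" "df X (i + 1) * df X i = 0\<^sub>m (rk X (i + 2)) (rk X i)"
    "finite {i. rk X i \<noteq> 0}" for i
    using assms unfolding is_cpx_def by auto
  from this(3)[of "i + 1"] show "df X (i + 2) * df X (i + 1) = 0\<^sub>m (rk X (i + 3)) (rk X (i + 1))"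
    by (simp add: add.assoc)
qed

lemma idx: "(i::int) + 1 + 1 = i + 2" "i + 1 + 2 = i + 3" "i + 2 + 1 = i + 3" by auto

lemma finite_shift: "finite {i. rk X i \<noteq> 0} \<Longrightarrow> finite {i::int. rk X (i + 1) \<noteq> 0}"
  using finite_vimageI[of "{i. rk X i \<noteq> 0}" "\<lambda>i::int. i + 1"] by (auto simp: vimage_def inj_def)

lemma FunE: assumes "(X, f, Y) \<in> dg_ob (Fun1 (Cpx m))"
  obtains f' where "f = (0, f')" "is_cpx X" "is_cpx Y"  "\<And>i. dim_row (f' i) = rk Y i" "\<And>i. dim_col (f' i) = rk X i"
    "\<And>i. df Y i * f' i = f' (i + 1) * df X i"
proof -
  from assms have c: "is_cpx X" "is_cpx Y" and f0: "f \<in> dg_hom (Cpx m) X Y 0" and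
    df: "dg_d (Cpx m) X Y f = dg_zero (Cpx m) X Y 1"
    by (simp_all add: Fun1_def Z0_hom_def Cpx_def)
  define f' where "f' = snd f"
  have f: "f = (0, f')" and d0: "\<And>i. f' i \<in> carrier_mat (rk Y i) (rk X i)"
    using f0 by (auto simp: Cpx_def f'_def)
  note d = carrier_matD[OF d0]
  have e: "df Y i * f' i - 1 \<cdot>\<^sub>m (f' (i + 1) * df X i) = 0\<^sub>m (rk Y (i + 1)) (rk X i)" for i
    using arg_cong[OF df, of "\<lambda>h. snd h i"] by (simp add: f Cpx_def ksign_def)
  have "df Y i * f' i = f' (i + 1) * df X i" for i
  proof (rule eq_matI)
    fix r c assume "r < dim_row (f' (i + 1) * df X i)" "c < dim_col (f' (i + 1) * df X i)"
    with e[of i] show "(df Y i * f' i) $$ (r, c) = (f' (i + 1) * df X i) $$ (r, c)"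
      using d is_cpx_simps[OF c(1)] is_cpx_simps[OF c(2)]
      by (auto dest!: arg_cong[of _ _ "\<lambda>M. M $$ (r, c)"])
  qed (use d is_cpx_simps[OF c(1)] is_cpx_simps[OF c(2)] in auto)
  with f c d that show ?thesis by auto
qed


lemma blk_col_mult: "\<lbrakk>dim_row A = n; dim_row C = k; dim_col A = dim_row M; dim_col C = dim_row M\<rbrakk> \<Longrightarrow>
   four_block_mat A (0\<^sub>m n 0) C (0\<^sub>m k 0) * (M::'a::{comm_ring, comm_monoid_mult} mat) = four_block_mat (A * M) (0\<^sub>m n 0) (C * M) (0\<^sub>m k 0)"
  by (intro eq_matI) (auto simp: scalar_prod_def row_def col_def)
lemma blk_row_mult: "\<lbrakk>dim_col A = n; dim_col B = k; dim_row A = dim_col M; dim_row B = dim_col M\<rbrakk> \<Longrightarrow>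
   (M::'a::{comm_ring, comm_monoid_mult} mat) * four_block_mat A B (0\<^sub>m 0 n) (0\<^sub>m 0 k) = four_block_mat (M * A) (M * B) (0\<^sub>m 0 n) (0\<^sub>m 0 k)"
  by (intro eq_matI) (auto simp: scalar_prod_def row_def col_def)
lemma blk_triv: "dim_row A = n \<Longrightarrow> dim_col A = k \<Longrightarrow> four_block_mat A (0\<^sub>m n 0) (0\<^sub>m 0 k) (0\<^sub>m 0 0) = A"
  by (intro eq_matI) auto
lemma smult_mult: "dim_row (A::'a::{comm_ring, comm_monoid_mult} mat) = dim_col B \<Longrightarrow> B * (k \<cdot>\<^sub>m A) = k \<cdot>\<^sub>m (B * A)"
  "dim_row A = dim_col B \<Longrightarrow> (k \<cdot>\<^sub>m B) * A = k \<cdot>\<^sub>m (B * A)"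
  by (auto intro!: eq_matI simp: scalar_prod_def sum_distrib_left algebra_simps)
lemma idx': "2 + (i::int) = i + 2" "3 + (i::int) = i + 3" "1 + (i::int) = i + 1" by auto
lemma blk_uminus: "\<lbrakk>dim_row B1 = dim_row A1; dim_col C1 = dim_col A1; dim_row D1 = dim_row C1; dim_col D1 = dim_col B1\<rbrakk> \<Longrightarrow>
   - (four_block_mat A1 B1 C1 (D1::'a::{comm_ring, comm_monoid_mult} mat)) = four_block_mat (- A1) (- B1) (- C1) (- D1)"
  by (rule eq_matI) auto
lemma is_cpx_cone: assumes "F \<in> dg_ob (Fun1 (Cpx m))" shows "is_cpx (cone_ob F)"
proof -
  obtain X f Y where F: "F = (X, f, Y)" by (cases F)
  from assms obtain f' where *: "f = (0, f')" "is_cpx X" "is_cpx Y" "\<And>i. dim_row (f' i) = rk Y i" "\<And>i. dim_col (f' i) = rk X i"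
    "\<And>i. df Y i * f' i = f' (i + 1) * df X i" unfolding F by (rule FunE) blast
  note ** = *(4-) is_cpx_simps[OF *(2)] is_cpx_simps[OF *(3)]
  have "finite {i. rk Y i + rk X (i + 1) \<noteq> 0}"
    by (rule finite_subset[OF _ finite_UnI[OF is_cpx_simps(4)[OF *(3)] finite_shift[OF is_cpx_simps(4)[OF *(2)]]]]) auto
  then show ?thesis
    unfolding is_cpx_def F
    apply (intro conjI allI carrier_matI)
    apply (simp_all add: *(1) ** mat_simps idx)
    done
qed
lemma is_cpx_shift: assumes "is_cpx X" shows "is_cpx (shift_cpx X)"
  using finite_shift[OF is_cpx_simps(4)[OF assms]]
  unfolding is_cpx_def shift_cpx_def
    apply (intro conjI allI carrier_matI)
  apply (simp_all add: is_cpx_simps[OF assms] mat_simps idx)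
  done

lemma exact_cone: assumes "F = (X, f, Y)" "F \<in> dg_ob (Fun1 (Cpx m))"
  shows "exact_seq (Cpx k) (Y, blk_unit X Y, cone_ob F, blk_proj X Y, shift_cpx X)"
proof -
  from assms obtain f' where *: "f = (0, f')" "is_cpx X" "is_cpx Y" "\<And>i. dim_row (f' i) = rk Y i" "\<And>i. dim_col (f' i) = rk X i"
    "\<And>i. df Y i * f' i = f' (i + 1) * df X i" using FunE by metis
  note ** = *(4-) is_cpx_simps[OF *(2)] is_cpx_simps[OF *(3)]
  define r where "r = (0::int, \<lambda>i. four_block_mat (1\<^sub>m (rk Y i)) (0\<^sub>m (rk Y i) (rk X (i + 1))) (0\<^sub>m 0 (rk Y i)) (0\<^sub>m 0 (rk X (i + 1))) :: 'a mat)"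
  define s where "s = (0::int, \<lambda>i. four_block_mat (0\<^sub>m (rk Y i) (rk X (i + 1))) (0\<^sub>m (rk Y i) 0) (1\<^sub>m (rk X (i + 1))) (0\<^sub>m (rk X (i + 1)) 0)  :: 'a mat)"
  have "split_by (Cpx k) (Y, blk_unit X Y, cone_ob F, blk_proj X Y, shift_cpx X) r s"
    unfolding split_by_def r_def s_def blk_unit_def blk_proj_def shift_cpx_def assms
    by (simp add: Cpx_def, intro conjI allI ext carrier_matI, simp_all add: mat_simps blk_triv)
  moreover have "blk_unit X Y \<in> Z0_hom (Cpx k) Y (cone_ob F)" "blk_proj X Y \<in> Z0_hom (Cpx k) (cone_ob F) (shift_cpx X)"
     "dg_comp (Cpx k) (blk_proj X Y) (blk_unit X Y) = dg_zero (Cpx k) Y (shift_cpx X) 0"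
    unfolding Z0_hom_def Cpx_def blk_unit_def blk_proj_def assms shift_cpx_def
    by (simp_all add: *(1) ksign_def)
       ((intro conjI allI ext carrier_matI;
         simp add: ** mat_simps idx idx' blk_triv blk_col_mult blk_row_mult blk_uminus)+)
  moreover have "is_cpx (cone_ob F)" using is_cpx_cone assms by blast
  moreover have "dg_ob (Cpx k) = {X. is_cpx X}" for k by (simp add: Cpx_def)
  ultimately show ?thesis unfolding exact_seq_def prod.case
    using *(2,3) is_cpx_shift[OF *(2)] by blast
qed

lemma Fun_id: assumes "is_cpx X" shows "(X, dg_id (Cpx m) X, X) \<in> dg_ob (Fun1 (Cpx m))"
  unfolding Fun1_def Z0_hom_def
  by (simp add: Cpx_def ksign_def assms, intro ext, simp add: mat_simps is_cpx_simps[OF assms])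

lemma C_tensor_cone: "C_tensor X = cone_ob (X, dg_id (Cpx m) X, X)"
  by (simp add: C_tensor_def Cpx_def)

lemma exact_gamma: "is_cpx X \<Longrightarrow> exact_seq (Cpx k) (gamma_tensor X)"
  unfolding gamma_tensor_def C_tensor_cone[where m=k] using exact_cone[OF refl Fun_id] by blast

lemma cone_lift_M:
  assumes "F = (X, f, Y)" "F \<in> dg_ob (Fun1 (Cpx m))"
  shows "cone_lift F \<in> M_ob (Cpx k)"
    and "\<exists>g0 g1 E1. cone_lift F = (gamma_tensor X, g0, E1, g1, gamma_tensor Y) \<and>
           seq_map_comp (Cpx k) g1 g0 = gamma_tensor_hom f"
proof -
  from assms obtain f' where *: "f = (0, f')" "is_cpx X" "is_cpx Y" "\<And>i. dim_row (f' i) = rk Y i" "\<And>i. dim_col (f' i) = rk X i"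
    "\<And>i. df Y i * f' i = f' (i + 1) * df X i" using FunE by metis
  note ** = *(4-) is_cpx_simps[OF *(2)] is_cpx_simps[OF *(3)]
  show "\<exists>g0 g1 E1. cone_lift F = (gamma_tensor X, g0, E1, g1, gamma_tensor Y) \<and>
           seq_map_comp (Cpx k) g1 g0 = gamma_tensor_hom f"
    by (simp add: assms(1) *(1) seq_map_comp_def gamma_tensor_hom_def Cpx_def ksign_def, intro conjI ext)
       (simp_all add: blk_diag_def ** mat_simps idx idx')
  have 1: "exact_seq_map (Cpx k) (gamma_tensor X) (Y, blk_unit X Y, cone_ob (X, f, Y), blk_proj X Y, shift_cpx X)
     (f, (0, \<lambda>i. blk_diag (snd f i) (1\<^sub>m (rk X (i + 1)))), (0, \<lambda>i. 1\<^sub>m (rk X (i + 1))))"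
    by (simp add: *(1) exact_seq_map_def gamma_tensor_def Cpx_def C_tensor_def Z0_hom_def ksign_def blk_unit_def blk_proj_def shift_cpx_def,
      intro conjI allI ext carrier_matI)
     (simp_all add: blk_diag_def ** mat_simps blk_triv blk_col_mult blk_row_mult blk_uminus idx idx')
  have 2: "exact_seq_map (Cpx k) (Y, blk_unit X Y, cone_ob (X, f, Y), blk_proj X Y, shift_cpx X) (gamma_tensor Y)
     ((0, \<lambda>i. 1\<^sub>m (rk Y i)), (0, \<lambda>i. blk_diag (1\<^sub>m (rk Y i)) (snd f (i + 1))), (0, \<lambda>i. snd f (i + 1)))"
    by (simp add: *(1) exact_seq_map_def gamma_tensor_def Cpx_def C_tensor_def Z0_hom_def ksign_def blk_unit_def blk_proj_def shift_cpx_def,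
      intro conjI allI ext carrier_matI)
     (simp_all add: blk_diag_def ** mat_simps blk_triv blk_col_mult blk_row_mult blk_uminus idx idx')
  have 3: "dg_id (Cpx k) Y = (0, \<lambda>i. 1\<^sub>m (rk Y i))" "dg_id (Cpx k) (shift_cpx X) = (0, \<lambda>i. 1\<^sub>m (rk X (i + 1)))"
    by (simp_all add: Cpx_def shift_cpx_def)
  show "cone_lift F \<in> M_ob (Cpx k)"
    using exact_gamma[OF *(2), of k] exact_gamma[OF *(3), of k] exact_cone[OF assms, of k] 1 2 3
    unfolding assms(1) M_ob_def by (simp add: gamma_tensor_def)
qed

lemma cone_hom_M:
  assumes "F = (X, f, Y)" "F \<in> dg_ob (Fun1 (Cpx m))" "G = (X', f', Y')" "G \<in> dg_ob (Fun1 (Cpx m))"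
    "(a, b) \<in> dg_hom (Fun1 (Cpx m)) F G n"
  shows "(gamma_tensor_hom a, (b, cone_hom (a, b), dg_shift_hom (Cpx k) a), gamma_tensor_hom b) \<in> M_hom (Cpx k) (cone_lift F) (cone_lift G) n"
proof -
  from assms obtain ff where F: "f = (0, ff)" "is_cpx X" "is_cpx Y" "\<And>i. dim_row (ff i) = rk Y i" "\<And>i. dim_col (ff i) = rk X i"
    "\<And>i. df Y i * ff i = ff (i + 1) * df X i" using FunE by metis
  from assms obtain gg where G: "f' = (0, gg)" "is_cpx X'" "is_cpx Y'" "\<And>i. dim_row (gg i) = rk Y' i" "\<And>i. dim_col (gg i) = rk X' i"
    "\<And>i. df Y' i * gg i = gg (i + 1) * df X' i" using FunE by metis
  from assms(5) obtain aa bb where h: "a = (n, aa)" "b = (n, bb)" and c: "\<And>i. aa i \<in> carrier_mat (rk X' (i + n)) (rk X i)"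
    "\<And>i. bb i \<in> carrier_mat (rk Y' (i + n)) (rk Y i)" and e0: "(\<lambda>i. bb i * ff i) = (\<lambda>i. gg (i + n) * aa i)"
    unfolding assms F G by (auto simp: Fun1_def Cpx_def)
  note e = fun_cong[OF e0]
  note d = c[THEN carrier_matD(1)] c[THEN carrier_matD(2)]
  have n: "i + 1 + n = i + n + 1" "1 + (i + n) = i + n + 1" for i by auto
  show ?thesis
    unfolding M_hom_def assms
    apply (simp add: exact_seq_hom_def seq_map_comp_def gamma_tensor_hom_def gamma_tensor_def Cpx_def C_tensor_def
      blk_unit_def blk_proj_def shift_cpx_def F(1) G(1) h)
    apply (intro conjI allI ext carrier_matI)
    apply (simp_all add: smult_mult blk_diag_def e d n F(4-) G(4-) mat_simps blk_triv blk_col_mult blk_row_mult blk_uminus idx idx')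
    done
qed


lemma ext_reindex: assumes "\<And>j. f (- m - 2 - j) = g (- m - 2 - j)" shows "f = (g :: int \<Rightarrow> 'b)"
proof
  fix i
  show "f i = g i" using assms[of "- m - 2 - i"] by simp
qed

lemma mat_minus_cancel: "A - B = 0\<^sub>m n k" if "A = (B :: 'a::{comm_ring, comm_monoid_mult} mat)" "dim_row B = n" "dim_col B = k"
  using that by (auto intro!: eq_matI)

lemma transpose_uminus: "transpose_mat (- A) = - transpose_mat (A :: 'a::{comm_ring, comm_monoid_mult} mat)"
  by (auto intro!: eq_matI)
lemma transpose_smult: "transpose_mat (k \<cdot>\<^sub>m A) = k \<cdot>\<^sub>m transpose_mat (A :: 'a::{comm_ring, comm_monoid_mult} mat)"
  by (auto intro!: eq_matI)

lemma cone_phi_closed: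
  assumes "F = (X, f, Y)" "F \<in> dg_ob (Fun1 (Cpx m))"
  shows "cone_phi m F \<in> Z0_hom (Cpx (m + 1)) (cone_ob (dg_dual (Fun1 (Cpx m)) F)) (dg_dual (Cpx (m + 1)) (cone_ob F))"
proof -
  from assms obtain f' where *: "f = (0, f')" "is_cpx X" "is_cpx Y" "\<And>i. dim_row (f' i) = rk Y i" "\<And>i. dim_col (f' i) = rk X i"
    "\<And>i. df Y i * f' i = f' (i + 1) * df X i" using FunE by metis
  note ** = *(4-) is_cpx_simps[OF *(2)] is_cpx_simps[OF *(3)]
  show ?thesis
    unfolding assms
    apply (simp add: Z0_hom_def Fun1_def  Cpx_def  *(1) dual_cpx_def)
    apply (intro conjI allI carrier_matI ext_reindex[where m=m])
      apply (simp_all add: ** idx idx' ksign_def)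
    apply (simp_all add: ** idx idx' mat_simps blk_uminus transpose_uminus)
    apply (simp add: algebra_simps)
    done
qed


lemma cone_phi_M:
  assumes "F = (X, f, Y)" "F \<in> dg_ob (Fun1 (Cpx m))"
  shows "(gamma_form m Y, (fst (gamma_form m X), cone_phi m F, snd (snd (gamma_form m Y))), gamma_form m X)
     \<in> M_hom (Cpx (m + 1)) (cone_lift (dg_dual (Fun1 (Cpx m)) F)) (M_dual (Cpx (m + 1)) (cone_lift F)) 0"
proof -
  from assms obtain f' where *: "f = (0, f')" "is_cpx X" "is_cpx Y" "\<And>i. dim_row (f' i) = rk Y i" "\<And>i. dim_col (f' i) = rk X i"
    "\<And>i. df Y i * f' i = f' (i + 1) * df X i" using FunE by metis
  note ** = *(4-) is_cpx_simps[OF *(2)] is_cpx_simps[OF *(3)]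
  show ?thesis
    unfolding assms M_hom_def M_dual_def Let_def
    apply (simp add: dual_seq_def gamma_form_def Fun1_def exact_seq_hom_def seq_map_comp_def gamma_tensor_def Cpx_def C_tensor_def
       blk_unit_def blk_proj_def shift_cpx_def dual_cpx_def blk_diag_def *(1))
    apply (intro conjI allI carrier_matI ext_reindex[where m=m])
      apply (simp_all add: ** idx idx' ksign_def mat_simps blk_triv blk_col_mult blk_row_mult blk_uminus transpose_uminus)
    apply (simp_all add: algebra_simps)
    done
qed


lemma cone_cols_unique:
  assumes "\<And>i. (f::int \<Rightarrow> 'a::{comm_ring, comm_monoid_mult} mat) i \<in> carrier_mat (rk Y i) (rk X i)"
    "B \<in> carrier_mat n (rk Y i + rk X (i + 1))" "B' \<in> carrier_mat n (rk Y i + rk X (i + 1))"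
    "B * snd (blk_unit X Y) i = B' * snd (blk_unit X Y) i"
    "B * blk_diag (f i) (1\<^sub>m (rk X (i + 1))) = B' * blk_diag (f i) (1\<^sub>m (rk X (i + 1)))"
  shows "B = B'"
proof -
  let ?U = "snd (blk_unit X Y) i" and ?V = "blk_diag (f i) (1\<^sub>m (rk X (i + 1)))"
  let ?P = "four_block_mat (1\<^sub>m (rk Y i)) (0\<^sub>m (rk Y i) (rk X (i + 1))) (0\<^sub>m 0 (rk Y i)) (0\<^sub>m 0 (rk X (i + 1))) :: 'a mat"
  let ?Q = "four_block_mat (0\<^sub>m (rk X i) (rk Y i)) (0\<^sub>m (rk X i) (rk X (i + 1))) (0\<^sub>m (rk X (i + 1)) (rk Y i)) (1\<^sub>m (rk X (i + 1))) :: 'a mat"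
  note d = carrier_matD[OF assms(1)]
  have U: "?U \<in> carrier_mat (rk Y i + rk X (i + 1)) (rk Y i)" and V: "?V \<in> carrier_mat (rk Y i + rk X (i + 1)) (rk X i + rk X (i + 1))"
    and P: "?P \<in> carrier_mat (rk Y i) (rk Y i + rk X (i + 1))" and Q: "?Q \<in> carrier_mat (rk X i + rk X (i + 1)) (rk Y i + rk X (i + 1))"
    by (intro carrier_matI; simp add: blk_unit_def blk_diag_def d)+
  have one: "?U * ?P + ?V * ?Q = 1\<^sub>m (rk Y i + rk X (i + 1))"
    by (simp add: blk_unit_def blk_diag_def d mat_simps)
  have "M = M * ?U * ?P + M * ?V * ?Q" if M: "M \<in> carrier_mat n (rk Y i + rk X (i + 1))" for M
  proof -
    have "M = M * (?U * ?P + ?V * ?Q)" using M by (simp add: one mult_one)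
    also have "\<dots> = M * ?U * ?P + M * ?V * ?Q"
      using mult_add_distrib_mat[OF M mult_carrier_mat[OF U P] mult_carrier_mat[OF V Q]]
        assoc_mult_mat[OF M U P] assoc_mult_mat[OF M V Q] by simp
    finally show ?thesis .
  qed
  from this[OF assms(2)] this[OF assms(3)] show ?thesis unfolding assms(4,5) by simp
qed

lemma M_hom_unique:
  assumes F: "F = (X, f, Y)" "F \<in> dg_ob (Fun1 (Cpx m))" and M: "M \<in> M_ob (Cpx k)"
    and h: "(h0, h1, h2) \<in> M_hom (Cpx k) (cone_lift F) M n" and h': "(h0, h1', h2) \<in> M_hom (Cpx k) (cone_lift F) M n"
  shows "h1 = h1'"
proof -
  obtain E0 g0 E1 g1 E2 where Meq: "M = (E0, g0, E1, g1, E2)" by (cases M)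
  obtain a b c where h1: "h1 = (a, b, c)" by (cases h1)
  obtain a' b' c' where h1': "h1' = (a', b', c')" by (cases h1')
  obtain ga gb gc where g0: "g0 = (ga, gb, gc)" by (cases g0)
  obtain gga ggb ggc where g1: "g1 = (gga, ggb, ggc)" by (cases g1)
  obtain a0 b0 c0 where h0: "h0 = (a0, b0, c0)" by (cases h0)
  obtain a2 b2 c2 where h2: "h2 = (a2, b2, c2)" by (cases h2)
  obtain U u V v W where E1: "E1 = (U, u, V, v, W)" by (cases E1)
  obtain U' u' V' v' W' where E0: "E0 = (U', u', V', v', W')" by (cases E0)
  obtain U2 u2 V2 v2 W2 where E2: "E2 = (U2, u2, V2, v2, W2)" by (cases E2)
  note eqs = h1 h1' g0 g1 h0 h2 E1 E0 E2 Meq F(1)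
  from F obtain f' where *: "f = (0, f')" "is_cpx X" "is_cpx Y" "\<And>i. dim_row (f' i) = rk Y i" "\<And>i. dim_col (f' i) = rk X i"
    "\<And>i. df Y i * f' i = f' (i + 1) * df X i" using FunE by metis
  have id: "gga = dg_id (Cpx k) U" using M unfolding M_ob_def eqs by simp
  have left: "x = dg_comp (Cpx k) a2 (0, \<lambda>i. 1\<^sub>m (rk Y i))"
    if hyp: "x \<in> dg_hom (Cpx k) Y U n" "dg_comp (Cpx k) a2 (0, \<lambda>i. 1\<^sub>m (rk Y i)) = dg_comp (Cpx k) (dg_id (Cpx k) U) x" for x
  proof -
    obtain xx where x: "x = (n, xx)" and c: "\<And>i. xx i \<in> carrier_mat (rk U (i + n)) (rk Y i)" using hyp(1) by (auto simp: Cpx_def)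
    have "dg_comp (Cpx k) (dg_id (Cpx k) U) x = x"
      unfolding x by (simp add: Cpx_def one_mult carrier_matD[OF c])
    with hyp(2) show ?thesis by simp
  qed
  have A: "a \<in> dg_hom (Cpx k) Y U n" "a' \<in> dg_hom (Cpx k) Y U n"
    "dg_comp (Cpx k) a2 (0, \<lambda>i. 1\<^sub>m (rk Y i)) = dg_comp (Cpx k) gga a"
    "dg_comp (Cpx k) a2 (0, \<lambda>i. 1\<^sub>m (rk Y i)) = dg_comp (Cpx k) gga a'"
    using h h' unfolding M_hom_def eqs by (simp_all add: exact_seq_hom_def seq_map_comp_def)
  have aa: "a = a'" using left[of a] left[of a'] A id by simp
  have C: "c \<in> dg_hom (Cpx k) (shift_cpx X) W n" "c' \<in> dg_hom (Cpx k) (shift_cpx X) W n"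
    "dg_comp (Cpx k) c (0, \<lambda>i. 1\<^sub>m (rk X (i + 1))) = dg_comp (Cpx k) c' (0, \<lambda>i. 1\<^sub>m (rk X (i + 1)))"
    using h h' unfolding M_hom_def eqs by (simp_all add: exact_seq_hom_def seq_map_comp_def)
  have "dg_comp (Cpx k) x (0, \<lambda>i. 1\<^sub>m (rk X (i + 1))) = x" if x: "x \<in> dg_hom (Cpx k) (shift_cpx X) W n" for x
  proof -
    obtain xx where x: "x = (n, xx)" and c: "\<And>i. xx i \<in> carrier_mat (rk W (i + n)) (rk X (i + 1))"
      using x by (auto simp: Cpx_def shift_cpx_def)
    show ?thesis unfolding x by (simp add: Cpx_def mult_one carrier_matD[OF c])
  qed
  with C have cc: "c = c'" by simp
  have B: "b \<in> dg_hom (Cpx k) (cone_ob F) V n" "b' \<in> dg_hom (Cpx k) (cone_ob F) V n"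
    "dg_comp (Cpx k) b (blk_unit X Y) = dg_comp (Cpx k) b' (blk_unit X Y)"
    "dg_comp (Cpx k) b (0, \<lambda>i. blk_diag (snd f i) (1\<^sub>m (rk X (i + 1)))) = dg_comp (Cpx k) b' (0, \<lambda>i. blk_diag (snd f i) (1\<^sub>m (rk X (i + 1))))"
    using h h' unfolding M_hom_def eqs aa by (simp_all add: exact_seq_hom_def seq_map_comp_def aa gamma_tensor_def)
  obtain bb bb' where b: "b = (n, bb)" "b' = (n, bb')"
    and bc: "\<And>i. bb i \<in> carrier_mat (rk V (i + n)) (rk Y i + rk X (i + 1))" "\<And>i. bb' i \<in> carrier_mat (rk V (i + n)) (rk Y i + rk X (i + 1))"
    using B(1,2) unfolding F(1) by (auto simp: Cpx_def)
  have "bb i = bb' i" for i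
  proof (rule cone_cols_unique[where f = f' and X = X and Y = Y and i = i and n = "rk V (i + n)"])
    show "f' i \<in> carrier_mat (rk Y i) (rk X i)" for i using *(4,5) by (intro carrier_matI) auto
    show "bb i * snd (blk_unit X Y) i = bb' i * snd (blk_unit X Y) i"
      using arg_cong[OF B(3), of "\<lambda>h. snd h i"] unfolding b by (simp add: Cpx_def blk_unit_def)
    show "bb i * blk_diag (f' i) (1\<^sub>m (rk X (i + 1))) = bb' i * blk_diag (f' i) (1\<^sub>m (rk X (i + 1)))"
      using arg_cong[OF B(4), of "\<lambda>h. snd h i"] unfolding b by (simp add: Cpx_def *(1))
  qed (use bc in auto)
  then have "b = b'" unfolding b by auto
  with aa cc show ?thesis unfolding h1 h1' by simp
qed

end

theory Submission
  imports Defs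
begin

text \<open>
  (1) On the nose, \<open>cone (0 \<rightarrow> Z) = Z\<close>, and every \<open>f : X \<rightarrow> Y\<close> is joined to \<open>0 \<rightarrow> cone f\<close> by the natural weak
  equivalences \<open>(X \<rightarrow> Y) \<rightarrow> (C \<otimes> X \<rightarrow> cone f) \<leftarrow> (0 \<rightarrow> cone f)\<close>.  So \<open>Z \<mapsto> (0 \<rightarrow> Z)\<close> is inverse to the cone
  on localizations.  The cone commutes with shifts up to the isomorphism \<open>diag (1, -1)\<close>, hence preserves
  standard triangles.

  (2) Quasi-isomorphisms of bounded complexes of free modules are homotopy equivalences, so a trace
  argument modulo \<open>2R\<close> shows that the parity of the total rank is an invariant on \<open>GW\<^sub>0\<close> when \<open>2\<close> is not a
  unit.  The form on a cone is, in degree \<open>0\<close>, of the shape \<open>B + B\<^sup>T\<close>, which forces the total rank to be even,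
  again by a trace computation; but the unit form on \<open>R\<close> has rank \<open>1\<close>.
\<close>

section \<open>Zigzags and localizations\<close>

text \<open>Morphisms of the localization are classes of arbitrary zigzags, and no calculus of
  fractions is set up for them. Full faithfulness rests on a formal principle instead: a zigzag of
  natural weak equivalences between GF and the identity becomes a natural isomorphism, because
  naturality for a morphism forces naturality for its formal inverse. For (2), the classical
  argument reduces modulo a maximal ideal containing 2. Over a field of characteristic 2 the total
  rank has the parity of the Euler characteristic, hence of the dimension of cohomology, where
  degrees i and -i pair off and the form on the middle degree is alternating. Here R is kept, and
  dimensions are replaced with traces read modulo 2R: all Koszul signs disappear, the sum of the
  traces of a chain map is a homotopy invariant, and B + B^T is what remains of being alternating.
  Homotopy inverses make traces applicable; they exist because bounded acyclic complexes of free
  modules are contractible.\<close>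

lemma zz_ends: "is_zigzag C W X p Y \<Longrightarrow> X \<in> Ob C \<and> Y \<in> Ob C"
  by (induction C W X p Y rule: is_zigzag.induct) auto

lemma zz_append: "is_zigzag C W X p Y \<Longrightarrow> is_zigzag C W Y q Z \<Longrightarrow> is_zigzag C W X (p @ q) Z"
  by (induction C W X p Y rule: is_zigzag.induct) auto

text \<open>The target stays fixed while the source varies, as legs are peeled off from the front.
  Each case also supplies that the intermediate object lies in \<open>Ob C\<close>, which is only
  implicit in the remaining zigzag.\<close>

lemma zz_induct [consumes 1, case_names Nil Fwd Bwd]:
  assumes "is_zigzag C W X p Y"
    and "Y \<in> Ob C \<Longrightarrow> P Y []"
    and "\<And>X f B p. \<lbrakk>X \<in> Ob C; B \<in> Ob C; f \<in> Hom C X B; is_zigzag C W B p Y; P B p\<rbrakk> \<Longrightarrow> P X ((X, Fwd f, B) # p)"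
    and "\<And>X f B p. \<lbrakk>X \<in> Ob C; B \<in> Ob C; f \<in> W B X; is_zigzag C W B p Y; P B p\<rbrakk> \<Longrightarrow> P X ((X, Bwd f, B) # p)"
  shows "P X p"
  using assms(1)
proof (induction p arbitrary: X)
  case (Cons l p)
  obtain A s B where l: "l = (A, s, B)" by (cases l)
  show ?case
  proof (cases s)
    case (Fwd f)
    then show ?thesis using Cons l zz_ends[of C W B p Y] assms(3) by auto
  next
    case (Bwd f)
    then show ?thesis using Cons l zz_ends[of C W B p Y] assms(4) by auto
  qed
qed (use assms(2) in auto)

text \<open>Composition in the localization is concatenation, which is associative and unital on its
  own. Hence closure under identities and composition, with \<open>W\<close> consisting of
  morphisms, is what is asked of \<open>C\<close>.\<close>

locale relcat =
  fixes C :: "('o, 'm) cat" and W :: "'o \<Rightarrow> 'o \<Rightarrow> 'm set"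
  assumes Ident_in: "X \<in> Ob C \<Longrightarrow> Ident C X \<in> Hom C X X"
    and Comp_in: "\<lbrakk>X \<in> Ob C; Y \<in> Ob C; Z \<in> Ob C; f \<in> Hom C X Y; g \<in> Hom C Y Z\<rbrakk> \<Longrightarrow> Comp C X Y Z g f \<in> Hom C X Z"
    and W_Hom: "\<lbrakk>X \<in> Ob C; Y \<in> Ob C; f \<in> W X Y\<rbrakk> \<Longrightarrow> f \<in> Hom C X Y"
begin

abbreviation "zz \<equiv> is_zigzag C W"
abbreviation "zeq \<equiv> zz_eq C W"
abbreviation "cls \<equiv> zz_class C W"
abbreviation "L \<equiv> localization C W"

lemma zz_rel_zz: "zz_rel C W X Y p q \<Longrightarrow> zz X p Y \<and> zz X q Y"
  by (induction rule: zz_rel.induct) (auto intro: Ident_in Comp_in W_Hom)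

lemma zeq_zz: "zeq X Y p q \<Longrightarrow> zz X p Y \<and> zz X q Y"
  by (induction rule: zz_eq.induct) (auto dest: zz_rel_zz intro!: zz_append)

lemma rel_zeq: "zz_rel C W X Y p q \<Longrightarrow> zeq X Y p q"
  using zz_step[of C W X "[]" X Y p q "[]" Y] zz_rel_zz[of X Y p q] zz_ends[of C W X p Y] by auto

lemma zeq_prepend: "zeq Y Z p q \<Longrightarrow> zz X a Y \<Longrightarrow> zeq X Z (a @ p) (a @ q)"
proof (induction rule: zz_eq.induct)
  case (zz_step X b A B p q c Y)
  then show ?case using zz_eq.zz_step[of C W _ "a @ b" A B p q c Y] zz_append by fastforce
qed (auto intro: zz_eq.intros zz_append)

lemma zeq_append: "zeq X Y p q \<Longrightarrow> zz Y b Z \<Longrightarrow> zeq X Z (p @ b) (q @ b)"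
proof (induction rule: zz_eq.induct)
  case (zz_step X a A B p q c Y)
  then show ?case using zz_eq.zz_step[of C W X a A B p q "c @ b" Z] zz_append by fastforce
qed (auto intro: zz_eq.intros zz_append)

lemma zeq_cong: "zeq X Y p p' \<Longrightarrow> zeq Y Z q q' \<Longrightarrow> zeq X Z (p @ q) (p' @ q')"
  by (meson zeq_append zeq_prepend zeq_zz zz_trans)

text \<open>\<open>zz_eq\<close> is reflexive on genuine zigzags only; for other lists both classes
  could be empty, and so equal, without the lists being related.\<close>

lemma cls_eq_iff: "zz X p Y \<Longrightarrow> cls X Y p = cls X Y q \<longleftrightarrow> zeq X Y p q"
  unfolding zz_class_def using zz_refl zz_sym zz_trans by (metis (no_types, lifting) Collect_cong mem_Collect_eq)

lemma cls_eqI: "zeq X Y p q \<Longrightarrow> cls X Y p = cls X Y q"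
  using cls_eq_iff zeq_zz by blast

text \<open>Composition is defined through all representatives; by \<open>zeq_cong\<close> any one
  pair of them is enough.\<close>

lemma Comp_cls:
  assumes "zz X p Y" "zz Y q Z"
  shows "Comp L X Y Z (cls Y Z q) (cls X Y p) = cls X Z (p @ q)"
proof -
  have "(\<exists>p'\<in>cls X Y p. \<exists>q'\<in>cls Y Z q. zeq X Z (p' @ q') r) \<longleftrightarrow> zeq X Z (p @ q) r" for r
  proof
    assume "zeq X Z (p @ q) r"
    then show "\<exists>p'\<in>cls X Y p. \<exists>q'\<in>cls Y Z q. zeq X Z (p' @ q') r"
      using zz_refl[OF assms(1)] zz_refl[OF assms(2)] unfolding zz_class_def by blast
  next
    assume "\<exists>p'\<in>cls X Y p. \<exists>q'\<in>cls Y Z q. zeq X Z (p' @ q') r"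
    then obtain p' q' where "zeq X Y p p'" "zeq Y Z q q'" "zeq X Z (p' @ q') r" unfolding zz_class_def by blast
    then show "zeq X Z (p @ q) r" using zz_trans[OF zeq_cong] by blast
  qed
  then show ?thesis unfolding localization_def by (simp add: zz_class_def)
qed

lemma Comp_L_assoc:
  assumes "f \<in> Hom L X Y" "g \<in> Hom L Y Z" "h \<in> Hom L Z U"
  shows "Comp L X Z U h (Comp L X Y Z g f) = Comp L X Y U (Comp L Y Z U h g) f"
proof -
  obtain p q r where "f = cls X Y p" "zz X p Y" "g = cls Y Z q" "zz Y q Z" "h = cls Z U r" "zz Z r U"
    using assms unfolding localization_def by auto
  then show ?thesis using zz_append[of C W X p Y q Z] zz_append[of C W Y q Z r U] by (simp add: Comp_cls)
qed

lemma Hom_L: "Hom L X Y = {cls X Y p | p. zz X p Y}" by (simp add: localization_def)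
lemma Ident_L: "Ident L X = cls X X []" by (simp add: localization_def)
lemma Ob_L: "Ob L = Ob C" by (simp add: localization_def)
lemma cls_in_Hom: "zz X p Y \<Longrightarrow> cls X Y p \<in> Hom L X Y" by (auto simp: Hom_L)

lemma fwd_comp: "\<lbrakk>X \<in> Ob C; Y \<in> Ob C; Z \<in> Ob C; f \<in> Hom C X Y; g \<in> Hom C Y Z\<rbrakk> \<Longrightarrow>
    zeq X Z [(X, Fwd f, Y), (Y, Fwd g, Z)] [(X, Fwd (Comp C X Y Z g f), Z)]"
  by (intro rel_zeq zz_comp)

lemma fwd_square:
  assumes "X \<in> Ob C" "Y \<in> Ob C" "Y' \<in> Ob C" "Z \<in> Ob C" "f \<in> Hom C X Y" "g \<in> Hom C Y Z" "f' \<in> Hom C X Y'" "g' \<in> Hom C Y' Z"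
    "Comp C X Y Z g f = Comp C X Y' Z g' f'"
  shows "zeq X Z [(X, Fwd f, Y), (Y, Fwd g, Z)] [(X, Fwd f', Y'), (Y', Fwd g', Z)]"
  using fwd_comp[OF assms(1,2,4,5,6)] fwd_comp[OF assms(1,3,4,7,8)] unfolding assms(9) by (rule zz_trans[OF _ zz_sym])

lemma fwd_bwd: "\<lbrakk>X \<in> Ob C; Y \<in> Ob C; f \<in> W X Y\<rbrakk> \<Longrightarrow> zeq X X [(X, Fwd f, Y), (Y, Bwd f, X)] []"
  by (intro rel_zeq zz_fwd_bwd)

lemma bwd_fwd: "\<lbrakk>X \<in> Ob C; Y \<in> Ob C; f \<in> W X Y\<rbrakk> \<Longrightarrow> zeq Y Y [(Y, Bwd f, X), (X, Fwd f, Y)] []"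
  by (intro rel_zeq zz_bwd_fwd)

lemma zz_single: "X \<in> Ob C \<Longrightarrow> Y \<in> Ob C \<Longrightarrow> f \<in> Hom C X Y \<Longrightarrow> zz X [(X, Fwd f, Y)] Y"
  by simp

lemma cat_iso_L_cls:
  assumes "zz X p Y" "zz Y q X" "zeq X X (p @ q) []" "zeq Y Y (q @ p) []"
  shows "cat_iso L X Y (cls X Y p)"
  unfolding cat_iso_def Ident_L
  using cls_eqI[OF assms(3)] cls_eqI[OF assms(4)] assms(1,2)
  by (metis Comp_cls cls_in_Hom)

lemma cat_iso_LE:
  assumes "cat_iso L X Y a"
  obtains p q where "a = cls X Y p" "zz X p Y" "zz Y q X" "zeq X X (p @ q) []" "zeq Y Y (q @ p) []"
proof -
  from assms obtain p q where p: "a = cls X Y p" "zz X p Y" "zz Y q X"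
    "Comp L X Y X (cls Y X q) a = cls X X []" "Comp L Y X Y a (cls Y X q) = cls Y Y []"
    unfolding cat_iso_def Ident_L Hom_L by auto
  have 4: "zeq X X (p @ q) []" using p(4) unfolding p(1) Comp_cls[OF p(2,3)] cls_eq_iff[OF zz_append[OF p(2,3)]] .
  have 5: "zeq Y Y (q @ p) []" using p(5) unfolding p(1) Comp_cls[OF p(3,2)] cls_eq_iff[OF zz_append[OF p(3,2)]] .
  show ?thesis by (rule that[OF p(1-3) 4 5])
qed

lemma cat_iso_loc_of:
  assumes "X \<in> Ob C" "Y \<in> Ob C" "f \<in> Hom C X Y" "g \<in> Hom C Y X"
    "Comp C X Y X g f = Ident C X" "Comp C Y X Y f g = Ident C Y"
  shows "cat_iso L X Y (loc_of C W X Y f)"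
  unfolding loc_of_def
proof (rule cat_iso_L_cls[where q = "[(Y, Fwd g, X)]"])
  show "zeq X X ([(X, Fwd f, Y)] @ [(Y, Fwd g, X)]) []"
    using fwd_comp[of X Y X f g] rel_zeq[OF zz_id[OF assms(1)]] assms by (simp, metis zz_trans)
  show "zeq Y Y ([(Y, Fwd g, X)] @ [(X, Fwd f, Y)]) []"
    using fwd_comp[of Y X Y g f] rel_zeq[OF zz_id[OF assms(2)]] assms by (simp, metis zz_trans)
qed (use assms in auto)

end

section \<open>Functors between localizations\<close>

locale relfunctor = C: relcat C W + D: relcat D V
  for C :: "('o, 'm) cat" and W and D :: "('p, 'n) cat" and V +
  fixes FO :: "'o \<Rightarrow> 'p" and FM :: "'o \<Rightarrow> 'o \<Rightarrow> 'm \<Rightarrow> 'n"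
  assumes F_functor: "is_functor C D FO FM"
    and F_W: "\<lbrakk>X \<in> Ob C; Y \<in> Ob C; f \<in> W X Y\<rbrakk> \<Longrightarrow> FM X Y f \<in> V (FO X) (FO Y)"
begin

abbreviation "mp \<equiv> map (map_leg FO FM)"

lemma FO_in: "X \<in> Ob C \<Longrightarrow> FO X \<in> Ob D"
  and F_Ident: "X \<in> Ob C \<Longrightarrow> FM X X (Ident C X) = Ident D (FO X)"
  and FM_in: "\<lbrakk>X \<in> Ob C; Y \<in> Ob C; f \<in> Hom C X Y\<rbrakk> \<Longrightarrow> FM X Y f \<in> Hom D (FO X) (FO Y)"
  and F_Comp: "\<lbrakk>X \<in> Ob C; Y \<in> Ob C; Z \<in> Ob C; f \<in> Hom C X Y; g \<in> Hom C Y Z\<rbrakk> \<Longrightarrow>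
    FM X Z (Comp C X Y Z g f) = Comp D (FO X) (FO Y) (FO Z) (FM Y Z g) (FM X Y f)"
  using F_functor unfolding is_functor_def by blast+

lemma mp_zz: "C.zz X p Y \<Longrightarrow> D.zz (FO X) (mp p) (FO Y)"
  by (induction rule: zz_induct) (auto intro: FO_in FM_in F_W)

lemma mp_rel: "zz_rel C W X Y p q \<Longrightarrow> D.zeq (FO X) (FO Y) (mp p) (mp q)"
proof (induction rule: zz_rel.induct)
  case (zz_comp X Y Z f g)
  then show ?case using zz_rel.zz_comp[of "FO X" D "FO Y" "FO Z" "FM X Y f" "FM Y Z g"] by (auto intro!: D.rel_zeq simp: F_Comp FO_in FM_in)
qed (auto intro!: D.rel_zeq zz_rel.intros simp: F_Ident FO_in FM_in F_W)

lemma mp_zeq: "C.zeq X Y p q \<Longrightarrow> D.zeq (FO X) (FO Y) (mp p) (mp q)"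
proof (induction rule: zz_eq.induct)
  case (zz_step X a A B p q b Y)
  show ?case using D.zeq_prepend[OF D.zeq_append[OF mp_rel[OF zz_step(2)] mp_zz[OF zz_step(3)]] mp_zz[OF zz_step(1)]]
    by simp
qed (auto intro: zz_eq.intros mp_zz)

abbreviation "lm \<equiv> loc_map D V FO FM"

lemma lm_cls: "C.zz X p Y \<Longrightarrow> lm X Y (C.cls X Y p) = D.cls (FO X) (FO Y) (mp p)"
  unfolding loc_map_def zz_class_def
  using mp_zeq zz_refl[of C W X p Y] by (blast intro: zz_trans)

lemma lm_loc_of: "\<lbrakk>X \<in> Ob C; Y \<in> Ob C; f \<in> Hom C X Y\<rbrakk> \<Longrightarrow>
    lm X Y (loc_of C W X Y f) = loc_of D V (FO X) (FO Y) (FM X Y f)"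
  unfolding loc_of_def by (subst lm_cls) auto

lemma lm_functor: "is_functor C.L D.L FO lm"
  unfolding is_functor_def C.Ob_L D.Ob_L C.Ident_L D.Ident_L C.Hom_L D.Hom_L
proof (intro conjI ballI; clarify?)
  show "lm X X (C.cls X X []) = D.cls (FO X) (FO X) []" if "X \<in> Ob C" for X
    using lm_cls[of X "[]" X] that by simp
  show "\<exists>p'. lm X Y (C.cls X Y p) = D.cls (FO X) (FO Y) p' \<and> D.zz (FO X) p' (FO Y)"
    if "C.zz X p Y" for X Y p using lm_cls mp_zz that by blast
  show "lm X Z (Comp C.L X Y Z (C.cls Y Z q) (C.cls X Y p)) =
     Comp D.L (FO X) (FO Y) (FO Z) (lm Y Z (C.cls Y Z q)) (lm X Y (C.cls X Y p))"
    if "C.zz X p Y" "C.zz Y q Z" for X Y Z p q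
    using that by (simp add: C.Comp_cls D.Comp_cls lm_cls zz_append mp_zz)
qed (rule FO_in)

lemma lm_iso: "cat_iso C.L X Y a \<Longrightarrow> cat_iso D.L (FO X) (FO Y) (lm X Y a)"
proof (erule C.cat_iso_LE)
  fix p q assume *: "a = C.cls X Y p" "C.zz X p Y" "C.zz Y q X" "C.zeq X X (p @ q) []" "C.zeq Y Y (q @ p) []"
  show "cat_iso D.L (FO X) (FO Y) (lm X Y a)"
    unfolding *(1) lm_cls[OF *(2)]
    using mp_zeq[OF *(4)] mp_zeq[OF *(5)] by (intro D.cat_iso_L_cls[where q = "mp q"]) (auto intro: mp_zz *)
qed

end

lemma map_leg_compose:
  "map_leg GO GM (map_leg FO FM l) = map_leg (\<lambda>X. GO (FO X)) (\<lambda>X Y f. GM (FO X) (FO Y) (FM X Y f)) l"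
proof -
  obtain A s B where l: "l = (A, s, B)" by (cases l)
  show ?thesis by (cases s) (simp_all add: l)
qed

lemma relfunctor_compose:
  assumes "relfunctor C W D V FO FM" "relfunctor D V E U GO GM"
  shows "relfunctor C W E U (\<lambda>X. GO (FO X)) (\<lambda>X Y f. GM (FO X) (FO Y) (FM X Y f))"
proof -
  interpret F: relfunctor C W D V FO FM by fact
  interpret G: relfunctor D V E U GO GM by fact
  show ?thesis
  proof
    show "is_functor C E (\<lambda>X. GO (FO X)) (\<lambda>X Y f. GM (FO X) (FO Y) (FM X Y f))"
      unfolding is_functor_def by (simp add: F.FO_in G.FO_in F.F_Ident G.F_Ident F.FM_in G.FM_in F.F_Comp G.F_Comp)
  qed (simp add: F.F_W G.F_W F.FO_in)
qed

text \<open>Naturality in the localization may be checked on morphisms of the original category, even for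
  transformations whose components are only zigzags.\<close>

lemma zz_natural:
  assumes F: "relfunctor C W D V FO FM" and G: "relfunctor C W D V GO GM"
    and \<theta>: "\<And>X. X \<in> Ob C \<Longrightarrow> is_zigzag D V (FO X) (\<theta> X) (GO X)"
    and nat: "\<And>X Y f. \<lbrakk>X \<in> Ob C; Y \<in> Ob C; f \<in> Hom C X Y\<rbrakk> \<Longrightarrow>
      zz_eq D V (FO X) (GO Y) ((FO X, Fwd (FM X Y f), FO Y) # \<theta> Y) (\<theta> X @ [(GO X, Fwd (GM X Y f), GO Y)])"
    and p: "is_zigzag C W X p Y"
  shows "zz_eq D V (FO X) (GO Y) (map (map_leg FO FM) p @ \<theta> Y) (\<theta> X @ map (map_leg GO GM) p)"
proof -
  interpret F: relfunctor C W D V FO FM by fact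
  interpret G: relfunctor C W D V GO GM by fact
  have C: "relcat C W" and D: "relcat D V" using F.C.relcat_axioms F.D.relcat_axioms by auto
  show ?thesis using p
  proof (induction p arbitrary: X)
    case Nil
    then show ?case using \<theta> by (auto intro: zz_refl)
  next
    case (Cons l p)
    obtain A s B where l: "l = (A, s, B)" by (cases l)
    show ?case
    proof (cases s)
      case (Fwd f)
      with Cons.prems l have *: "X = A" "X \<in> Ob C" "f \<in> Hom C X B" "is_zigzag C W B p Y" by auto
      then have B: "B \<in> Ob C" "Y \<in> Ob C" using zz_ends by metis+
      have "F.D.zeq (FO X) (GO Y) ([(FO X, Fwd (FM X B f), FO B)] @ (F.mp p @ \<theta> Y)) ([(FO X, Fwd (FM X B f), FO B)] @ (\<theta> B @ G.mp p))"
        by (rule F.D.zeq_prepend[OF Cons.IH[OF *(4)]]) (use * B in \<open>simp add: F.FO_in F.FM_in\<close>)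
      moreover have "F.D.zeq (FO X) (GO Y) (((FO X, Fwd (FM X B f), FO B) # \<theta> B) @ G.mp p) ((\<theta> X @ [(GO X, Fwd (GM X B f), GO B)]) @ G.mp p)"
        by (rule F.D.zeq_append[OF nat[OF *(2) B(1) *(3)] G.mp_zz[OF *(4)]])
      ultimately show ?thesis using * by (auto simp: l Fwd intro: zz_trans)
    next
      case (Bwd f)
      with Cons.prems l have *: "X = A" "X \<in> Ob C" "f \<in> W B X" "is_zigzag C W B p Y" by auto
      then have B: "B \<in> Ob C" "Y \<in> Ob C" using zz_ends by metis+
      let ?Ff = "(FO B, Fwd (FM B X f), FO X)" and ?Fb = "(FO X, Bwd (FM B X f), FO B)"
      let ?Gf = "(GO B, Fwd (GM B X f), GO X)" and ?Gb = "(GO X, Bwd (GM B X f), GO B)"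
      have h: "f \<in> Hom C B X" using F.C.W_Hom * B by blast
      have zFb: "F.D.zz (FO X) [?Fb] (FO B)" and zGb: "F.D.zz (GO X) [?Gb] (GO B)"
        using F.F_W[OF B(1) *(2,3)] G.F_W[OF B(1) *(2,3)] B * by (auto simp: F.FO_in G.FO_in)
      \<comment> \<open>The square of \<open>f\<close> has to be turned around for a backward leg:
        insert \<open>?Gf\<close>, \<open>?Gb\<close> after \<open>\<theta> B\<close>, replace
        \<open>\<theta> B\<close>, \<open>?Gf\<close> by \<open>?Ff\<close>,
        \<open>\<theta> X\<close>, and cancel \<open>?Fb\<close> against \<open>?Ff\<close>.\<close>
      have 1: "F.D.zeq (FO X) (GO Y) (?Fb # F.mp p @ \<theta> Y) (?Fb # \<theta> B @ G.mp p)"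
        using F.D.zeq_prepend[OF Cons.IH[OF *(4)] zFb] by simp
      have 2: "F.D.zeq (FO X) (GO B) (?Fb # \<theta> B) (?Fb # \<theta> B @ [?Gf, ?Gb])"
        using F.D.zeq_prepend[OF zz_sym[OF F.D.fwd_bwd[OF G.FO_in[OF B(1)] G.FO_in[OF *(2)] G.F_W[OF B(1) *(2,3)]]] zz_append[OF zFb \<theta>[OF B(1)]]]
        by simp
      have 3: "F.D.zeq (FO X) (GO B) (?Fb # \<theta> B @ [?Gf, ?Gb]) (?Fb # ?Ff # \<theta> X @ [?Gb])"
        using F.D.zeq_append[OF F.D.zeq_prepend[OF zz_sym[OF nat[OF B(1) *(2) h]] zFb] zGb] by simp
      have 4: "F.D.zeq (FO X) (GO B) (?Fb # ?Ff # \<theta> X @ [?Gb]) (\<theta> X @ [?Gb])"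
        using F.D.zeq_append[OF F.D.bwd_fwd[OF F.FO_in[OF B(1)] F.FO_in[OF *(2)] F.F_W[OF B(1) *(2,3)]] zz_append[OF \<theta>[OF *(2)] zGb]]
        by simp
      have "F.D.zeq (FO X) (GO B) (?Fb # \<theta> B) (\<theta> X @ [?Gb])"
        using 2 3 4 by (meson zz_trans)
      from zz_trans[OF 1] F.D.zeq_append[OF this G.mp_zz[OF *(4)]] show ?thesis
        using * by (simp add: l Bwd)
    qed
  qed
qed

text \<open>The zigzag \<open>1 \<rightarrow> H \<leftarrow> GF\<close> given by \<open>\<alpha>\<close> and \<open>\<beta>\<close> becomes an isomorphism after localizing, while \<open>FG = 1\<close>
  holds on the nose.\<close>

locale rel_equivalence = F: relfunctor C W D V FO FM + G: relfunctor D V C W GO GM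
  for C :: "('o, 'm) cat" and W and D :: "('p, 'n) cat" and V and FO FM GO GM +
  fixes HO :: "'o \<Rightarrow> 'o" and HM :: "'o \<Rightarrow> 'o \<Rightarrow> 'm \<Rightarrow> 'm" and \<alpha> \<beta>
  assumes H: "X \<in> Ob C \<Longrightarrow> HO X \<in> Ob C" "\<lbrakk>X \<in> Ob C; Y \<in> Ob C; f \<in> Hom C X Y\<rbrakk> \<Longrightarrow> HM X Y f \<in> Hom C (HO X) (HO Y)"
    and \<alpha>: "X \<in> Ob C \<Longrightarrow> \<alpha> X \<in> W X (HO X)"
    and \<beta>: "X \<in> Ob C \<Longrightarrow> \<beta> X \<in> W (GO (FO X)) (HO X)"
    and \<alpha>_nat: "\<lbrakk>X \<in> Ob C; Y \<in> Ob C; f \<in> Hom C X Y\<rbrakk> \<Longrightarrow>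
      Comp C X Y (HO Y) (\<alpha> Y) f = Comp C X (HO X) (HO Y) (HM X Y f) (\<alpha> X)"
    and \<beta>_nat: "\<lbrakk>X \<in> Ob C; Y \<in> Ob C; f \<in> Hom C X Y\<rbrakk> \<Longrightarrow>
      Comp C (GO (FO X)) (GO (FO Y)) (HO Y) (\<beta> Y) (GM (FO X) (FO Y) (FM X Y f)) =
      Comp C (GO (FO X)) (HO X) (HO Y) (HM X Y f) (\<beta> X)"
    and FG_ob: "Z \<in> Ob D \<Longrightarrow> FO (GO Z) = Z"
    and FG_hom: "\<lbrakk>Z \<in> Ob D; Z' \<in> Ob D; k \<in> Hom D Z Z'\<rbrakk> \<Longrightarrow> FM (GO Z) (GO Z') (GM Z Z' k) = k"
begin

sublocale GF: relfunctor C W C W "\<lambda>X. GO (FO X)" "\<lambda>X Y f. GM (FO X) (FO Y) (FM X Y f)"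
  by (rule relfunctor_compose[OF F.relfunctor_axioms G.relfunctor_axioms])

sublocale I: relfunctor C W C W "\<lambda>X. X" "\<lambda>X Y f. f"
  by standard (auto simp: is_functor_def)

lemma map_I: "I.mp p = p"
proof -
  have "map_leg (\<lambda>X. X) (\<lambda>X Y f. f) l = l" for l :: "'o \<times> 'm leg \<times> 'o"
    by (cases l, case_tac b) auto
  then show ?thesis by (simp add: map_idI)
qed

lemma map_GF: "GF.mp p = G.mp (F.mp p)"
  by (simp add: map_leg_compose)

text \<open>FG is the identity on the nose, so the two zigzags agree as lists and not just as
  classes. This lets an equivalence of the form FG p ~ FG q be read as p ~ q in
  \<open>F_full\<close>.\<close>

lemma map_FG: "F.D.zz Z q Z' \<Longrightarrow> F.mp (G.mp q) = q"
  by (induction rule: zz_induct) (auto simp: FG_ob FG_hom F.D.W_Hom)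

definition "\<theta> X = [(X, Fwd (\<alpha> X), HO X), (HO X, Bwd (\<beta> X), GO (FO X))]"
definition "\<theta>' X = [(GO (FO X), Fwd (\<beta> X), HO X), (HO X, Bwd (\<alpha> X), X)]"

context fixes X assumes X: "X \<in> Ob C"
begin

lemma \<theta>_obs: "HO X \<in> Ob C" "GO (FO X) \<in> Ob C" "\<alpha> X \<in> Hom C X (HO X)" "\<beta> X \<in> Hom C (GO (FO X)) (HO X)"
  using X H \<alpha> \<beta> F.C.W_Hom GF.FO_in by auto

lemma \<theta>_zz: "F.C.zz X (\<theta> X) (GO (FO X))" "F.C.zz (GO (FO X)) (\<theta>' X) X"
  unfolding \<theta>_def \<theta>'_def using X \<theta>_obs \<alpha> \<beta> by auto

lemma \<theta>_inv: "F.C.zeq X X (\<theta> X @ \<theta>' X) []" "F.C.zeq (GO (FO X)) (GO (FO X)) (\<theta>' X @ \<theta> X) []"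
proof -
  have "F.C.zeq X X ([(X, Fwd (\<alpha> X), HO X)] @ [(HO X, Bwd (\<beta> X), GO (FO X)), (GO (FO X), Fwd (\<beta> X), HO X)] @ [(HO X, Bwd (\<alpha> X), X)])
    ([(X, Fwd (\<alpha> X), HO X)] @ [] @ [(HO X, Bwd (\<alpha> X), X)])"
    by (rule zz_step) (use X \<theta>_obs \<alpha> \<beta> in \<open>auto intro!: zz_rel.intros\<close>)
  from zz_trans[OF this] F.C.fwd_bwd[OF X \<theta>_obs(1) \<alpha>[OF X]]
  show "F.C.zeq X X (\<theta> X @ \<theta>' X) []" by (simp add: \<theta>_def \<theta>'_def)
  have "F.C.zeq (GO (FO X)) (GO (FO X)) ([(GO (FO X), Fwd (\<beta> X), HO X)] @ [(HO X, Bwd (\<alpha> X), X), (X, Fwd (\<alpha> X), HO X)] @ [(HO X, Bwd (\<beta> X), GO (FO X))])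
    ([(GO (FO X), Fwd (\<beta> X), HO X)] @ [] @ [(HO X, Bwd (\<beta> X), GO (FO X))])"
    by (rule zz_step) (use X \<theta>_obs \<alpha> \<beta> in \<open>auto intro!: zz_rel.intros\<close>)
  from zz_trans[OF this] F.C.fwd_bwd[OF \<theta>_obs(2,1) \<beta>[OF X]]
  show "F.C.zeq (GO (FO X)) (GO (FO X)) (\<theta>' X @ \<theta> X) []" by (simp add: \<theta>_def \<theta>'_def)
qed

end

lemma \<theta>_nat:
  assumes XY: "X \<in> Ob C" "Y \<in> Ob C" and f: "f \<in> Hom C X Y"
  shows "F.C.zeq X (GO (FO Y)) ((X, Fwd f, Y) # \<theta> Y) (\<theta> X @ [(GO (FO X), Fwd (GM (FO X) (FO Y) (FM X Y f)), GO (FO Y))])"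
proof -
  let ?\<alpha> = "\<lambda>X. (X, Fwd (\<alpha> X), HO X)" and ?\<beta> = "\<lambda>X. (GO (FO X), Fwd (\<beta> X), HO X)" and ?\<beta>' = "\<lambda>X. (HO X, Bwd (\<beta> X), GO (FO X))"
  let ?g = "GM (FO X) (FO Y) (FM X Y f)"
  let ?G = "(GO (FO X), Fwd ?g, GO (FO Y))" and ?H = "(HO X, Fwd (HM X Y f), HO Y)"
  note o = XY \<theta>_obs[OF XY(1)] \<theta>_obs[OF XY(2)] H(2)[OF XY f] GF.FM_in[OF XY f] \<beta>[OF XY(1)] \<beta>[OF XY(2)]
  have a: "F.C.zeq X (HO Y) [(X, Fwd f, Y), ?\<alpha> Y] [?\<alpha> X, ?H]"
    by (rule F.C.fwd_square) (use \<alpha>_nat[OF XY f] o f in auto)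
  have b: "F.C.zeq (GO (FO X)) (HO Y) [?\<beta> X, ?H] [?G, ?\<beta> Y]"
    by (rule F.C.fwd_square) (use \<beta>_nat[OF XY f] o in auto)
  have "F.C.zeq X (GO (FO Y)) [(X, Fwd f, Y), ?\<alpha> Y, ?\<beta>' Y] [?\<alpha> X, ?H, ?\<beta>' Y]"
    using F.C.zeq_append[OF a, of "[?\<beta>' Y]" "GO (FO Y)"] o by simp
  \<comment> \<open>The square of \<open>\<beta>\<close> contains its components as forward legs,
    whereas the zigzag has them backward; a cancelling pair \<open>?\<beta>' X\<close>,
    \<open>?\<beta> X\<close> is inserted so that the square applies.\<close>
  moreover have "F.C.zeq X (GO (FO Y)) [?\<alpha> X, ?\<beta>' X, ?\<beta> X, ?H, ?\<beta>' Y] [?\<alpha> X, ?H, ?\<beta>' Y]"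
    using zz_step[where a = "[?\<alpha> X]" and b = "[?H, ?\<beta>' Y]" and X = X and Y = "GO (FO Y)", OF _ zz_bwd_fwd[of "GO (FO X)" C "HO X" "\<beta> X" W]] o by simp
  moreover have "F.C.zeq X (GO (FO Y)) [?\<alpha> X, ?\<beta>' X, ?\<beta> X, ?H, ?\<beta>' Y] [?\<alpha> X, ?\<beta>' X, ?G, ?\<beta> Y, ?\<beta>' Y]"
    using F.C.zeq_prepend[OF F.C.zeq_append[OF b, of "[?\<beta>' Y]" "GO (FO Y)"], of X "[?\<alpha> X, ?\<beta>' X]"] o by simp
  moreover have "F.C.zeq X (GO (FO Y)) [?\<alpha> X, ?\<beta>' X, ?G, ?\<beta> Y, ?\<beta>' Y] [?\<alpha> X, ?\<beta>' X, ?G]"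
    using zz_step[where a = "[?\<alpha> X, ?\<beta>' X, ?G]" and b = "[]" and X = X and Y = "GO (FO Y)", OF _ zz_fwd_bwd[of "GO (FO Y)" C "HO Y" "\<beta> Y" W]] o by simp
  ultimately show ?thesis unfolding \<theta>_def by (simp, meson zz_trans zz_sym)
qed

lemma \<theta>_conj:
  assumes "F.C.zz X p Y"
  shows "F.C.zeq X (GO (FO Y)) (p @ \<theta> Y) (\<theta> X @ G.mp (F.mp p))"
  using zz_natural[OF I.relfunctor_axioms GF.relfunctor_axioms \<theta>_zz(1) \<theta>_nat assms]
  by (simp only: map_I map_GF)

text \<open>Naturality of \<theta>, extended from morphisms to zigzags by \<open>zz_natural\<close>,
  makes every zigzag the \<theta>-conjugate of its image under GF. Faithfulness is immediate from
  this, and it dictates the preimage chosen in \<open>F_full\<close>.\<close>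

lemma conj_GF:
  assumes "F.C.zz X p Y"
  shows "F.C.zeq X Y p (\<theta> X @ G.mp (F.mp p) @ \<theta>' Y)"
proof -
  have Y: "Y \<in> Ob C" using assms zz_ends by metis
  have "F.C.zeq X Y (p @ (\<theta> Y @ \<theta>' Y)) (p @ [])" by (rule F.C.zeq_prepend[OF \<theta>_inv(1)[OF Y] assms])
  moreover have "F.C.zeq X Y ((p @ \<theta> Y) @ \<theta>' Y) ((\<theta> X @ G.mp (F.mp p)) @ \<theta>' Y)"
    by (rule F.C.zeq_append[OF \<theta>_conj[OF assms] \<theta>_zz(2)[OF Y]])
  ultimately show ?thesis by (simp, meson zz_trans zz_sym)
qed

lemma F_faithful:
  assumes "F.C.zz X p Y" "F.C.zz X q Y" "F.D.zeq (FO X) (FO Y) (F.mp p) (F.mp q)"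
  shows "F.C.zeq X Y p q"
proof -
  have XY: "X \<in> Ob C" "Y \<in> Ob C" using assms(1) zz_ends by metis+
  have "F.C.zeq X Y (\<theta> X @ (G.mp (F.mp p) @ \<theta>' Y)) (\<theta> X @ (G.mp (F.mp q) @ \<theta>' Y))"
    by (intro F.C.zeq_prepend F.C.zeq_append) (use XY \<theta>_zz G.mp_zeq[OF assms(3)] in auto)
  with conj_GF[OF assms(1)] conj_GF[OF assms(2)] show ?thesis by (meson zz_trans zz_sym)
qed

text \<open>The preimage of \<open>q\<close> is the conjugate of \<open>G.mp q\<close> by \<theta>.
  Comparing it with \<open>conj_GF\<close> and cancelling \<theta> shows that GF of it agrees with
  \<open>G.mp q\<close>; one more application of F removes G.\<close>

lemma F_full:
  assumes XY: "X \<in> Ob C" "Y \<in> Ob C" and q: "F.D.zz (FO X) q (FO Y)"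
  shows "\<exists>p. F.C.zz X p Y \<and> F.D.zeq (FO X) (FO Y) (F.mp p) q"
proof (intro exI conjI)
  let ?q = "G.mp q" and ?p = "\<theta> X @ G.mp q @ \<theta>' Y"
  have Gq: "F.C.zz (GO (FO X)) ?q (GO (FO Y))" by (rule G.mp_zz[OF q])
  show p: "F.C.zz X ?p Y" by (intro zz_append[OF \<theta>_zz(1)[OF XY(1)]] zz_append[OF Gq] \<theta>_zz(2) XY)
  have GFp: "F.C.zz (GO (FO X)) (G.mp (F.mp ?p)) (GO (FO Y))" by (rule G.mp_zz[OF F.mp_zz[OF p]])
  have l: "F.C.zeq (GO (FO X)) Y r s" if "F.C.zeq X Y (\<theta> X @ r) (\<theta> X @ s)" "F.C.zz (GO (FO X)) r Y" "F.C.zz (GO (FO X)) s Y" for r s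
  proof -
    have "F.C.zeq (GO (FO X)) Y ((\<theta>' X @ \<theta> X) @ r) ((\<theta>' X @ \<theta> X) @ s)"
      using F.C.zeq_prepend[OF that(1) \<theta>_zz(2)[OF XY(1)]] by simp
    note 1 = this
    have "F.C.zeq (GO (FO X)) Y ((\<theta>' X @ \<theta> X) @ r) ([] @ r)" if "F.C.zz (GO (FO X)) r Y" for r
      by (rule F.C.zeq_append[OF \<theta>_inv(2)[OF XY(1)] that])
    from zz_trans[OF zz_sym[OF this[OF that(2)]] zz_trans[OF 1 this[OF that(3)]]] show ?thesis by simp
  qed
  have "F.C.zeq (GO (FO X)) Y (G.mp (F.mp ?p) @ \<theta>' Y) (?q @ \<theta>' Y)"
    by (rule l[OF zz_sym[OF conj_GF[OF p]]]) (intro zz_append[OF GFp] zz_append[OF Gq] \<theta>_zz(2) XY)+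
  from F.C.zeq_append[OF this \<theta>_zz(1)[OF XY(2)]]
  have 1: "F.C.zeq (GO (FO X)) (GO (FO Y)) (G.mp (F.mp ?p) @ (\<theta>' Y @ \<theta> Y)) (?q @ (\<theta>' Y @ \<theta> Y))" by simp
  have "F.C.zeq (GO (FO X)) (GO (FO Y)) (r @ (\<theta>' Y @ \<theta> Y)) (r @ [])" if "F.C.zz (GO (FO X)) r (GO (FO Y))" for r
    by (rule F.C.zeq_prepend[OF \<theta>_inv(2)[OF XY(2)] that])
  from zz_trans[OF zz_sym[OF this[OF GFp]] zz_trans[OF 1 this[OF Gq]]]
  have "F.C.zeq (GO (FO X)) (GO (FO Y)) (G.mp (F.mp ?p)) ?q" by simp
  from F.mp_zeq[OF this] show "F.D.zeq (FO X) (FO Y) (F.mp ?p) q"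
    unfolding map_FG[OF F.mp_zz[OF p]] map_FG[OF q] using XY by (simp add: FG_ob F.FO_in)
qed

lemma lm_fully_faithful: "fully_faithful F.C.L F.D.L FO F.lm"
  unfolding fully_faithful_def F.C.Ob_L
proof (intro ballI)
  fix X Y assume XY: "X \<in> Ob C" "Y \<in> Ob C"
  show "bij_betw (F.lm X Y) (Hom F.C.L X Y) (Hom F.D.L (FO X) (FO Y))"
    unfolding bij_betw_def inj_on_def F.C.Hom_L F.D.Hom_L
  proof (intro conjI ballI impI)
    fix c d assume "c \<in> {F.C.cls X Y p |p. F.C.zz X p Y}" "d \<in> {F.C.cls X Y p |p. F.C.zz X p Y}" "F.lm X Y c = F.lm X Y d"
    then obtain p q where pq: "c = F.C.cls X Y p" "d = F.C.cls X Y q" "F.C.zz X p Y" "F.C.zz X q Y"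
      and "F.lm X Y c = F.lm X Y d" by blast
    then have "F.D.zeq (FO X) (FO Y) (F.mp p) (F.mp q)" by (simp add: F.lm_cls F.D.cls_eq_iff F.mp_zz)
    from F_faithful[OF pq(3,4) this] show "c = d" unfolding pq by (rule F.C.cls_eqI)
  next
    show "F.lm X Y ` {F.C.cls X Y p |p. F.C.zz X p Y} = {F.D.cls (FO X) (FO Y) p |p. F.D.zz (FO X) p (FO Y)}"
    proof (intro equalityI subsetI)
      fix c assume "c \<in> {F.D.cls (FO X) (FO Y) p |p. F.D.zz (FO X) p (FO Y)}"
      then obtain q where q: "c = F.D.cls (FO X) (FO Y) q" "F.D.zz (FO X) q (FO Y)" by blast
      from F_full[OF XY q(2)] obtain p where "F.C.zz X p Y" "F.D.zeq (FO X) (FO Y) (F.mp p) q" by blast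
      then have "c = F.lm X Y (F.C.cls X Y p)" "F.C.zz X p Y"
        unfolding q(1) by (simp_all add: F.lm_cls F.D.cls_eqI zz_sym)
      then show "c \<in> F.lm X Y ` {F.C.cls X Y p |p. F.C.zz X p Y}" by blast
    next
      fix c assume "c \<in> F.lm X Y ` {F.C.cls X Y p |p. F.C.zz X p Y}"
      then obtain p where "c = F.lm X Y (F.C.cls X Y p)" "F.C.zz X p Y" by blast
      then show "c \<in> {F.D.cls (FO X) (FO Y) p |p. F.D.zz (FO X) p (FO Y)}"
        using F.mp_zz F.lm_cls by blast
    qed
  qed
qed

lemma lm_essentially_surjective: "essentially_surjective F.C.L F.D.L FO"
  unfolding essentially_surjective_def F.C.Ob_L F.D.Ob_L
proof
  fix Z assume Z: "Z \<in> Ob D"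
  have "cat_iso F.D.L Z Z (F.D.cls Z Z [])"
    by (rule F.D.cat_iso_L_cls[where q = "[]"]) (use Z in \<open>auto intro: zz_refl\<close>)
  then show "\<exists>X\<in>Ob C. \<exists>e. cat_iso F.D.L (FO X) Z e" using FG_ob[OF Z] G.FO_in[OF Z] by metis
qed

end

section \<open>Dg categories with duality and form functors\<close>

text \<open>These laws are checked by hand for \<open>Cpx\<close> and inherited by
  \<open>Fun1\<close>, so that triangles and Grothendieck-Witt relations can be treated abstractly.
  Composition and associativity are stated in all degrees because \<open>dg_sus\<close> has degree
  -1 and enters the null homotopies of standard triangles.\<close>

locale dg_category =
  fixes A :: "('o, 'm) dgcat"
  assumes id_Z0: "X \<in> dg_ob A \<Longrightarrow> dg_id A X \<in> Z0_hom A X X"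
    and comp_in: "\<lbrakk>X \<in> dg_ob A; Y \<in> dg_ob A; Z \<in> dg_ob A; f \<in> dg_hom A X Y n; g \<in> dg_hom A Y Z m\<rbrakk> \<Longrightarrow>
      dg_comp A g f \<in> dg_hom A X Z (m + n)"
    and comp_Z0: "\<lbrakk>X \<in> dg_ob A; Y \<in> dg_ob A; Z \<in> dg_ob A; f \<in> Z0_hom A X Y; g \<in> Z0_hom A Y Z\<rbrakk> \<Longrightarrow>
      dg_comp A g f \<in> Z0_hom A X Z"
    and assoc: "\<lbrakk>X \<in> dg_ob A; Y \<in> dg_ob A; Z \<in> dg_ob A; U \<in> dg_ob A;
      f \<in> dg_hom A X Y n; g \<in> dg_hom A Y Z m; h \<in> dg_hom A Z U k\<rbrakk> \<Longrightarrow>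
      dg_comp A (dg_comp A h g) f = dg_comp A h (dg_comp A g f)"
    and id_left: "\<lbrakk>X \<in> dg_ob A; Y \<in> dg_ob A; f \<in> dg_hom A X Y n\<rbrakk> \<Longrightarrow> dg_comp A (dg_id A Y) f = f"
    and id_right: "\<lbrakk>X \<in> dg_ob A; Y \<in> dg_ob A; f \<in> dg_hom A X Y n\<rbrakk> \<Longrightarrow> dg_comp A f (dg_id A X) = f"
    and comp_add_right: "\<lbrakk>X \<in> dg_ob A; Y \<in> dg_ob A; Z \<in> dg_ob A;
      f \<in> dg_hom A X Y n; f' \<in> dg_hom A X Y n; g \<in> dg_hom A Y Z m\<rbrakk> \<Longrightarrow>
      dg_comp A g (dg_add A f f') = dg_add A (dg_comp A g f) (dg_comp A g f')"
    and comp_zero: "\<lbrakk>X \<in> dg_ob A; Y \<in> dg_ob A; Z \<in> dg_ob A; g \<in> dg_hom A Y Z 0\<rbrakk> \<Longrightarrow>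
      dg_comp A g (dg_zero A X Y 0) = dg_zero A X Z 0"
    and dual_ob: "X \<in> dg_ob A \<Longrightarrow> dg_dual A X \<in> dg_ob A"
    and dual_Z0: "\<lbrakk>X \<in> dg_ob A; Y \<in> dg_ob A; f \<in> Z0_hom A X Y\<rbrakk> \<Longrightarrow> dg_dual_hom A f \<in> Z0_hom A (dg_dual A Y) (dg_dual A X)"
    and dual_in: "\<lbrakk>X \<in> dg_ob A; Y \<in> dg_ob A; f \<in> dg_hom A X Y 0\<rbrakk> \<Longrightarrow> dg_dual_hom A f \<in> dg_hom A (dg_dual A Y) (dg_dual A X) 0"
    and dual_comp: "\<lbrakk>X \<in> dg_ob A; Y \<in> dg_ob A; Z \<in> dg_ob A; f \<in> dg_hom A X Y 0; g \<in> dg_hom A Y Z 0\<rbrakk> \<Longrightarrow>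
      dg_dual_hom A (dg_comp A g f) = dg_comp A (dg_dual_hom A f) (dg_dual_hom A g)"
    and can_Z0: "X \<in> dg_ob A \<Longrightarrow> dg_can A X \<in> Z0_hom A X (dg_dual A (dg_dual A X))"
    and can_nat: "\<lbrakk>X \<in> dg_ob A; Y \<in> dg_ob A; f \<in> dg_hom A X Y 0\<rbrakk> \<Longrightarrow>
      dg_comp A (dg_can A Y) f = dg_comp A (dg_dual_hom A (dg_dual_hom A f)) (dg_can A X)"
    and shift_ob: "X \<in> dg_ob A \<Longrightarrow> dg_shift A X \<in> dg_ob A"
    and shift_Z0: "\<lbrakk>X \<in> dg_ob A; Y \<in> dg_ob A; f \<in> Z0_hom A X Y\<rbrakk> \<Longrightarrow> dg_shift_hom A f \<in> Z0_hom A (dg_shift A X) (dg_shift A Y)"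
    and shift_in: "\<lbrakk>X \<in> dg_ob A; Y \<in> dg_ob A; f \<in> dg_hom A X Y 0\<rbrakk> \<Longrightarrow> dg_shift_hom A f \<in> dg_hom A (dg_shift A X) (dg_shift A Y) 0"
    and shift_comp: "\<lbrakk>X \<in> dg_ob A; Y \<in> dg_ob A; Z \<in> dg_ob A; f \<in> dg_hom A X Y 0; g \<in> dg_hom A Y Z 0\<rbrakk> \<Longrightarrow>
      dg_shift_hom A (dg_comp A g f) = dg_comp A (dg_shift_hom A g) (dg_shift_hom A f)"
    and shift_id: "X \<in> dg_ob A \<Longrightarrow> dg_shift_hom A (dg_id A X) = dg_id A (dg_shift A X)"
    and sus_in: "X \<in> dg_ob A \<Longrightarrow> dg_sus A X \<in> dg_hom A X (dg_shift A X) (- 1)"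
    and sus_nat: "\<lbrakk>X \<in> dg_ob A; Y \<in> dg_ob A; f \<in> dg_hom A X Y 0\<rbrakk> \<Longrightarrow>
      dg_comp A (dg_sus A Y) f = dg_comp A (dg_shift_hom A f) (dg_sus A X)"
begin

lemma Z0_in: "f \<in> Z0_hom A X Y \<Longrightarrow> f \<in> dg_hom A X Y 0"
  by (simp add: Z0_hom_def)

lemma comp_in0: "\<lbrakk>X \<in> dg_ob A; Y \<in> dg_ob A; Z \<in> dg_ob A; f \<in> dg_hom A X Y 0; g \<in> dg_hom A Y Z 0\<rbrakk> \<Longrightarrow>
    dg_comp A g f \<in> dg_hom A X Z 0"
  using comp_in[of X Y Z f 0 g 0] by simp

lemma assoc0: "\<lbrakk>X \<in> dg_ob A; Y \<in> dg_ob A; Z \<in> dg_ob A; U \<in> dg_ob A;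
      f \<in> dg_hom A X Y 0; g \<in> dg_hom A Y Z 0; h \<in> dg_hom A Z U 0\<rbrakk> \<Longrightarrow>
      dg_comp A (dg_comp A h g) f = dg_comp A h (dg_comp A g f)"
  by (rule assoc)

lemma relcat_Z0: "(\<And>X Y. X \<in> dg_ob A \<Longrightarrow> Y \<in> dg_ob A \<Longrightarrow> W X Y \<subseteq> Z0_hom A X Y) \<Longrightarrow> relcat (Z0 A) W"
  by standard (auto simp: Z0_def intro: id_Z0 comp_Z0)

lemma shift_relfunctor:
  assumes "\<And>X Y. X \<in> dg_ob A \<Longrightarrow> Y \<in> dg_ob A \<Longrightarrow> W X Y \<subseteq> Z0_hom A X Y"
    and "\<And>X Y f. \<lbrakk>X \<in> dg_ob A; Y \<in> dg_ob A; f \<in> W X Y\<rbrakk> \<Longrightarrow> dg_shift_hom A f \<in> W (dg_shift A X) (dg_shift A Y)"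
  shows "relfunctor (Z0 A) W (Z0 A) W (dg_shift A) (\<lambda>X Y. dg_shift_hom A)"
  unfolding relfunctor_def relfunctor_axioms_def is_functor_def
  using relcat_Z0[OF assms(1)] by (auto simp: Z0_def shift_ob shift_id shift_Z0 assms(2) intro: shift_comp Z0_in)

end

section \<open>The dg category of arrows\<close>

lemma Fun1_Z0: "((a, b) \<in> Z0_hom (Fun1 A) (X, f, Y) (X', f', Y')) \<longleftrightarrow>
   a \<in> Z0_hom A X X' \<and> b \<in> Z0_hom A Y Y' \<and> dg_comp A b f = dg_comp A f' a"
  by (auto simp: Z0_hom_def Fun1_def)

lemma Fun1_sel:
  "dg_ob (Fun1 A) = {(X, f, Y). X \<in> dg_ob A \<and> Y \<in> dg_ob A \<and> f \<in> Z0_hom A X Y}"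
  "dg_hom (Fun1 A) (X, f, Y) (X', f', Y') n =
     {(a, b). a \<in> dg_hom A X X' n \<and> b \<in> dg_hom A Y Y' n \<and> dg_comp A b f = dg_comp A f' a}"
  "dg_zero (Fun1 A) (X, f, Y) (X', f', Y') n = (dg_zero A X X' n, dg_zero A Y Y' n)"
  "dg_add (Fun1 A) (a, b) (a', b') = (dg_add A a a', dg_add A b b')"
  "dg_d (Fun1 A) (X, f, Y) (X', f', Y') (a, b) = (dg_d A X X' a, dg_d A Y Y' b)"
  "dg_comp (Fun1 A) (a', b') (a, b) = (dg_comp A a' a, dg_comp A b' b)"
  "dg_id (Fun1 A) (X, f, Y) = (dg_id A X, dg_id A Y)"
  "dg_shift (Fun1 A) (X, f, Y) = (dg_shift A X, dg_shift_hom A f, dg_shift A Y)"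
  "dg_shift_hom (Fun1 A) (a, b) = (dg_shift_hom A a, dg_shift_hom A b)"
  "dg_sus (Fun1 A) (X, f, Y) = (dg_sus A X, dg_sus A Y)"
  "dg_dual (Fun1 A) (X, f, Y) = (dg_dual A Y, dg_dual_hom A f, dg_dual A X)"
  "dg_dual_hom (Fun1 A) (a, b) = (dg_dual_hom A b, dg_dual_hom A a)"
  "dg_can (Fun1 A) (X, f, Y) = (dg_can A X, dg_can A Y)"
  by (simp_all add: Fun1_def)

text \<open>Equations hold componentwise. The content is that commutative squares are preserved: by
  composition (\<open>sq\<close>), by the duality, which swaps source and target
  (\<open>du\<close>), and by the shift (\<open>sh\<close>).\<close>

lemma Fun1_dg_category:
  assumes "dg_category A"
  shows "dg_category (Fun1 A)"
proof -
  interpret dg_category A by fact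
  note ob = dual_ob shift_ob
  have sq: "dg_comp A (dg_comp A b' b) f = dg_comp A f'' (dg_comp A a' a)"
    if "X \<in> dg_ob A" "Y \<in> dg_ob A" "X' \<in> dg_ob A" "Y' \<in> dg_ob A" "X'' \<in> dg_ob A" "Y'' \<in> dg_ob A"
      "f \<in> dg_hom A X Y 0" "f' \<in> dg_hom A X' Y' 0" "f'' \<in> dg_hom A X'' Y'' 0"
      "a \<in> dg_hom A X X' n" "b \<in> dg_hom A Y Y' n" "a' \<in> dg_hom A X' X'' m" "b' \<in> dg_hom A Y' Y'' m"
      "dg_comp A b f = dg_comp A f' a" "dg_comp A b' f' = dg_comp A f'' a'"
    for X Y X' Y' X'' Y'' f f' f'' a b a' b' n m
  proof -
    have "dg_comp A (dg_comp A b' b) f = dg_comp A b' (dg_comp A f' a)" using assoc[of X Y Y' Y'' f 0 b n b' m] that by simp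
    also have "\<dots> = dg_comp A (dg_comp A f'' a') a" using assoc[of X X' Y' Y'' a n f' 0 b' m] that by simp
    also have "\<dots> = dg_comp A f'' (dg_comp A a' a)" by (rule assoc) (use that in auto)
    finally show ?thesis .
  qed
  have du: "dg_comp A (dg_dual_hom A a) (dg_dual_hom A f') = dg_comp A (dg_dual_hom A f) (dg_dual_hom A b)"
    if "X \<in> dg_ob A" "Y \<in> dg_ob A" "X' \<in> dg_ob A" "Y' \<in> dg_ob A"
      "f \<in> dg_hom A X Y 0" "f' \<in> dg_hom A X' Y' 0" "a \<in> dg_hom A X X' 0" "b \<in> dg_hom A Y Y' 0" "dg_comp A b f = dg_comp A f' a"
    for X Y X' Y' f f' a b
    using dual_comp[of X Y Y' f b] dual_comp[of X X' Y' a f'] that by simp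
  have sh: "dg_comp A (dg_shift_hom A b) (dg_shift_hom A f) = dg_comp A (dg_shift_hom A f') (dg_shift_hom A a)"
    if "X \<in> dg_ob A" "Y \<in> dg_ob A" "X' \<in> dg_ob A" "Y' \<in> dg_ob A"
      "f \<in> dg_hom A X Y 0" "f' \<in> dg_hom A X' Y' 0" "a \<in> dg_hom A X X' 0" "b \<in> dg_hom A Y Y' 0" "dg_comp A b f = dg_comp A f' a"
    for X Y X' Y' f f' a b
    using shift_comp[of X Y Y' f b] shift_comp[of X X' Y' a f'] that by simp
  have ids: "dg_id A X \<in> dg_hom A X X 0" if "X \<in> dg_ob A" for X using id_Z0[OF that] by (rule Z0_in)
  have cans: "dg_can A X \<in> dg_hom A X (dg_dual A (dg_dual A X)) 0" if "X \<in> dg_ob A" for X using can_Z0[OF that] by (rule Z0_in)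
  show ?thesis
  proof (unfold_locales, goal_cases)
    case (1 X) then show ?case by (cases X) (auto simp: Fun1_sel Fun1_Z0 id_Z0 id_left id_right dest: Z0_in)
  next
    case (2 X Y Z f n g m)
    obtain X0 u X1 Y0 v Y1 Z0 w Z1 f0 f1 g0 g1 where "X = (X0, u, X1)" "Y = (Y0, v, Y1)" "Z = (Z0, w, Z1)" "f = (f0, f1)" "g = (g0, g1)"
      by (metis surj_pair)
    with 2 show ?case using sq[of X0 X1 Y0 Y1 Z0 Z1 u v w f0 n f1 g0 m g1] comp_in[of X0 Y0 Z0 f0 n g0 m] comp_in[of X1 Y1 Z1 f1 n g1 m]
      by (simp add: Fun1_sel Z0_in)
  next
    case (3 X Y Z f g)
    obtain X0 u X1 Y0 v Y1 Z0 w Z1 f0 f1 g0 g1 where "X = (X0, u, X1)" "Y = (Y0, v, Y1)" "Z = (Z0, w, Z1)" "f = (f0, f1)" "g = (g0, g1)"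
      by (metis surj_pair)
    with 3 show ?case using sq[of X0 X1 Y0 Y1 Z0 Z1 u v w f0 0 f1 g0 0 g1] comp_Z0[of X0 Y0 Z0 f0 g0] comp_Z0[of X1 Y1 Z1 f1 g1]
      by (simp add: Fun1_sel Fun1_Z0 Z0_in)
  next
    case (4 X Y Z U f n g m h k)
    obtain X0 u X1 Y0 v Y1 Z0 w Z1 U0 t U1 f0 f1 g0 g1 h0 h1 where "X = (X0, u, X1)" "Y = (Y0, v, Y1)" "Z = (Z0, w, Z1)"
      "U = (U0, t, U1)" "f = (f0, f1)" "g = (g0, g1)" "h = (h0, h1)"
      by (metis surj_pair)
    with 4 show ?case using assoc[of X0 Y0 Z0 U0 f0 n g0 m h0 k] assoc[of X1 Y1 Z1 U1 f1 n g1 m h1 k] by (simp add: Fun1_sel)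
  next
    case (5 X Y f n)
    then show ?case by (cases X; cases Y; cases f) (auto simp: Fun1_sel intro: id_left)
  next
    case (6 X Y f n)
    then show ?case by (cases X; cases Y; cases f) (auto simp: Fun1_sel intro: id_right)
  next
    case (7 X Y Z f n f' g m)
    then show ?case by (cases X; cases Y; cases Z; cases f; cases g; cases f') (auto simp: Fun1_sel intro: comp_add_right)
  next
    case (8 X Y Z g)
    then show ?case by (cases X; cases Y; cases Z; cases g) (auto simp: Fun1_sel intro: comp_zero)
  next
    case (9 X)
    then show ?case by (cases X) (auto simp: Fun1_sel ob dual_Z0)
  next
    case (10 X Y f)
    obtain X0 u X1 Y0 v Y1 f0 f1 where "X = (X0, u, X1)" "Y = (Y0, v, Y1)" "f = (f0, f1)"
      by (metis surj_pair)
    with 10 show ?case using du[of X0 X1 Y0 Y1 u v f0 f1] by (simp add: Fun1_sel Fun1_Z0 dual_Z0 Z0_in)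
  next
    case (11 X Y f)
    obtain X0 u X1 Y0 v Y1 f0 f1 where "X = (X0, u, X1)" "Y = (Y0, v, Y1)" "f = (f0, f1)"
      by (metis surj_pair)
    with 11 show ?case using du[of X0 X1 Y0 Y1 u v f0 f1] by (simp add: Fun1_sel dual_in Z0_in)
  next
    case (12 X Y Z f g)
    then show ?case by (cases X; cases Y; cases Z; cases f; cases g) (auto simp: Fun1_sel intro: dual_comp)
  next
    case (13 X)
    then show ?case by (cases X) (auto simp: Fun1_sel Fun1_Z0 can_Z0 intro: can_nat Z0_in)
  next
    case (14 X Y f)
    then show ?case by (cases X; cases Y; cases f) (auto simp: Fun1_sel intro: can_nat)
  next
    case (15 X)
    then show ?case by (cases X) (auto simp: Fun1_sel ob shift_Z0)
  next
    case (16 X Y f)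
    obtain X0 u X1 Y0 v Y1 f0 f1 where "X = (X0, u, X1)" "Y = (Y0, v, Y1)" "f = (f0, f1)"
      by (metis surj_pair)
    with 16 show ?case using sh[of X0 X1 Y0 Y1 u v f0 f1] by (simp add: Fun1_sel Fun1_Z0 shift_Z0 Z0_in)
  next
    case (17 X Y f)
    obtain X0 u X1 Y0 v Y1 f0 f1 where "X = (X0, u, X1)" "Y = (Y0, v, Y1)" "f = (f0, f1)"
      by (metis surj_pair)
    with 17 show ?case using sh[of X0 X1 Y0 Y1 u v f0 f1] by (simp add: Fun1_sel shift_in Z0_in)
  next
    case (18 X Y Z f g)
    then show ?case by (cases X; cases Y; cases Z; cases f; cases g) (auto simp: Fun1_sel intro: shift_comp)
  next
    case (19 X)
    then show ?case by (cases X) (auto simp: Fun1_sel shift_id)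
  next
    case (20 X)
    then show ?case by (cases X) (auto simp: Fun1_sel sus_in intro: sus_nat Z0_in)
  next
    case (21 X Y f)
    then show ?case by (cases X; cases Y; cases f) (auto simp: Fun1_sel intro: sus_nat)
  qed
qed

text \<open>\<open>\<eta>\<close> compares the shifts, with inverse \<open>\<eta>'\<close>, and
  \<open>\<Phi>\<close> compares the dualities. By \<open>W_iff\<close> the class \<open>W\<close>
  is the preimage of \<open>V\<close>, so closure properties are demanded of \<open>V\<close> and
  pulled back.\<close>

locale dg_form_functor = A: dg_category A + B: dg_category B
  for A :: "('o, 'm) dgcat" and B :: "('p, 'n) dgcat" +
  fixes FO :: "'o \<Rightarrow> 'p" and FM :: "'m \<Rightarrow> 'n" and \<eta> \<eta>' \<Phi> :: "'o \<Rightarrow> 'n"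
    and W :: "'o \<Rightarrow> 'o \<Rightarrow> 'm set" and V :: "'p \<Rightarrow> 'p \<Rightarrow> 'n set"
  assumes FO: "X \<in> dg_ob A \<Longrightarrow> FO X \<in> dg_ob B"
    and FM_in: "\<lbrakk>X \<in> dg_ob A; Y \<in> dg_ob A; f \<in> dg_hom A X Y n\<rbrakk> \<Longrightarrow> FM f \<in> dg_hom B (FO X) (FO Y) n"
    and FM_id: "X \<in> dg_ob A \<Longrightarrow> FM (dg_id A X) = dg_id B (FO X)"
    and FM_comp: "\<lbrakk>X \<in> dg_ob A; Y \<in> dg_ob A; Z \<in> dg_ob A; f \<in> dg_hom A X Y n; g \<in> dg_hom A Y Z m\<rbrakk> \<Longrightarrow>
      FM (dg_comp A g f) = dg_comp B (FM g) (FM f)"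
    and FM_zero: "\<lbrakk>X \<in> dg_ob A; Y \<in> dg_ob A\<rbrakk> \<Longrightarrow> FM (dg_zero A X Y n) = dg_zero B (FO X) (FO Y) n"
    and FM_add: "\<lbrakk>X \<in> dg_ob A; Y \<in> dg_ob A; f \<in> dg_hom A X Y 0; g \<in> dg_hom A X Y 0\<rbrakk> \<Longrightarrow>
      FM (dg_add A f g) = dg_add B (FM f) (FM g)"
    and FM_d: "\<lbrakk>X \<in> dg_ob A; Y \<in> dg_ob A; f \<in> dg_hom A X Y n\<rbrakk> \<Longrightarrow> FM (dg_d A X Y f) = dg_d B (FO X) (FO Y) (FM f)"
    and \<eta>: "X \<in> dg_ob A \<Longrightarrow> \<eta> X \<in> V (FO (dg_shift A X)) (dg_shift B (FO X))"
    and \<eta>': "X \<in> dg_ob A \<Longrightarrow> \<eta>' X \<in> V (dg_shift B (FO X)) (FO (dg_shift A X))"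
    and \<eta>\<eta>': "X \<in> dg_ob A \<Longrightarrow> dg_comp B (\<eta> X) (\<eta>' X) = dg_id B (dg_shift B (FO X))"
    and \<eta>'\<eta>: "X \<in> dg_ob A \<Longrightarrow> dg_comp B (\<eta>' X) (\<eta> X) = dg_id B (FO (dg_shift A X))"
    and \<eta>_nat: "\<lbrakk>X \<in> dg_ob A; Y \<in> dg_ob A; f \<in> dg_hom A X Y 0\<rbrakk> \<Longrightarrow>
      dg_comp B (\<eta> Y) (FM (dg_shift_hom A f)) = dg_comp B (dg_shift_hom B (FM f)) (\<eta> X)"
    and \<eta>_sus: "X \<in> dg_ob A \<Longrightarrow> dg_comp B (\<eta> X) (FM (dg_sus A X)) = dg_sus B (FO X)"
    and \<Phi>: "X \<in> dg_ob A \<Longrightarrow> \<Phi> X \<in> V (FO (dg_dual A X)) (dg_dual B (FO X))"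
    and \<Phi>_nat: "\<lbrakk>X \<in> dg_ob A; Y \<in> dg_ob A; f \<in> dg_hom A X Y 0\<rbrakk> \<Longrightarrow>
      dg_comp B (\<Phi> X) (FM (dg_dual_hom A f)) = dg_comp B (dg_dual_hom B (FM f)) (\<Phi> Y)"
    and \<Phi>_can: "X \<in> dg_ob A \<Longrightarrow>
      dg_comp B (\<Phi> (dg_dual A X)) (FM (dg_can A X)) = dg_comp B (dg_dual_hom B (\<Phi> X)) (dg_can B (FO X))"
    and W_iff: "\<lbrakk>X \<in> dg_ob A; Y \<in> dg_ob A\<rbrakk> \<Longrightarrow> f \<in> W X Y \<longleftrightarrow> f \<in> Z0_hom A X Y \<and> FM f \<in> V (FO X) (FO Y)"
    and V_Z0: "\<lbrakk>P \<in> dg_ob B; Q \<in> dg_ob B\<rbrakk> \<Longrightarrow> V P Q \<subseteq> Z0_hom B P Q"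
    and V_comp: "\<lbrakk>P \<in> dg_ob B; Q \<in> dg_ob B; R \<in> dg_ob B; k \<in> V P Q; l \<in> V Q R\<rbrakk> \<Longrightarrow> dg_comp B l k \<in> V P R"
    and V_shift: "\<lbrakk>P \<in> dg_ob B; Q \<in> dg_ob B; k \<in> V P Q\<rbrakk> \<Longrightarrow> dg_shift_hom B k \<in> V (dg_shift B P) (dg_shift B Q)"
begin

lemma \<eta>_Z0: "X \<in> dg_ob A \<Longrightarrow> \<eta> X \<in> Z0_hom B (FO (dg_shift A X)) (dg_shift B (FO X))"
  and \<eta>'_Z0: "X \<in> dg_ob A \<Longrightarrow> \<eta>' X \<in> Z0_hom B (dg_shift B (FO X)) (FO (dg_shift A X))"
  and \<Phi>_Z0: "X \<in> dg_ob A \<Longrightarrow> \<Phi> X \<in> Z0_hom B (FO (dg_dual A X)) (dg_dual B (FO X))"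
  using \<eta>[of X] \<eta>'[of X] \<Phi>[of X] V_Z0 FO[of X] FO[OF A.shift_ob, of X] FO[OF A.dual_ob, of X] B.shift_ob[OF FO, of X] B.dual_ob[OF FO, of X]
  by (meson subsetD)+

lemmas obs = FO A.shift_ob A.dual_ob B.shift_ob B.dual_ob

lemma FM_Z0: "\<lbrakk>X \<in> dg_ob A; Y \<in> dg_ob A; f \<in> Z0_hom A X Y\<rbrakk> \<Longrightarrow> FM f \<in> Z0_hom B (FO X) (FO Y)"
  unfolding Z0_hom_def using FM_in FM_d FM_zero by (auto, metis)

text \<open>By naturality of \<open>\<eta>\<close> the image of the shifted map is the composite of
  \<open>\<eta> X\<close>, the shift of \<open>FM f\<close> and \<open>\<eta>' Y\<close>, all of
  which lie in \<open>V\<close>.\<close>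

lemma W_shift:
  assumes X: "X \<in> dg_ob A" "Y \<in> dg_ob A" and f: "f \<in> W X Y"
  shows "dg_shift_hom A f \<in> W (dg_shift A X) (dg_shift A Y)"
proof -
  have f: "f \<in> Z0_hom A X Y" "FM f \<in> V (FO X) (FO Y)" using W_iff X f by auto
  note i = B.Z0_in A.Z0_in FM_Z0 \<eta>_Z0 \<eta>'_Z0 A.shift_Z0 X f(1) obs
  have "FM (dg_shift_hom A f) = dg_comp B (dg_comp B (\<eta>' Y) (\<eta> Y)) (FM (dg_shift_hom A f))"
    unfolding \<eta>'\<eta>[OF X(2)] by (rule B.id_left[OF FO[OF A.shift_ob[OF X(1)]] FO[OF A.shift_ob[OF X(2)]], where n = 0, symmetric]) (intro i)+
  also have "\<dots> = dg_comp B (\<eta>' Y) (dg_comp B (\<eta> Y) (FM (dg_shift_hom A f)))"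
    by (rule B.assoc0[OF FO[OF A.shift_ob[OF X(1)]] FO[OF A.shift_ob[OF X(2)]] B.shift_ob[OF FO[OF X(2)]] FO[OF A.shift_ob[OF X(2)]]]) (intro i)+
  also have "\<dots> = dg_comp B (\<eta>' Y) (dg_comp B (dg_shift_hom B (FM f)) (\<eta> X))"
    by (simp add: \<eta>_nat[OF X A.Z0_in[OF f(1)]])
  also have "\<dots> \<in> V (FO (dg_shift A X)) (FO (dg_shift A Y))"
    by (intro V_comp[OF _ _ _ V_comp[OF _ _ _ \<eta>[OF X(1)] V_shift[OF _ _ f(2)]] \<eta>'[OF X(2)]] obs X)
  finally show ?thesis by (simp add: W_iff A.shift_Z0 f(1) X obs)
qed

lemma F_relfunctor: "relfunctor (Z0 A) W (Z0 B) V FO (\<lambda>X Y. FM)"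
proof -
  have c: "FM (dg_comp A g f) = dg_comp B (FM g) (FM f)"
    if "X \<in> dg_ob A" "Y \<in> dg_ob A" "Z \<in> dg_ob A" "f \<in> Z0_hom A X Y" "g \<in> Z0_hom A Y Z" for X Y Z f g
    using FM_comp[of X Y Z f 0 g 0] that by (simp add: A.Z0_in)
  have "relcat (Z0 A) W" by (rule A.relcat_Z0) (use W_iff in auto)
  moreover have "relcat (Z0 B) V" by (rule B.relcat_Z0) (use V_Z0 in auto)
  ultimately show ?thesis
    unfolding relfunctor_def relfunctor_axioms_def is_functor_def
    by (simp add: Z0_def FO FM_id FM_Z0 c W_iff)
qed

lemma F_exact_split:
  assumes E: "exact_seq A (X, f, Y, g, Z)" and s: "split_by A (X, f, Y, g, Z) r s"
  shows "exact_seq B (FO X, FM f, FO Y, FM g, FO Z)" "split_by B (FO X, FM f, FO Y, FM g, FO Z) (FM r) (FM s)"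
proof -
  have o: "X \<in> dg_ob A" "Y \<in> dg_ob A" "Z \<in> dg_ob A" and z: "f \<in> Z0_hom A X Y" "g \<in> Z0_hom A Y Z" "dg_comp A g f = dg_zero A X Z 0"
    using E by (auto simp: exact_seq_def)
  have s: "r \<in> dg_hom A Y X 0" "s \<in> dg_hom A Z Y 0" "dg_comp A r f = dg_id A X" "dg_comp A g s = dg_id A Z"
    "dg_add A (dg_comp A f r) (dg_comp A s g) = dg_id A Y" using s by (auto simp: split_by_def)
  note z' = z(1,2)[THEN A.Z0_in]
  note c = FM_comp[OF o(1) o(2) o(3) z'] FM_comp[OF o(1) o(2) o(1) z'(1) s(1)] FM_comp[OF o(2) o(1) o(2) s(1) z'(1)]
    FM_comp[OF o(3,2,3) s(2) z'(2)] FM_comp[OF o(2,3,2) z'(2) s(2)]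
  have "FM (dg_add A (dg_comp A f r) (dg_comp A s g)) = dg_add B (FM (dg_comp A f r)) (FM (dg_comp A s g))"
    by (intro FM_add[OF o(2,2)] A.comp_in0[of Y X Y] A.comp_in0[of Y Z Y] o z' s)
  with c show 1: "split_by B (FO X, FM f, FO Y, FM g, FO Z) (FM r) (FM s)"
    unfolding split_by_def by (simp add: s FM_id o FM_in)
  from c z have "dg_comp B (FM g) (FM f) = dg_zero B (FO X) (FO Z) 0" by (simp add: FM_zero o)
  with 1 show "exact_seq B (FO X, FM f, FO Y, FM g, FO Z)"
    unfolding exact_seq_def by (auto intro: FO FM_Z0 o z)
qed

text \<open>The image is split by \<open>FM r\<close> and by \<open>FM s\<close> composed with
  \<open>\<eta>' X\<close>. The axiom \<open>\<eta>_sus\<close> identifies the latter, restricted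
  along the suspension, with the image of s composed with the suspension, so the null homotopy that
  makes Z a cone is carried over.\<close>

lemma F_std_triangle:
  assumes "std_triangle A (X, Y, Z, u, v, w)"
  shows "std_triangle B (FO X, FO Y, FO Z, FM u, FM v, dg_comp B (\<eta> X) (FM w))"
proof -
  let ?S = "dg_shift A X" and ?T = "dg_shift B (FO X)"
  obtain r s where X: "X \<in> dg_ob A" and u: "u \<in> Z0_hom A X Y" and E: "exact_seq A (Y, v, Z, w, ?S)"
    and sp: "split_by A (Y, v, Z, w, ?S) r s"
    and d: "dg_d A X Z (dg_comp A s (dg_sus A X)) = dg_comp A v u"
    using assms by (auto simp: std_triangle_def)
  from E have o: "Y \<in> dg_ob A" "Z \<in> dg_ob A" "?S \<in> dg_ob A" and z: "v \<in> Z0_hom A Y Z" "w \<in> Z0_hom A Z ?S"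
    by (auto simp: exact_seq_def)
  have s: "r \<in> dg_hom A Z Y 0" "s \<in> dg_hom A ?S Z 0" using sp by (auto simp: split_by_def)
  note oF = FO[OF X] FO[OF o(1)] FO[OF o(2)] FO[OF o(3)] B.shift_ob[OF FO[OF X]]
  have eta: "\<eta> X \<in> dg_hom B (FO ?S) ?T 0" "\<eta>' X \<in> dg_hom B ?T (FO ?S) 0" using \<eta>_Z0[OF X] \<eta>'_Z0[OF X] by (auto intro: B.Z0_in)
  have Fv: "FM v \<in> dg_hom B (FO Y) (FO Z) 0" "FM w \<in> dg_hom B (FO Z) (FO ?S) 0" "FM s \<in> dg_hom B (FO ?S) (FO Z) 0"
    using FM_in z[THEN A.Z0_in] o s by auto
  note F = F_exact_split[OF E sp]
  from F(2) have F2: "FM r \<in> dg_hom B (FO Z) (FO Y) 0" "dg_comp B (FM r) (FM v) = dg_id B (FO Y)"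
    "dg_add B (dg_comp B (FM v) (FM r)) (dg_comp B (FM s) (FM w)) = dg_id B (FO Z)" "dg_comp B (FM w) (FM s) = dg_id B (FO ?S)"
    by (auto simp: split_by_def)
  have sw: "dg_comp B (dg_comp B (FM s) (\<eta>' X)) (dg_comp B (\<eta> X) (FM w)) = dg_comp B (FM s) (FM w)"
  proof -
    have "dg_comp B (dg_comp B (FM s) (\<eta>' X)) (dg_comp B (\<eta> X) (FM w)) = dg_comp B (FM s) (dg_comp B (\<eta>' X) (dg_comp B (\<eta> X) (FM w)))"
      by (rule B.assoc0[OF oF(3,5,4,3)]) (use B.comp_in0[OF oF(3,4,5) Fv(2) eta(1)] eta Fv in auto)
    also have "dg_comp B (\<eta>' X) (dg_comp B (\<eta> X) (FM w)) = FM w"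
      using B.assoc0[OF oF(3,4,5,4) Fv(2) eta] \<eta>'\<eta>[OF X] B.id_left[OF oF(3,4) Fv(2)] by simp
    finally show ?thesis .
  qed
  have ws: "dg_comp B (dg_comp B (\<eta> X) (FM w)) (dg_comp B (FM s) (\<eta>' X)) = dg_id B ?T"
  proof -
    have "dg_comp B (dg_comp B (\<eta> X) (FM w)) (dg_comp B (FM s) (\<eta>' X)) = dg_comp B (\<eta> X) (dg_comp B (FM w) (dg_comp B (FM s) (\<eta>' X)))"
      by (rule B.assoc0[OF oF(5,3,4,5)]) (use B.comp_in0[OF oF(5,4,3) eta(2) Fv(3)] eta Fv in auto)
    also have "dg_comp B (FM w) (dg_comp B (FM s) (\<eta>' X)) = \<eta>' X"
      using B.assoc0[OF oF(5,4,3,4) eta(2) Fv(3,2)] F2(4) B.id_left[OF oF(5,4) eta(2)] by simp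
    finally show ?thesis using \<eta>\<eta>'[OF X] by simp
  qed
  have zero: "dg_comp B (dg_comp B (\<eta> X) (FM w)) (FM v) = dg_zero B (FO Y) ?T 0"
    using B.assoc0[OF oF(2,3,4,5) Fv(1,2) eta(1)] F(1) B.comp_zero[OF oF(2,4,5) eta(1)] by (simp add: exact_seq_def)
  have split: "split_by B (FO Y, FM v, FO Z, dg_comp B (\<eta> X) (FM w), ?T) (FM r) (dg_comp B (FM s) (\<eta>' X))"
    unfolding split_by_def by (simp add: F2 sw ws B.comp_in0[OF oF(5,4,3) eta(2) Fv(3)])
  have exact: "exact_seq B (FO Y, FM v, FO Z, dg_comp B (\<eta> X) (FM w), ?T)"
    unfolding exact_seq_def using split zero oF B.comp_Z0[OF oF(3,4,5) FM_Z0[OF o(2,3) z(2)] \<eta>_Z0[OF X]] FM_Z0[OF o(1,2) z(1)] by auto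
  have sus: "dg_comp B (dg_comp B (FM s) (\<eta>' X)) (dg_sus B (FO X)) = FM (dg_comp A s (dg_sus A X))"
  proof -
    have Fs: "FM (dg_sus A X) \<in> dg_hom B (FO X) (FO ?S) (- 1)" using FM_in[OF X o(3) A.sus_in[OF X]] .
    have "dg_comp B (dg_comp B (FM s) (\<eta>' X)) (dg_sus B (FO X)) = dg_comp B (FM s) (dg_comp B (\<eta>' X) (dg_sus B (FO X)))"
      by (rule B.assoc[OF oF(1,5,4,3) B.sus_in[OF oF(1)] eta(2) Fv(3)])
    also have "dg_comp B (\<eta>' X) (dg_sus B (FO X)) = FM (dg_sus A X)"
      using B.assoc[OF oF(1,4,5,4) Fs eta] \<eta>'\<eta>[OF X] B.id_left[OF oF(1,4) Fs] \<eta>_sus[OF X] by simp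
    finally show ?thesis using FM_comp[OF X o(3,2) A.sus_in[OF X] s(2)] by simp
  qed
  have "dg_d B (FO X) (FO Z) (FM (dg_comp A s (dg_sus A X))) = dg_comp B (FM v) (FM u)"
    using FM_d[OF X o(2) A.comp_in[OF X o(3,2) A.sus_in[OF X] s(2)]] d FM_comp[OF X o(1,2) A.Z0_in[OF u] A.Z0_in[OF z(1)]] by simp
  with split sus have "\<exists>r s. split_by B (FO Y, FM v, FO Z, dg_comp B (\<eta> X) (FM w), ?T) r s \<and>
      dg_d B (FO X) (FO Z) (dg_comp B s (dg_sus B (FO X))) = dg_comp B (FM v) (FM u)" by metis
  then show ?thesis unfolding std_triangle_def using oF FM_Z0[OF X o(1) u] exact by simp
qed

end


section \<open>Triangles in the localization\<close>

lemma map_map_leg: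
  "map (map_leg GO GM) (map (map_leg FO FM) p) = map (map_leg (\<lambda>X. GO (FO X)) (\<lambda>X Y f. GM (FO X) (FO Y) (FM X Y f))) p"
  by (simp add: map_leg_compose)

lemma (in relcat) Comp_loc_of:
  assumes "X \<in> Ob C" "Y \<in> Ob C" "Z \<in> Ob C" "f \<in> Hom C X Y" "g \<in> Hom C Y Z"
  shows "Comp L X Y Z (loc_of C W Y Z g) (loc_of C W X Y f) = loc_of C W X Z (Comp C X Y Z g f)"
  unfolding loc_of_def using assms by (simp add: Comp_cls cls_eqI[OF fwd_comp])

lemma derived_cat_sel:
  "Ob (derived_cat A W) = Ob (localization (Z0 A) W)" "Hom (derived_cat A W) = Hom (localization (Z0 A) W)"
  "Comp (derived_cat A W) = Comp (localization (Z0 A) W)" "Ident (derived_cat A W) = Ident (localization (Z0 A) W)"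
  "Sh_ob (derived_cat A W) = dg_shift A"
  "Sh_hom (derived_cat A W) = loc_map (Z0 A) W (dg_shift A) (\<lambda>X Y. dg_shift_hom A)"
  by (simp_all add: derived_cat_def Let_def)

lemma derived_cat_Tri:
  "(X, Y, Z, u, v, w) \<in> Tri (derived_cat A W) \<longleftrightarrow>
    (let L = localization (Z0 A) W; Q = loc_of (Z0 A) W; sh = dg_shift A;
          shm = loc_map (Z0 A) W sh (\<lambda>X Y. dg_shift_hom A)
      in X \<in> Ob L \<and> Y \<in> Ob L \<and> Z \<in> Ob L \<and>
            u \<in> Hom L X Y \<and> v \<in> Hom L Y Z \<and> w \<in> Hom L Z (sh X) \<and>
            (\<exists>X' Y' Z' u' v' w' a b c. std_triangle A (X', Y', Z', u', v', w') \<and>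
               cat_iso L X X' a \<and> cat_iso L Y Y' b \<and> cat_iso L Z Z' c \<and>
               Comp L X Y Y' b u = Comp L X X' Y' (Q X' Y' u') a \<and>
               Comp L Y Z Z' c v = Comp L Y Y' Z' (Q Y' Z' v') b \<and>
               Comp L Z (sh X) (sh X') (shm X X' a) w = Comp L Z Z' (sh X') (Q Z' (sh X') w') c))"
  by (simp add: derived_cat_def Let_def)

lemma cat_iso_derived: "cat_iso (derived_cat A W) = cat_iso (localization (Z0 A) W)"
  by (intro ext) (simp add: cat_iso_def derived_cat_sel)

context dg_form_functor begin

sublocale F: relfunctor "Z0 A" W "Z0 B" V FO "\<lambda>X Y. FM" by (rule F_relfunctor)

sublocale SA: relfunctor "Z0 A" W "Z0 A" W "dg_shift A" "\<lambda>X Y. dg_shift_hom A"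
  by (rule A.shift_relfunctor) (use W_iff W_shift in auto)

sublocale SB: relfunctor "Z0 B" V "Z0 B" V "dg_shift B" "\<lambda>X Y. dg_shift_hom B"
  by (rule B.shift_relfunctor) (use V_Z0 V_shift in auto)

sublocale FS: relfunctor "Z0 A" W "Z0 B" V "\<lambda>X. FO (dg_shift A X)" "\<lambda>X Y f. FM (dg_shift_hom A f)"
  by (rule relfunctor_compose[OF SA.relfunctor_axioms F.relfunctor_axioms])

sublocale SF: relfunctor "Z0 A" W "Z0 B" V "\<lambda>X. dg_shift B (FO X)" "\<lambda>X Y f. dg_shift_hom B (FM f)"
  by (rule relfunctor_compose[OF F.relfunctor_axioms SB.relfunctor_axioms])

abbreviation "\<eta>L X \<equiv> loc_of (Z0 B) V (FO (dg_shift A X)) (dg_shift B (FO X)) (\<eta> X)"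

lemma Ob_Z0: "Ob (Z0 A) = dg_ob A" "Ob (Z0 B) = dg_ob B" by (simp_all add: Z0_def)
lemma Hom_Z0: "Hom (Z0 A) = Z0_hom A" "Hom (Z0 B) = Z0_hom B" by (simp_all add: Z0_def)

lemma \<eta>_iso:
  assumes X: "X \<in> dg_ob A"
  shows "cat_iso F.D.L (FO (dg_shift A X)) (dg_shift B (FO X)) (\<eta>L X)"
  by (rule F.D.cat_iso_loc_of[where g = "\<eta>' X"])
     (use X obs \<eta>_Z0 \<eta>'_Z0 \<eta>\<eta>' \<eta>'\<eta> in \<open>auto simp: Z0_def\<close>)

text \<open>An instance of \<open>zz_natural\<close> for shift followed by F and F followed by
  shift, with the components of \<open>\<eta>\<close> as zigzags of one leg.\<close>

lemma \<eta>_loc_nat: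
  assumes XY: "X \<in> dg_ob A" "Y \<in> dg_ob A" and f: "f \<in> Hom F.C.L X Y"
  shows "Comp F.D.L (FO (dg_shift A X)) (dg_shift B (FO X)) (dg_shift B (FO Y)) (SB.lm (FO X) (FO Y) (F.lm X Y f)) (\<eta>L X) =
    Comp F.D.L (FO (dg_shift A X)) (FO (dg_shift A Y)) (dg_shift B (FO Y)) (\<eta>L Y) (F.lm (dg_shift A X) (dg_shift A Y) (SA.lm X Y f))"
proof -
  from f obtain p where p: "f = F.C.cls X Y p" "F.C.zz X p Y" by (auto simp: F.C.Hom_L)
  let ?h = "\<lambda>X. [(FO (dg_shift A X), Fwd (\<eta> X), dg_shift B (FO X))]"
  have h: "F.D.zz (FO (dg_shift A X)) (?h X) (dg_shift B (FO X))" if "X \<in> dg_ob A" for X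
    using that obs \<eta>_Z0 by (simp add: Ob_Z0 Hom_Z0)
  have "F.D.zeq (FO (dg_shift A X)) (dg_shift B (FO Y)) (FS.mp p @ ?h Y) (?h X @ SF.mp p)"
  proof (rule zz_natural[OF FS.relfunctor_axioms SF.relfunctor_axioms h _ p(2)])
    fix X Y f assume "X \<in> Ob (Z0 A)" "Y \<in> Ob (Z0 A)" "f \<in> Hom (Z0 A) X Y"
    then have *: "X \<in> dg_ob A" "Y \<in> dg_ob A" "f \<in> Z0_hom A X Y" by (auto simp: Z0_def)
    show "F.D.zeq (FO (dg_shift A X)) (dg_shift B (FO Y)) ((FO (dg_shift A X), Fwd (FM (dg_shift_hom A f)), FO (dg_shift A Y)) # ?h Y)
      (?h X @ [(dg_shift B (FO X), Fwd (dg_shift_hom B (FM f)), dg_shift B (FO Y))])"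
      unfolding append.simps
      by (rule F.D.fwd_square)
         (use * obs \<eta>_Z0 FM_Z0 A.shift_Z0 B.shift_Z0 \<eta>_nat[OF *(1,2) A.Z0_in[OF *(3)]] in \<open>auto simp: Z0_def\<close>)
  qed (simp add: Ob_Z0)
  then have e: "F.D.zeq (FO (dg_shift A X)) (dg_shift B (FO Y)) (F.mp (SA.mp p) @ ?h Y) (?h X @ SB.mp (F.mp p))"
    by (simp only: map_map_leg append.simps)
  have "SB.lm (FO X) (FO Y) (F.lm X Y f) = F.D.cls (dg_shift B (FO X)) (dg_shift B (FO Y)) (SB.mp (F.mp p))"
    unfolding p(1) F.lm_cls[OF p(2)] SB.lm_cls[OF F.mp_zz[OF p(2)]] ..
  moreover have "F.lm (dg_shift A X) (dg_shift A Y) (SA.lm X Y f) = F.D.cls (FO (dg_shift A X)) (FO (dg_shift A Y)) (F.mp (SA.mp p))"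
    unfolding p(1) SA.lm_cls[OF p(2)] F.lm_cls[OF SA.mp_zz[OF p(2)]] ..
  ultimately show ?thesis
    unfolding loc_of_def
    using F.D.cls_eqI[OF e] h XY SB.mp_zz[OF F.mp_zz[OF p(2)]] F.mp_zz[OF SA.mp_zz[OF p(2)]]
    by (simp only: F.D.Comp_cls)
qed

lemma F_Tri:
  assumes "(X, Y, Z, u, v, w) \<in> Tri (derived_cat A W)"
  shows "(FO X, FO Y, FO Z, F.lm X Y u, F.lm Y Z v,
     Comp F.D.L (FO Z) (FO (dg_shift A X)) (dg_shift B (FO X)) (\<eta>L X) (F.lm Z (dg_shift A X) w)) \<in> Tri (derived_cat B V)"
proof -
  let ?LA = F.C.L and ?LB = F.D.L and ?sA = "dg_shift A" and ?sB = "dg_shift B"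
  from assms obtain X' Y' Z' u' v' w' a b c where
    o: "X \<in> dg_ob A" "Y \<in> dg_ob A" "Z \<in> dg_ob A" and
    h: "u \<in> Hom ?LA X Y" "v \<in> Hom ?LA Y Z" "w \<in> Hom ?LA Z (?sA X)" and
    std: "std_triangle A (X', Y', Z', u', v', w')" and
    iso: "cat_iso ?LA X X' a" "cat_iso ?LA Y Y' b" "cat_iso ?LA Z Z' c" and
    sq: "Comp ?LA X Y Y' b u = Comp ?LA X X' Y' (loc_of (Z0 A) W X' Y' u') a"
      "Comp ?LA Y Z Z' c v = Comp ?LA Y Y' Z' (loc_of (Z0 A) W Y' Z' v') b"
      "Comp ?LA Z (?sA X) (?sA X') (SA.lm X X' a) w = Comp ?LA Z Z' (?sA X') (loc_of (Z0 A) W Z' (?sA X') w') c"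
    unfolding derived_cat_Tri by (auto simp: Let_def F.C.Ob_L Ob_Z0)
  from std have o': "X' \<in> dg_ob A" "Y' \<in> dg_ob A" "Z' \<in> dg_ob A" and
    z: "u' \<in> Z0_hom A X' Y'" "v' \<in> Z0_hom A Y' Z'" "w' \<in> Z0_hom A Z' (?sA X')"
    by (auto simp: std_triangle_def exact_seq_def)
  from iso have i: "a \<in> Hom ?LA X X'" "b \<in> Hom ?LA Y Y'" "c \<in> Hom ?LA Z Z'" by (auto simp: cat_iso_def)
  have Q: "loc_of (Z0 A) W M N f \<in> Hom ?LA M N \<and> F.lm M N (loc_of (Z0 A) W M N f) = loc_of (Z0 B) V (FO M) (FO N) (FM f)"
    if "M \<in> dg_ob A" "N \<in> dg_ob A" "f \<in> Z0_hom A M N" for M N f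
    using that F.lm_loc_of[of M N f] F.C.cls_in_Hom[OF F.C.zz_single[of M N f]] by (simp add: Ob_Z0 Hom_Z0 loc_of_def)
  note Q' = Q[OF o'(1,2) z(1)] Q[OF o'(2,3) z(2)] Q[OF o'(3) A.shift_ob[OF o'(1)] z(3)]
  have C: "F.lm M K (Comp ?LA M N K g f) = Comp ?LB (FO M) (FO N) (FO K) (F.lm N K g) (F.lm M N f)"
    if "f \<in> Hom ?LA M N" "g \<in> Hom ?LA N K" for M N K f g
  proof -
    from that obtain p q where "F.C.zz M p N" "F.C.zz N q K" by (auto simp: F.C.Hom_L)
    from zz_ends[OF this(1)] zz_ends[OF this(2)] have "M \<in> Ob ?LA" "N \<in> Ob ?LA" "K \<in> Ob ?LA" by (simp_all add: F.C.Ob_L)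
    with that F.lm_functor show ?thesis unfolding is_functor_def by blast
  qed
  have H: "F.lm M N f \<in> Hom ?LB (FO M) (FO N)" if "f \<in> Hom ?LA M N" for M N f
    using that by (auto simp: F.C.Hom_L F.D.Hom_L F.lm_cls intro: F.mp_zz)
  have Sa: "SA.lm X X' a \<in> Hom ?LA (?sA X) (?sA X')" using i(1) by (auto simp: F.C.Hom_L SA.lm_cls intro: SA.mp_zz)
  have SFa: "SB.lm (FO X) (FO X') (F.lm X X' a) \<in> Hom ?LB (?sB (FO X)) (?sB (FO X'))"
    using H[OF i(1)] by (auto simp: F.D.Hom_L SB.lm_cls intro: SB.mp_zz)
  have eta: "\<eta>L X \<in> Hom ?LB (FO (?sA X)) (?sB (FO X))" "\<eta>L X' \<in> Hom ?LB (FO (?sA X')) (?sB (FO X'))"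
    using \<eta>_iso o o' by (auto simp: cat_iso_def)
  have "F.lm X Y' (Comp ?LA X Y Y' b u) = F.lm X Y' (Comp ?LA X X' Y' (loc_of (Z0 A) W X' Y' u') a)" using sq(1) by simp
  then have 1: "Comp ?LB (FO X) (FO Y) (FO Y') (F.lm Y Y' b) (F.lm X Y u) =
      Comp ?LB (FO X) (FO X') (FO Y') (loc_of (Z0 B) V (FO X') (FO Y') (FM u')) (F.lm X X' a)"
    using Q' by (simp add: C[OF h(1) i(2)] C[OF i(1)])
  have "F.lm Y Z' (Comp ?LA Y Z Z' c v) = F.lm Y Z' (Comp ?LA Y Y' Z' (loc_of (Z0 A) W Y' Z' v') b)" using sq(2) by simp
  then have 2: "Comp ?LB (FO Y) (FO Z) (FO Z') (F.lm Z Z' c) (F.lm Y Z v) =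
      Comp ?LB (FO Y) (FO Y') (FO Z') (loc_of (Z0 B) V (FO Y') (FO Z') (FM v')) (F.lm Y Y' b)"
    using Q' by (simp add: C[OF h(2) i(3)] C[OF i(2)])
  have "F.lm Z (?sA X') (Comp ?LA Z (?sA X) (?sA X') (SA.lm X X' a) w) =
     F.lm Z (?sA X') (Comp ?LA Z Z' (?sA X') (loc_of (Z0 A) W Z' (?sA X') w') c)" using sq(3) by simp
  then have 3: "Comp ?LB (FO Z) (FO (?sA X)) (FO (?sA X')) (F.lm (?sA X) (?sA X') (SA.lm X X' a)) (F.lm Z (?sA X) w) =
      Comp ?LB (FO Z) (FO Z') (FO (?sA X')) (loc_of (Z0 B) V (FO Z') (FO (?sA X')) (FM w')) (F.lm Z Z' c)"
    using Q' by (simp add: C[OF h(3) Sa] C[OF i(3)])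
  have Qw: "loc_of (Z0 B) V (FO Z') (FO (?sA X')) (FM w') \<in> Hom ?LB (FO Z') (FO (?sA X'))" using Q'(3) H by metis
  have comp: "Comp ?LB (FO Z') (FO (?sA X')) (?sB (FO X')) (\<eta>L X') (loc_of (Z0 B) V (FO Z') (FO (?sA X')) (FM w')) =
     loc_of (Z0 B) V (FO Z') (?sB (FO X')) (dg_comp B (\<eta> X') (FM w'))"
  proof -
    have *: "FO Z' \<in> dg_ob B" "FO (?sA X') \<in> dg_ob B" "?sB (FO X') \<in> dg_ob B" "\<eta> X' \<in> Z0_hom B (FO (?sA X')) (?sB (FO X'))"
      "FM w' \<in> Z0_hom B (FO Z') (FO (?sA X'))" using o' obs \<eta>_Z0 FM_Z0 z(3) by auto
    then show ?thesis using F.D.Comp_loc_of[of "FO Z'" "FO (?sA X')" "?sB (FO X')" "FM w'" "\<eta> X'"]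
      unfolding Ob_Z0 Hom_Z0 by (simp add: Z0_def)
  qed
  \<comment> \<open>The third square is the one that meets the shift: naturality moves
    \<open>\<eta>\<close> past the isomorphism \<open>a\<close>, square \<open>3\<close> applies,
    and \<open>\<eta>L X'\<close> is absorbed into the last map of the standard triangle.\<close>
  have 4: "Comp ?LB (FO Z) (?sB (FO X)) (?sB (FO X')) (SB.lm (FO X) (FO X') (F.lm X X' a))
      (Comp ?LB (FO Z) (FO (?sA X)) (?sB (FO X)) (\<eta>L X) (F.lm Z (?sA X) w)) =
    Comp ?LB (FO Z) (FO Z') (?sB (FO X')) (loc_of (Z0 B) V (FO Z') (?sB (FO X')) (dg_comp B (\<eta> X') (FM w'))) (F.lm Z Z' c)"
    unfolding F.D.Comp_L_assoc[OF H[OF h(3)] eta(1) SFa] \<eta>_loc_nat[OF o(1) o'(1) i(1)]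
      F.D.Comp_L_assoc[OF H[OF h(3)] H[OF Sa] eta(2), symmetric] 3 F.D.Comp_L_assoc[OF H[OF i(3)] Qw eta(2)] comp ..
  have m: "Comp ?LB (FO Z) (FO (?sA X)) (?sB (FO X)) (\<eta>L X) (F.lm Z (?sA X) w) \<in> Hom ?LB (FO Z) (?sB (FO X))"
  proof -
    from H[OF h(3)] eta(1) obtain p q where "F.lm Z (?sA X) w = F.D.cls (FO Z) (FO (?sA X)) p" "F.D.zz (FO Z) p (FO (?sA X))"
      "\<eta>L X = F.D.cls (FO (?sA X)) (?sB (FO X)) q" "F.D.zz (FO (?sA X)) q (?sB (FO X))" by (auto simp: F.D.Hom_L)
    then show ?thesis by (simp add: F.D.Comp_cls F.D.cls_in_Hom zz_append[of "Z0 B" V _ p _ q])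
  qed
  show ?thesis
    unfolding derived_cat_Tri Let_def F.D.Ob_L Ob_Z0
    using F_std_triangle[OF std] F.lm_iso[OF iso(1)] F.lm_iso[OF iso(2)] F.lm_iso[OF iso(3)] 1 2 4 H[OF h(1)] H[OF h(2)] m o FO
    by blast
qed

end

section \<open>The induced triangulated equivalence\<close>

locale dg_form_equivalence = dg_form_functor A B FO FM \<eta> \<eta>' \<Phi> W V +
  rel_equivalence "Z0 A" W "Z0 B" V FO "\<lambda>X Y. FM" GO GM HO HM \<alpha> \<beta>
  for A :: "('o, 'm) dgcat" and B :: "('p, 'n) dgcat" and FO FM \<eta> \<eta>' \<Phi> W V GO GM HO HM \<alpha> \<beta>
begin

theorem F_triangulated_equivalence:
  "triangulated_equivalence (derived_cat A W) (derived_cat B V) FO (loc_map (Z0 B) V FO (\<lambda>X Y. FM))"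
proof -
  have 1: "is_functor (derived_cat A W) (derived_cat B V) FO F.lm"
    using F.lm_functor unfolding is_functor_def derived_cat_sel .
  have 2: "fully_faithful (derived_cat A W) (derived_cat B V) FO F.lm"
    using lm_fully_faithful unfolding fully_faithful_def derived_cat_sel .
  have 3: "essentially_surjective (derived_cat A W) (derived_cat B V) FO"
    using lm_essentially_surjective unfolding essentially_surjective_def derived_cat_sel cat_iso_derived .
  show ?thesis
    unfolding triangulated_equivalence_def
    apply (intro conjI exI[of _ "\<lambda>X. \<eta>L X"] 1 2 3)
    subgoal unfolding derived_cat_sel cat_iso_derived F.C.Ob_L Ob_Z0 using \<eta>_iso by blast
    subgoal unfolding derived_cat_sel F.C.Ob_L Ob_Z0 using \<eta>_loc_nat by blast
    subgoal unfolding derived_cat_sel using F_Tri by blast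
    done
qed

end

section \<open>Form functors on Grothendieck--Witt groups\<close>

abbreviation (input) "frag_grp A W \<equiv> free_Abelian_group (sym_spaces A W)"

lemma keys_frag_diff: "Poly_Mapping.keys a \<subseteq> S \<Longrightarrow> Poly_Mapping.keys b \<subseteq> S \<Longrightarrow> Poly_Mapping.keys (a - b) \<subseteq> S"
  for a b :: "'a \<Rightarrow>\<^sub>0 int"
  using keys_diff[of a b] by blast

lemma keys_frag_add: "Poly_Mapping.keys a \<subseteq> S \<Longrightarrow> Poly_Mapping.keys b \<subseteq> S \<Longrightarrow> Poly_Mapping.keys (a + b) \<subseteq> S"
  for a b :: "'a \<Rightarrow>\<^sub>0 int"
  using keys_add[of a b] by blast

text \<open>That the middle term is a symmetric space is implied by the other premises of
  \<open>gw_exact\<close>; it ensures that the relator lies in the free group.\<close>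

lemma gw_exact_sym:
  assumes "exact_seq A (X, f, Y, g, Z)" "exact_seq_map A (X, f, Y, g, Z) (dual_seq A (X, f, Y, g, Z)) (a, b, c)"
    "b \<in> W Y (dg_dual A Y)" "b = dg_comp A (dg_dual_hom A b) (dg_can A Y)"
  shows "(Y, b) \<in> sym_spaces A W"
  using assms by (auto simp: sym_spaces_def exact_seq_def exact_seq_map_def dual_seq_def)

lemma gw_relators_carrier:
  assumes "r \<in> gw_relators A W"
  shows "r \<in> carrier (frag_grp A W)"
  using assms unfolding carrier_free_Abelian_group_iff
proof cases
  case (gw_exact Em f E0 g Ep \<phi>m \<phi>0 \<phi>p S i j p q \<omega>)
  show "Poly_Mapping.keys r \<subseteq> sym_spaces A W"
    using gw_exact(1,12) gw_exact_sym[where W = W, OF gw_exact(2,3,5,8)] keys_frag_diff[of "frag_of (E0, \<phi>0)" "sym_spaces A W" "frag_of (S, \<omega>)"] by simp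
qed (simp_all add: keys_frag_diff keys_frag_add)

lemma GW0_rel_subgroup: "subgroup (GW0_rel A W) (frag_grp A W)"
  unfolding GW0_rel_def by (rule group.generate_is_subgroup) (auto dest: gw_relators_carrier simp del: carrier_free_Abelian_group_iff)

lemma GW0_rel_normal: "GW0_rel A W \<lhd> frag_grp A W"
  by (rule comm_group.subgroup_imp_normal[OF abelian_free_Abelian_group GW0_rel_subgroup])

lemma GW0_group: "group (GW0 A W)"
  unfolding GW0_def by (rule normal.factorgroup_is_group[OF GW0_rel_normal])

lemma GW0_coset_hom: "r_coset (frag_grp A W) (GW0_rel A W) \<in> hom (frag_grp A W) (GW0 A W)"
  unfolding GW0_def by (rule normal.r_coset_hom_Mod[OF GW0_rel_normal])

lemma hom_free_diff:
  assumes "h \<in> hom (free_Abelian_group S) G" "group G" "Poly_Mapping.keys a \<subseteq> S" "Poly_Mapping.keys b \<subseteq> S"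
  shows "h (a - b) = h a \<otimes>\<^bsub>G\<^esub> inv\<^bsub>G\<^esub> h b"
proof -
  interpret group_hom "free_Abelian_group S" G h using assms by (simp add: group_hom_def group_hom_axioms_def)
  have "a - b = a \<otimes>\<^bsub>free_Abelian_group S\<^esub> inv\<^bsub>free_Abelian_group S\<^esub> b" using assms by simp
  then have "h (a - b) = h (a \<otimes>\<^bsub>free_Abelian_group S\<^esub> inv\<^bsub>free_Abelian_group S\<^esub> b)" by (rule arg_cong)
  also have "\<dots> = h a \<otimes>\<^bsub>G\<^esub> h (inv\<^bsub>free_Abelian_group S\<^esub> b)" by (rule hom_mult) (use assms in simp_all)
  also have "h (inv\<^bsub>free_Abelian_group S\<^esub> b) = inv\<^bsub>G\<^esub> h b" by (rule hom_inv) (use assms in simp)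
  finally show ?thesis .
qed

lemma hom_free_eq:
  assumes h: "h \<in> hom (free_Abelian_group S) G" "k \<in> hom (free_Abelian_group S) G" "group G"
    and eq: "\<And>x. x \<in> S \<Longrightarrow> h (frag_of x) = k (frag_of x)" and c: "Poly_Mapping.keys c \<subseteq> S"
  shows "h c = k c"
proof (rule free_Abelian_group_induct[OF c])
  show "h 0 = k 0"
    using hom_one[OF h(1)] hom_one[OF h(2)] h(3) by simp
  show "h (x - y) = k (x - y)"
    if "Poly_Mapping.keys x \<subseteq> S" "Poly_Mapping.keys y \<subseteq> S" "h x = k x" "h y = k y" for x y
    using hom_free_diff[OF h(1,3)] hom_free_diff[OF h(2,3)] that by simp
qed (rule eq)

section \<open>Induced homomorphisms on Grothendieck-Witt groups\<close>

definition form_map :: "('p, 'n) dgcat \<Rightarrow> ('o \<Rightarrow> 'p) \<Rightarrow> ('m \<Rightarrow> 'n) \<Rightarrow> ('o \<Rightarrow> 'n) \<Rightarrow> 'o \<times> 'm \<Rightarrow> 'p \<times> 'n" where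
  "form_map B FO FM \<Phi> = (\<lambda>(X, \<phi>). (FO X, dg_comp B (\<Phi> X) (FM \<phi>)))"

abbreviation "form_frag B FO FM \<Phi> \<equiv> frag_extend (\<lambda>x. frag_of (form_map B FO FM \<Phi> x))"

lemma frag_extend_of_hom:
  assumes "\<And>x. x \<in> S \<Longrightarrow> f x \<in> T"
  shows "frag_extend (\<lambda>x. frag_of (f x)) \<in> hom (free_Abelian_group S) (free_Abelian_group T)"
proof (rule homI)
  fix c assume "c \<in> carrier (free_Abelian_group S)"
  then show "frag_extend (\<lambda>x. frag_of (f x)) c \<in> carrier (free_Abelian_group T)"
    using keys_frag_extend[of "\<lambda>x. frag_of (f x)" c] assms by fastforce
qed (simp add: frag_extend_add)

lemma GW0_induced_exists:
  assumes sym: "\<And>x. x \<in> sym_spaces A W \<Longrightarrow> form_map B FO FM \<Phi> x \<in> sym_spaces B V"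
    and rel: "\<And>r. r \<in> gw_relators A W \<Longrightarrow> form_frag B FO FM \<Phi> r \<in> gw_relators B V"
  shows "\<exists>h. GW0_induced A W B V FO FM \<Phi> h"
proof -
  let ?k = "form_frag B FO FM \<Phi>" and ?q = "r_coset (frag_grp B V) (GW0_rel B V)"
  have k: "?k \<in> hom (frag_grp A W) (frag_grp B V)" by (rule frag_extend_of_hom[OF sym])
  have qk: "?q \<circ> ?k \<in> hom (frag_grp A W) (GW0 B V)" by (rule hom_compose[OF k GW0_coset_hom])
  interpret group_hom "frag_grp A W" "GW0 B V" "?q \<circ> ?k"
    using qk GW0_group by (simp add: group_hom_def group_hom_axioms_def)
  have "GW0_rel A W \<subseteq> kernel (frag_grp A W) (GW0 B V) (?q \<circ> ?k)"
    unfolding GW0_rel_def[of A W]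
  proof (rule group.generate_subgroup_incl[OF group_free_Abelian_group _ subgroup_kernel], rule subsetI)
    fix r assume r: "r \<in> gw_relators A W"
    then have "?k r \<in> GW0_rel B V" unfolding GW0_rel_def using rel by (blast intro: generate.incl)
    then have "?q (?k r) = GW0_rel B V"
      using group.coset_join2[OF group_free_Abelian_group _ GW0_rel_subgroup] subgroup.subset[OF GW0_rel_subgroup[of B V]] by blast
    then show "r \<in> kernel (frag_grp A W) (GW0 B V) (?q \<circ> ?k)"
      using gw_relators_carrier[OF r] by (simp add: kernel_def GW0_def FactGroup_def)
  qed
  from FactGroup_universal_kernel[OF GW0_rel_normal this] obtain h
    where h: "h \<in> hom (GW0 A W) (GW0 B V)" "\<And>x. x \<in> carrier (frag_grp A W) \<Longrightarrow> h (GW0_rel A W #>\<^bsub>frag_grp A W\<^esub> x) = (?q \<circ> ?k) x"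
    unfolding GW0_def by blast
  have "h (gw_class A W X \<phi>) = gw_class B V (FO X) (dg_comp B (\<Phi> X) (FM \<phi>))" if "(X, \<phi>) \<in> sym_spaces A W" for X \<phi>
    using h(2)[of "frag_of (X, \<phi>)"] that by (simp add: gw_class_def form_map_def)
  with h(1) show ?thesis unfolding GW0_induced_def by blast
qed

text \<open>\<open>GW0_induced\<close> prescribes \<open>h\<close> on classes of generators. Being a
  homomorphism, \<open>h\<close> is then determined on the class of every element of the free group,
  which is what a statement about its image requires.\<close>

lemma GW0_induced_coset:
  assumes h: "GW0_induced A W B V FO FM \<Phi> h"
    and sym: "\<And>x. x \<in> sym_spaces A W \<Longrightarrow> form_map B FO FM \<Phi> x \<in> sym_spaces B V"
    and c: "Poly_Mapping.keys c \<subseteq> sym_spaces A W"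
  shows "h (GW0_rel A W #>\<^bsub>frag_grp A W\<^esub> c) = GW0_rel B V #>\<^bsub>frag_grp B V\<^esub> form_frag B FO FM \<Phi> c"
proof -
  let ?k = "form_frag B FO FM \<Phi>" and ?q = "r_coset (frag_grp B V) (GW0_rel B V)"
  have "h \<in> hom (GW0 A W) (GW0 B V)" using h by (simp add: GW0_induced_def)
  then have 1: "h \<circ> r_coset (frag_grp A W) (GW0_rel A W) \<in> hom (frag_grp A W) (GW0 B V)"
    by (rule hom_compose[OF GW0_coset_hom])
  have 2: "?q \<circ> ?k \<in> hom (frag_grp A W) (GW0 B V)" by (rule hom_compose[OF frag_extend_of_hom[OF sym] GW0_coset_hom])
  have "(h \<circ> r_coset (frag_grp A W) (GW0_rel A W)) c = (?q \<circ> ?k) c"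
  proof (rule hom_free_eq[OF 1 2 GW0_group _ c])
    fix x assume "x \<in> sym_spaces A W"
    then show "(h \<circ> r_coset (frag_grp A W) (GW0_rel A W)) (frag_of x) = (?q \<circ> ?k) (frag_of x)"
      using h by (auto simp: GW0_induced_def gw_class_def form_map_def)
  qed
  then show ?thesis by simp
qed

section \<open>A parity obstruction to surjectivity\<close>

definition frag_weight :: "('a \<Rightarrow> int) \<Rightarrow> ('a \<Rightarrow>\<^sub>0 int) \<Rightarrow> int" where
  "frag_weight N c = Poly_Mapping.lookup (frag_extend (\<lambda>x. frag_cmul (N x) (frag_of ())) c) ()"

text \<open>The weight is read off in the free group on one generator, that is, in Z, so additivity
  is inherited from \<open>frag_extend\<close>.\<close>

lemma frag_weight_simps [simp]:
  "frag_weight N 0 = 0" "frag_weight N (frag_of x) = N x"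
  "frag_weight N (a + b) = frag_weight N a + frag_weight N b"
  "frag_weight N (a - b) = frag_weight N a - frag_weight N b"
  "frag_weight N (- a) = - frag_weight N a"
  by (simp_all add: frag_weight_def frag_extend_add frag_extend_diff frag_extend_minus lookup_add lookup_minus)

lemma GW0_rel_even:
  assumes "\<And>r. r \<in> gw_relators B V \<Longrightarrow> even (frag_weight N r)" "r \<in> GW0_rel B V"
  shows "even (frag_weight N r)"
  using assms(2) unfolding GW0_rel_def
proof (induction rule: generate.induct)
  case (inv h)
  then show ?case using gw_relators_carrier[OF inv] assms(1)[OF inv] by simp
qed (use assms(1) in auto)

text \<open>The parity of \<open>frag_weight N\<close> is well defined on \<open>GW0 B V\<close> by
  \<open>rel\<close>. It vanishes on the image of \<open>h\<close>, since generators go to classes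
  of even weight, but not on the class of \<open>y\<close>.\<close>

lemma not_surj_if_even:
  assumes h: "GW0_induced A W B V FO FM \<Phi> h"
    and sym: "\<And>x. x \<in> sym_spaces A W \<Longrightarrow> form_map B FO FM \<Phi> x \<in> sym_spaces B V"
    and rel: "\<And>r. r \<in> gw_relators B V \<Longrightarrow> even (frag_weight N r)"
    and img: "\<And>x. x \<in> sym_spaces A W \<Longrightarrow> even (N (form_map B FO FM \<Phi> x))"
    and odd: "y \<in> sym_spaces B V" "odd (N y)"
  shows "h ` carrier (GW0 A W) \<noteq> carrier (GW0 B V)"
proof
  let ?k = "form_frag B FO FM \<Phi>"
  assume *: "h ` carrier (GW0 A W) = carrier (GW0 B V)"
  have "GW0_rel B V #>\<^bsub>frag_grp B V\<^esub> frag_of y \<in> carrier (GW0 B V)"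
    using hom_in_carrier[OF GW0_coset_hom, of "frag_of y" B V] odd(1) by simp
  then have "GW0_rel B V #>\<^bsub>frag_grp B V\<^esub> frag_of y \<in> h ` carrier (GW0 A W)" using * by simp
  then obtain c where "GW0_rel B V #>\<^bsub>frag_grp B V\<^esub> frag_of y = h c" "c \<in> carrier (GW0 A W)" by (rule imageE)
  then obtain a where a: "Poly_Mapping.keys a \<subseteq> sym_spaces A W"
    and e: "GW0_rel B V #>\<^bsub>frag_grp B V\<^esub> frag_of y = h (GW0_rel A W #>\<^bsub>frag_grp A W\<^esub> a)"
    by (auto simp: GW0_def FactGroup_def RCOSETS_def)
  have "frag_of y \<in> GW0_rel B V #>\<^bsub>frag_grp B V\<^esub> frag_of y"
    using group.rcos_self[OF group_free_Abelian_group _ GW0_rel_subgroup, of "frag_of y"] odd(1) by simp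
  then have "frag_of y \<in> GW0_rel B V #>\<^bsub>frag_grp B V\<^esub> ?k a" using e GW0_induced_coset[OF h sym a] by simp
  then obtain r where r: "r \<in> GW0_rel B V" "frag_of y = r + ?k a" by (auto simp: r_coset_def)
  have "even (frag_weight N (?k a))"
    by (rule free_Abelian_group_induct[OF a]) (simp_all add: frag_extend_diff img)
  with GW0_rel_even[OF rel r(1)] have "even (frag_weight N (frag_of y))" unfolding r(2) by simp
  with odd(2) show False by simp
qed

section \<open>Symmetric spaces and relations under a form functor\<close>

context dg_form_functor begin

lemma FM_comp0: "\<lbrakk>X \<in> dg_ob A; Y \<in> dg_ob A; Z \<in> dg_ob A; f \<in> Z0_hom A X Y; g \<in> Z0_hom A Y Z\<rbrakk> \<Longrightarrow>
      FM (dg_comp A g f) = dg_comp B (FM g) (FM f)"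
  by (rule FM_comp[OF _ _ _ A.Z0_in A.Z0_in])

lemma \<Phi>F_Z0:
  assumes X: "X \<in> dg_ob A" "Y \<in> dg_ob A" and f: "\<phi> \<in> Z0_hom A X (dg_dual A Y)"
  shows "dg_comp B (\<Phi> Y) (FM \<phi>) \<in> Z0_hom B (FO X) (dg_dual B (FO Y))"
  by (rule B.comp_Z0[OF FO[OF X(1)] FO[OF A.dual_ob[OF X(2)]] B.dual_ob[OF FO[OF X(2)]] FM_Z0[OF X(1) A.dual_ob[OF X(2)] f] \<Phi>_Z0[OF X(2)]])

lemma \<Phi>F_V:
  assumes X: "X \<in> dg_ob A" "Y \<in> dg_ob A" and f: "\<phi> \<in> W X (dg_dual A Y)"
  shows "dg_comp B (\<Phi> Y) (FM \<phi>) \<in> V (FO X) (dg_dual B (FO Y))"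
  using f W_iff[OF X(1) A.dual_ob[OF X(2)]]
  by (intro V_comp[OF FO[OF X(1)] FO[OF A.dual_ob[OF X(2)]] B.dual_ob[OF FO[OF X(2)]] _ \<Phi>[OF X(2)]]) simp

text \<open>Both sides are the adjoint of \<open>\<phi> : X \<rightarrow> Y\<^sup>\<or>\<close>, transported along the form functor.\<close>

lemma \<Phi>F_adjoint:
  assumes X: "X \<in> dg_ob A" "Y \<in> dg_ob A" and f: "\<phi> \<in> Z0_hom A X (dg_dual A Y)"
  shows "dg_comp B (dg_dual_hom B (dg_comp B (\<Phi> Y) (FM \<phi>))) (dg_can B (FO Y)) =
     dg_comp B (\<Phi> X) (FM (dg_comp A (dg_dual_hom A \<phi>) (dg_can A Y)))"
proof -
  let ?Y = "dg_dual A Y"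
  note o = X A.dual_ob[OF X(1)] A.dual_ob[OF X(2)] A.dual_ob[OF A.dual_ob[OF X(2)]]
  note b = o[THEN FO] o(1,2)[THEN FO, THEN B.dual_ob] FO[OF o(4), THEN B.dual_ob] B.dual_ob[OF B.dual_ob[OF FO[OF X(2)]]]
  note h = B.Z0_in[OF FM_Z0[OF o(1,4) f]] B.Z0_in[OF \<Phi>_Z0[OF X(2)]]
  have "dg_comp B (dg_dual_hom B (dg_comp B (\<Phi> Y) (FM \<phi>))) (dg_can B (FO Y)) =
    dg_comp B (dg_comp B (dg_dual_hom B (FM \<phi>)) (dg_dual_hom B (\<Phi> Y))) (dg_can B (FO Y))"
    using B.dual_comp[OF b(1,4,7) h] by simp
  also have "\<dots> = dg_comp B (dg_dual_hom B (FM \<phi>)) (dg_comp B (dg_dual_hom B (\<Phi> Y)) (dg_can B (FO Y)))"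
    by (rule B.assoc0[OF b(2,9,8,6) B.Z0_in[OF B.can_Z0[OF b(2)]] B.dual_in[OF b(4,7) h(2)] B.dual_in[OF b(1,4) h(1)]])
  also have "\<dots> = dg_comp B (dg_dual_hom B (FM \<phi>)) (dg_comp B (\<Phi> ?Y) (FM (dg_can A Y)))"
    by (simp add: \<Phi>_can[OF X(2)])
  also have "\<dots> = dg_comp B (dg_comp B (dg_dual_hom B (FM \<phi>)) (\<Phi> ?Y)) (FM (dg_can A Y))"
    by (rule B.assoc0[OF b(2,5,8,6) B.Z0_in[OF FM_Z0[OF o(2,5) A.can_Z0[OF X(2)]]] B.Z0_in[OF \<Phi>_Z0[OF o(4)]] B.dual_in[OF b(1,4) h(1)], symmetric])
  also have "\<dots> = dg_comp B (dg_comp B (\<Phi> X) (FM (dg_dual_hom A \<phi>))) (FM (dg_can A Y))"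
    by (simp add: \<Phi>_nat[OF o(1,4) A.Z0_in[OF f]])
  also have "\<dots> = dg_comp B (\<Phi> X) (dg_comp B (FM (dg_dual_hom A \<phi>)) (FM (dg_can A Y)))"
    by (rule B.assoc0[OF b(2,5,3,6) B.Z0_in[OF FM_Z0[OF o(2,5) A.can_Z0[OF X(2)]]]
         B.Z0_in[OF FM_Z0[OF o(5,3) A.dual_Z0[OF o(1,4) f]]] B.Z0_in[OF \<Phi>_Z0[OF X(1)]]])
  finally show ?thesis by (simp add: FM_comp0[OF o(2,5,3) A.can_Z0[OF X(2)] A.dual_Z0[OF o(1,4) f]])
qed

text \<open>Two different maps \<open>p\<close> and \<open>q\<close> are allowed so that the
  off-diagonal entries of a hyperbolic form are covered together with isometries and orthogonal
  sums, where both coincide.\<close>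

lemma \<Phi>F_pull:
  assumes X: "S \<in> dg_ob A" "X \<in> dg_ob A" "Y \<in> dg_ob A" and f: "\<phi> \<in> Z0_hom A X (dg_dual A Y)"
    and p: "p \<in> Z0_hom A S Y" "q \<in> Z0_hom A S X"
  shows "dg_comp B (\<Phi> S) (FM (pull_form A p \<phi> q)) = pull_form B (FM p) (dg_comp B (\<Phi> Y) (FM \<phi>)) (FM q)"
    and "pull_form A p \<phi> q \<in> Z0_hom A S (dg_dual A S)"
proof -
  note o = X A.dual_ob[OF X(1)] A.dual_ob[OF X(3)]
  note b = o[THEN FO] B.dual_ob[OF FO[OF o(1)]] B.dual_ob[OF FO[OF o(3)]]
  have pq: "dg_comp A \<phi> q \<in> Z0_hom A S (dg_dual A Y)" by (rule A.comp_Z0[OF o(1,2,5) p(2) f])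
  note dp = A.dual_Z0[OF X(1,3) p(1)]
  show "pull_form A p \<phi> q \<in> Z0_hom A S (dg_dual A S)" unfolding pull_form_def
    by (rule A.comp_Z0[OF o(1,5,4) pq dp])
  have "dg_comp B (\<Phi> S) (FM (pull_form A p \<phi> q)) = dg_comp B (\<Phi> S) (dg_comp B (FM (dg_dual_hom A p)) (FM (dg_comp A \<phi> q)))"
    unfolding pull_form_def by (simp add: FM_comp0[OF o(1,5,4) pq dp])
  also have "\<dots> = dg_comp B (dg_comp B (\<Phi> S) (FM (dg_dual_hom A p))) (FM (dg_comp A \<phi> q))"
    by (rule B.assoc0[OF b(1,5,4,6) B.Z0_in[OF FM_Z0[OF o(1,5) pq]] B.Z0_in[OF FM_Z0[OF o(5,4) dp]] B.Z0_in[OF \<Phi>_Z0[OF X(1)]], symmetric])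
  also have "\<dots> = dg_comp B (dg_comp B (dg_dual_hom B (FM p)) (\<Phi> Y)) (dg_comp B (FM \<phi>) (FM q))"
    by (simp add: \<Phi>_nat[OF X(1,3) A.Z0_in[OF p(1)]] FM_comp0[OF o(1,2,5) p(2) f])
  also have "\<dots> = dg_comp B (dg_dual_hom B (FM p)) (dg_comp B (\<Phi> Y) (dg_comp B (FM \<phi>) (FM q)))"
    by (rule B.assoc0[OF b(1,5,7,6)])
       (use B.comp_Z0[OF b(1,2,5) FM_Z0[OF X(1,2) p(2)] FM_Z0[OF o(2,5) f]] \<Phi>_Z0[OF X(3)] B.dual_Z0[OF b(1,3) FM_Z0[OF X(1,3) p(1)]] B.Z0_in in auto)
  also have "dg_comp B (\<Phi> Y) (dg_comp B (FM \<phi>) (FM q)) = dg_comp B (dg_comp B (\<Phi> Y) (FM \<phi>)) (FM q)"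
    by (rule B.assoc0[OF b(1,2,5,7) B.Z0_in[OF FM_Z0[OF X(1,2) p(2)]] B.Z0_in[OF FM_Z0[OF o(2,5) f]] B.Z0_in[OF \<Phi>_Z0[OF X(3)]], symmetric])
  finally show "dg_comp B (\<Phi> S) (FM (pull_form A p \<phi> q)) = pull_form B (FM p) (dg_comp B (\<Phi> Y) (FM \<phi>)) (FM q)"
    unfolding pull_form_def .
qed

lemma \<Phi>F_add:
  assumes X: "X \<in> dg_ob A" and f: "\<phi> \<in> Z0_hom A X (dg_dual A X)" "\<psi> \<in> Z0_hom A X (dg_dual A X)"
  shows "dg_comp B (\<Phi> X) (FM (dg_add A \<phi> \<psi>)) = dg_add B (dg_comp B (\<Phi> X) (FM \<phi>)) (dg_comp B (\<Phi> X) (FM \<psi>))"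
proof -
  note o = X A.dual_ob[OF X]
  show ?thesis
    unfolding FM_add[OF o A.Z0_in[OF f(1)] A.Z0_in[OF f(2)]]
    by (rule B.comp_add_right[OF FO[OF X] FO[OF o(2)] B.dual_ob[OF FO[OF X]] B.Z0_in[OF FM_Z0[OF o f(1)]] B.Z0_in[OF FM_Z0[OF o f(2)]] B.Z0_in[OF \<Phi>_Z0[OF X]]])
qed

lemma F_sym: "x \<in> sym_spaces A W \<Longrightarrow> form_map B FO FM \<Phi> x \<in> sym_spaces B V"
  using \<Phi>F_adjoint \<Phi>F_Z0 \<Phi>F_V FO by (auto simp: sym_spaces_def form_map_def)

lemma F_biproduct:
  assumes "biproduct A X Y S i j p q"
  shows "biproduct B (FO X) (FO Y) (FO S) (FM i) (FM j) (FM p) (FM q)"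
proof -
  have o: "X \<in> dg_ob A" "Y \<in> dg_ob A" "S \<in> dg_ob A" and z: "i \<in> Z0_hom A X S" "j \<in> Z0_hom A Y S" "p \<in> Z0_hom A S X" "q \<in> Z0_hom A S Y"
    and e: "dg_comp A p i = dg_id A X" "dg_comp A q j = dg_id A Y" "dg_comp A q i = dg_zero A X Y 0" "dg_comp A p j = dg_zero A Y X 0"
     "dg_add A (dg_comp A i p) (dg_comp A j q) = dg_id A S"
    using assms by (auto simp: biproduct_def)
  have "dg_comp A i p \<in> dg_hom A S S 0" "dg_comp A j q \<in> dg_hom A S S 0"
    using A.comp_Z0[OF o(3,1,3) z(3,1)] A.comp_Z0[OF o(3,2,3) z(4,2)] by (auto intro: A.Z0_in)
  from FM_add[OF o(3,3) this] show ?thesis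
    unfolding biproduct_def
    using FM_comp0[OF o(1,3,1) z(1,3)] FM_comp0[OF o(2,3,2) z(2,4)] FM_comp0[OF o(1,3,2) z(1,4)] FM_comp0[OF o(2,3,1) z(2,3)]
      FM_comp0[OF o(3,1,3) z(3,1)] FM_comp0[OF o(3,2,3) z(4,2)]
    by (simp add: e FM_id FM_zero FO FM_Z0 o z)
qed

lemma F_relator:
  assumes "r \<in> gw_relators A W"
  shows "form_frag B FO FM \<Phi> r \<in> gw_relators B V"
  using assms
proof cases
  case (gw_sum X \<phi> Y \<psi> S i j p q \<omega>)
  have o: "X \<in> dg_ob A" "Y \<in> dg_ob A" "S \<in> dg_ob A" and z: "p \<in> Z0_hom A S X" "q \<in> Z0_hom A S Y"
    "\<phi> \<in> Z0_hom A X (dg_dual A X)" "\<psi> \<in> Z0_hom A Y (dg_dual A Y)"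
    using gw_sum by (auto simp: biproduct_def sym_spaces_def)
  have "dg_comp B (\<Phi> S) (FM \<omega>) = dg_add B (pull_form B (FM p) (dg_comp B (\<Phi> X) (FM \<phi>)) (FM p)) (pull_form B (FM q) (dg_comp B (\<Phi> Y) (FM \<psi>)) (FM q))"
    unfolding gw_sum(5) using \<Phi>F_add[OF o(3) \<Phi>F_pull(2)[OF o(3,1,1) z(3,1,1)] \<Phi>F_pull(2)[OF o(3,2,2) z(4,2,2)]]
      \<Phi>F_pull(1)[OF o(3,1,1) z(3,1,1)] \<Phi>F_pull(1)[OF o(3,2,2) z(4,2,2)] by simp
  from gw_relators.gw_sum[where W = V, OF _ _ F_biproduct[OF gw_sum(4)] this]
  show ?thesis using F_sym[OF gw_sum(2)] F_sym[OF gw_sum(3)] F_sym[OF gw_sum(6)]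
    by (simp add: gw_sum(1) form_map_def frag_extend_add frag_extend_diff)
next
  case (gw_isometry Y \<psi> X g)
  have o: "X \<in> dg_ob A" "Y \<in> dg_ob A" and z: "\<psi> \<in> Z0_hom A Y (dg_dual A Y)"
    using gw_isometry by (auto simp: sym_spaces_def)
  note e = \<Phi>F_pull(1)[OF o(1,2,2) z gw_isometry(4,4)]
  have "FM g \<in> V (FO X) (FO Y)" using gw_isometry(5) W_iff[OF o] by simp
  from gw_relators.gw_isometry[where W = V, OF _ FO[OF o(1)] FM_Z0[OF o gw_isometry(4)] this]
  show ?thesis using F_sym[OF gw_isometry(2)] F_sym[OF gw_isometry(6)]
    by (simp add: gw_isometry(1) form_map_def frag_extend_diff e)
next
  case (gw_exact Em f E0 g Ep \<phi>m \<phi>0 \<phi>p S i j p q \<omega>)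
  have o: "Em \<in> dg_ob A" "E0 \<in> dg_ob A" "Ep \<in> dg_ob A" "S \<in> dg_ob A" and fg: "f \<in> Z0_hom A Em E0" "g \<in> Z0_hom A E0 Ep"
    and z: "\<phi>m \<in> Z0_hom A Em (dg_dual A Ep)" "\<phi>0 \<in> Z0_hom A E0 (dg_dual A E0)" "\<phi>p \<in> Z0_hom A Ep (dg_dual A Em)"
    and sq: "dg_comp A \<phi>0 f = dg_comp A (dg_dual_hom A g) \<phi>m" "dg_comp A \<phi>p g = dg_comp A (dg_dual_hom A f) \<phi>0"
    and pq: "p \<in> Z0_hom A S Em" "q \<in> Z0_hom A S Ep"
    using gw_exact(2,3,10) by (auto simp: exact_seq_def exact_seq_map_def dual_seq_def biproduct_def)
  obtain r s where sp: "split_by A (Em, f, E0, g, Ep) r s" using gw_exact(2) by (auto simp: exact_seq_def)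
  \<comment> \<open>Both squares of the map of exact sequences have this shape: one side is an
    ordinary composite, the other passes through a dual. Naturality of \<open>\<Phi>\<close> moves
    the dual of \<open>l\<close> outside.\<close>
  have sq': "dg_comp B (dg_comp B (\<Phi> Z) (FM \<chi>)) (FM k) = dg_comp B (dg_dual_hom B (FM l)) (dg_comp B (\<Phi> Z') (FM \<chi>'))"
    if "X \<in> dg_ob A" "Y \<in> dg_ob A" "Z \<in> dg_ob A" "Z' \<in> dg_ob A" "\<chi> \<in> Z0_hom A Y (dg_dual A Z)" "\<chi>' \<in> Z0_hom A X (dg_dual A Z')"
      "k \<in> Z0_hom A X Y" "l \<in> Z0_hom A Z Z'" "dg_comp A \<chi> k = dg_comp A (dg_dual_hom A l) \<chi>'" for X Y Z Z' \<chi> \<chi>' k l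
  proof -
    note o' = that(1-4) A.dual_ob[OF that(3)] A.dual_ob[OF that(4)]
    note b = o'[THEN FO] B.dual_ob[OF FO[OF that(3)]] B.dual_ob[OF FO[OF that(4)]]
    note h = B.Z0_in[OF FM_Z0[OF o'(2,5) that(5)]] B.Z0_in[OF FM_Z0[OF o'(1,6) that(6)]] B.Z0_in[OF FM_Z0[OF o'(1,2) that(7)]]
      B.Z0_in[OF FM_Z0[OF o'(3,4) that(8)]] B.Z0_in[OF \<Phi>_Z0[OF that(3)]] B.Z0_in[OF \<Phi>_Z0[OF that(4)]]
      B.Z0_in[OF FM_Z0[OF o'(6,5) A.dual_Z0[OF o'(3,4) that(8)]]]
    have "dg_comp B (dg_comp B (\<Phi> Z) (FM \<chi>)) (FM k) = dg_comp B (\<Phi> Z) (dg_comp B (FM \<chi>) (FM k))"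
      by (rule B.assoc0[OF b(1,2,5,7) h(3,1,5)])
    also have "dg_comp B (FM \<chi>) (FM k) = dg_comp B (FM (dg_dual_hom A l)) (FM \<chi>')"
      using FM_comp0[OF o'(1,2,5) that(7,5)] FM_comp0[OF o'(1,6,5) that(6) A.dual_Z0[OF o'(3,4) that(8)]] that(9) by simp
    also have "dg_comp B (\<Phi> Z) \<dots> = dg_comp B (dg_comp B (\<Phi> Z) (FM (dg_dual_hom A l))) (FM \<chi>')"
      by (rule B.assoc0[OF b(1,6,5,7) h(2,7,5), symmetric])
    also have "\<dots> = dg_comp B (dg_comp B (dg_dual_hom B (FM l)) (\<Phi> Z')) (FM \<chi>')"
      by (simp add: \<Phi>_nat[OF that(3,4) A.Z0_in[OF that(8)]])
    also have "\<dots> = dg_comp B (dg_dual_hom B (FM l)) (dg_comp B (\<Phi> Z') (FM \<chi>'))"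
      by (rule B.assoc0[OF b(1,6,8,7) h(2,6) B.dual_in[OF b(3,4) h(4)]])
    finally show ?thesis .
  qed
  have map: "exact_seq_map B (FO Em, FM f, FO E0, FM g, FO Ep) (dual_seq B (FO Em, FM f, FO E0, FM g, FO Ep))
      (dg_comp B (\<Phi> Ep) (FM \<phi>m), dg_comp B (\<Phi> E0) (FM \<phi>0), dg_comp B (\<Phi> Em) (FM \<phi>p))"
    unfolding exact_seq_map_def dual_seq_def
    using sq'[OF o(1,2,2,3) z(2,1) fg sq(1)] sq'[OF o(2,3,1,2) z(3,2) fg(2,1) sq(2)]
    by (simp add: \<Phi>F_Z0 o z)
  have e: "dg_comp B (\<Phi> Ep) (FM \<phi>m) = dg_comp B (dg_dual_hom B (dg_comp B (\<Phi> Em) (FM \<phi>p))) (dg_can B (FO Em))"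
    "dg_comp B (\<Phi> E0) (FM \<phi>0) = dg_comp B (dg_dual_hom B (dg_comp B (\<Phi> E0) (FM \<phi>0))) (dg_can B (FO E0))"
    "dg_comp B (\<Phi> Em) (FM \<phi>p) = dg_comp B (dg_dual_hom B (dg_comp B (\<Phi> Ep) (FM \<phi>m))) (dg_can B (FO Ep))"
    unfolding \<Phi>F_adjoint[OF o(3,1) z(3)] \<Phi>F_adjoint[OF o(2,2) z(2)] \<Phi>F_adjoint[OF o(1,3) z(1)]
    by (rule arg_cong[OF gw_exact(7)] arg_cong[OF gw_exact(8)] arg_cong[OF gw_exact(9)])+
  have "dg_comp B (\<Phi> S) (FM \<omega>) = dg_add B (pull_form B (FM p) (dg_comp B (\<Phi> Em) (FM \<phi>p)) (FM q)) (pull_form B (FM q) (dg_comp B (\<Phi> Ep) (FM \<phi>m)) (FM p))"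
    unfolding gw_exact(11) using \<Phi>F_add[OF o(4) \<Phi>F_pull(2)[OF o(4,3,1) z(3) pq] \<Phi>F_pull(2)[OF o(4,1,3) z(1) pq(2,1)]]
      \<Phi>F_pull(1)[OF o(4,3,1) z(3) pq] \<Phi>F_pull(1)[OF o(4,1,3) z(1) pq(2,1)] by simp
  from gw_relators.gw_exact[where W = V, OF F_exact_split(1)[OF gw_exact(2) sp] map \<Phi>F_V[OF o(1,3) gw_exact(4)] \<Phi>F_V[OF o(2,2) gw_exact(5)]
      \<Phi>F_V[OF o(3,1) gw_exact(6)] e F_biproduct[OF gw_exact(10)] this]
  show ?thesis using F_sym[OF gw_exact(12)]
    by (simp add: gw_exact(1) form_map_def frag_extend_diff)
qed

lemma F_GW0_induced: "\<exists>h. GW0_induced A W B V FO FM \<Phi> h"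
  by (rule GW0_induced_exists[OF F_sym F_relator])

end

section \<open>The dg category of bounded free complexes\<close>

lemma mat_assoc: "dim_col A = dim_row B \<Longrightarrow> dim_col B = dim_row C \<Longrightarrow> A * B * C = A * (B * (C :: 'a::semiring_0 mat))"
  by (rule assoc_mult_mat[OF carrier_matI[OF refl refl] carrier_matI carrier_matI]) auto

lemma mat_distrib:
  "dim_row B = dim_col A \<Longrightarrow> dim_row C = dim_col A \<Longrightarrow> dim_col B = dim_col C \<Longrightarrow> A * (B + C) = A * B + A * (C :: 'a::semiring_0 mat)"
  "dim_row B = dim_row A \<Longrightarrow> dim_col B = dim_col A \<Longrightarrow> dim_row C = dim_col A \<Longrightarrow> (A + B) * C = A * C + B * (C :: 'a::semiring_0 mat)"
  by (auto intro!: eq_matI simp: scalar_prod_def sum.distrib algebra_simps)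

lemma mat_distrib_diff:
  "dim_row B = dim_col A \<Longrightarrow> dim_row C = dim_col A \<Longrightarrow> dim_col B = dim_col C \<Longrightarrow> A * (B - C) = A * B - A * (C :: 'a::{comm_ring, comm_monoid_mult} mat)"
  "dim_row B = dim_row A \<Longrightarrow> dim_col B = dim_col A \<Longrightarrow> dim_row C = dim_col A \<Longrightarrow> (A - B) * C = A * C - B * (C :: 'a::{comm_ring, comm_monoid_mult} mat)"
  by (auto intro!: eq_matI simp: scalar_prod_def sum_subtractf algebra_simps)

lemma mat_transpose_mult:
  "dim_col A = dim_row B \<Longrightarrow> transpose_mat (A * B) = transpose_mat B * transpose_mat (A :: 'a::comm_semiring_0 mat)"
  by (rule transpose_mult[OF carrier_matI[OF refl refl] carrier_matI]) auto

lemma mat_eq_if_diff_zero: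
  assumes "A - B = 0\<^sub>m n k" "dim_row A = n" "dim_col A = k" "dim_row B = n" "dim_col B = (k::nat)"
  shows "A = (B :: 'a::{comm_ring, comm_monoid_mult} mat)"
proof (rule eq_matI)
  fix i j assume "i < dim_row B" "j < dim_col B"
  then have "A $$ (i, j) - B $$ (i, j) = (A - B) $$ (i, j)" "i < n" "j < k" using assms(4,5) by simp_all
  then show "A $$ (i, j) = B $$ (i, j)" by (simp only: assms(1)) simp
qed (use assms in auto)

lemma Cpx_sel:
  "dg_ob (Cpx m) = {X. is_cpx X}"
  "dg_hom (Cpx m) X Y n = {(n, f) | f. \<forall>i. f i \<in> carrier_mat (rk Y (i + n)) (rk X i)}"
  "dg_zero (Cpx m) X Y n = (n, \<lambda>i. 0\<^sub>m (rk Y (i + n)) (rk X i))"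
  "dg_add (Cpx m) (n, f) (k, g) = (n, \<lambda>i. f i + g i)"
  "dg_d (Cpx m) X Y (n, f) = (n + 1, \<lambda>i. df Y (i + n) * f i - ksign n \<cdot>\<^sub>m (f (i + 1) * df X i))"
  "dg_comp (Cpx m) (k, g) (n, f) = (k + n, \<lambda>i. g (i + n) * f i)"
  "dg_id (Cpx m) X = (0, \<lambda>i. 1\<^sub>m (rk X i))"
  "dg_shift (Cpx m) = shift_cpx"
  "dg_shift_hom (Cpx m) (n, f) = (n, \<lambda>i. ksign n \<cdot>\<^sub>m f (i + 1))"
  "dg_sus (Cpx m) X = (- 1, \<lambda>i. 1\<^sub>m (rk X i))"
  "dg_dual (Cpx m) = dual_cpx m"
  "dg_dual_hom (Cpx m) (n, f) = (n, \<lambda>j. ksign (n * j) \<cdot>\<^sub>m transpose_mat (f (- m - j - n)))"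
  "dg_can (Cpx m) X = (0, \<lambda>i. ksign (i * (- m - i)) \<cdot>\<^sub>m 1\<^sub>m (rk X i))"
  by (simp_all add: Cpx_def)

lemma Cpx_homE:
  assumes "f \<in> dg_hom (Cpx m) X Y n"
  obtains f' where "f = (n, f')" "\<And>i. dim_row (f' i) = rk Y (i + n)" "\<And>i. dim_col (f' i) = rk X i"
  using assms by (auto simp: Cpx_sel)

definition chain_map :: "'a::{comm_ring, comm_monoid_mult} cpx \<Rightarrow> 'a cpx \<Rightarrow> (int \<Rightarrow> 'a mat) \<Rightarrow> bool" where
  "chain_map X Y f \<longleftrightarrow> (\<forall>i. f i \<in> carrier_mat (rk Y i) (rk X i)) \<and> (\<forall>i. df Y i * f i = f (i + 1) * df X i)"

lemma ksign_0 [simp]: "ksign 0 = 1" by (simp add: ksign_def)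
lemma ksign_square [simp]: "ksign i * ksign i = 1" by (simp add: ksign_def)
lemma ksign_add: "ksign (i + j) = ksign i * ksign j" by (simp add: ksign_def)
lemma ksign_uminus [simp]: "ksign (- i) = ksign i" by (simp add: ksign_def)
lemma ksign_1 [simp]: "ksign 1 = - 1" by (simp add: ksign_def)

lemma chain_map_simps:
  assumes "chain_map X Y f"
  shows "dim_row (f i) = rk Y i" "dim_col (f i) = rk X i" "df Y i * f i = f (i + 1) * df X i"
  using assms by (auto simp: chain_map_def)

lemma Cpx_Z0:
  assumes "is_cpx X" "is_cpx Y"
  shows "h \<in> Z0_hom (Cpx m) X Y \<longleftrightarrow> fst h = 0 \<and> chain_map X Y (snd h)"
proof -
  obtain n f where h: "h = (n, f)" by (cases h)
  note s = is_cpx_simps[OF assms(1)] is_cpx_simps[OF assms(2)]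
  have "df Y i * f i - f (i + 1) * df X i = 0\<^sub>m (rk Y (i + 1)) (rk X i) \<longleftrightarrow> df Y i * f i = f (i + 1) * df X i"
    if "\<forall>i. f i \<in> carrier_mat (rk Y i) (rk X i)" for i
    using that carrier_matD[OF that[rule_format]] s
    by (auto intro: mat_minus_cancel mat_eq_if_diff_zero)
  then show ?thesis
    by (auto simp: h Z0_hom_def Cpx_sel chain_map_def mat_simps fun_eq_iff)
qed

lemma is_cpx_dual:
  assumes "is_cpx X" shows "is_cpx (dual_cpx m X)"
proof -
  note s = is_cpx_simps[OF assms]
  have "finite {j. rk X (- m - j) \<noteq> 0}"
    using finite_vimageI[OF s(4), of "\<lambda>j. - m - j"] by (auto simp: vimage_def inj_def)
  moreover have "df (dual_cpx m X) j \<in> carrier_mat (rk (dual_cpx m X) (j + 1)) (rk (dual_cpx m X) j)" for j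
  proof -
    have "- m - (j + 1) = - m - j - 1" "- m - j - 1 + 1 = - m - j" by simp_all
    then show ?thesis by (intro carrier_matI) (simp_all only: dual_cpx_def cpx.simps index_smult_mat index_transpose_mat s)
  qed
  moreover have "df (dual_cpx m X) (j + 1) * df (dual_cpx m X) j = 0\<^sub>m (rk (dual_cpx m X) (j + 2)) (rk (dual_cpx m X) j)" for j
  proof -
    \<comment> \<open>With this index the two differentials of the dual are, up to sign, the
      transposes of the consecutive \<open>df X (i + 1)\<close> and \<open>df X i\<close>.\<close>
    define i where "i = - m - j - 2"
    have i: "- m - (j + 1) - 1 = i" "- m - j - 1 = i + 1" "- m - (j + 2) = i" "- m - j = i + 2" by (auto simp: i_def)
    have "transpose_mat (df X i) * transpose_mat (df X (i + 1)) = 0\<^sub>m (rk X i) (rk X (i + 2))"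
      by (subst mat_transpose_mult[symmetric]) (auto simp: s intro!: eq_matI)
    then show ?thesis by (simp add: dual_cpx_def i smult_mult s idx idx')
  qed
  ultimately show ?thesis unfolding is_cpx_def by (simp add: dual_cpx_def)
qed

lemma Cpx_dg_category: "dg_category (Cpx m :: ('a::{comm_ring, comm_monoid_mult} cpx, 'a gmap) dgcat)"
proof (unfold_locales, goal_cases)
  case (1 X)
  then show ?case by (auto simp: Cpx_Z0 Cpx_sel chain_map_def is_cpx_simps mat_simps)
next
  case (2 X Y Z f n g k)
  then obtain f' g' where *: "f = (n, f')" "g = (k, g')"
     "\<And>i. f' i \<in> carrier_mat (rk Y (i + n)) (rk X i)" "\<And>i. g' i \<in> carrier_mat (rk Z (i + k)) (rk Y i)"
    by (auto simp: Cpx_sel)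
  have "g' (i + n) * f' i \<in> carrier_mat (rk Z (i + (k + n))) (rk X i)" for i
    using mult_carrier_mat[OF *(4)[of "i + n"] *(3)[of i]] by (simp add: algebra_simps)
  then show ?case by (simp add: * Cpx_sel)
next
  case (3 X Y Z f g)
  then obtain f' g' where fg: "f = (0, f')" "g = (0, g')" "chain_map X Y f'" "chain_map Y Z g'"
    by (cases f, cases g) (auto simp: Cpx_sel Cpx_Z0)
  note s = chain_map_simps[OF fg(3)] chain_map_simps[OF fg(4)] 3(1-3)[unfolded Cpx_sel mem_Collect_eq, THEN is_cpx_simps(1)]
     3(1-3)[unfolded Cpx_sel mem_Collect_eq, THEN is_cpx_simps(2)]
  have "df Z i * (g' i * f' i) = g' (i + 1) * f' (i + 1) * df X i" for i
  proof -
    have "df Z i * (g' i * f' i) = df Z i * g' i * f' i" by (rule mat_assoc[symmetric]) (simp_all add: s)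
    also have "\<dots> = g' (i + 1) * (df Y i * f' i)" unfolding s(6) by (rule mat_assoc) (simp_all add: s)
    also have "\<dots> = g' (i + 1) * f' (i + 1) * df X i" unfolding s(3) by (rule mat_assoc[symmetric]) (simp_all add: s)
    finally show ?thesis .
  qed
  then show ?case using 3 by (auto simp: Cpx_Z0 fg Cpx_sel chain_map_def s intro!: carrier_matI)
next
  case (4 X Y Z U f n g k h l)
  then obtain f' g' h' where *: "f = (n, f')" "g = (k, g')" "h = (l, h')"
     "\<And>i. f' i \<in> carrier_mat (rk Y (i + n)) (rk X i)" "\<And>i. g' i \<in> carrier_mat (rk Z (i + k)) (rk Y i)"
     "\<And>i. h' i \<in> carrier_mat (rk U (i + l)) (rk Z i)"
    by (auto simp: Cpx_sel)
  have "h' (i + n + k) * g' (i + n) * f' i = h' (i + n + k) * (g' (i + n) * f' i)" for i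
    by (rule mat_assoc) (use *(4)[of i] *(5)[of "i + n"] *(6)[of "i + n + k"] in auto)
  then show ?case by (simp add: * Cpx_sel algebra_simps)
next
  case (5 X Y f n)
  then obtain f' where *: "f = (n, f')" "\<And>i. f' i \<in> carrier_mat (rk Y (i + n)) (rk X i)" by (auto simp: Cpx_sel)
  show ?case by (simp add: * Cpx_sel one_mult carrier_matD(1)[OF *(2)])
next
  case (6 X Y f n)
  then obtain f' where *: "f = (n, f')" "\<And>i. f' i \<in> carrier_mat (rk Y (i + n)) (rk X i)" by (auto simp: Cpx_sel)
  show ?case by (simp add: * Cpx_sel mult_one carrier_matD(2)[OF *(2)])
next
  case (7 X Y Z f n f' g k)
  obtain u where u: "f = (n, u)" "\<And>i. dim_row (u i) = rk Y (i + n)" "\<And>i. dim_col (u i) = rk X i" using 7(4) by (rule Cpx_homE) blast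
  obtain v where v: "f' = (n, v)" "\<And>i. dim_row (v i) = rk Y (i + n)" "\<And>i. dim_col (v i) = rk X i" using 7(5) by (rule Cpx_homE) blast
  obtain w where w: "g = (k, w)" "\<And>i. dim_row (w i) = rk Z (i + k)" "\<And>i. dim_col (w i) = rk Y i" using 7(6) by (rule Cpx_homE) blast
  show ?case by (simp add: u v w Cpx_sel mat_distrib)
next
  case (8 X Y Z g)
  obtain w where w: "g = (0, w)" "\<And>i. dim_row (w i) = rk Z (i + 0)" "\<And>i. dim_col (w i) = rk Y i" using 8(4) by (rule Cpx_homE) blast
  show ?case by (simp add: w Cpx_sel mult_zero)
next
  case (9 X)
  then show ?case by (simp add: Cpx_sel is_cpx_dual)
next
  case (10 X Y f)
  then obtain f' where f: "f = (0, f')" "chain_map X Y f'" by (cases f) (auto simp: Cpx_sel Cpx_Z0)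
  note o = 10(1,2)[unfolded Cpx_sel mem_Collect_eq]
  note s = chain_map_simps[OF f(2)] is_cpx_simps(1,2)[OF o(1)] is_cpx_simps(1,2)[OF o(2)]
  have "transpose_mat (df X (- m - i - 1)) * transpose_mat (f' (- m - i)) =
     transpose_mat (f' (- m - i - 1)) * transpose_mat (df Y (- m - i - 1))" for i
    using arg_cong[OF s(3)[of "- m - i - 1"], of transpose_mat] by (simp add: mat_transpose_mult s(1,2,4-7))
  note 1 = this
  have j: "- m - (i + 1) = - m - i - 1" "- m - i - 1 + 1 = - m - i" for i by simp_all
  have "chain_map (dual_cpx m Y) (dual_cpx m X) (\<lambda>j. transpose_mat (f' (- m - j)))"
    unfolding chain_map_def by (simp add: dual_cpx_def smult_mult s(1,2,4-7) carrier_matI j 1)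
  then show ?case using o by (simp add: f Cpx_sel Cpx_Z0 is_cpx_dual minus_mats)
next
  case (11 X Y f)
  then show ?case by (auto simp: Cpx_sel dual_cpx_def mat_simps)
next
  case (12 X Y Z f g)
  obtain u where u: "f = (0, u)" "\<And>i. dim_row (u i) = rk Y (i + 0)" "\<And>i. dim_col (u i) = rk X i" using 12(4) by (rule Cpx_homE) blast
  obtain w where w: "g = (0, w)" "\<And>i. dim_row (w i) = rk Z (i + 0)" "\<And>i. dim_col (w i) = rk Y i" using 12(5) by (rule Cpx_homE) blast
  show ?case by (simp add: u w Cpx_sel mat_simps mat_transpose_mult)
next
  case (13 X)
  then show ?case by (auto simp: Cpx_sel Cpx_Z0 is_cpx_dual) (auto simp: chain_map_def dual_cpx_def smult_mult mat_simps is_cpx_simps algebra_simps ksign_def)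
next
  case (14 X Y f)
  obtain u where u: "f = (0, u)" "\<And>i. dim_row (u i) = rk Y (i + 0)" "\<And>i. dim_col (u i) = rk X i" using 14(3) by (rule Cpx_homE) blast
  show ?case by (simp add: u Cpx_sel mat_simps smult_mult)
next
  case (15 X)
  then show ?case by (simp add: Cpx_sel is_cpx_shift)
next
  case (16 X Y f)
  then obtain f' where f: "f = (0, f')" "chain_map X Y f'" by (cases f) (auto simp: Cpx_sel Cpx_Z0)
  note o = 16(1,2)[unfolded Cpx_sel mem_Collect_eq]
  note s = chain_map_simps[OF f(2)] is_cpx_simps(1,2)[OF o(1)] is_cpx_simps(1,2)[OF o(2)]
  have "chain_map (shift_cpx X) (shift_cpx Y) (\<lambda>i. f' (i + 1))"
    by (simp add: chain_map_def shift_cpx_def s uminus_mult carrier_matI)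
  then show ?case using o by (simp add: f Cpx_sel Cpx_Z0 is_cpx_shift minus_mats)
next
  case (17 X Y f)
  obtain u where u: "f = (0, u)" "\<And>i. dim_row (u i) = rk Y (i + 0)" "\<And>i. dim_col (u i) = rk X i" using 17(3) by (rule Cpx_homE) blast
  show ?case by (auto simp: u Cpx_sel shift_cpx_def mat_simps intro!: carrier_matI)
next
  case (18 X Y Z f g)
  then show ?case by (auto simp: Cpx_sel mat_simps)
next
  case (19 X)
  then show ?case by (simp add: Cpx_sel shift_cpx_def mat_simps)
next
  case (20 X)
  then show ?case by (simp add: Cpx_sel shift_cpx_def)
next
  case (21 X Y f)
  obtain u where u: "f = (0, u)" "\<And>i. dim_row (u i) = rk Y (i + 0)" "\<And>i. dim_col (u i) = rk X i" using 21(3) by (rule Cpx_homE) blast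
  show ?case by (simp add: u Cpx_sel mat_simps)
qed

section \<open>Quasi-isomorphisms and homotopy equivalences\<close>

lemma mv_assoc: "dim_col A = dim_row B \<Longrightarrow> dim_col B = dim_vec v \<Longrightarrow> A * B *\<^sub>v v = A *\<^sub>v (B *\<^sub>v (v :: 'a::semiring_0 vec))"
  by (rule assoc_mult_mat_vec) (auto intro: carrier_matI carrier_vecI)

lemma mv_distrib:
  fixes v w :: "'a::{comm_ring, comm_monoid_mult} vec"
  shows "dim_col A = dim_vec v \<Longrightarrow> dim_col A = dim_vec w \<Longrightarrow> A *\<^sub>v (v + w) = A *\<^sub>v v + A *\<^sub>v w"
    "dim_col A = dim_vec v \<Longrightarrow> dim_col A = dim_vec w \<Longrightarrow> A *\<^sub>v (v - w) = A *\<^sub>v v - A *\<^sub>v w"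
    "dim_row A = dim_row B \<Longrightarrow> dim_col A = dim_vec v \<Longrightarrow> dim_col B = dim_vec v \<Longrightarrow> (A + B) *\<^sub>v v = A *\<^sub>v v + B *\<^sub>v v"
    "dim_col A = dim_vec v \<Longrightarrow> A *\<^sub>v (- v) = - (A *\<^sub>v v)"
    "dim_col A = dim_vec v \<Longrightarrow> - A *\<^sub>v v = - (A *\<^sub>v v)"
    "dim_vec v = n \<Longrightarrow> 1\<^sub>m n *\<^sub>v v = v"
    "dim_vec v = n \<Longrightarrow> 0\<^sub>m k n *\<^sub>v v = 0\<^sub>v k"
    "dim_col A = n \<Longrightarrow> A *\<^sub>v 0\<^sub>v n = (0\<^sub>v (dim_row A) :: 'a vec)"
proof -
  show "dim_col A = dim_vec v \<Longrightarrow> dim_col A = dim_vec w \<Longrightarrow> A *\<^sub>v (v + w) = A *\<^sub>v v + A *\<^sub>v w"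
    by (rule mult_add_distrib_mat_vec[OF carrier_matI[OF refl refl]]) (auto intro: carrier_vecI)
  show "dim_col A = dim_vec v \<Longrightarrow> dim_col A = dim_vec w \<Longrightarrow> A *\<^sub>v (v - w) = A *\<^sub>v v - A *\<^sub>v w"
    by (rule mult_minus_distrib_mat_vec[OF carrier_matI[OF refl refl]]) (auto intro: carrier_vecI)
  show "dim_row A = dim_row B \<Longrightarrow> dim_col A = dim_vec v \<Longrightarrow> dim_col B = dim_vec v \<Longrightarrow> (A + B) *\<^sub>v v = A *\<^sub>v v + B *\<^sub>v v"
    by (rule add_mult_distrib_mat_vec[OF carrier_matI[OF refl refl]]) (auto intro: carrier_vecI carrier_matI)
  show "dim_col A = dim_vec v \<Longrightarrow> A *\<^sub>v (- v) = - (A *\<^sub>v v)" by (intro eq_vecI) (simp_all add: scalar_prod_def sum_negf)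
  show "dim_col A = dim_vec v \<Longrightarrow> - A *\<^sub>v v = - (A *\<^sub>v v)" by (intro eq_vecI) (simp_all add: scalar_prod_def sum_negf)
  show "dim_vec v = n \<Longrightarrow> 1\<^sub>m n *\<^sub>v v = v"
  proof (intro eq_vecI)
    fix i assume i: "dim_vec v = n" "i < dim_vec v"
    have "(\<Sum>j = 0..<n. (if i = j then 1 else 0) * v $ j) = (\<Sum>j = 0..<n. if i = j then v $ j else 0)"
      by (intro sum.cong) auto
    with i show "(1\<^sub>m n *\<^sub>v v) $ i = v $ i" by (simp add: scalar_prod_def)
  qed simp
  show "dim_vec v = n \<Longrightarrow> 0\<^sub>m k n *\<^sub>v v = 0\<^sub>v k" by (intro eq_vecI) (simp_all add: scalar_prod_def)
  show "dim_col A = n \<Longrightarrow> A *\<^sub>v 0\<^sub>v n = (0\<^sub>v (dim_row A) :: 'a vec)" by (intro eq_vecI) (simp_all add: scalar_prod_def)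
qed

section \<open>Cocycles and coboundaries under chain maps\<close>

lemma in_coboundaries_iff: "x \<in> coboundaries X n \<longleftrightarrow> (\<exists>z. dim_vec z = rk X (n - 1) \<and> x = df X (n - 1) *\<^sub>v z)"
  unfolding coboundaries_def image_iff Bex_def carrier_dim_vec by blast

lemma in_cocycles_iff: "x \<in> cocycles X n \<longleftrightarrow> dim_vec x = rk X n \<and> df X n *\<^sub>v x = 0\<^sub>v (rk X (n + 1))"
  unfolding cocycles_def mem_Collect_eq carrier_dim_vec ..

lemma coboundaries_add:
  assumes "is_cpx X" "x \<in> coboundaries X n" "y \<in> coboundaries X n" shows "x + y \<in> coboundaries X n"
proof -
  from assms obtain z w where "dim_vec z = rk X (n - 1)" "x = df X (n - 1) *\<^sub>v z" "dim_vec w = rk X (n - 1)" "y = df X (n - 1) *\<^sub>v w"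
    by (auto simp: in_coboundaries_iff)
  then show ?thesis unfolding in_coboundaries_iff
    by (intro exI[of _ "z + w"]) (simp add: mv_distrib is_cpx_simps[OF assms(1)])
qed

lemma coboundaries_uminus:
  assumes "is_cpx X" "x \<in> coboundaries X n" shows "- x \<in> coboundaries X n"
proof -
  from assms obtain z where "dim_vec z = rk X (n - 1)" "x = df X (n - 1) *\<^sub>v z" by (auto simp: in_coboundaries_iff)
  then show ?thesis unfolding in_coboundaries_iff
    by (intro exI[of _ "- z"]) (simp add: mv_distrib is_cpx_simps[OF assms(1)])
qed

lemma coboundaries_zero:
  assumes "is_cpx X" shows "0\<^sub>v (rk X n) \<in> coboundaries X n"
  unfolding in_coboundaries_iff using is_cpx_simps(1)[OF assms, of "n - 1"]
  by (intro exI[of _ "0\<^sub>v (rk X (n - 1))"]) (simp add: mv_distrib is_cpx_simps[OF assms])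

lemma chain_map_coboundaries:
  assumes "chain_map X Y f" "is_cpx X" "is_cpx Y" "x \<in> coboundaries X n" shows "f n *\<^sub>v x \<in> coboundaries Y n"
proof -
  from assms obtain z where z: "dim_vec z = rk X (n - 1)" "x = df X (n - 1) *\<^sub>v z" by (auto simp: in_coboundaries_iff)
  note s = chain_map_simps(1,2)[OF assms(1)] is_cpx_simps(1,2)[OF assms(2)] is_cpx_simps(1,2)[OF assms(3)]
  have "f n *\<^sub>v x = (f (n - 1 + 1) * df X (n - 1)) *\<^sub>v z" unfolding z(2) by (subst mv_assoc) (simp_all add: s z(1))
  also have "\<dots> = df Y (n - 1) *\<^sub>v (f (n - 1) *\<^sub>v z)"
    unfolding chain_map_simps(3)[OF assms(1), symmetric] by (rule mv_assoc) (simp_all add: s z(1))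
  finally show ?thesis unfolding in_coboundaries_iff by (intro exI[of _ "f (n - 1) *\<^sub>v z"]) (simp add: s)
qed

lemma chain_map_cocycles:
  assumes "chain_map X Y f" "is_cpx X" "is_cpx Y" "x \<in> cocycles X n" shows "f n *\<^sub>v x \<in> cocycles Y n"
proof -
  note s = chain_map_simps(1,2)[OF assms(1)] is_cpx_simps(1,2)[OF assms(2)] is_cpx_simps(1,2)[OF assms(3)]
  have x: "dim_vec x = rk X n" "df X n *\<^sub>v x = 0\<^sub>v (rk X (n + 1))" using assms(4) by (auto simp: in_cocycles_iff)
  have "df Y n *\<^sub>v (f n *\<^sub>v x) = (f (n + 1) * df X n) *\<^sub>v x"
    unfolding chain_map_simps(3)[OF assms(1), symmetric] by (rule mv_assoc[symmetric]) (simp_all add: s x(1))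
  also have "\<dots> = f (n + 1) *\<^sub>v (df X n *\<^sub>v x)" by (rule mv_assoc) (simp_all add: s x(1))
  also have "\<dots> = 0\<^sub>v (rk Y (n + 1))" unfolding x(2) by (simp add: mv_distrib s)
  finally show ?thesis by (simp add: in_cocycles_iff s)
qed

lemma equiv_cohomologous:
  assumes "is_cpx X" shows "equiv (cocycles X n) (cohomologous X n)"
proof (rule equivI)
  show "cohomologous X n \<subseteq> cocycles X n \<times> cocycles X n" by (auto simp: cohomologous_def)
  show "refl_on (cocycles X n) (cohomologous X n)"
  proof (rule refl_onI)
    fix x assume x: "x \<in> cocycles X n"
    then have "x - x = 0\<^sub>v (rk X n)" by (auto simp: in_cocycles_iff intro!: eq_vecI)
    with x show "(x, x) \<in> cohomologous X n" using coboundaries_zero[OF assms, of n] by (simp add: cohomologous_def)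
  qed
  show "sym (cohomologous X n)"
  proof (rule symI)
    fix x y assume "(x, y) \<in> cohomologous X n"
    then have *: "x \<in> cocycles X n" "y \<in> cocycles X n" "x - y \<in> coboundaries X n" by (auto simp: cohomologous_def)
    then have "y - x = - (x - y)" by (auto simp: in_cocycles_iff intro!: eq_vecI)
    with * coboundaries_uminus[OF assms *(3)] show "(y, x) \<in> cohomologous X n" by (simp add: cohomologous_def)
  qed
  show "trans (cohomologous X n)"
  proof (rule transI)
    fix x y z assume "(x, y) \<in> cohomologous X n" "(y, z) \<in> cohomologous X n"
    then have *: "x \<in> cocycles X n" "y \<in> cocycles X n" "z \<in> cocycles X n" "x - y \<in> coboundaries X n" "y - z \<in> coboundaries X n"
      by (auto simp: cohomologous_def)
    then have "x - z = (x - y) + (y - z)" by (auto simp: in_cocycles_iff intro!: eq_vecI)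
    with * coboundaries_add[OF assms *(4,5)] show "(x, z) \<in> cohomologous X n" by (simp add: cohomologous_def)
  qed
qed

definition quis_inj :: "'a::{comm_ring, comm_monoid_mult} cpx \<Rightarrow> 'a cpx \<Rightarrow> (int \<Rightarrow> 'a mat) \<Rightarrow> bool" where
  "quis_inj X Y f \<longleftrightarrow> (\<forall>n. \<forall>x \<in> cocycles X n. f n *\<^sub>v x \<in> coboundaries Y n \<longrightarrow> x \<in> coboundaries X n)"

definition quis_surj :: "'a::{comm_ring, comm_monoid_mult} cpx \<Rightarrow> 'a cpx \<Rightarrow> (int \<Rightarrow> 'a mat) \<Rightarrow> bool" where
  "quis_surj X Y f \<longleftrightarrow> (\<forall>n. \<forall>y \<in> cocycles Y n. \<exists>x \<in> cocycles X n. f n *\<^sub>v x - y \<in> coboundaries Y n)"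

lemma cocycles_minus:
  assumes "is_cpx X" "x \<in> cocycles X n" "y \<in> cocycles X n" shows "x - y \<in> cocycles X n"
  using assms by (auto simp: in_cocycles_iff mv_distrib is_cpx_simps)

text \<open>The map on classes is additive, so injectivity amounts to a trivial kernel. This turns
  both conditions into statements about vectors, the form in which all later arguments use
  quasi-isomorphisms.\<close>

lemma quis_iff:
  assumes X: "is_cpx X" and Y: "is_cpx Y"
  shows "h \<in> quis X Y \<longleftrightarrow> fst h = 0 \<and> chain_map X Y (snd h) \<and> quis_inj X Y (snd h) \<and> quis_surj X Y (snd h)"
proof -
  obtain k f where h: "h = (k, f)" by (cases h)
  have "(\<forall>n. bij_betw (cohomology_map Y h n) (cohomology X n) (cohomology Y n)) \<longleftrightarrow> quis_inj X Y f \<and> quis_surj X Y f"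
    if f: "chain_map X Y f"
  proof -
    note eX = equiv_cohomologous[OF X] and eY = equiv_cohomologous[OF Y]
    let ?cX = "\<lambda>n x. cohomologous X n `` {x}" and ?cY = "\<lambda>n x. cohomologous Y n `` {x}"
    note d = chain_map_simps(1,2)[OF f]
    have diff: "f n *\<^sub>v (x - y) = f n *\<^sub>v x - f n *\<^sub>v y" if "x \<in> cocycles X n" "y \<in> cocycles X n" for n x y
      using that by (intro mv_distrib) (auto simp: in_cocycles_iff d)
    have cm: "cohomology_map Y h n (?cX n x) = ?cY n (f n *\<^sub>v x)" if x: "x \<in> cocycles X n" for n x
    proof -
      have r: "(f n *\<^sub>v x, f n *\<^sub>v y) \<in> cohomologous Y n" if "(x, y) \<in> cohomologous X n" for y
        using that chain_map_cocycles[OF f X Y] chain_map_coboundaries[OF f X Y, of "x - y" n] diff[of x n y]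
        by (simp add: cohomologous_def)
      have "(x, x) \<in> cohomologous X n" using x eX[of n] by (simp add: equiv_def refl_on_def)
      then have "cohomology_map Y h n (?cX n x) = (\<Union>y\<in>?cX n x. ?cY n (f n *\<^sub>v y))" unfolding cohomology_map_def h by auto
      also have "\<dots> = (\<Union>y\<in>?cX n x. ?cY n (f n *\<^sub>v x))"
        by (intro SUP_cong refl equiv_class_eq[OF eY, symmetric]) (use r in auto)
      also have "\<dots> = ?cY n (f n *\<^sub>v x)" using \<open>(x, x) \<in> cohomologous X n\<close> by auto
      finally show ?thesis .
    qed
    have HX: "cohomology X n = ?cX n ` cocycles X n" and HY: "cohomology Y n = ?cY n ` cocycles Y n" for n
      by (auto simp: cohomology_def quotient_def)
    have eqX: "?cX n x = ?cX n y \<longleftrightarrow> x - y \<in> coboundaries X n" if "x \<in> cocycles X n" "y \<in> cocycles X n" for n x y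
      using eq_equiv_class_iff[OF eX that] that by (simp add: cohomologous_def)
    have eqY: "?cY n x = ?cY n y \<longleftrightarrow> x - y \<in> coboundaries Y n" if "x \<in> cocycles Y n" "y \<in> cocycles Y n" for n x y
      using eq_equiv_class_iff[OF eY that] that by (simp add: cohomologous_def)
    have fc: "f n *\<^sub>v x \<in> cocycles Y n" if "x \<in> cocycles X n" for n x using chain_map_cocycles[OF f X Y that] .
    have inj: "inj_on (cohomology_map Y h n) (cohomology X n) \<longleftrightarrow>
       (\<forall>x \<in> cocycles X n. f n *\<^sub>v x \<in> coboundaries Y n \<longrightarrow> x \<in> coboundaries X n)" for n
    proof
      assume i: "inj_on (cohomology_map Y h n) (cohomology X n)"
      show "\<forall>x \<in> cocycles X n. f n *\<^sub>v x \<in> coboundaries Y n \<longrightarrow> x \<in> coboundaries X n"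
      proof (intro ballI impI)
        fix x assume x: "x \<in> cocycles X n" "f n *\<^sub>v x \<in> coboundaries Y n"
        have z: "0\<^sub>v (rk X n) \<in> cocycles X n" by (simp add: in_cocycles_iff mv_distrib is_cpx_simps[OF X])
        have v: "x - 0\<^sub>v (rk X n) = x" "f n *\<^sub>v x - f n *\<^sub>v 0\<^sub>v (rk X n) = f n *\<^sub>v x"
          using x(1) by (auto simp: in_cocycles_iff mv_distrib d intro!: eq_vecI)
        have "cohomology_map Y h n (?cX n x) = cohomology_map Y h n (?cX n (0\<^sub>v (rk X n)))"
          unfolding cm[OF x(1)] cm[OF z] eqY[OF fc[OF x(1)] fc[OF z]] v by (rule x(2))
        then have "?cX n x = ?cX n (0\<^sub>v (rk X n))" using i x(1) z unfolding inj_on_def HX by blast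
        then show "x \<in> coboundaries X n" unfolding eqX[OF x(1) z] v .
      qed
    next
      assume i: "\<forall>x \<in> cocycles X n. f n *\<^sub>v x \<in> coboundaries Y n \<longrightarrow> x \<in> coboundaries X n"
      show "inj_on (cohomology_map Y h n) (cohomology X n)" unfolding HX
      proof (rule inj_onI, clarify)
        fix x y assume xy: "x \<in> cocycles X n" "y \<in> cocycles X n" "cohomology_map Y h n (?cX n x) = cohomology_map Y h n (?cX n y)"
        then have "f n *\<^sub>v (x - y) \<in> coboundaries Y n" by (simp only: cm diff eqY fc)
        with i cocycles_minus[OF X xy(1,2)] show "?cX n x = ?cX n y" unfolding eqX[OF xy(1,2)] by blast
      qed
    qed
    have surj: "cohomology_map Y h n ` cohomology X n = cohomology Y n \<longleftrightarrow>
       (\<forall>y \<in> cocycles Y n. \<exists>x \<in> cocycles X n. f n *\<^sub>v x - y \<in> coboundaries Y n)" for n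
    proof -
      have 1: "cohomology_map Y h n ` cohomology X n = (\<lambda>x. ?cY n (f n *\<^sub>v x)) ` cocycles X n"
        unfolding HX by (simp only: image_image) (rule image_cong[OF refl cm])
      have "cohomology_map Y h n ` cohomology X n \<subseteq> cohomology Y n" unfolding 1 HY using fc by auto
      moreover have "cohomology Y n \<subseteq> cohomology_map Y h n ` cohomology X n \<longleftrightarrow>
         (\<forall>y \<in> cocycles Y n. \<exists>x \<in> cocycles X n. ?cY n (f n *\<^sub>v x) = ?cY n y)"
        unfolding 1 HY image_subset_iff image_iff by (simp only: eq_commute)
      moreover have "\<dots> \<longleftrightarrow> (\<forall>y \<in> cocycles Y n. \<exists>x \<in> cocycles X n. f n *\<^sub>v x - y \<in> coboundaries Y n)"
        by (intro ball_cong bex_cong refl eqY fc)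
      ultimately show ?thesis by (simp only: set_eq_subset simp_thms)
    qed
    show ?thesis unfolding bij_betw_def inj surj quis_inj_def quis_surj_def by blast
  qed
  then show ?thesis unfolding quis_def mem_Collect_eq Cpx_Z0[OF X Y] by (auto simp: h)
qed

section \<open>Homotopies to the identity\<close>

definition homotopic_id :: "'a::{comm_ring, comm_monoid_mult} cpx \<Rightarrow> (int \<Rightarrow> 'a mat) \<Rightarrow> bool" where
  "homotopic_id X p \<longleftrightarrow> (\<exists>l. (\<forall>i. l i \<in> carrier_mat (rk X (i - 1)) (rk X i)) \<and>
     (\<forall>i. p i = 1\<^sub>m (rk X i) + (df X (i - 1) * l i + l (i + 1) * df X i)))"

lemma homotopic_id_cohomologous:
  assumes "is_cpx X" "homotopic_id X p" "x \<in> cocycles X n"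
  shows "p n *\<^sub>v x - x \<in> coboundaries X n"
proof -
  obtain l where l: "\<And>i. l i \<in> carrier_mat (rk X (i - 1)) (rk X i)"
    "\<And>i. p i = 1\<^sub>m (rk X i) + (df X (i - 1) * l i + l (i + 1) * df X i)" using assms(2) by (auto simp: homotopic_id_def)
  note d = carrier_matD[OF l(1)] is_cpx_simps(1,2)[OF assms(1)]
  have d1: "dim_row (df X (n - 1)) = rk X n" using d(3)[of "n - 1"] by simp
  have d2: "dim_row (l (n + 1)) = rk X n" using d(1)[of "n + 1"] by simp
  have x: "dim_vec x = rk X n" "df X n *\<^sub>v x = 0\<^sub>v (rk X (n + 1))" using assms(3) by (auto simp: in_cocycles_iff)
  have "p n *\<^sub>v x = x + (df X (n - 1) *\<^sub>v (l n *\<^sub>v x) + l (n + 1) *\<^sub>v (df X n *\<^sub>v x))"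
    unfolding l(2) by (simp add: mv_distrib mv_assoc x(1) d d1 d2)
  also have "l (n + 1) *\<^sub>v (df X n *\<^sub>v x) = 0\<^sub>v (rk X n)" unfolding x(2) by (simp add: mv_distrib d d2)
  finally have "p n *\<^sub>v x - x = df X (n - 1) *\<^sub>v (l n *\<^sub>v x)"
    using x(1) d1 by (auto intro!: eq_vecI)
  then show ?thesis unfolding in_coboundaries_iff by (intro exI[of _ "l n *\<^sub>v x"]) (simp add: d)
qed

lemma quis_if_homotopy_equivalence:
  assumes X: "is_cpx X" and Y: "is_cpx Y" and f: "chain_map X Y f" and g: "chain_map Y X g"
    and gf: "homotopic_id X (\<lambda>i. g i * f i)" and fg: "homotopic_id Y (\<lambda>i. f i * g i)"
  shows "(0, f) \<in> quis X Y"
  unfolding quis_iff[OF X Y] quis_inj_def quis_surj_def fst_conv snd_conv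
proof (intro conjI allI ballI impI f refl)
  fix n x assume x: "x \<in> cocycles X n" "f n *\<^sub>v x \<in> coboundaries Y n"
  have "g n * f n *\<^sub>v x = g n *\<^sub>v (f n *\<^sub>v x)" using x(1) by (intro mv_assoc) (auto simp: in_cocycles_iff chain_map_simps[OF f] chain_map_simps[OF g])
  then have "g n * f n *\<^sub>v x \<in> coboundaries X n" using chain_map_coboundaries[OF g Y X x(2)] by simp
  from coboundaries_add[OF X this coboundaries_uminus[OF X homotopic_id_cohomologous[OF X gf x(1)]]]
  have "g n * f n *\<^sub>v x + - (g n * f n *\<^sub>v x - x) \<in> coboundaries X n" .
  moreover have "g n * f n *\<^sub>v x + - (g n * f n *\<^sub>v x - x) = x"
    using x(1) by (auto simp: in_cocycles_iff chain_map_simps[OF g] intro!: eq_vecI)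
  ultimately show "x \<in> coboundaries X n" by simp
next
  fix n y assume y: "y \<in> cocycles Y n"
  have "f n * g n *\<^sub>v y = f n *\<^sub>v (g n *\<^sub>v y)" using y by (intro mv_assoc) (auto simp: in_cocycles_iff chain_map_simps[OF f] chain_map_simps[OF g])
  then show "\<exists>x\<in>cocycles X n. f n *\<^sub>v x - y \<in> coboundaries Y n"
    using homotopic_id_cohomologous[OF Y fg y] chain_map_cocycles[OF g Y X y] by (intro bexI[of _ "g n *\<^sub>v y"]) simp_all
qed

lemma quis_comp:
  assumes X: "is_cpx X" and Y: "is_cpx Y" and Z: "is_cpx Z" and f: "h \<in> quis X Y" and g: "k \<in> quis Y Z"
  shows "dg_comp (Cpx 0) k h \<in> quis X Z"
proof -
  obtain f where f: "h = (0, f)" "chain_map X Y f" "quis_inj X Y f" "quis_surj X Y f" using f quis_iff[OF X Y] by (cases h) auto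
  obtain g where g: "k = (0, g)" "chain_map Y Z g" "quis_inj Y Z g" "quis_surj Y Z g" using g quis_iff[OF Y Z] by (cases k) auto
  have gf: "chain_map X Z (\<lambda>i. g i * f i)"
    using dg_category.comp_Z0[OF Cpx_dg_category, of X 0 Y Z "(0, f)" "(0, g)"] X Y Z f(2) g(2)
    by (simp add: Cpx_sel Cpx_Z0)
  note d = chain_map_simps(1,2)[OF f(2)] chain_map_simps(1,2)[OF g(2)]
  have a: "g n * f n *\<^sub>v x = g n *\<^sub>v (f n *\<^sub>v x)" if "dim_vec x = rk X n" for n x using that by (intro mv_assoc) (simp_all add: d)
  have "quis_inj X Z (\<lambda>i. g i * f i)" unfolding quis_inj_def
  proof (intro allI ballI impI)
    fix n x assume x: "x \<in> cocycles X n" "g n * f n *\<^sub>v x \<in> coboundaries Z n"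
    then have "g n *\<^sub>v (f n *\<^sub>v x) \<in> coboundaries Z n" by (simp add: a in_cocycles_iff)
    then show "x \<in> coboundaries X n" using f(3) g(3) x(1) chain_map_cocycles[OF f(2) X Y x(1)] unfolding quis_inj_def by blast
  qed
  moreover have "quis_surj X Z (\<lambda>i. g i * f i)" unfolding quis_surj_def
  proof (intro allI ballI)
    fix n z assume z: "z \<in> cocycles Z n"
    obtain y where y: "y \<in> cocycles Y n" "g n *\<^sub>v y - z \<in> coboundaries Z n" using g(4) z unfolding quis_surj_def by blast
    obtain x where x: "x \<in> cocycles X n" "f n *\<^sub>v x - y \<in> coboundaries Y n" using f(4) y(1) unfolding quis_surj_def by blast
    from x(1) y(1) have dd: "dim_vec x = rk X n" "dim_vec y = rk Y n" by (auto simp: in_cocycles_iff)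
    from coboundaries_add[OF Z chain_map_coboundaries[OF g(2) Y Z x(2)] y(2)]
    have "g n *\<^sub>v (f n *\<^sub>v x - y) + (g n *\<^sub>v y - z) \<in> coboundaries Z n" .
    moreover have "g n *\<^sub>v (f n *\<^sub>v x - y) = g n * f n *\<^sub>v x - g n *\<^sub>v y" unfolding a[OF dd(1)] by (rule mv_distrib) (simp_all add: d dd)
    moreover have "(g n * f n *\<^sub>v x - g n *\<^sub>v y) + (g n *\<^sub>v y - z) = g n * f n *\<^sub>v x - z"
      using z by (auto simp: in_cocycles_iff d intro!: eq_vecI)
    ultimately show "\<exists>x\<in>cocycles X n. g n * f n *\<^sub>v x - z \<in> coboundaries Z n" using x(1) by auto
  qed
  ultimately show ?thesis using gf by (simp add: quis_iff[OF X Z] f(1) g(1) Cpx_sel)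
qed

section \<open>Shifts of quasi-isomorphisms\<close>

lemma uminus_zero_vec_iff: "- v = 0\<^sub>v n \<longleftrightarrow> v = (0\<^sub>v n :: 'a::group_add vec)"
proof
  assume "- v = 0\<^sub>v n"
  then have "- (- v) = - 0\<^sub>v n" by simp
  then show "v = 0\<^sub>v n" by (metis uminus_uminus_vec uminus_zero_vec)
qed auto

lemma shift_cocycles: "is_cpx X \<Longrightarrow> cocycles (shift_cpx X) n = cocycles X (n + 1)"
  unfolding set_eq_iff in_cocycles_iff
  by (auto simp: shift_cpx_def mv_distrib is_cpx_simps idx uminus_zero_vec_iff)

lemma shift_coboundaries:
  assumes "is_cpx X" shows "coboundaries (shift_cpx X) n = coboundaries X (n + 1)"
proof -
  have "x \<in> coboundaries (shift_cpx X) n \<longleftrightarrow> (\<exists>z. dim_vec z = rk X n \<and> x = - (df X n *\<^sub>v z))" for x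
    by (auto simp: in_coboundaries_iff shift_cpx_def mv_distrib is_cpx_simps[OF assms])
  moreover have "\<dots> x \<longleftrightarrow> x \<in> coboundaries X (n + 1)" for x
  proof
    assume "\<exists>z. dim_vec z = rk X n \<and> x = - (df X n *\<^sub>v z)"
    then obtain z where "dim_vec z = rk X n" "x = - (df X n *\<^sub>v z)" by blast
    then show "x \<in> coboundaries X (n + 1)" unfolding in_coboundaries_iff
      by (intro exI[of _ "- z"]) (simp add: mv_distrib is_cpx_simps[OF assms])
  next
    assume "x \<in> coboundaries X (n + 1)"
    then obtain z where "dim_vec z = rk X n" "x = df X n *\<^sub>v z" unfolding in_coboundaries_iff by auto
    then show "\<exists>z. dim_vec z = rk X n \<and> x = - (df X n *\<^sub>v z)"
      by (intro exI[of _ "- z"]) (simp add: mv_distrib is_cpx_simps[OF assms])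
  qed
  ultimately show ?thesis by blast
qed

lemma quis_shift:
  assumes X: "is_cpx X" and Y: "is_cpx Y" and f: "h \<in> quis X Y"
  shows "dg_shift_hom (Cpx 0) h \<in> quis (shift_cpx X) (shift_cpx Y)"
proof -
  obtain f where f: "h = (0, f)" "chain_map X Y f" "quis_inj X Y f" "quis_surj X Y f" using f quis_iff[OF X Y] by (cases h) auto
  have "chain_map (shift_cpx X) (shift_cpx Y) (\<lambda>i. f (i + 1))"
    using dg_category.shift_Z0[OF Cpx_dg_category, of X 0 Y "(0, f)"] X Y f(2)
    by (simp add: Cpx_sel Cpx_Z0 is_cpx_shift mat_simps)
  then show ?thesis using f(3,4)
    by (simp add: f(1) Cpx_sel quis_iff is_cpx_shift X Y mat_simps quis_inj_def quis_surj_def shift_cocycles shift_coboundaries)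
qed


section \<open>Contractions of bounded acyclic complexes\<close>

lemma lift_cols:
  assumes "\<And>j. j < k \<Longrightarrow> \<exists>x. dim_vec x = m \<and> col B j = A *\<^sub>v x" "dim_row B = dim_row A" "dim_col B = k" "dim_col A = m"
  shows "\<exists>H. H \<in> carrier_mat m k \<and> A * H = B"
proof -
  obtain x where x: "\<And>j. j < k \<Longrightarrow> dim_vec (x j) = m \<and> col B j = A *\<^sub>v x j" using assms(1) by metis
  \<comment> \<open>Projectivity of a free module in matrix form: preimages of the images of the
    basis vectors, chosen one at a time, are the columns of the lift.\<close>
  define H where "H = mat m k (\<lambda>(r, c). x c $ r)"
  have c: "col H j = x j" if "j < k" for j using that x[OF that] by (intro eq_vecI) (simp_all add: H_def)
  have "A * H = B"
  proof (rule eq_matI)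
    fix i j assume ij: "i < dim_row B" "j < dim_col B"
    have "(A * H) $$ (i, j) = row A i \<bullet> col H j" using ij assms by (simp add: H_def)
    also have "\<dots> = (A *\<^sub>v x j) $ i" using ij assms c by simp
    also have "\<dots> = col B j $ i" using ij assms x by simp
    finally show "(A * H) $$ (i, j) = B $$ (i, j)" using ij by simp
  qed (use assms in \<open>simp_all add: H_def\<close>)
  moreover have "H \<in> carrier_mat m k" by (simp add: H_def)
  ultimately show ?thesis by blast
qed

definition contraction :: "'a::{comm_ring, comm_monoid_mult} cpx \<Rightarrow> (int \<Rightarrow> 'a mat) \<Rightarrow> bool" where
  "contraction C h \<longleftrightarrow> (\<forall>i. h i \<in> carrier_mat (rk C (i - 1)) (rk C i)) \<and>
     (\<forall>i. df C (i - 1) * h i + h (i + 1) * df C i = 1\<^sub>m (rk C i))"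

text \<open>The identity in degree i + 1 gives d H d = d, since the term with \<open>H2\<close> ends
  in d d = 0. So the columns of 1 - H d are cocycles, hence coboundaries, and lift along d to the
  required \<open>h\<close>.\<close>

lemma contraction_step:
  assumes C: "is_cpx C" and ac: "cocycles C i \<subseteq> coboundaries C i"
    and H: "H \<in> carrier_mat (rk C i) (rk C (i + 1))" "H2 \<in> carrier_mat (rk C (i + 1)) (rk C (i + 2))"
      "df C i * H + H2 * df C (i + 1) = 1\<^sub>m (rk C (i + 1))"
  shows "\<exists>h. h \<in> carrier_mat (rk C (i - 1)) (rk C i) \<and> df C (i - 1) * h + H * df C i = 1\<^sub>m (rk C i)"
proof -
  note d = is_cpx_simps(1,2)[OF C] carrier_matD[OF H(1)] carrier_matD[OF H(2)]
  have d1: "dim_row (df C (i - 1)) = rk C i" using d(1)[of "i - 1"] by simp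
  let ?B = "1\<^sub>m (rk C i) - H * df C i"
  have "df C i * (H * df C i) + H2 * df C (i + 1) * df C i = df C i"
    using arg_cong[OF H(3), of "\<lambda>M. M * df C i"] by (simp add: mat_distrib mat_assoc one_mult d idx)
  moreover have "H2 * df C (i + 1) * df C i = 0\<^sub>m (rk C (i + 1)) (rk C i)"
    by (simp add: mat_assoc d is_cpx_simps(3)[OF C] mult_zero idx)
  ultimately have e: "df C i * (H * df C i) = df C i" by (simp add: add_zero d)
  have z: "df C i * ?B = 0\<^sub>m (rk C (i + 1)) (rk C i)"
    by (subst mat_distrib_diff) (simp_all add: d mult_one e minus_mats)
  have "\<exists>h. h \<in> carrier_mat (rk C (i - 1)) (rk C i) \<and> df C (i - 1) * h = ?B"
  proof (rule lift_cols)
    fix j assume j: "j < rk C i"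
    have "df C i *\<^sub>v col ?B j = col (df C i * ?B) j"
      using j by (intro col_mult2[OF carrier_matI carrier_matI, symmetric]) (auto simp: d)
    also have "\<dots> = 0\<^sub>v (rk C (i + 1))" unfolding z using j by (intro eq_vecI) simp_all
    finally have "col ?B j \<in> cocycles C i" by (simp add: in_cocycles_iff d)
    with ac show "\<exists>x. dim_vec x = rk C (i - 1) \<and> col ?B j = df C (i - 1) *\<^sub>v x" using in_coboundaries_iff by blast
  qed (simp_all add: d d1)
  then obtain h where h: "h \<in> carrier_mat (rk C (i - 1)) (rk C i)" "df C (i - 1) * h = ?B" by blast
  have "?B + H * df C i = 1\<^sub>m (rk C i)" by (intro eq_matI) (auto simp: d simp del: index_mult_mat(1))
  with h show ?thesis by metis
qed

lemma acyclic_contraction: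
  assumes C: "is_cpx C" and ac: "\<And>n. cocycles C n \<subseteq> coboundaries C n"
  shows "\<exists>h. contraction C h"
proof -
  obtain K where K: "\<And>i. rk C i \<noteq> 0 \<Longrightarrow> i \<le> K"
    using bdd_above_finite[OF is_cpx_simps(4)[OF C]] unfolding bdd_above_def by blast
  define M where "M = K + 1"
  have M: "rk C i = 0" if "i \<ge> M" for i
    using K[of i] that by (force simp: M_def)
  note d = is_cpx_simps(1,2)[OF C]
  \<comment> \<open>Degrees go down from \<open>M\<close>, at and above which the ranks vanish.
    \<open>?P\<close> says that the contraction identity in degree \<open>M - n\<close> can be
    completed by some \<open>h2\<close>; \<open>?Q\<close> says that one degree lower this
    completion is the matrix already chosen, so dependent choice yields one coherent family.\<close>
  let ?P = "\<lambda>n h. h \<in> carrier_mat (rk C (M - int n - 1)) (rk C (M - int n)) \<and>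
     (\<exists>h2 \<in> carrier_mat (rk C (M - int n)) (rk C (M - int n + 1)). df C (M - int n - 1) * h + h2 * df C (M - int n) = 1\<^sub>m (rk C (M - int n)))"
  let ?Q = "\<lambda>n h h'. df C (M - int (Suc n) - 1) * h' + h * df C (M - int (Suc n)) = 1\<^sub>m (rk C (M - int (Suc n)))"
  have "\<exists>f. \<forall>n. ?P n (f n) \<and> ?Q n (f n) (f (Suc n))"
  proof (rule dependent_nat_choice)
    have "dim_row (df C (M - 1)) = 0" using d(1)[of "M - 1"] M[of M] by simp
    then show "\<exists>h. ?P 0 h"
      by (intro exI[of _ "0\<^sub>m (rk C (M - 1)) 0"] conjI bexI[of _ "0\<^sub>m (rk C M) (rk C (M + 1))"]) (auto simp: M d intro!: eq_matI)
  next
    fix h n assume P: "?P n h"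
    define i where "i = M - int (Suc n)"
    have i: "M - int n - 1 = i" "M - int n = i + 1" by (simp_all add: i_def)
    note P' = P[unfolded i add_diff_cancel_right']
    note h = conjunct1[OF P']
    from conjunct2[OF P'] obtain h2 where h2: "h2 \<in> carrier_mat (rk C (i + 1)) (rk C (i + 1 + 1))" "df C i * h + h2 * df C (i + 1) = 1\<^sub>m (rk C (i + 1))" ..
    from contraction_step[OF C ac h h2(1)[unfolded idx(1)] h2(2)] obtain h' where
      "h' \<in> carrier_mat (rk C (i - 1)) (rk C i)" "df C (i - 1) * h' + h * df C i = 1\<^sub>m (rk C i)" by blast
    then show "\<exists>h'. ?P (Suc n) h' \<and> ?Q n h h'" unfolding i_def[symmetric] using h by (intro exI[of _ h'] conjI bexI[of _ h])
  qed
  then obtain f where f: "\<And>n. ?P n (f n)" "\<And>n. ?Q n (f n) (f (Suc n))" by blast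
  define h where "h i = (if i \<le> M then f (nat (M - i)) else 0\<^sub>m (rk C (i - 1)) (rk C i))" for i
  have h: "h i \<in> carrier_mat (rk C (i - 1)) (rk C i)" for i
    using f(1)[of "nat (M - i)"] by (auto simp: h_def)
  moreover have "df C (i - 1) * h i + h (i + 1) * df C i = 1\<^sub>m (rk C i)" for i
  proof (cases "i < M")
    case True
    define n where "n = nat (M - (i + 1))"
    have i: "M - int (Suc n) = i" using True by (simp add: n_def)
    have "h i = f (Suc n)" "h (i + 1) = f n" unfolding i[symmetric] by (simp_all add: h_def nat_add_distrib)
    with f(2)[of n] show ?thesis unfolding i by simp
  next
    case False
    then have "rk C i = 0" using M by simp
    then show ?thesis using d(2)[of i] carrier_matD(1)[OF h[of "i + 1"]] by (intro eq_matI) simp_all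
  qed
  ultimately show ?thesis unfolding contraction_def by blast
qed

text \<open>The chase of the long exact sequence. For a cocycle (y, x), injectivity on cohomology
  gives x = d u, surjectivity gives v and w with f v - (y + f u) = d w, and (-w, v - u) is a
  primitive of (y, x).\<close>

lemma cone_acyclic:
  assumes X: "is_cpx X" and Y: "is_cpx Y" and f: "chain_map X Y f" "quis_inj X Y f" "quis_surj X Y f"
  shows "cocycles (cone_ob (X, (0, f), Y)) n \<subseteq> coboundaries (cone_ob (X, (0, f), Y)) n"
proof
  note d = chain_map_simps(1,2)[OF f(1)] is_cpx_simps(1,2)[OF X] is_cpx_simps(1,2)[OF Y]
  fix z assume "z \<in> cocycles (cone_ob (X, (0, f), Y)) n"
  then have z: "dim_vec z = rk Y n + rk X (n + 1)"
    "four_block_mat (df Y n) (f (n + 1)) (0\<^sub>m (rk X (n + 2)) (rk Y n)) (- df X (n + 1)) *\<^sub>v z = 0\<^sub>v (rk Y (n + 1) + rk X (n + 2))"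
    by (simp_all add: in_cocycles_iff idx)
  define y where "y = vec_first z (rk Y n)"
  define x where "x = vec_last z (rk X (n + 1))"
  have "z \<in> carrier_vec (rk Y n + rk X (n + 1))" using z(1) carrier_dim_vec by blast
  from vec_first_last_append[OF this]
  have yx: "z = y @\<^sub>v x" "dim_vec y = rk Y n" "dim_vec x = rk X (n + 1)" by (simp_all add: y_def x_def)
  have blk: "four_block_mat (df Y k) (f (k + 1)) (0\<^sub>m (rk X (k + 2)) (rk Y k)) (- df X (k + 1)) *\<^sub>v (a @\<^sub>v b) =
      (df Y k *\<^sub>v a + f (k + 1) *\<^sub>v b) @\<^sub>v - (df X (k + 1) *\<^sub>v b)"
    if "dim_vec a = rk Y k" "dim_vec b = rk X (k + 1)" for k a b
  proof -
    have "four_block_mat (df Y k) (f (k + 1)) (0\<^sub>m (rk X (k + 2)) (rk Y k)) (- df X (k + 1)) *\<^sub>v (a @\<^sub>v b) =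
      (df Y k *\<^sub>v a + f (k + 1) *\<^sub>v b) @\<^sub>v (0\<^sub>m (rk X (k + 2)) (rk Y k) *\<^sub>v a + - df X (k + 1) *\<^sub>v b)"
      by (rule four_block_mat_mult_vec[of _ "rk Y (k + 1)" "rk Y k" _ "rk X (k + 1)" _ "rk X (k + 2)"])
        (use that carrier_dim_vec in \<open>auto simp: d idx intro!: carrier_matI\<close>)
    also have "0\<^sub>m (rk X (k + 2)) (rk Y k) *\<^sub>v a + - df X (k + 1) *\<^sub>v b = - (df X (k + 1) *\<^sub>v b)"
      using that by (auto simp: mv_distrib d idx intro!: eq_vecI)
    finally show ?thesis .
  qed
  have "(df Y n *\<^sub>v y + f (n + 1) *\<^sub>v x) @\<^sub>v - (df X (n + 1) *\<^sub>v x) = 0\<^sub>v (rk Y (n + 1)) @\<^sub>v 0\<^sub>v (rk X (n + 2))"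
    using z(2) unfolding yx(1) blk[OF yx(2,3)] by (auto intro!: eq_vecI)
  note 1 = this
  have e: "df Y n *\<^sub>v y + f (n + 1) *\<^sub>v x = 0\<^sub>v (rk Y (n + 1))" "df X (n + 1) *\<^sub>v x = 0\<^sub>v (rk X (n + 2))"
  proof -
    have "df Y n *\<^sub>v y + f (n + 1) *\<^sub>v x \<in> carrier_vec (rk Y (n + 1))" by (rule carrier_vecI) (simp add: d)
    then have "df Y n *\<^sub>v y + f (n + 1) *\<^sub>v x = 0\<^sub>v (rk Y (n + 1)) \<and> - (df X (n + 1) *\<^sub>v x) = 0\<^sub>v (rk X (n + 2))"
      if "(df Y n *\<^sub>v y + f (n + 1) *\<^sub>v x) @\<^sub>v - (df X (n + 1) *\<^sub>v x) = 0\<^sub>v (rk Y (n + 1)) @\<^sub>v 0\<^sub>v (rk X (n + 2))"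
      using that append_vec_eq[OF _ zero_carrier_vec, of "df Y n *\<^sub>v y + f (n + 1) *\<^sub>v x" "rk Y (n + 1)"] by blast
    then show "df Y n *\<^sub>v y + f (n + 1) *\<^sub>v x = 0\<^sub>v (rk Y (n + 1))" "df X (n + 1) *\<^sub>v x = 0\<^sub>v (rk X (n + 2))"
      using 1 by (simp_all only: uminus_zero_vec_iff)
  qed
  have xc: "x \<in> cocycles X (n + 1)" using e(2) yx(3) by (simp add: in_cocycles_iff idx)
  have "f (n + 1) *\<^sub>v x = - (df Y n *\<^sub>v y)"
  proof (rule eq_vecI)
    fix i assume i: "i < dim_vec (- (df Y n *\<^sub>v y))"
    then have "(df Y n *\<^sub>v y + f (n + 1) *\<^sub>v x) $ i = 0" unfolding e(1) by (simp add: d)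
    with i show "(f (n + 1) *\<^sub>v x) $ i = (- (df Y n *\<^sub>v y)) $ i"
      by (simp add: d add_eq_0_iff del: index_mult_mat_vec)
  qed (simp add: d)
  then have "f (n + 1) *\<^sub>v x = df Y n *\<^sub>v (- y)" using yx(2) by (simp add: mv_distrib d)
  then have "f (n + 1) *\<^sub>v x \<in> coboundaries Y (n + 1)" unfolding in_coboundaries_iff
    using yx(2) by (intro exI[of _ "- y"]) simp
  with f(2) xc obtain u where u: "dim_vec u = rk X n" "x = df X n *\<^sub>v u"
    unfolding quis_inj_def in_coboundaries_iff by fastforce
  have fu: "df Y n *\<^sub>v (f n *\<^sub>v u) = f (n + 1) *\<^sub>v x"
    using chain_map_simps(3)[OF f(1), of n] mv_assoc[of "df Y n" "f n" u] mv_assoc[of "f (n + 1)" "df X n" u]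
    unfolding u(2) by (simp add: d u(1))
  have "y + f n *\<^sub>v u \<in> cocycles Y n"
    using e(1) by (simp add: in_cocycles_iff d yx(2) u(1) mv_distrib fu)
  with f(3) obtain v where v: "v \<in> cocycles X n" "f n *\<^sub>v v - (y + f n *\<^sub>v u) \<in> coboundaries Y n"
    unfolding quis_surj_def by blast
  then obtain w where w: "dim_vec w = rk Y (n - 1)" "f n *\<^sub>v v - (y + f n *\<^sub>v u) = df Y (n - 1) *\<^sub>v w"
    unfolding in_coboundaries_iff by blast
  have v': "dim_vec v = rk X n" "df X n *\<^sub>v v = 0\<^sub>v (rk X (n + 1))" using v(1) by (simp_all add: in_cocycles_iff)
  have d1: "dim_row (df Y (n - 1)) = rk Y n" using d(5)[of "n - 1"] by simp
  have "y = df Y (n - 1) *\<^sub>v (- w) + f n *\<^sub>v (v - u)"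
  proof (rule eq_vecI)
    fix i assume "i < dim_vec (df Y (n - 1) *\<^sub>v (- w) + f n *\<^sub>v (v - u))"
    then have i: "i < rk Y n" by (simp add: d)
    have "(f n *\<^sub>v v - (y + f n *\<^sub>v u)) $ i = (df Y (n - 1) *\<^sub>v w) $ i" using w(2) by simp
    with i show "y $ i = (df Y (n - 1) *\<^sub>v (- w) + f n *\<^sub>v (v - u)) $ i"
      by (simp add: mv_distrib w(1) v'(1) u(1) d d1 yx(2) algebra_simps del: index_mult_mat_vec)
  qed (simp add: yx(2) d)
  moreover have "x = - (df X n *\<^sub>v (v - u))"
    unfolding u(2) using v' by (auto simp: mv_distrib d u(1) intro!: eq_vecI)
  ultimately have "z = df (cone_ob (X, (0, f), Y)) (n - 1) *\<^sub>v (- w @\<^sub>v (v - u))"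
    unfolding yx(1) using blk[of "- w" "n - 1" "v - u"] w(1) v'(1) u(1) by (simp add: add.commute)
  then show "z \<in> coboundaries (cone_ob (X, (0, f), Y)) n"
    unfolding in_coboundaries_iff using w(1) u(1) v'(1) by (intro exI[of _ "- w @\<^sub>v (v - u)"]) simp
qed

section \<open>Homotopy inverses from contractions of the cone\<close>

lemma four_block_eqD:
  assumes "four_block_mat A B C D = four_block_mat A' B' C' D'"
    "dim_row A' = dim_row A" "dim_col A' = dim_col A" "dim_row D' = dim_row D" "dim_col D' = dim_col D"
    "dim_row B = dim_row A" "dim_col B = dim_col D" "dim_row C = dim_row D" "dim_col C = dim_col A"
    "dim_row B' = dim_row A" "dim_col B' = dim_col D" "dim_row C' = dim_row D" "dim_col C' = dim_col A"
  shows "A = A'" "C = C'" "D = D'"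
proof -
  have e: "four_block_mat A B C D $$ ij = four_block_mat A' B' C' D' $$ ij" for ij using assms(1) by simp
  show "A = A'"
  proof (rule eq_matI)
    fix i j assume "i < dim_row A'" "j < dim_col A'"
    then show "A $$ (i, j) = A' $$ (i, j)" using e[of "(i, j)"] assms(2-) by simp
  qed (use assms in auto)
  show "C = C'"
  proof (rule eq_matI)
    fix i j assume "i < dim_row C'" "j < dim_col C'"
    then show "C $$ (i, j) = C' $$ (i, j)" using e[of "(i + dim_row A, j)"] assms(2-) by simp
  qed (use assms in auto)
  show "D = D'"
  proof (rule eq_matI)
    fix i j assume "i < dim_row D'" "j < dim_col D'"
    then show "D $$ (i, j) = D' $$ (i, j)" using e[of "(i + dim_row A, j + dim_col A)"] assms(2-) by simp
  qed (use assms in auto)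
qed

text \<open>A contraction of the cone of f contains everything in its blocks: \<open>g\<close> is
  the inverse, and \<open>- k\<close> and \<open>l\<close> are the homotopies. In the contraction
  identity the lower left block says that \<open>g\<close> is a chain map, and the diagonal blocks
  are the two homotopy identities.\<close>

lemma quis_homotopy_inverse:
  assumes X: "is_cpx X" and Y: "is_cpx Y" and q: "(0, f) \<in> quis X Y"
  shows "\<exists>g. chain_map Y X g \<and> homotopic_id X (\<lambda>i. g i * f i) \<and> homotopic_id Y (\<lambda>i. f i * g i)"
proof -
  from q have f: "chain_map X Y f" "quis_inj X Y f" "quis_surj X Y f" unfolding quis_iff[OF X Y] by auto
  note d = chain_map_simps(1,2)[OF f(1)] is_cpx_simps(1,2)[OF X] is_cpx_simps(1,2)[OF Y]
  let ?C = "cone_ob (X, (0, f), Y)"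
  have "(X, (0, f), Y) \<in> dg_ob (Fun1 (Cpx 0))" using X Y f(1) by (simp add: Fun1_sel Cpx_Z0) (simp add: Cpx_sel)
  from is_cpx_cone[OF this] obtain h where "contraction ?C h"
    using acyclic_contraction[of ?C] cone_acyclic[OF X Y f] by blast
  then have h: "\<And>i. h i \<in> carrier_mat (rk Y (i - 1) + rk X i) (rk Y i + rk X (i + 1))"
    "\<And>i. df ?C (i - 1) * h i + h (i + 1) * df ?C i = 1\<^sub>m (rk Y i + rk X (i + 1))"
    by (simp_all add: contraction_def)
  define k where "k i = mat (rk Y (i - 1)) (rk Y i) (\<lambda>(r, c). h i $$ (r, c))" for i
  define s where "s i = mat (rk Y (i - 1)) (rk X (i + 1)) (\<lambda>(r, c). h i $$ (r, c + rk Y i))" for i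
  define g where "g i = mat (rk X i) (rk Y i) (\<lambda>(r, c). h i $$ (r + rk Y (i - 1), c))" for i
  define l where "l i = mat (rk X i) (rk X (i + 1)) (\<lambda>(r, c). h i $$ (r + rk Y (i - 1), c + rk Y i))" for i
  have dims: "dim_row (k i) = rk Y (i - 1)" "dim_col (k i) = rk Y i" "dim_row (s i) = rk Y (i - 1)" "dim_col (s i) = rk X (i + 1)"
    "dim_row (g i) = rk X i" "dim_col (g i) = rk Y i" "dim_row (l i) = rk X i" "dim_col (l i) = rk X (i + 1)" for i
    by (simp_all add: k_def s_def g_def l_def)
  have hb: "h i = four_block_mat (k i) (s i) (g i) (l i)" for i
    using h(1)[of i] by (intro eq_matI) (auto simp: k_def s_def g_def l_def)
  have d1: "dim_row (df Y (i - 1)) = rk Y i" for i using d(5)[of "i - 1"] by simp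
  have e: "df Y (i - 1) * k i + f i * g i + k (i + 1) * df Y i = 1\<^sub>m (rk Y i) \<and>
      - (df X i * g i) + g (i + 1) * df Y i = 0\<^sub>m (rk X (i + 1)) (rk Y i) \<and>
      - (df X i * l i) + (g (i + 1) * f (i + 1) + - (l (i + 1) * df X (i + 1))) = 1\<^sub>m (rk X (i + 1))" for i
  proof -
    have a: "df ?C (i - 1) = four_block_mat (df Y (i - 1)) (f i) (0\<^sub>m (rk X (i + 1)) (rk Y (i - 1))) (- df X i)"
      by (simp add: add.commute)
    have b: "df ?C i = four_block_mat (df Y i) (f (i + 1)) (0\<^sub>m (rk X (i + 2)) (rk Y i)) (- df X (i + 1))" by simp
    have 1: "df ?C (i - 1) * h i = four_block_mat (df Y (i - 1) * k i + f i * g i) (df Y (i - 1) * s i + f i * l i) (- (df X i * g i)) (- (df X i * l i))"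
      unfolding a hb[of i] by (simp add: blk_mult d d1 dims zero_mult uminus_mult add_zero)
    have 2: "h (i + 1) * df ?C i = four_block_mat (k (i + 1) * df Y i) (k (i + 1) * f (i + 1) + - (s (i + 1) * df X (i + 1)))
       (g (i + 1) * df Y i) (g (i + 1) * f (i + 1) + - (l (i + 1) * df X (i + 1)))"
      unfolding b hb[of "i + 1"] by (simp add: blk_mult d d1 dims mult_zero uminus_mult add_zero idx)
    have 3: "four_block_mat (df Y (i - 1) * k i + f i * g i + k (i + 1) * df Y i)
       (df Y (i - 1) * s i + f i * l i + (k (i + 1) * f (i + 1) + - (s (i + 1) * df X (i + 1))))
       (- (df X i * g i) + g (i + 1) * df Y i)
       (- (df X i * l i) + (g (i + 1) * f (i + 1) + - (l (i + 1) * df X (i + 1)))) =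
       four_block_mat (1\<^sub>m (rk Y i)) (0\<^sub>m (rk Y i) (rk X (i + 1))) (0\<^sub>m (rk X (i + 1)) (rk Y i)) (1\<^sub>m (rk X (i + 1)))"
      unfolding four_block_one_mat h(2)[symmetric] 1 2 by (subst blk_add) (simp_all add: d d1 dims)
    from four_block_eqD[OF 3] show ?thesis by (simp add: d d1 dims)
  qed
  have "chain_map Y X g"
    unfolding chain_map_def
  proof (intro conjI allI)
    fix i
    have e2: "- (df X i * g i) + g (i + 1) * df Y i = 0\<^sub>m (rk X (i + 1)) (rk Y i)" using e by blast
    show "df X i * g i = g (i + 1) * df Y i"
    proof (rule eq_matI)
      fix r c assume rc: "r < dim_row (g (i + 1) * df Y i)" "c < dim_col (g (i + 1) * df Y i)"
      have "(- (df X i * g i) + g (i + 1) * df Y i) $$ (r, c) = 0" unfolding e2 using rc by (simp add: d dims)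
      with rc show "(df X i * g i) $$ (r, c) = (g (i + 1) * df Y i) $$ (r, c)"
        by (simp add: d dims neg_eq_iff_add_eq_0[symmetric] del: index_mult_mat(1))
    qed (simp_all add: d dims)
  qed (intro carrier_matI dims)
  moreover have "homotopic_id Y (\<lambda>i. f i * g i)"
    unfolding homotopic_id_def
  proof (intro exI[of _ "\<lambda>i. - k i"] conjI allI)
    fix i
    have e1: "df Y (i - 1) * k i + f i * g i + k (i + 1) * df Y i = 1\<^sub>m (rk Y i)" using e by blast
    show "f i * g i = 1\<^sub>m (rk Y i) + (df Y (i - 1) * - k i + - k (i + 1) * df Y i)"
      unfolding e1[symmetric]
      by (simp add: uminus_mult d d1 dims, intro eq_matI) (simp_all add: d d1 dims del: index_mult_mat(1))
  qed (intro carrier_matI; simp add: dims)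
  \<comment> \<open>The cone contains X shifted by one, so \<open>l i\<close> goes from degree i + 1
    of X to degree i; the homotopy on X is therefore \<open>l (i - 1)\<close>.\<close>
  moreover have "homotopic_id X (\<lambda>i. g i * f i)"
    unfolding homotopic_id_def
  proof (intro exI[of _ "\<lambda>i. l (i - 1)"] conjI allI)
    fix i
    have e3: "- (df X (i - 1) * l (i - 1)) + (g i * f i + - (l i * df X i)) = 1\<^sub>m (rk X i)" using e[of "i - 1"] by simp
    have dl: "dim_row (df X (i - 1)) = rk X i" "dim_col (l (i - 1)) = rk X i" using d(3)[of "i - 1"] dims(8)[of "i - 1"] by simp_all
    show "g i * f i = 1\<^sub>m (rk X i) + (df X (i - 1) * l (i - 1) + l (i + 1 - 1) * df X i)"
      unfolding e3[symmetric]
      by (intro eq_matI) (simp_all add: d dl dims del: index_mult_mat(1))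
  qed (intro carrier_matI; simp add: dims dims(8)[of "_ - 1", simplified])
  ultimately show ?thesis by blast
qed

section \<open>The cone as a form functor\<close>

lemma homotopic_id_if_eq:
  assumes "is_cpx X" "\<And>i. p i = 1\<^sub>m (rk X i)" shows "homotopic_id X p"
  unfolding homotopic_id_def
proof (intro exI[of _ "\<lambda>i. 0\<^sub>m (rk X (i - 1)) (rk X i)"] conjI allI)
  fix i show "p i = 1\<^sub>m (rk X i) + (df X (i - 1) * 0\<^sub>m (rk X (i - 1)) (rk X i) + 0\<^sub>m (rk X (i + 1 - 1)) (rk X (i + 1)) * df X i)"
    using is_cpx_simps(1)[OF assms(1), of "i - 1"] by (simp add: assms(2) mult_zero zero_mult is_cpx_simps[OF assms(1)] add_zero)
qed simp

text \<open>A degreewise inverse of a chain map commutes with the differentials automatically, so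
  the comparison maps for shift and duality are settled by matrix identities.\<close>

lemma quis_if_iso:
  assumes X: "is_cpx X" and Y: "is_cpx Y" and f: "chain_map X Y f"
    and g: "\<And>i. g i \<in> carrier_mat (rk X i) (rk Y i)" "\<And>i. g i * f i = 1\<^sub>m (rk X i)" "\<And>i. f i * g i = 1\<^sub>m (rk Y i)"
  shows "(0, f) \<in> quis X Y"
proof -
  note d = chain_map_simps(1,2)[OF f] carrier_matD[OF g(1)] is_cpx_simps(1,2)[OF X] is_cpx_simps(1,2)[OF Y]
  have "df X i * g i = g (i + 1) * df Y i" for i
  proof -
    have "df X i * g i = g (i + 1) * f (i + 1) * (df X i * g i)" by (simp add: g one_mult d)
    also have "\<dots> = g (i + 1) * (f (i + 1) * df X i * g i)" by (simp add: mat_assoc d)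
    also have "\<dots> = g (i + 1) * (df Y i * (f i * g i))"
      unfolding chain_map_simps(3)[OF f, symmetric] by (simp add: mat_assoc d)
    also have "\<dots> = g (i + 1) * df Y i" by (simp add: g mult_one d)
    finally show ?thesis .
  qed
  then have "chain_map Y X g" using g(1) by (simp add: chain_map_def)
  from quis_if_homotopy_equivalence[OF X Y f this] show ?thesis
    using homotopic_id_if_eq[OF X g(2)] homotopic_id_if_eq[OF Y g(3)] by blast
qed

text \<open>An instance of two out of three. Surjectivity of f on cohomology holds because f (r y) -
  y is killed by r, and r is injective on cohomology.\<close>

lemma quis_if_retraction:
  assumes X: "is_cpx X" and Y: "is_cpx Y" and f: "chain_map X Y f" and r: "chain_map Y X r" "quis_inj Y X r"
    and rf: "\<And>i. r i * f i = 1\<^sub>m (rk X i)"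
  shows "(0, f) \<in> quis X Y"
proof -
  note d = chain_map_simps(1,2)[OF f] chain_map_simps(1,2)[OF r(1)]
  have a: "r n *\<^sub>v (f n *\<^sub>v x) = x" if "dim_vec x = rk X n" for n x
    using mv_assoc[of "r n" "f n" x] that by (simp add: d rf mv_distrib)
  have "quis_inj X Y f" unfolding quis_inj_def
  proof (intro allI ballI impI)
    fix n x assume "x \<in> cocycles X n" "f n *\<^sub>v x \<in> coboundaries Y n"
    then show "x \<in> coboundaries X n" using chain_map_coboundaries[OF r(1) Y X, of "f n *\<^sub>v x" n] a[of x n] by (simp add: in_cocycles_iff)
  qed
  moreover have "quis_surj X Y f" unfolding quis_surj_def
  proof (intro allI ballI)
    fix n y assume y: "y \<in> cocycles Y n"
    have x: "r n *\<^sub>v y \<in> cocycles X n" by (rule chain_map_cocycles[OF r(1) Y X y])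
    have c: "f n *\<^sub>v (r n *\<^sub>v y) - y \<in> cocycles Y n" by (rule cocycles_minus[OF Y chain_map_cocycles[OF f X Y x] y])
    have "r n *\<^sub>v (f n *\<^sub>v (r n *\<^sub>v y) - y) = r n *\<^sub>v (f n *\<^sub>v (r n *\<^sub>v y)) - r n *\<^sub>v y"
      using y by (intro mv_distrib) (simp_all add: in_cocycles_iff d)
    also have "\<dots> = 0\<^sub>v (rk X n)" by (subst a) (auto simp: d intro!: eq_vecI)
    finally have "f n *\<^sub>v (r n *\<^sub>v y) - y \<in> coboundaries Y n"
      using r(2) c coboundaries_zero[OF X, of n] unfolding quis_inj_def by metis
    with x show "\<exists>x\<in>cocycles X n. f n *\<^sub>v x - y \<in> coboundaries Y n" by blast
  qed
  ultimately show ?thesis using f by (simp add: quis_iff[OF X Y])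
qed

section \<open>Arrows and squares in matrix form\<close>

lemma Fun1_obI: "is_cpx X \<Longrightarrow> is_cpx Y \<Longrightarrow> chain_map X Y f \<Longrightarrow> (X, (0, f), Y) \<in> dg_ob (Fun1 (Cpx m))"
  by (simp add: Fun1_sel Cpx_Z0 Cpx_sel(1))

lemma Fun1_obE:
  assumes "F \<in> dg_ob (Fun1 (Cpx m))"
  obtains X f Y where "F = (X, (0, f), Y)" "is_cpx X" "is_cpx Y" "chain_map X Y f"
proof -
  obtain X g Y where F: "F = (X, g, Y)" by (cases F)
  with assms have "is_cpx X" "is_cpx Y" "g \<in> Z0_hom (Cpx m) X Y" by (auto simp: Fun1_sel Cpx_sel)
  then show ?thesis using that[of X "snd g" Y] by (cases g) (auto simp: Cpx_Z0 F)
qed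

lemma Fun1_homE:
  assumes "h \<in> dg_hom (Fun1 (Cpx m)) (X, (0, f), Y) (X', (0, f'), Y') n"
  obtains a b where "h = ((n, a), (n, b))"
    "\<And>i. dim_row (a i) = rk X' (i + n)" "\<And>i. dim_col (a i) = rk X i" "\<And>i. dim_row (b i) = rk Y' (i + n)" "\<And>i. dim_col (b i) = rk Y i"
    "\<And>i. b i * f i = f' (i + n) * a i"
proof -
  obtain u v where h: "h = (u, v)" by (cases h)
  with assms have u: "u \<in> dg_hom (Cpx m) X X' n" and v: "v \<in> dg_hom (Cpx m) Y Y' n" and e: "dg_comp (Cpx m) v (0, f) = dg_comp (Cpx m) (0, f') u"
    by (auto simp: Fun1_sel)
  obtain a where a: "u = (n, a)" "\<And>i. dim_row (a i) = rk X' (i + n)" "\<And>i. dim_col (a i) = rk X i" using u by (rule Cpx_homE) blast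
  obtain b where b: "v = (n, b)" "\<And>i. dim_row (b i) = rk Y' (i + n)" "\<And>i. dim_col (b i) = rk Y i" using v by (rule Cpx_homE) blast
  have "b i * f i = f' (i + n) * a i" for i using e by (simp add: a b Cpx_sel fun_eq_iff)
  with a b h that show ?thesis by blast
qed

text \<open>As B is contractible, \<open>j i * h (i + 1)\<close> is a null homotopy of
  \<open>j\<close>; together with the identity of A it retracts the cone onto A. This is applied to
  B = C \<otimes> X and A the cone of f, where it handles both legs of the zigzag between the
  identity and GF.\<close>

lemma cone_retraction:
  assumes A: "is_cpx A" and B: "is_cpx B" and j: "chain_map B A j" and h: "contraction B h"
  defines "r \<equiv> \<lambda>i. four_block_mat (1\<^sub>m (rk A i)) (j i * h (i + 1)) (0\<^sub>m 0 (rk A i)) (0\<^sub>m 0 (rk B (i + 1)))"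
  shows "chain_map (cone_ob (B, (0, j), A)) A r" "quis_inj (cone_ob (B, (0, j), A)) A r"
    "blk_unit B A \<in> quis A (cone_ob (B, (0, j), A))"
proof -
  let ?C = "cone_ob (B, (0, j), A)"
  define u where "u = snd (blk_unit B A)"
  have C: "is_cpx ?C" using is_cpx_cone[OF Fun1_obI[OF B A j, of 0]] .
  have h': "\<And>i. h i \<in> carrier_mat (rk B (i - 1)) (rk B i)" "\<And>i. df B (i - 1) * h i + h (i + 1) * df B i = 1\<^sub>m (rk B i)"
    using h by (auto simp: contraction_def)
  have dh: "dim_col (h i) = rk B i" "dim_row (h (i + 1)) = rk B i" "dim_row (h (i + 2)) = rk B (i + 1)" for i
    using h'(1)[of i] h'(1)[of "i + 1"] h'(1)[of "i + 2"] by (simp_all add: idx')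
  note d = chain_map_simps(1,2)[OF j] is_cpx_simps(1,2)[OF A] is_cpx_simps(1,2)[OF B] dh
  have h2: "df B i * h (i + 1) + h (i + 2) * df B (i + 1) = 1\<^sub>m (rk B (i + 1))" for i using h'(2)[of "i + 1"] by (simp add: idx)
  have null: "df A i * (j i * h (i + 1)) = j (i + 1) + - (j (i + 1) * h (i + 2) * df B (i + 1))" for i
  proof -
    have "j (i + 1) = j (i + 1) * (df B i * h (i + 1) + h (i + 2) * df B (i + 1))" unfolding h2 by (simp add: mult_one d)
    also have "\<dots> = j (i + 1) * df B i * h (i + 1) + j (i + 1) * h (i + 2) * df B (i + 1)" by (simp add: mat_distrib mat_assoc d idx)
    also have "j (i + 1) * df B i * h (i + 1) = df A i * (j i * h (i + 1))"
      unfolding chain_map_simps(3)[OF j, symmetric] by (simp add: mat_assoc d)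
    finally have e: "j (i + 1) = df A i * (j i * h (i + 1)) + j (i + 1) * h (i + 2) * df B (i + 1)" .
    have "M = N" if "L = M + K" "N = L + - K" "dim_row M = dim_row K" "dim_col M = dim_col K" for L M N K :: "'a mat"
      using that by (auto intro!: eq_matI)
    from this[OF e refl] show ?thesis by (simp add: d)
  qed
  show r: "chain_map ?C A r"
    unfolding chain_map_def
  proof (intro conjI allI)
    fix i
    show "r i \<in> carrier_mat (rk A i) (rk ?C i)" by (intro carrier_matI) (simp_all add: r_def d)
    have "df A i * r i = four_block_mat (df A i) (df A i * (j i * h (i + 1))) (0\<^sub>m 0 (rk A i)) (0\<^sub>m 0 (rk B (i + 1)))"
      by (simp add: r_def blk_row_mult d mult_one)
    also have "\<dots> = r (i + 1) * df ?C i"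
      by (simp add: r_def blk_mult d idx null one_mult mult_zero zero_mult add_zero uminus_mult minus_mats)
    finally show "df A i * r i = r (i + 1) * df ?C i" .
  qed
  have ud: "u i = four_block_mat (1\<^sub>m (rk A i)) (0\<^sub>m (rk A i) 0) (0\<^sub>m (rk B (i + 1)) (rk A i)) (0\<^sub>m (rk B (i + 1)) 0)" for i
    by (simp add: u_def blk_unit_def)
  have "blk_unit B A \<in> Z0_hom (Cpx 0) A ?C"
    using exact_cone[OF refl Fun1_obI[OF B A j, of 0], of 0] by (simp add: exact_seq_def)
  then have u: "chain_map A ?C u" unfolding Cpx_Z0[OF A C] u_def by blast
  have ru: "r i * u i = 1\<^sub>m (rk A i)" for i
    by (simp add: r_def ud blk_mult d one_mult mult_zero zero_mult add_zero blk_triv)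
  \<comment> \<open>The homotopy is the contraction of B on the summand B[1] and zero on A. The
    differential of B[1] carries a minus sign, so d l + l d is -1 in the lower right corner, where
    \<open>u i * r i\<close> vanishes.\<close>
  define l where "l i = four_block_mat (0\<^sub>m (rk A (i - 1)) (rk A i)) (0\<^sub>m (rk A (i - 1)) (rk B (i + 1))) (0\<^sub>m (rk B i) (rk A i)) (h (i + 1))" for i
  have ur: "u i * r i = 1\<^sub>m (rk ?C i) + (df ?C (i - 1) * l i + l (i + 1) * df ?C i)" for i
  proof -
    have d1: "dim_row (df A (i - 1)) = rk A i" "dim_col (df A (i - 1)) = rk A (i - 1)" using d(3,4)[of "i - 1"] by simp_all
    have 1: "u i * r i = four_block_mat (1\<^sub>m (rk A i)) (j i * h (i + 1)) (0\<^sub>m (rk B (i + 1)) (rk A i)) (0\<^sub>m (rk B (i + 1)) (rk B (i + 1)))"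
      by (simp add: r_def ud blk_mult d one_mult mult_zero zero_mult add_zero)
    have 2: "df ?C (i - 1) * l i = four_block_mat (0\<^sub>m (rk A i) (rk A i)) (j i * h (i + 1)) (0\<^sub>m (rk B (i + 1)) (rk A i)) (- (df B i * h (i + 1)))"
      by (simp add: l_def blk_mult d d1 one_mult mult_zero zero_mult add_zero uminus_mult minus_mats idx')
    have 3: "l (i + 1) * df ?C i = four_block_mat (0\<^sub>m (rk A i) (rk A i)) (0\<^sub>m (rk A i) (rk B (i + 1))) (0\<^sub>m (rk B (i + 1)) (rk A i)) (- (h (i + 2) * df B (i + 1)))"
      by (simp add: l_def blk_mult d d1 one_mult mult_zero zero_mult add_zero uminus_mult minus_mats idx)
    have 4: "1\<^sub>m (rk B (i + 1)) + (- (df B i * h (i + 1)) + - (h (i + 2) * df B (i + 1))) = 0\<^sub>m (rk B (i + 1)) (rk B (i + 1))"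
      unfolding h2[symmetric] by (intro eq_matI) (simp_all add: d idx del: index_mult_mat(1))
    have 5: "1\<^sub>m (rk ?C i) = four_block_mat (1\<^sub>m (rk A i)) (0\<^sub>m (rk A i) (rk B (i + 1))) (0\<^sub>m (rk B (i + 1)) (rk A i)) (1\<^sub>m (rk B (i + 1)))"
      by simp
    show ?thesis unfolding 1 2 3 5 by (simp add: blk_add d idx add_zero 4 del: four_block_one_mat)
  qed
  have "homotopic_id ?C (\<lambda>i. u i * r i)" unfolding homotopic_id_def
    by (intro exI[of _ l] conjI allI carrier_matI ur) (simp_all add: l_def d)
  from quis_if_homotopy_equivalence[OF A C u r homotopic_id_if_eq[OF A ru] this]
  show "blk_unit B A \<in> quis A ?C" by (simp add: u_def blk_unit_def)
  have "(0, r) \<in> quis ?C A"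
    by (rule quis_if_homotopy_equivalence[OF C A r u]) (use \<open>homotopic_id ?C (\<lambda>i. u i * r i)\<close> homotopic_id_if_eq[OF A ru] in auto)
  then show "quis_inj ?C A r" unfolding quis_iff[OF C A] snd_conv by blast
qed

text \<open>Multiplication by e, which sends 1 \<otimes> x to e \<otimes> x and kills e \<otimes> x,
  is a contraction because de = 1.\<close>

lemma C_tensor_contraction:
  assumes "is_cpx X"
  shows "contraction (C_tensor X) (\<lambda>i. four_block_mat (0\<^sub>m (rk X (i - 1)) (rk X i)) (0\<^sub>m (rk X (i - 1)) (rk X (i + 1))) (1\<^sub>m (rk X i)) (0\<^sub>m (rk X i) (rk X (i + 1))))"
proof -
  note d = is_cpx_simps(1,2)[OF assms]
  have d1: "dim_row (df X (i - 1)) = rk X i" "dim_col (df X (i - 1)) = rk X (i - 1)" for i using d(1,2)[of "i - 1"] by simp_all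
  show ?thesis
    unfolding contraction_def
    by (auto simp: C_tensor_def d d1 blk_mult blk_add one_mult mult_one mult_zero zero_mult add_zero uminus_mult minus_mats idx idx'
      intro!: carrier_matI)
qed

text \<open>The sign on X comes from exchanging e with the suspension. The isomorphism squares to
  the identity, so the same family serves as \<open>\<eta>\<close> and as
  \<open>\<eta>'\<close>.\<close>

definition cone_eta :: "'a::{comm_ring, comm_monoid_mult} cpx \<times> 'a gmap \<times> 'a cpx \<Rightarrow> 'a gmap" where
  "cone_eta = (\<lambda>(X, f, Y). (0, \<lambda>i. blk_diag (1\<^sub>m (rk Y (i + 1))) (- 1\<^sub>m (rk X (i + 2)))))"

definition zero_cpx :: "'a::{comm_ring, comm_monoid_mult} cpx" where
  "zero_cpx = \<lparr>rk = (\<lambda>i. 0), df = (\<lambda>i. 0\<^sub>m 0 0)\<rparr>"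

definition from_zero :: "'a::{comm_ring, comm_monoid_mult} cpx \<Rightarrow> 'a cpx \<times> 'a gmap \<times> 'a cpx" where
  "from_zero Z = (zero_cpx, (0, \<lambda>i. 0\<^sub>m (rk Z i) 0), Z)"

definition from_zero_hom :: "'a::{comm_ring, comm_monoid_mult} gmap \<Rightarrow> 'a gmap \<times> 'a gmap" where
  "from_zero_hom h = ((0, \<lambda>i. 0\<^sub>m 0 0), h)"

text \<open>The middle component of the first map in \<open>cone_lift\<close>, that is, f pushed out
  along the inclusion of X in C \<otimes> X. Its source is contractible, so up to quasi-isomorphism
  its cone is its target, the cone of f.\<close>

definition cone_pushout :: "'a::{comm_ring, comm_monoid_mult} cpx \<times> 'a gmap \<times> 'a cpx \<Rightarrow> 'a cpx \<times> 'a gmap \<times> 'a cpx" where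
  "cone_pushout = (\<lambda>(X, f, Y). (C_tensor X, (0, \<lambda>i. blk_diag (snd f i) (1\<^sub>m (rk X (i + 1)))), cone_ob (X, f, Y)))"

text \<open>C \<otimes> X is the cone of the identity of X, so C \<otimes> a is
  \<open>cone_hom (a, a)\<close>.\<close>

definition cone_pushout_hom :: "'a::{comm_ring, comm_monoid_mult} gmap \<times> 'a gmap \<Rightarrow> 'a gmap \<times> 'a gmap" where
  "cone_pushout_hom = (\<lambda>(a, b). (cone_hom (a, a), cone_hom (a, b)))"

definition cone_alpha :: "'a::{comm_ring, comm_monoid_mult} cpx \<times> 'a gmap \<times> 'a cpx \<Rightarrow> 'a gmap \<times> 'a gmap" where
  "cone_alpha = (\<lambda>(X, f, Y). (blk_unit X X, blk_unit X Y))"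

definition cone_beta :: "'a::{comm_ring, comm_monoid_mult} cpx \<times> 'a gmap \<times> 'a cpx \<Rightarrow> 'a gmap \<times> 'a gmap" where
  "cone_beta = (\<lambda>(X, f, Y). ((0, \<lambda>i. 0\<^sub>m (rk X i + rk X (i + 1)) 0), dg_id (Cpx 0) (cone_ob (X, f, Y))))"

text \<open>\<open>cone_eta\<close> and \<open>cone_phi\<close> are isomorphisms in every degree,
  hence quasi-isomorphisms. The functor laws and naturality conditions are block matrix identities,
  in which the Koszul signs are the only delicate point.\<close>

lemma cone_dg_form_functor:
  "dg_form_functor (Fun1 (Cpx (- 1))) (Cpx 0 :: ('a::{comm_ring, comm_monoid_mult} cpx, 'a gmap) dgcat)
     cone_ob cone_hom cone_eta cone_eta (cone_phi (- 1)) w_cone quis"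
proof -
  interpret A: dg_category "Fun1 (Cpx (- 1)) :: ('a cpx \<times> 'a gmap \<times> 'a cpx, 'a gmap \<times> 'a gmap) dgcat"
    by (rule Fun1_dg_category[OF Cpx_dg_category])
  interpret B: dg_category "Cpx 0 :: ('a cpx, 'a gmap) dgcat" by (rule Cpx_dg_category)
  let ?A = "Fun1 (Cpx (- 1)) :: ('a cpx \<times> 'a gmap \<times> 'a cpx, 'a gmap \<times> 'a gmap) dgcat" and ?B = "Cpx 0 :: ('a cpx, 'a gmap) dgcat"
  have eta: "cone_eta F \<in> quis (cone_ob (dg_shift ?A F)) (shift_cpx (cone_ob F)) \<and>
     cone_eta F \<in> quis (shift_cpx (cone_ob F)) (cone_ob (dg_shift ?A F)) \<and>
     dg_comp ?B (cone_eta F) (cone_eta F) = dg_id ?B (shift_cpx (cone_ob F)) \<and>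
     dg_comp ?B (cone_eta F) (cone_eta F) = dg_id ?B (cone_ob (dg_shift ?A F))"
    if F0: "F \<in> dg_ob ?A" for F
  proof -
    obtain X f Y where F: "F = (X, (0, f), Y)" "is_cpx X" "is_cpx Y" "chain_map X Y f" using F0 by (rule Fun1_obE)
    note d = chain_map_simps(1,2)[OF F(4)] is_cpx_simps(1,2)[OF F(2)] is_cpx_simps(1,2)[OF F(3)]
    define e where "e i = (blk_diag (1\<^sub>m (rk Y (i + 1))) (- 1\<^sub>m (rk X (i + 2))) :: 'a mat)" for i
    have ce: "cone_eta F = (0, e)" by (simp add: cone_eta_def e_def F(1) fun_eq_iff)
    have c: "is_cpx (cone_ob (dg_shift ?A F))" "is_cpx (shift_cpx (cone_ob F))"
      using is_cpx_cone[OF A.shift_ob[OF F0]] is_cpx_shift[OF is_cpx_cone[OF F0]] by auto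
    have ee: "e i * e i = 1\<^sub>m (rk Y (i + 1) + rk X (i + 2))" for i
      by (simp add: e_def blk_diag_def blk_mult mult_one zero_mult mult_zero add_zero uminus_mult minus_mats)
    have ch: "chain_map (cone_ob (dg_shift ?A F)) (shift_cpx (cone_ob F)) e" "chain_map (shift_cpx (cone_ob F)) (cone_ob (dg_shift ?A F)) e"
      unfolding chain_map_def F(1)
      by (auto simp: Fun1_sel Cpx_sel shift_cpx_def e_def blk_diag_def blk_mult mult_one one_mult zero_mult mult_zero add_zero uminus_mult
          minus_mats blk_uminus d idx intro!: carrier_matI)
    have r: "rk (cone_ob (dg_shift ?A F)) i = rk Y (i + 1) + rk X (i + 2)" "rk (shift_cpx (cone_ob F)) i = rk Y (i + 1) + rk X (i + 2)" for i
      by (simp_all add: F(1) Fun1_sel Cpx_sel shift_cpx_def idx)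
    have "e i \<in> carrier_mat (rk Y (i + 1) + rk X (i + 2)) (rk Y (i + 1) + rk X (i + 2))" for i
      by (simp add: e_def blk_diag_def carrier_matI)
    with quis_if_iso[OF c ch(1), of e] quis_if_iso[OF c(2,1) ch(2), of e] ee show ?thesis
      by (simp add: r ce Cpx_sel)
  qed
  have phi: "cone_phi (- 1) F \<in> quis (cone_ob (dg_dual ?A F)) (dual_cpx 0 (cone_ob F))" if F0: "F \<in> dg_ob ?A" for F
  proof -
    obtain X f Y where F: "F = (X, (0, f), Y)" "is_cpx X" "is_cpx Y" "chain_map X Y f" using F0 by (rule Fun1_obE)
    have c: "is_cpx (cone_ob (dg_dual ?A F))" "is_cpx (dual_cpx 0 (cone_ob F))"
      using is_cpx_cone[OF A.dual_ob[OF F0]] is_cpx_dual[OF is_cpx_cone[OF F0]] by auto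
    define p where "p = snd (cone_phi (- 1) F)"
    have cp: "cone_phi (- 1) F = (0, p)" by (simp add: p_def F(1))
    have "cone_phi (- 1) F \<in> Z0_hom (Cpx 0) (cone_ob (dg_dual ?A F)) (dual_cpx 0 (cone_ob F))"
      using cone_phi_closed[OF F(1) F0] by (simp add: Cpx_sel)
    then have ch: "chain_map (cone_ob (dg_dual ?A F)) (dual_cpx 0 (cone_ob F)) p" by (simp add: Cpx_Z0 c cp)
    \<comment> \<open>\<open>cone_phi\<close> exchanges the two summands; its inverse exchanges them
      back, with the self-inverse sign in the opposite corner.\<close>
    define q where "q i = (four_block_mat (0\<^sub>m (rk X (1 - i)) (rk Y (- i))) (ksign i \<cdot>\<^sub>m 1\<^sub>m (rk X (1 - i)))
      (1\<^sub>m (rk Y (- i))) (0\<^sub>m (rk Y (- i)) (rk X (1 - i))) :: 'a mat)" for i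
    have r: "rk (cone_ob (dg_dual ?A F)) i = rk X (1 - i) + rk Y (- i)" "rk (dual_cpx 0 (cone_ob F)) i = rk Y (- i) + rk X (1 - i)" for i
      by (simp_all add: F(1) Fun1_sel Cpx_sel dual_cpx_def)
    have pe: "p i = four_block_mat (0\<^sub>m (rk Y (- i)) (rk X (1 - i))) (1\<^sub>m (rk Y (- i))) (ksign i \<cdot>\<^sub>m 1\<^sub>m (rk X (1 - i))) (0\<^sub>m (rk X (1 - i)) (rk Y (- i)))" for i
      by (simp add: p_def F(1))
    have ks: "ksign i \<cdot>\<^sub>m (ksign i \<cdot>\<^sub>m M) = M" for i and M :: "'a mat" by (auto intro!: eq_matI simp: mult.assoc[symmetric])
    show ?thesis unfolding cp
      by (rule quis_if_iso[OF c ch, of q])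
        (simp_all add: r pe q_def carrier_matI blk_mult mult_one one_mult zero_mult mult_zero add_zero smult_mult ks)
  qed
  show ?thesis
  proof (unfold_locales, goal_cases)
    case (1 F)
    then show ?case using is_cpx_cone by (simp add: Cpx_sel)
  next
    case (2 F G h n)
    obtain X f Y where F: "F = (X, (0, f), Y)" "is_cpx X" "is_cpx Y" "chain_map X Y f" using 2(1) by (rule Fun1_obE)
    obtain X' f' Y' where G: "G = (X', (0, f'), Y')" "is_cpx X'" "is_cpx Y'" "chain_map X' Y' f'" using 2(2) by (rule Fun1_obE)
    obtain a b where h: "h = ((n, a), (n, b))" "\<And>i. dim_row (a i) = rk X' (i + n)" "\<And>i. dim_col (a i) = rk X i"
      "\<And>i. dim_row (b i) = rk Y' (i + n)" "\<And>i. dim_col (b i) = rk Y i" "\<And>i. b i * f i = f' (i + n) * a i"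
      using 2(3) unfolding F(1) G(1) by (rule Fun1_homE) blast
    have i: "i + 1 + n = i + n + 1" for i by simp
    show ?case by (auto simp: F(1) G(1) h Cpx_sel i intro!: carrier_matI)
  next
    case (3 F)
    obtain X f Y where F: "F = (X, (0, f), Y)" using 3 by (rule Fun1_obE)
    show ?case by (simp add: F Fun1_sel Cpx_sel minus_mats)
  next
    case (4 F G K h n k m)
    obtain X f Y where F: "F = (X, (0, f), Y)" "is_cpx X" "is_cpx Y" "chain_map X Y f" using 4(1) by (rule Fun1_obE)
    obtain X' f' Y' where G: "G = (X', (0, f'), Y')" "is_cpx X'" "is_cpx Y'" "chain_map X' Y' f'" using 4(2) by (rule Fun1_obE)
    obtain X'' f'' Y'' where K: "K = (X'', (0, f''), Y'')" "is_cpx X''" "is_cpx Y''" "chain_map X'' Y'' f''" using 4(3) by (rule Fun1_obE)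
    obtain a b where h: "h = ((n, a), (n, b))" "\<And>i. dim_row (a i) = rk X' (i + n)" "\<And>i. dim_col (a i) = rk X i"
      "\<And>i. dim_row (b i) = rk Y' (i + n)" "\<And>i. dim_col (b i) = rk Y i" "\<And>i. b i * f i = f' (i + n) * a i"
      using 4(4) unfolding F(1) G(1) by (rule Fun1_homE) blast
    obtain a' b' where k: "k = ((m, a'), (m, b'))" "\<And>i. dim_row (a' i) = rk X'' (i + m)" "\<And>i. dim_col (a' i) = rk X' i"
      "\<And>i. dim_row (b' i) = rk Y'' (i + m)" "\<And>i. dim_col (b' i) = rk Y' i" "\<And>i. b' i * f' i = f'' (i + m) * a' i"
      using 4(5) unfolding G(1) K(1) by (rule Fun1_homE) blast
    have i: "i + 1 + n = i + n + 1" for i by simp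
    have s: "ksign p \<cdot>\<^sub>m (ksign q \<cdot>\<^sub>m M) = ksign (q + p) \<cdot>\<^sub>m M" for p q and M :: "'a mat" by (auto intro!: eq_matI simp: ksign_add ac_simps)
    show ?case
      by (simp add: h k Fun1_sel Cpx_sel i blk_mult zero_mult mult_zero add_zero smult_mult s)
  next
    case (5 F G n)
    obtain X f Y where F: "F = (X, (0, f), Y)" using 5(1) by (rule Fun1_obE)
    obtain X' f' Y' where G: "G = (X', (0, f'), Y')" using 5(2) by (rule Fun1_obE)
    have i: "i + 1 + n = i + n + 1" for i by simp
    show ?case by (simp add: F G Fun1_sel Cpx_sel fun_eq_iff i)
  next
    case (6 F G h k)
    obtain X f Y where F: "F = (X, (0, f), Y)" using 6(1) by (rule Fun1_obE)
    obtain X' f' Y' where G: "G = (X', (0, f'), Y')" using 6(2) by (rule Fun1_obE)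
    obtain a b where h: "h = ((0, a), (0, b))" "\<And>i. dim_row (a i) = rk X' (i + 0)" "\<And>i. dim_col (a i) = rk X i"
      "\<And>i. dim_row (b i) = rk Y' (i + 0)" "\<And>i. dim_col (b i) = rk Y i"
      using 6(3) unfolding F(1) G(1) by (rule Fun1_homE) blast
    obtain a' b' where k: "k = ((0, a'), (0, b'))" "\<And>i. dim_row (a' i) = rk X' (i + 0)" "\<And>i. dim_col (a' i) = rk X i"
      "\<And>i. dim_row (b' i) = rk Y' (i + 0)" "\<And>i. dim_col (b' i) = rk Y i"
      using 6(4) unfolding F(1) G(1) by (rule Fun1_homE) blast
    show ?case by (simp add: h k Fun1_sel Cpx_sel blk_add add_zero minus_mats)
  next
    case (7 F G h n)
    obtain X f Y where F: "F = (X, (0, f), Y)" "is_cpx X" "is_cpx Y" "chain_map X Y f" using 7(1) by (rule Fun1_obE)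
    obtain X' f' Y' where G: "G = (X', (0, f'), Y')" "is_cpx X'" "is_cpx Y'" "chain_map X' Y' f'" using 7(2) by (rule Fun1_obE)
    obtain a b where h: "h = ((n, a), (n, b))" "\<And>i. dim_row (a i) = rk X' (i + n)" "\<And>i. dim_col (a i) = rk X i"
      "\<And>i. dim_row (b i) = rk Y' (i + n)" "\<And>i. dim_col (b i) = rk Y i" "\<And>i. b i * f i = f' (i + n) * a i"
      using 7(3) unfolding F(1) G(1) by (rule Fun1_homE) blast
    note d = chain_map_simps(1,2)[OF F(4)] is_cpx_simps(1,2)[OF F(2)] is_cpx_simps(1,2)[OF F(3)]
      chain_map_simps(1,2)[OF G(4)] is_cpx_simps(1,2)[OF G(2)] is_cpx_simps(1,2)[OF G(3)]
    have i: "i + 1 + n = i + n + 1" "i + 2 + n = i + n + 2" "2 + i + n = i + n + 2" for i by simp_all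
    have e: "f' (i + n + 1) * a (i + 1) = b (i + 1) * f (i + 1)" for i using h(6)[of "i + 1"] by (simp add: i)
    have su: "k \<cdot>\<^sub>m (- M) = - (k \<cdot>\<^sub>m M)" for k and M :: "'a mat" by (auto intro!: eq_matI)
    \<comment> \<open>The lower right block: the sign \<open>ksign n\<close> with which a map of
      degree n acts on e \<otimes> x and the minus sign of the differential there combine to
      \<open>ksign (n + 1)\<close>, the sign with which the differential of that map must
      act.\<close>
    have m: "- (ksign n \<cdot>\<^sub>m P) - - (ksign n \<cdot>\<^sub>m (ksign n \<cdot>\<^sub>m Q)) = ksign (n + 1) \<cdot>\<^sub>m (P - ksign n \<cdot>\<^sub>m Q)"
      if "dim_row P = dim_row Q" "dim_col P = dim_col Q" for P Q :: "'a mat"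
      by (rule eq_matI) (use that in \<open>simp_all add: ksign_def\<close>)
    show ?case
      by (simp add: F(1) G(1) h(1) Fun1_sel Cpx_sel)
        (intro ext, simp add: h(2-5) d i idx idx' su blk_mult blk_minus blk_smult mult_zero zero_mult add_zero minus_mats smult_mult uminus_mult e m)
  next
    case (8 F) then show ?case unfolding Cpx_sel(8) using eta by blast
  next
    case (9 F) then show ?case unfolding Cpx_sel(8) using eta by blast
  next
    case (10 F) then show ?case unfolding Cpx_sel(8) using eta by blast
  next
    case (11 F) then show ?case unfolding Cpx_sel(8) using eta by blast
  next
    case (12 F G h)
    obtain X f Y where F: "F = (X, (0, f), Y)" using 12(1) by (rule Fun1_obE)
    obtain X' f' Y' where G: "G = (X', (0, f'), Y')" using 12(2) by (rule Fun1_obE)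
    obtain a b where h: "h = ((0, a), (0, b))" "\<And>i. dim_row (a i) = rk X' (i + 0)" "\<And>i. dim_col (a i) = rk X i"
      "\<And>i. dim_row (b i) = rk Y' (i + 0)" "\<And>i. dim_col (b i) = rk Y i"
      using 12(3) unfolding F(1) G(1) by (rule Fun1_homE) blast
    show ?case
      by (simp add: F G h Fun1_sel Cpx_sel cone_eta_def blk_diag_def idx blk_mult mult_zero zero_mult mult_one one_mult add_zero minus_mats uminus_mult)
  next
    case (13 F)
    obtain X f Y where F: "F = (X, (0, f), Y)" using 13(1) by (rule Fun1_obE)
    show ?case
      by (simp add: F Fun1_sel Cpx_sel cone_eta_def blk_diag_def idx idx' blk_mult mult_zero zero_mult mult_one one_mult add_zero minus_mats uminus_mult)
  next
    case (14 F) then show ?case using phi by (simp add: Cpx_sel)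
  next
    case (15 F G h)
    obtain X f Y where F: "F = (X, (0, f), Y)" using 15(1) by (rule Fun1_obE)
    obtain X' f' Y' where G: "G = (X', (0, f'), Y')" using 15(2) by (rule Fun1_obE)
    obtain a b where h: "h = ((0, a), (0, b))" "\<And>i. dim_row (a i) = rk X' (i + 0)" "\<And>i. dim_col (a i) = rk X i"
      "\<And>i. dim_row (b i) = rk Y' (i + 0)" "\<And>i. dim_col (b i) = rk Y i"
      using 15(3) unfolding F(1) G(1) by (rule Fun1_homE) blast
    show ?case
      by (simp add: F G h Fun1_sel Cpx_sel blk_transpose blk_mult mult_zero zero_mult mult_one one_mult add_zero minus_mats smult_mult)
  next
    case (16 F)
    obtain X f Y where F: "F = (X, (0, f), Y)" using 16(1) by (rule Fun1_obE)
    \<comment> \<open>For the duality of index -1 the sign exponent i (1 - i) of the canonical map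
      is always even, while for index 0 it has the parity of i. The resulting discrepancy is
      compensated by the block with sign \<open>ksign i\<close> in \<open>cone_phi\<close>.\<close>
    have k: "(ksign (i * (1 - i)) :: 'a) = 1" "(ksign (i * i) :: 'a) = ksign i" for i by (auto simp: ksign_def)
    have ks: "ksign i \<cdot>\<^sub>m (ksign i \<cdot>\<^sub>m M) = M" for i and M :: "'a mat" by (auto intro!: eq_matI simp: mult.assoc[symmetric])
    show ?case
      by (simp add: F Fun1_sel Cpx_sel dual_cpx_def k ks idx' blk_transpose blk_smult blk_mult mult_zero zero_mult mult_one one_mult add_zero minus_mats smult_mult transpose_smult)
  next
    case (17 F G h) then show ?case by (simp add: w_cone_def)
  next
    case (18 P Q) show ?case by (auto simp: quis_def)
  next
    case (19 P Q R k l) then show ?case by (auto simp: Cpx_sel(1) intro: quis_comp)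
  next
    case (20 P Q k) then show ?case by (auto simp: Cpx_sel(1,8) intro: quis_shift)
  qed
qed


text \<open>The index of \<open>Cpx\<close> affects the duality alone, so closed maps may be moved
  freely between the source and the target of the cone functor.\<close>

lemma Z0_hom_Cpx: "Z0_hom (Cpx m) = Z0_hom (Cpx k)"
  by (intro ext) (simp add: Z0_hom_def Cpx_def)

lemma dg_comp_Cpx: "dg_comp (Cpx m) = dg_comp (Cpx k)"
  by (simp add: Cpx_def)

section \<open>The arrows from zero as an inverse of the cone\<close>

lemma cone_from_zero:
  assumes "is_cpx Z" shows "cone_ob (from_zero Z) = Z"
  by (simp add: from_zero_def zero_cpx_def minus_mats blk_triv is_cpx_simps[OF assms])

lemma cone_from_zero_hom: "fst h = 0 \<Longrightarrow> cone_hom (from_zero_hom h) = h"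
  by (cases h) (simp add: from_zero_hom_def minus_mats blk_triv)

text \<open>The data of \<open>rel_equivalence\<close> are \<open>from_zero\<close> for G,
  \<open>cone_pushout\<close> for H, and \<open>cone_alpha\<close>, \<open>cone_beta\<close> for the
  two legs. The work lies in showing that both legs become quasi-isomorphisms on cones.\<close>

lemma cone_dg_form_equivalence:
  "dg_form_equivalence (Fun1 (Cpx (- 1))) (Cpx 0 :: ('a::{comm_ring, comm_monoid_mult} cpx, 'a gmap) dgcat)
     cone_ob cone_hom cone_eta cone_eta (cone_phi (- 1)) w_cone quis
     from_zero (\<lambda>Z Z'. from_zero_hom) cone_pushout (\<lambda>F G. cone_pushout_hom) cone_alpha cone_beta"
proof -
  interpret cone: dg_form_functor "Fun1 (Cpx (- 1))" "Cpx 0 :: ('a cpx, 'a gmap) dgcat" cone_ob cone_hom cone_eta cone_eta "cone_phi (- 1)" w_cone quis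
    by (rule cone_dg_form_functor)
  let ?A = "Fun1 (Cpx (- 1)) :: ('a cpx \<times> 'a gmap \<times> 'a cpx, 'a gmap \<times> 'a gmap) dgcat" and ?B = "Cpx 0 :: ('a cpx, 'a gmap) dgcat"
  have zc: "is_cpx (zero_cpx :: 'a cpx)" by (simp add: is_cpx_def zero_cpx_def mult_zero)
  have fz: "from_zero Z \<in> dg_ob ?A" if "is_cpx Z" for Z
    unfolding from_zero_def
    by (intro Fun1_obI zc that) (auto simp: chain_map_def zero_cpx_def mult_zero is_cpx_simps[OF that])
  have fzh: "from_zero_hom h \<in> Z0_hom ?A (from_zero Z) (from_zero Z')" if Z: "is_cpx Z" "is_cpx Z'" and h: "h \<in> Z0_hom ?B Z Z'" for Z Z' h
  proof -
    from h have "h \<in> Z0_hom (Cpx (- 1)) Z Z'" using Z0_hom_Cpx by metis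
    moreover obtain b where b: "h = (0, b)" "chain_map Z Z' b" using h by (cases h) (auto simp: Cpx_Z0 Z)
    moreover have "(0, \<lambda>i. 0\<^sub>m 0 0) \<in> Z0_hom (Cpx (- 1)) zero_cpx (zero_cpx :: 'a cpx)"
      by (simp add: Cpx_Z0 zc) (simp add: chain_map_def zero_cpx_def)
    ultimately show ?thesis
      by (auto simp: from_zero_hom_def from_zero_def Fun1_Z0 Cpx_sel mult_zero zero_mult chain_map_simps[OF b(2)])
  qed
  have G: "relfunctor (Z0 ?B) quis (Z0 ?A) w_cone from_zero (\<lambda>Z Z'. from_zero_hom)"
    unfolding relfunctor_def relfunctor_axioms_def is_functor_def
  proof (intro conjI ballI allI impI cone.F.C.relcat_axioms cone.F.D.relcat_axioms)
    fix Z assume "Z \<in> Ob (Z0 ?B)"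
    then have Z: "is_cpx Z" by (simp add: Z0_def Cpx_sel)
    show "from_zero Z \<in> Ob (Z0 ?A)" using fz[OF Z] by (simp add: Z0_def)
    show "from_zero_hom (Ident (Z0 ?B) Z) = Ident (Z0 ?A) (from_zero Z)"
      by (auto simp: Z0_def from_zero_hom_def from_zero_def Fun1_sel Cpx_sel zero_cpx_def intro!: eq_matI)
  next
    fix Z Z' h assume "Z \<in> Ob (Z0 ?B)" "Z' \<in> Ob (Z0 ?B)" "h \<in> Hom (Z0 ?B) Z Z'"
    then show "from_zero_hom h \<in> Hom (Z0 ?A) (from_zero Z) (from_zero Z')" using fzh by (simp add: Z0_def Cpx_sel(1))
  next
    fix X Y Z h k assume "X \<in> Ob (Z0 ?B)" "Y \<in> Ob (Z0 ?B)" "Z \<in> Ob (Z0 ?B)" "h \<in> Hom (Z0 ?B) X Y" "k \<in> Hom (Z0 ?B) Y Z"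
    then show "from_zero_hom (Comp (Z0 ?B) X Y Z k h) =
      Comp (Z0 ?A) (from_zero X) (from_zero Y) (from_zero Z) (from_zero_hom k) (from_zero_hom h)"
      by (simp add: Z0_def from_zero_hom_def Fun1_sel dg_comp_Cpx[of "- 1" 0]) (simp add: Cpx_sel mult_zero)
  next
    fix Z Z' h assume "Z \<in> Ob (Z0 ?B)" "Z' \<in> Ob (Z0 ?B)" and h: "h \<in> quis Z Z'"
    then have Z: "is_cpx Z" "is_cpx Z'" by (simp_all add: Z0_def Cpx_sel)
    from h have h0: "h \<in> Z0_hom ?B Z Z'" by (simp add: quis_def)
    then have "fst h = 0" by (simp add: Cpx_Z0 Z)
    then show "from_zero_hom h \<in> w_cone (from_zero Z) (from_zero Z')"
      using h fzh[OF Z h0] by (simp add: w_cone_def cone_from_zero_hom cone_from_zero Z)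
  qed
  have C_cpx: "is_cpx (C_tensor X)" if "is_cpx X" for X :: "'a cpx"
    unfolding C_tensor_cone[where m = "- 1"] using is_cpx_cone[OF Fun_id[OF that]] .
  have unit_Z0: "blk_unit X X \<in> Z0_hom (Cpx m) X (C_tensor X)" if "is_cpx X" for X :: "'a cpx" and m
    using exact_gamma[OF that, of m] by (simp add: gamma_tensor_def exact_seq_def)
  have unit_Z0': "blk_unit X Y \<in> Z0_hom (Cpx m) Y (cone_ob (X, f, Y))" if "(X, f, Y) \<in> dg_ob ?A" for X Y f m
    using exact_cone[OF refl that, of m] by (simp add: exact_seq_def)
  \<comment> \<open>Both facts are contained in \<open>cone_lift_M\<close>: the first map of the
    lift is a map of exact sequences, so its middle component is closed and compatible with the
    inclusions.\<close>
  have j: "(0, \<lambda>i. blk_diag (f i) (1\<^sub>m (rk X (i + 1)))) \<in> Z0_hom (Cpx m) (C_tensor X) (cone_ob (X, (0, f), Y)) \<and>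
      dg_comp (Cpx m) (0, \<lambda>i. blk_diag (f i) (1\<^sub>m (rk X (i + 1)))) (blk_unit X X) = dg_comp (Cpx m) (blk_unit X Y) (0, f)"
    if "(X, (0, f), Y) \<in> dg_ob ?A" for X Y f m
    using cone_lift_M(1)[OF refl that, of m] 
    unfolding cone_lift.simps gamma_tensor_def M_ob_def exact_seq_map_def mem_Collect_eq prod.case snd_conv by blast
  have push: "cone_pushout F \<in> dg_ob ?A" if F0: "F \<in> dg_ob ?A" for F
  proof -
    obtain X f Y where F: "F = (X, (0, f), Y)" "is_cpx X" "is_cpx Y" "chain_map X Y f" using F0 by (rule Fun1_obE)
    have Fob: "(X, (0, f), Y) \<in> dg_ob ?A" using F0 F(1) by simp
    then show ?thesis using j[OF Fob, of "- 1"] C_cpx[OF F(2)] is_cpx_cone[OF Fob]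
      unfolding F(1) cone_pushout_def Fun1_sel(1) by (simp add: Cpx_sel(1))
  qed
  have push_hom: "cone_pushout_hom h \<in> Z0_hom ?A (cone_pushout F) (cone_pushout G)"
    if F0: "F \<in> dg_ob ?A" and G0: "G \<in> dg_ob ?A" and h0: "h \<in> Z0_hom ?A F G" for F G h
  proof -
    obtain X f Y where F: "F = (X, (0, f), Y)" "is_cpx X" "is_cpx Y" "chain_map X Y f" using F0 by (rule Fun1_obE)
    obtain X' f' Y' where G: "G = (X', (0, f'), Y')" "is_cpx X'" "is_cpx Y'" "chain_map X' Y' f'" using G0 by (rule Fun1_obE)
    obtain a b where h: "h = ((0, a), (0, b))" "\<And>i. dim_row (a i) = rk X' (i + 0)" "\<And>i. dim_col (a i) = rk X i"
      "\<And>i. dim_row (b i) = rk Y' (i + 0)" "\<And>i. dim_col (b i) = rk Y i" "\<And>i. b i * f i = f' (i + 0) * a i"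
      using cone.A.Z0_in[OF h0] unfolding F(1) G(1) by (rule Fun1_homE) blast
    note d = h(2-5) chain_map_simps(1,2)[OF F(4)] chain_map_simps(1,2)[OF G(4)]
    have a: "(0, a) \<in> Z0_hom (Cpx (- 1)) X X'" using h0 by (simp add: h(1) F(1) G(1) Fun1_Z0)
    have aa: "((0, a), (0, a)) \<in> Z0_hom ?A (X, dg_id (Cpx (- 1)) X, X) (X', dg_id (Cpx (- 1)) X', X')"
      unfolding Fun1_Z0 using a by (simp add: Cpx_sel mult_one one_mult d)
    have "cone_hom ((0, a), (0, a)) \<in> Z0_hom ?B (C_tensor X) (C_tensor X')"
      using cone.FM_Z0[OF Fun_id[OF F(2)] Fun_id[OF G(2)] aa] unfolding C_tensor_cone[symmetric] .
    moreover have "cone_hom h \<in> Z0_hom ?B (cone_ob F) (cone_ob G)" by (rule cone.FM_Z0[OF F0 G0 h0])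
    ultimately show ?thesis
      unfolding cone_pushout_hom_def cone_pushout_def h(1) F(1) G(1) prod.case Fun1_Z0 Z0_hom_Cpx[of "- 1" 0]
      by (simp add: h(1) F(1) G(1) Cpx_sel(6) blk_diag_def blk_mult mult_zero zero_mult add_zero mult_one one_mult minus_mats d h(6))
  qed
  have alpha: "cone_alpha F \<in> w_cone F (cone_pushout F)" if F0: "F \<in> dg_ob ?A" for F
  proof -
    obtain X f Y where F: "F = (X, (0, f), Y)" "is_cpx X" "is_cpx Y" "chain_map X Y f" using F0 by (rule Fun1_obE)
    have Fob: "(X, (0, f), Y) \<in> dg_ob ?A" using F0 F(1) by simp
    note cF = is_cpx_cone[OF Fob] C_cpx[OF F(2)]
    have z: "cone_alpha F \<in> Z0_hom ?A F (cone_pushout F)"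
      unfolding F(1) cone_alpha_def cone_pushout_def prod.case Fun1_Z0
      using unit_Z0[OF F(2)] unit_Z0'[OF Fob] j[OF Fob, of "- 1"] by simp
    define jj where "jj = (\<lambda>i. blk_diag (f i) (1\<^sub>m (rk X (i + 1))))"
    have jc: "chain_map (C_tensor X) (cone_ob (X, (0, f), Y)) jj"
      using j[OF Fob, of 0] unfolding Cpx_Z0[OF cF(2,1)] by (simp add: jj_def)
    note R = cone_retraction[OF cF jc C_tensor_contraction[OF F(2)]]
    have P: "cone_pushout F = (C_tensor X, (0, jj), cone_ob (X, (0, f), Y))" by (simp add: F(1) cone_pushout_def jj_def)
    define al where "al = snd (cone_hom (cone_alpha F))"
    have al: "cone_hom (cone_alpha F) = (0, al)" by (simp add: al_def F(1) cone_alpha_def blk_unit_def)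
    have cP: "is_cpx (cone_ob (cone_pushout F))" using is_cpx_cone[OF push[OF F0]] .
    have "cone_hom (cone_alpha F) \<in> Z0_hom ?B (cone_ob F) (cone_ob (cone_pushout F))"
      by (rule cone.FM_Z0[OF F0 push[OF F0] z])
    then have ch: "chain_map (cone_ob F) (cone_ob (cone_pushout F)) al"
      unfolding Cpx_Z0[OF is_cpx_cone[OF F0] cP] al by simp
    \<comment> \<open>The retraction composed with the cone of \<alpha> is the identity: y is fixed,
      and e \<otimes> x goes to e \<otimes> (1 \<otimes> x), which the contraction takes to e
      \<otimes> x in C \<otimes> X and \<open>jj\<close> to e \<otimes> x in the cone of f.\<close>
    have "(0, al) \<in> quis (cone_ob F) (cone_ob (cone_pushout F))"
    proof (rule quis_if_retraction[OF is_cpx_cone[OF F0] cP ch R(1,2)[folded P F(1)]])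
      fix i
      have al_i: "al i = four_block_mat
         (four_block_mat (1\<^sub>m (rk Y i)) (0\<^sub>m (rk Y i) 0) (0\<^sub>m (rk X (i + 1)) (rk Y i)) (0\<^sub>m (rk X (i + 1)) 0))
         (0\<^sub>m (rk Y i + rk X (i + 1)) (rk X (i + 1))) (0\<^sub>m (rk X (i + 1) + rk X (i + 2)) (rk Y i))
         (four_block_mat (1\<^sub>m (rk X (i + 1))) (0\<^sub>m (rk X (i + 1)) 0) (0\<^sub>m (rk X (i + 2)) (rk X (i + 1))) (0\<^sub>m (rk X (i + 2)) 0))"
        by (simp add: al_def F(1) cone_alpha_def blk_unit_def idx minus_mats)
      have "jj i * four_block_mat (0\<^sub>m (rk X i) (rk X (i + 1))) (0\<^sub>m (rk X i) (rk X (i + 2))) (1\<^sub>m (rk X (i + 1))) (0\<^sub>m (rk X (i + 1)) (rk X (i + 2)))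
          = four_block_mat (0\<^sub>m (rk Y i) (rk X (i + 1))) (0\<^sub>m (rk Y i) (rk X (i + 2))) (1\<^sub>m (rk X (i + 1))) (0\<^sub>m (rk X (i + 1)) (rk X (i + 2)))"
        by (simp add: jj_def blk_diag_def blk_mult mult_zero zero_mult add_zero one_mult chain_map_simps[OF F(4)])
      note jh = this
      show "four_block_mat (1\<^sub>m (rk (cone_ob F) i)) (jj i * four_block_mat (0\<^sub>m (rk X (i + 1 - 1)) (rk X (i + 1))) (0\<^sub>m (rk X (i + 1 - 1)) (rk X (i + 1 + 1))) (1\<^sub>m (rk X (i + 1))) (0\<^sub>m (rk X (i + 1)) (rk X (i + 1 + 1))))
         (0\<^sub>m 0 (rk (cone_ob F) i)) (0\<^sub>m 0 (rk (C_tensor X) (i + 1))) * al i = 1\<^sub>m (rk (cone_ob F) i)"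
        unfolding al_i add_diff_cancel_right' idx(1) jh
        by (simp add: F(1) C_tensor_def idx blk_mult mult_zero zero_mult add_zero one_mult mult_one) (auto intro!: eq_matI)
    qed
    then show ?thesis using z al by (simp add: w_cone_def)
  qed
  have beta: "cone_beta F \<in> w_cone (from_zero (cone_ob F)) (cone_pushout F)" if F0: "F \<in> dg_ob ?A" for F
  proof -
    obtain X f Y where F: "F = (X, (0, f), Y)" "is_cpx X" "is_cpx Y" "chain_map X Y f" using F0 by (rule Fun1_obE)
    have Fob: "(X, (0, f), Y) \<in> dg_ob ?A" using F0 F(1) by simp
    note cF = is_cpx_cone[OF Fob] C_cpx[OF F(2)]
    note d = chain_map_simps(1,2)[OF F(4)] is_cpx_simps(1,2)[OF F(2)] is_cpx_simps(1,2)[OF F(3)]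
    define jj where "jj = (\<lambda>i. blk_diag (f i) (1\<^sub>m (rk X (i + 1))))"
    have jc: "chain_map (C_tensor X) (cone_ob (X, (0, f), Y)) jj"
      using j[OF Fob, of 0] unfolding Cpx_Z0[OF cF(2,1)] by (simp add: jj_def)
    have P: "cone_pushout F = (C_tensor X, (0, jj), cone_ob (X, (0, f), Y))" by (simp add: F(1) cone_pushout_def jj_def)
    have z0: "(0, \<lambda>i. 0\<^sub>m (rk X i + rk X (i + 1)) 0) \<in> Z0_hom (Cpx (- 1)) zero_cpx (C_tensor X)"
      unfolding Cpx_Z0[OF zc cF(2)] by (simp add: chain_map_def zero_cpx_def C_tensor_def mult_zero zero_mult idx d)
    have z: "cone_beta F \<in> Z0_hom ?A (from_zero (cone_ob F)) (cone_pushout F)"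
      unfolding P unfolding F(1) cone_beta_def from_zero_def prod.case Fun1_Z0
      using z0 dg_category.id_Z0[OF Cpx_dg_category, of "cone_ob (X, (0, f), Y)" "- 1"] cF(1)
      by (simp add: Cpx_sel jj_def blk_diag_def mult_zero d)
    \<comment> \<open>The cone of \<beta> is the inclusion of the cone of f in the cone of
      \<open>jj\<close>, a quasi-isomorphism because the source C \<otimes> X of \<open>jj\<close>
      is contractible.\<close>
    have "cone_hom (cone_beta F) = blk_unit (C_tensor X) (cone_ob F)"
      by (simp add: F(1) cone_beta_def blk_unit_def Cpx_sel C_tensor_def idx minus_mats)
    then have "cone_hom (cone_beta F) \<in> quis (cone_ob F) (cone_ob (cone_pushout F))"
      using cone_retraction(3)[OF cF jc C_tensor_contraction[OF F(2)]] unfolding P unfolding F(1) by simp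
    then show ?thesis using z by (simp add: w_cone_def cone_from_zero is_cpx_cone[OF F0])
  qed
  show ?thesis
    unfolding dg_form_equivalence_def rel_equivalence_def rel_equivalence_axioms_def
  proof (intro conjI allI impI cone_dg_form_functor cone.F_relfunctor G, goal_cases)
    case (1 F) then show ?case using push by (simp add: Z0_def)
  next
    case (2 F G h) then show ?case using push_hom by (simp add: Z0_def)
  next
    case (3 F) then show ?case using alpha by (simp add: Z0_def)
  next
    case (4 F) then show ?case using beta by (simp add: Z0_def)
  next
    case (5 F G h)
    then have FG: "F \<in> dg_ob ?A" "G \<in> dg_ob ?A" "h \<in> Z0_hom ?A F G" by (simp_all add: Z0_def)
    obtain X f Y where F: "F = (X, (0, f), Y)" using FG(1) by (rule Fun1_obE)
    obtain X' f' Y' where G: "G = (X', (0, f'), Y')" using FG(2) by (rule Fun1_obE)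
    obtain a b where h: "h = ((0, a), (0, b))" "\<And>i. dim_row (a i) = rk X' (i + 0)" "\<And>i. dim_col (a i) = rk X i"
      "\<And>i. dim_row (b i) = rk Y' (i + 0)" "\<And>i. dim_col (b i) = rk Y i"
      using cone.A.Z0_in[OF FG(3)] unfolding F(1) G(1) by (rule Fun1_homE) blast
    show ?case
      by (simp add: Z0_def F G h cone_alpha_def cone_pushout_hom_def Fun1_sel Cpx_sel(6) blk_unit_def blk_col_mult blk_mult
          mult_zero zero_mult add_zero mult_one one_mult minus_mats)
  next
    case (6 F G h)
    then have FG: "F \<in> dg_ob ?A" "G \<in> dg_ob ?A" "h \<in> Z0_hom ?A F G" by (simp_all add: Z0_def)
    obtain X f Y where F: "F = (X, (0, f), Y)" using FG(1) by (rule Fun1_obE)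
    obtain X' f' Y' where G: "G = (X', (0, f'), Y')" using FG(2) by (rule Fun1_obE)
    obtain a b where h: "h = ((0, a), (0, b))" "\<And>i. dim_row (a i) = rk X' (i + 0)" "\<And>i. dim_col (a i) = rk X i"
      "\<And>i. dim_row (b i) = rk Y' (i + 0)" "\<And>i. dim_col (b i) = rk Y i"
      using cone.A.Z0_in[OF FG(3)] unfolding F(1) G(1) by (rule Fun1_homE) blast
    show ?case
      by (simp add: Z0_def F G h cone_beta_def cone_pushout_hom_def from_zero_hom_def Fun1_sel Cpx_sel
          mult_zero zero_mult mult_one one_mult minus_mats del: four_block_one_mat)
  next
    case (7 Z) then show ?case by (simp add: Z0_def Cpx_sel cone_from_zero)
  next
    case (8 Z Z' k) then show ?case by (auto simp: Z0_def Cpx_sel(1) Cpx_Z0 cone_from_zero_hom)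
  qed
qed

section \<open>The parity of the total rank\<close>

definition mat_trace :: "'a::comm_monoid_add mat \<Rightarrow> 'a" where
  "mat_trace A = (\<Sum>i = 0..<dim_row A. A $$ (i, i))"

lemma mat_trace_mult_comm:
  assumes "dim_row A = dim_col B" "dim_col A = dim_row B"
  shows "mat_trace (A * B) = mat_trace (B * (A :: 'a::comm_semiring_0 mat))"
proof -
  have "mat_trace (A * B) = (\<Sum>i = 0..<dim_row A. \<Sum>j = 0..<dim_col A. A $$ (i, j) * B $$ (j, i))"
    using assms by (auto simp: mat_trace_def scalar_prod_def intro!: sum.cong)
  also have "\<dots> = (\<Sum>j = 0..<dim_col A. \<Sum>i = 0..<dim_row A. B $$ (j, i) * A $$ (i, j))"
    by (subst sum.swap) (simp add: mult.commute)
  also have "\<dots> = mat_trace (B * A)"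
    using assms by (auto simp: mat_trace_def scalar_prod_def intro!: sum.cong)
  finally show ?thesis .
qed

lemma mat_trace_add:
  "dim_row A = dim_row B \<Longrightarrow> dim_col A = dim_row B \<Longrightarrow> dim_col B = dim_row B \<Longrightarrow> mat_trace (A + B) = mat_trace A + mat_trace B"
  by (simp add: mat_trace_def sum.distrib)

lemma mat_trace_uminus:
  "dim_col A = dim_row A \<Longrightarrow> mat_trace (- A) = - mat_trace (A :: 'a::ab_group_add mat)"
  by (simp add: mat_trace_def sum_negf)

lemma mat_trace_transpose: "dim_col A = dim_row A \<Longrightarrow> mat_trace (transpose_mat A) = mat_trace A"
  by (simp add: mat_trace_def)

lemma mat_trace_zero_dim: "dim_row A = 0 \<Longrightarrow> mat_trace A = 0"
  by (simp add: mat_trace_def)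

section \<open>Congruence modulo 2R\<close>

definition eq2 :: "'a::comm_ring \<Rightarrow> 'a \<Rightarrow> bool" where
  "eq2 x y \<longleftrightarrow> (\<exists>z. x = y + (z + z))"

definition nat_sum :: "nat \<Rightarrow> 'a::{comm_monoid_add, one}" where  \<comment> \<open>\<open>of_nat\<close> would exclude the zero ring\<close>
  "nat_sum n = (\<Sum>i = 0..<n. 1)"

lemma eq2_refl: "eq2 x x" unfolding eq2_def by (intro exI[of _ 0]) simp
lemma eq2_sym: "eq2 x y \<Longrightarrow> eq2 y x"
proof -
  assume "eq2 x y"
  then obtain z where "x = y + (z + z)" by (auto simp: eq2_def)
  then have "y = x + (- z + - z)" by simp
  then show "eq2 y x" unfolding eq2_def by blast
qed
lemma eq2_trans: "eq2 x y \<Longrightarrow> eq2 y u \<Longrightarrow> eq2 x u"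
proof -
  assume "eq2 x y" "eq2 y u"
  then obtain z w where "x = y + (z + z)" "y = u + (w + w)" by (auto simp: eq2_def)
  then have "x = u + ((z + w) + (z + w))" by (simp add: algebra_simps)
  then show "eq2 x u" unfolding eq2_def by blast
qed
lemma eq2_add: "eq2 x y \<Longrightarrow> eq2 x' y' \<Longrightarrow> eq2 (x + x') (y + y')"
proof -
  assume "eq2 x y" "eq2 x' y'"
  then obtain z w where "x = y + (z + z)" "x' = y' + (w + w)" by (auto simp: eq2_def)
  then have "x + x' = (y + y') + ((z + w) + (z + w))" by (simp add: algebra_simps)
  then show ?thesis unfolding eq2_def by blast
qed
lemma eq2_uminus: "eq2 (- x) x"
  unfolding eq2_def by (intro exI[of _ "- x"]) simp
lemma eq2_double: "eq2 (x + x) 0"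
  unfolding eq2_def by (intro exI[of _ x]) simp
lemma eq2_sum: "(\<And>i. i \<in> I \<Longrightarrow> eq2 (f i) (g i)) \<Longrightarrow> eq2 (sum f I) (sum g I)"
  by (induction I rule: infinite_finite_induct) (auto intro: eq2_refl eq2_add)

lemma nat_sum_0: "nat_sum 0 = 0" and nat_sum_Suc: "nat_sum (Suc n) = nat_sum n + 1"
  by (simp_all add: nat_sum_def)

lemma nat_sum_add: "nat_sum (m + n) = nat_sum m + nat_sum n"
  by (induction n) (simp_all add: nat_sum_0 nat_sum_Suc add.assoc)

lemmas nat_sum_simps = nat_sum_0 nat_sum_Suc nat_sum_add

lemma nat_sum_sum: "finite I \<Longrightarrow> nat_sum (sum f I) = (\<Sum>i\<in>I. nat_sum (f i))"
  by (induction I rule: finite_induct) (simp_all add: nat_sum_simps)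

lemma mat_trace_one: "mat_trace (1\<^sub>m n) = nat_sum n"
  by (simp add: mat_trace_def nat_sum_def)

text \<open>If 1 were a double z + z, then 2 would divide 1; hence n times 1 is a double for even n
  only. The assumption that 2 is not a unit enters the parity argument through this
  equivalence.\<close>

lemma nat_sum_even:
  assumes two: "\<not> (1 + 1 :: 'a::{comm_ring, comm_monoid_mult}) dvd 1"
  shows "eq2 (nat_sum n :: 'a) 0 \<longleftrightarrow> even n"
proof -
  have e: "eq2 (nat_sum n :: 'a) 0" if "even n" for n
    using that eq2_double by (auto elim!: evenE simp: mult_2 nat_sum_simps)
  have n1: "\<not> eq2 (1::'a) 0"
  proof
    assume "eq2 (1::'a) 0"
    then obtain z :: 'a where "1 = z + z" by (auto simp: eq2_def)
    then have "1 = (1 + 1) * z" by (simp add: algebra_simps)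
    then have "(1 + 1 :: 'a) dvd 1" by (rule dvdI)
    with two show False by blast
  qed
  have "\<not> eq2 (nat_sum n :: 'a) 0" if odd: "odd n"
  proof
    assume o: "eq2 (nat_sum n :: 'a) 0"
    obtain m where m: "n = Suc m" "even m" using odd by (cases n) auto
    have "eq2 (nat_sum m + (1::'a)) (0 + 1)" by (intro eq2_add e m eq2_refl)
    then have "eq2 (1::'a) 0" using o unfolding m(1) nat_sum_simps by (metis add_0 eq2_sym eq2_trans)
    with n1 show False by blast
  qed
  with e show ?thesis by blast
qed

lemma nat_sum_eq2:
  assumes two: "\<not> (1 + 1 :: 'a::{comm_ring, comm_monoid_mult}) dvd 1" and e: "eq2 (nat_sum m :: 'a) (nat_sum n)"
  shows "even (int m - int n)"
proof -
  have "eq2 (nat_sum (m + n) :: 'a) (nat_sum n + nat_sum n)" unfolding nat_sum_simps by (intro eq2_add e eq2_refl)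
  then have "eq2 (nat_sum (m + n) :: 'a) 0" using eq2_double eq2_trans by blast
  then show ?thesis unfolding nat_sum_even[OF two] by simp
qed

section \<open>Total ranks and traces of chain maps\<close>

definition total_rank :: "'a::{comm_ring, comm_monoid_mult} cpx \<Rightarrow> nat" where
  "total_rank X = (\<Sum>i | rk X i \<noteq> 0. rk X i)"

text \<open>The range is symmetric about 0, so it is stable under the index reversal of the duality.
  The endpoints belong to the vanishing range, so boundary terms of index-shifted sums are
  zero.\<close>

definition supported :: "int \<Rightarrow> 'a::{comm_ring, comm_monoid_mult} cpx \<Rightarrow> bool" where
  "supported K X \<longleftrightarrow> (\<forall>i. i \<le> - K \<or> K \<le> i \<longrightarrow> rk X i = 0)"

lemma supported_exists: "is_cpx X \<Longrightarrow> \<exists>K. supported K X"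
proof -
  assume X: "is_cpx X"
  obtain K where K: "\<And>i. rk X i \<noteq> 0 \<Longrightarrow> i \<le> K"
    using bdd_above_finite[OF is_cpx_simps(4)[OF X]] unfolding bdd_above_def by blast
  obtain k where k: "\<And>i. rk X i \<noteq> 0 \<Longrightarrow> k \<le> i"
    using bdd_below_finite[OF is_cpx_simps(4)[OF X]] unfolding bdd_below_def by blast
  have "supported (max (K + 1) (1 - k)) X" unfolding supported_def using K k by fastforce
  then show ?thesis ..
qed

lemma supported_mono: "supported K X \<Longrightarrow> K \<le> K' \<Longrightarrow> supported K' X"
  unfolding supported_def by auto

lemma total_rank_supported: "supported K X \<Longrightarrow> total_rank X = (\<Sum>i\<in>{- K..K}. rk X i)"
  unfolding total_rank_def
proof (rule sum.mono_neutral_left)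
  assume K: "supported K X"
  show "{i. rk X i \<noteq> 0} \<subseteq> {- K..K}"
  proof
    fix i assume "i \<in> {i. rk X i \<noteq> 0}"
    with K[unfolded supported_def, rule_format, of i] show "i \<in> {- K..K}" by force
  qed
qed auto

text \<open>By cyclicity the trace of l d V in degree i is, up to sign, the trace
  \<open>t (i + 1)\<close> of d l V in degree i + 1, so the whole sum is congruent to twice the sum
  of \<open>t\<close>. \<open>V\<close> may also anticommute with the differential, since signs are
  invisible modulo 2; that case arises from a double dual.\<close>

lemma trace_null_homotopic:
  fixes X :: "'a::{comm_ring, comm_monoid_mult} cpx"
  assumes X: "is_cpx X" and K: "supported K X" and l: "\<And>i. l i \<in> carrier_mat (rk X (i - 1)) (rk X i)"
    and V: "\<And>i. V i \<in> carrier_mat (rk X i) (rk X i)" "\<And>i. df X i * V i = V (i + 1) * df X i \<or> df X i * V i = - (V (i + 1) * df X i)"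
  shows "eq2 (\<Sum>i\<in>{- K..K}. mat_trace ((df X (i - 1) * l i + l (i + 1) * df X i) * V i)) 0"
proof -
  define t where "t i = mat_trace (df X (i - 1) * (l i * V i))" for i
  note d = is_cpx_simps(1,2)[OF X] carrier_matD[OF V(1)] carrier_matD(2)[OF l]
  have d1: "dim_row (df X (i - 1)) = rk X i" "dim_row (l (i + 1)) = rk X i" "dim_row (l i) = rk X (i - 1)" for i
    using d(1)[of "i - 1"] carrier_matD(1)[OF l, of "i + 1"] carrier_matD(1)[OF l, of i] by simp_all
  have step: "eq2 (mat_trace ((df X (i - 1) * l i + l (i + 1) * df X i) * V i)) (t i + t (i + 1))" for i
  proof -
    have "mat_trace ((df X (i - 1) * l i + l (i + 1) * df X i) * V i) = t i + mat_trace (l (i + 1) * (df X i * V i))"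
      by (simp add: t_def mat_distrib mat_assoc mat_trace_add d d1)
    moreover have "t (i + 1) = mat_trace (l (i + 1) * (V (i + 1) * df X i))"
      unfolding t_def by (subst mat_trace_mult_comm) (simp_all add: d d1 mat_assoc)
    moreover have "eq2 (mat_trace (l (i + 1) * (df X i * V i))) (mat_trace (l (i + 1) * (V (i + 1) * df X i)))"
      using V(2)[of i]
    proof
      assume "df X i * V i = - (V (i + 1) * df X i)"
      then have "mat_trace (l (i + 1) * (df X i * V i)) = - mat_trace (l (i + 1) * (V (i + 1) * df X i))"
        by (simp add: uminus_mult mat_trace_uminus d d1)
      then show ?thesis by (simp add: eq2_uminus)
    qed (simp add: eq2_refl)
    ultimately show ?thesis by (simp add: eq2_add eq2_refl)
  qed
  have z: "t (- K) = 0" "t (K + 1) = 0"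
    using K by (auto simp: t_def supported_def d intro!: mat_trace_zero_dim)
  have "sum t {- K..K} = sum t {- K + 1..K}"
  proof (rule sum.mono_neutral_right)
    show "\<forall>i\<in>{- K..K} - {- K + 1..K}. t i = 0"
    proof
      fix i assume "i \<in> {- K..K} - {- K + 1..K}"
      then have "i = - K" by auto
      then show "t i = 0" using z(1) by simp
    qed
  qed auto
  moreover have "sum t {- K + 1..K + 1} = sum t {- K + 1..K}"
  proof (rule sum.mono_neutral_right)
    show "\<forall>i\<in>{- K + 1..K + 1} - {- K + 1..K}. t i = 0"
    proof
      fix i assume "i \<in> {- K + 1..K + 1} - {- K + 1..K}"
      then have "i = K + 1" by auto
      then show "t i = 0" using z(2) by simp
    qed
  qed auto
  moreover have "(\<Sum>i\<in>{- K..K}. t (i + 1)) = sum t {- K + 1..K + 1}"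
    by (rule sum.reindex_bij_witness[where i = "\<lambda>i. i - 1" and j = "\<lambda>i. i + 1"]) auto
  ultimately have "(\<Sum>i\<in>{- K..K}. t i + t (i + 1)) = sum t {- K..K} + sum t {- K..K}" by (simp add: sum.distrib)
  note e = this
  have "eq2 (\<Sum>i\<in>{- K..K}. mat_trace ((df X (i - 1) * l i + l (i + 1) * df X i) * V i)) (\<Sum>i\<in>{- K..K}. t i + t (i + 1))"
    by (rule eq2_sum) (rule step)
  then show ?thesis unfolding e by (rule eq2_trans[OF _ eq2_double])
qed

lemma trace_homotopic_id:
  fixes X :: "'a::{comm_ring, comm_monoid_mult} cpx"
  assumes X: "is_cpx X" and K: "supported K X" and p: "homotopic_id X p"
    and V: "\<And>i. V i \<in> carrier_mat (rk X i) (rk X i)" "\<And>i. df X i * V i = V (i + 1) * df X i \<or> df X i * V i = - (V (i + 1) * df X i)"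
  shows "eq2 (\<Sum>i\<in>{- K..K}. mat_trace (p i * V i)) (\<Sum>i\<in>{- K..K}. mat_trace (V i))"
proof -
  obtain l where l: "\<And>i. l i \<in> carrier_mat (rk X (i - 1)) (rk X i)"
    "\<And>i. p i = 1\<^sub>m (rk X i) + (df X (i - 1) * l i + l (i + 1) * df X i)" using p by (auto simp: homotopic_id_def)
  note d = is_cpx_simps(1,2)[OF X] carrier_matD[OF V(1)] carrier_matD(2)[OF l(1)]
  have d1: "dim_row (df X (i - 1)) = rk X i" "dim_row (l (i + 1)) = rk X i" for i
    using d(1)[of "i - 1"] carrier_matD(1)[OF l(1), of "i + 1"] by simp_all
  have "mat_trace (p i * V i) = mat_trace (V i) + mat_trace ((df X (i - 1) * l i + l (i + 1) * df X i) * V i)" for i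
  proof -
    have "p i * V i = V i + (df X (i - 1) * l i + l (i + 1) * df X i) * V i"
      unfolding l(2) by (subst mat_distrib(2)) (simp_all add: d d1 one_mult)
    then show ?thesis by (simp add: mat_trace_add d d1)
  qed
  then have "(\<Sum>i\<in>{- K..K}. mat_trace (p i * V i)) = (\<Sum>i\<in>{- K..K}. mat_trace (V i)) +
      (\<Sum>i\<in>{- K..K}. mat_trace ((df X (i - 1) * l i + l (i + 1) * df X i) * V i))" by (simp add: sum.distrib)
  with eq2_add[OF eq2_refl trace_null_homotopic[OF X K l(1) V]] show ?thesis by simp
qed

lemma trace_homotopic_id_rank:
  fixes X :: "'a::{comm_ring, comm_monoid_mult} cpx"
  assumes X: "is_cpx X" and K: "supported K X" and p: "homotopic_id X p" "\<And>i. dim_col (p i) = rk X i"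
  shows "eq2 (\<Sum>i\<in>{- K..K}. mat_trace (p i)) (nat_sum (total_rank X))"
  using trace_homotopic_id[OF X K p(1), of "\<lambda>i. 1\<^sub>m (rk X i)"]
  by (simp add: mult_one one_mult p(2) is_cpx_simps[OF X] mat_trace_one total_rank_supported[OF K] nat_sum_sum)

text \<open>For homotopy inverse maps f and g the traces of gf and fg agree in each degree, and
  their sums are congruent to the two total ranks. Modulo 2 this is the invariance of the Euler
  characteristic.\<close>

lemma total_rank_quis:
  fixes X Y :: "'a::{comm_ring, comm_monoid_mult} cpx"
  assumes X: "is_cpx X" and Y: "is_cpx Y" and h: "h \<in> quis X Y"
  shows "eq2 (nat_sum (total_rank X) :: 'a) (nat_sum (total_rank Y))"
proof -
  obtain f where f: "h = (0, f)" "chain_map X Y f" using h quis_iff[OF X Y] by (cases h) auto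
  obtain g where g: "chain_map Y X g" "homotopic_id X (\<lambda>i. g i * f i)" "homotopic_id Y (\<lambda>i. f i * g i)"
    using quis_homotopy_inverse[OF X Y] h f(1) by blast
  obtain K K' where "supported K X" "supported K' Y" using supported_exists X Y by blast
  then have K: "supported (max K K') X" "supported (max K K') Y" using supported_mono by fastforce+
  note d = chain_map_simps(1,2)[OF f(2)] chain_map_simps(1,2)[OF g(1)]
  have "mat_trace (g i * f i) = mat_trace (f i * g i)" for i by (rule mat_trace_mult_comm) (simp_all add: d)
  with trace_homotopic_id_rank[OF X K(1) g(2)] trace_homotopic_id_rank[OF Y K(2) g(3)] show ?thesis
    using eq2_sym eq2_trans by (simp add: d) blast
qed

text \<open>With \<open>\<psi>\<close> a homotopy inverse of \<open>q\<close>, the trace of \<open>\<psi> q \<psi>\<^sup>\<or> q\<close> is the total rank modulo \<open>2\<close>.  Its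
  terms in degrees \<open>i\<close> and \<open>-i\<close> agree, and the one in degree \<open>0\<close> is the trace of a symmetric matrix
  times \<open>B + B\<^sup>T\<close>.\<close>

lemma total_rank_even_form:
  fixes Z :: "'a::{comm_ring, comm_monoid_mult} cpx"
  assumes Z: "is_cpx Z" and q: "(0, q) \<in> quis Z (dual_cpx 0 Z)"
    and sym: "\<And>i. transpose_mat (q (- i)) = ksign i \<cdot>\<^sub>m q i"
    and B: "B \<in> carrier_mat (rk Z 0) (rk Z 0)" "q 0 = B + transpose_mat B"
  shows "eq2 (nat_sum (total_rank Z) :: 'a) 0"
proof -
  let ?D = "dual_cpx 0 Z"
  note D = is_cpx_dual[OF Z, of 0]
  have qc: "chain_map Z ?D q" using q quis_iff[OF Z D] by simp
  obtain p where p: "chain_map ?D Z p" "homotopic_id Z (\<lambda>i. p i * q i)" "homotopic_id ?D (\<lambda>i. q i * p i)"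
    using quis_homotopy_inverse[OF Z D q] by blast
  have rD: "rk ?D i = rk Z (- i)" for i by (simp add: dual_cpx_def)
  have dD: "df ?D i = ksign (i + 1) \<cdot>\<^sub>m transpose_mat (df Z (- i - 1))" for i by (simp add: dual_cpx_def)
  note d = chain_map_simps(1,2)[OF qc] chain_map_simps(1,2)[OF p(1)] rD is_cpx_simps(1,2)[OF Z]
  obtain K where K: "supported K Z" using supported_exists[OF Z] by blast
  then have KD: "supported K ?D" by (auto simp: supported_def rD)
  have ks: "ksign i \<cdot>\<^sub>m (ksign i \<cdot>\<^sub>m M) = M" for i and M :: "'a mat" by (auto intro!: eq_matI simp: mult.assoc[symmetric])
  have ks1: "ksign i \<cdot>\<^sub>m M = M \<or> ksign i \<cdot>\<^sub>m M = - M" for i and M :: "'a mat"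
    by (cases "even i") (auto simp: ksign_def minus_mats)
  have qt: "q i = ksign i \<cdot>\<^sub>m transpose_mat (q (- i))" for i by (simp add: sym ks)
  have qt': "q (- i) = ksign i \<cdot>\<^sub>m transpose_mat (q i)" for i using qt[of "- i"] by simp
  \<comment> \<open>\<open>p\<close> is the homotopy inverse \<psi>, and \<open>W\<close> is its
    dual composed with \<open>q\<close>, a chain map from Z to the double dual. The double dual has
    the same ranks as Z but differential \<open>- df Z\<close>, so \<open>W\<close> is an
    endomorphism in each degree that anticommutes with the differential (\<open>Wc\<close>).\<close>
  define W where "W i = transpose_mat (p (- i)) * q i" for i
  have Wd: "dim_row (W i) = rk Z i" "dim_col (W i) = rk Z i" for i by (simp_all add: W_def d)
  have Wc: "df Z i * W i = - (W (i + 1) * df Z i)" for i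
  proof -
    have "transpose_mat (df Z (- i - 1) * p (- i - 1)) = transpose_mat (p (- i) * df ?D (- i - 1))"
      using chain_map_simps(3)[OF p(1), of "- i - 1"] by simp
    then have "transpose_mat (p (- i - 1)) * transpose_mat (df Z (- i - 1)) = ksign i \<cdot>\<^sub>m (df Z i * transpose_mat (p (- i)))"
      by (simp add: mat_transpose_mult d dD transpose_smult smult_mult)
    then have 1: "df Z i * transpose_mat (p (- i)) = ksign i \<cdot>\<^sub>m (transpose_mat (p (- i - 1)) * transpose_mat (df Z (- i - 1)))"
      by (simp add: ks)
    have "ksign (i + 1) \<cdot>\<^sub>m (transpose_mat (df Z (- i - 1)) * q i) = q (i + 1) * df Z i"
      using chain_map_simps(3)[OF qc, of i] by (simp add: dD smult_mult d)
    then have 2: "transpose_mat (df Z (- i - 1)) * q i = ksign (i + 1) \<cdot>\<^sub>m (q (i + 1) * df Z i)"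
      using ks[of "i + 1" "transpose_mat (df Z (- i - 1)) * q i"] by simp
    have "df Z i * W i = (df Z i * transpose_mat (p (- i))) * q i" by (simp add: W_def mat_assoc d)
    also have "\<dots> = ksign i \<cdot>\<^sub>m (transpose_mat (p (- i - 1)) * (transpose_mat (df Z (- i - 1)) * q i))"
      unfolding 1 by (simp add: smult_mult mat_assoc d)
    also have "\<dots> = ksign i \<cdot>\<^sub>m (ksign (i + 1) \<cdot>\<^sub>m (transpose_mat (p (- i - 1)) * (q (i + 1) * df Z i)))"
      unfolding 2 by (simp add: smult_mult d)
    also have "\<dots> = - (transpose_mat (p (- i - 1)) * (q (i + 1) * df Z i))"
      by (auto intro!: eq_matI simp: ksign_def)
    also have "transpose_mat (p (- i - 1)) * (q (i + 1) * df Z i) = W (i + 1) * df Z i"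
      by (simp add: W_def mat_assoc d)
    finally show ?thesis .
  qed
  define T where "T i = mat_trace (p i * q i * W i)" for i
  \<comment> \<open>The factor \<open>p i * q i\<close> is homotopic to the identity and may be
    dropped. What remains, \<open>W i\<close>, is up to sign the transpose of q p in degree -i,
    again homotopic to the identity, so its traces sum to the total rank.\<close>
  have s1: "eq2 (sum T {- K..K}) (\<Sum>i\<in>{- K..K}. mat_trace (W i))"
    unfolding T_def by (rule trace_homotopic_id[OF Z K p(2)]) (auto intro!: carrier_matI simp: Wd Wc)
  have "eq2 (mat_trace (W i)) (mat_trace (q (- i) * p (- i)))" for i
  proof -
    have "W i = ksign i \<cdot>\<^sub>m transpose_mat (q (- i) * p (- i))"
      unfolding W_def by (subst qt) (simp add: mat_transpose_mult smult_mult d)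
    with ks1[of i "transpose_mat (q (- i) * p (- i))"] have "mat_trace (W i) = mat_trace (q (- i) * p (- i)) \<or> mat_trace (W i) = - mat_trace (q (- i) * p (- i))"
      by (auto simp: mat_trace_uminus mat_trace_transpose d)
    then show ?thesis using eq2_refl eq2_uminus by metis
  qed
  then have s2: "eq2 (\<Sum>i\<in>{- K..K}. mat_trace (W i)) (\<Sum>i\<in>{- K..K}. mat_trace (q (- i) * p (- i)))" by (rule eq2_sum)
  have s3: "(\<Sum>i\<in>{- K..K}. mat_trace (q (- i) * p (- i))) = (\<Sum>i\<in>{- K..K}. mat_trace (q i * p i))"
    by (rule sum.reindex_bij_witness[where i = uminus and j = uminus]) auto
  have s4: "eq2 (\<Sum>i\<in>{- K..K}. mat_trace (q i * p i)) (nat_sum (total_rank ?D))"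
    by (rule trace_homotopic_id_rank[OF D KD p(3)]) (simp add: d)
  have "total_rank ?D = total_rank Z"
    unfolding total_rank_supported[OF K] total_rank_supported[OF KD] rD
    by (rule sum.reindex_bij_witness[where i = uminus and j = uminus]) auto
  with s1 s2 s3 s4 have main: "eq2 (sum T {- K..K}) (nat_sum (total_rank Z))" by (metis eq2_trans)
  \<comment> \<open>Symmetry replaces both factors \<open>q (- i)\<close> by transposes of
    \<open>q i\<close>; the sign occurs twice and cancels. Transposing the product and rotating it
    cyclically gives \<open>T i\<close>.\<close>
  have Tsym: "T (- i) = T i" for i
  proof -
    let ?M = "q i * (p i * q i * transpose_mat (p (- i)))"
    have "T (- i) = mat_trace (p (- i) * q (- i) * (transpose_mat (p i) * q (- i)))" by (simp add: T_def W_def)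
    also have "p (- i) * q (- i) * (transpose_mat (p i) * q (- i)) =
       ksign i \<cdot>\<^sub>m (ksign i \<cdot>\<^sub>m (p (- i) * transpose_mat (q i) * (transpose_mat (p i) * transpose_mat (q i))))"
      unfolding qt' by (simp add: smult_mult d)
    also have "\<dots> = transpose_mat ?M" by (simp add: ks mat_transpose_mult mat_assoc d)
    also have "mat_trace (transpose_mat ?M) = mat_trace ?M" by (rule mat_trace_transpose) (simp add: d)
    also have "\<dots> = mat_trace (p i * q i * transpose_mat (p (- i)) * q i)" by (rule mat_trace_mult_comm) (simp_all add: d)
    also have "\<dots> = T i" unfolding T_def W_def by (subst mat_assoc) (simp_all add: d)
    finally show ?thesis .
  qed
  have T0: "eq2 (T 0) 0"
  proof -
    \<comment> \<open>\<open>q 0\<close> is symmetric, hence so is \<open>S\<close>, and B and its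
      transpose have equal traces against a symmetric matrix.\<close>
    define S where "S = p 0 * q 0 * transpose_mat (p 0)"
    have dS: "dim_row S = rk Z 0" "dim_col S = rk Z 0" by (simp_all add: S_def d)
    have q0: "transpose_mat (q 0) = q 0" using sym[of 0] by (simp add: minus_mats)
    have St: "transpose_mat S = S" by (simp add: S_def mat_transpose_mult mat_assoc d q0)
    note dB = carrier_matD[OF B(1)]
    have "T 0 = mat_trace (S * q 0)" unfolding T_def W_def S_def by (subst mat_assoc) (simp_all add: d)
    also have "\<dots> = mat_trace (S * B) + mat_trace (S * transpose_mat B)"
      unfolding B(2) by (simp add: mat_distrib mat_trace_add dS dB)
    also have "mat_trace (S * transpose_mat B) = mat_trace (transpose_mat (B * S))"
      by (simp add: mat_transpose_mult dS dB St)
    also have "\<dots> = mat_trace (S * B)"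
      using mat_trace_mult_comm[of B S] by (simp add: mat_trace_transpose dS dB)
    finally show ?thesis by (simp add: eq2_double)
  qed
  have "eq2 (sum T {- K..K}) 0"
  proof (cases "K \<ge> 0")
    case True
    then have "{- K..K} = {- K..-1} \<union> ({0} \<union> {1..K})" by auto
    then have "sum T {- K..K} = sum T {- K..-1} + (T 0 + sum T {1..K})" by (simp add: sum.union_disjoint)
    also have "sum T {- K..-1} = sum T {1..K}"
      by (rule sum.reindex_bij_witness[where i = uminus and j = uminus]) (auto simp: Tsym)
    finally have e: "sum T {- K..K} = T 0 + (sum T {1..K} + sum T {1..K})" by (simp add: algebra_simps)
    show ?thesis unfolding e using eq2_add[OF T0 eq2_double[of "sum T {1..K}"]] by simp
  qed (simp add: eq2_refl)
  with main show ?thesis using eq2_sym eq2_trans by blast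
qed

text \<open>By cyclicity the trace of f r + s g = 1 is the sum of the traces of r f = 1 and g s = 1.
  The equality is one of elements of R, since over the zero ring the ranks themselves need not add
  up.\<close>

lemma exact_seq_rank:
  assumes "is_cpx X" "is_cpx Y" "is_cpx Z" "exact_seq (Cpx m :: ('a::{comm_ring, comm_monoid_mult} cpx, 'a gmap) dgcat) (X, f, Y, g, Z)"
  shows "(nat_sum (rk Y i) :: 'a) = nat_sum (rk X i + rk Z i)"
proof -
  obtain r s where f: "f \<in> dg_hom (Cpx m) X Y 0" and g: "g \<in> dg_hom (Cpx m) Y Z 0" and "split_by (Cpx m) (X, f, Y, g, Z) r s"
    using assms(4) by (auto simp: exact_seq_def Z0_hom_def)
  then have r: "r \<in> dg_hom (Cpx m) Y X 0" and s: "s \<in> dg_hom (Cpx m) Z Y 0" and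
    e: "dg_comp (Cpx m) r f = dg_id (Cpx m) X" "dg_add (Cpx m) (dg_comp (Cpx m) f r) (dg_comp (Cpx m) s g) = dg_id (Cpx m) Y"
      "dg_comp (Cpx m) g s = dg_id (Cpx m) Z" by (auto simp: split_by_def)
  obtain f' where f': "f = (0, f')" "\<And>i. dim_row (f' i) = rk Y (i + 0)" "\<And>i. dim_col (f' i) = rk X i" using f by (rule Cpx_homE) blast
  obtain g' where g': "g = (0, g')" "\<And>i. dim_row (g' i) = rk Z (i + 0)" "\<And>i. dim_col (g' i) = rk Y i" using g by (rule Cpx_homE) blast
  obtain r' where r': "r = (0, r')" "\<And>i. dim_row (r' i) = rk X (i + 0)" "\<And>i. dim_col (r' i) = rk Y i" using r by (rule Cpx_homE) blast
  obtain s' where s': "s = (0, s')" "\<And>i. dim_row (s' i) = rk Y (i + 0)" "\<And>i. dim_col (s' i) = rk Z i" using s by (rule Cpx_homE) blast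
  have m: "r' i * f' i = 1\<^sub>m (rk X i)" "f' i * r' i + s' i * g' i = 1\<^sub>m (rk Y i)" "g' i * s' i = 1\<^sub>m (rk Z i)"
    using e by (simp_all add: f'(1) g'(1) r'(1) s'(1) Cpx_sel fun_eq_iff)
  have "nat_sum (rk Y i) = mat_trace (f' i * r' i + s' i * g' i)" unfolding m(2) mat_trace_one ..
  also have "\<dots> = mat_trace (f' i * r' i) + mat_trace (s' i * g' i)" by (rule mat_trace_add) (simp_all add: f' g' r' s')
  also have "mat_trace (f' i * r' i) = mat_trace (r' i * f' i)" by (rule mat_trace_mult_comm) (simp_all add: f' r')
  also have "mat_trace (s' i * g' i) = mat_trace (g' i * s' i)" by (rule mat_trace_mult_comm) (simp_all add: g' s')
  finally show ?thesis unfolding m mat_trace_one nat_sum_simps .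
qed

lemma total_rank_add:
  fixes X Y Z :: "'a::{comm_ring, comm_monoid_mult} cpx"
  assumes "is_cpx X" "is_cpx Y" "is_cpx Z" "\<And>i. (nat_sum (rk Y i) :: 'a) = nat_sum (rk X i + rk Z i)"
  shows "(nat_sum (total_rank Y) :: 'a) = nat_sum (total_rank X + total_rank Z)"
proof -
  obtain K1 K2 K3 where "supported K1 X" "supported K2 Y" "supported K3 Z" using supported_exists assms(1-3) by metis
  then have K: "supported (max K1 (max K2 K3)) X" "supported (max K1 (max K2 K3)) Y" "supported (max K1 (max K2 K3)) Z"
    by (auto intro: supported_mono)
  show ?thesis
    unfolding K[THEN total_rank_supported] sum.distrib[symmetric] nat_sum_sum[OF finite_atLeastAtMost_int] assms(4) ..
qed

text \<open>The splitting is given by \<open>p\<close> and \<open>j\<close>. Rank additivity for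
  exact sequences thereby covers orthogonal sums as well as the hyperbolic space in
  \<open>gw_exact\<close>.\<close>

lemma biproduct_exact:
  "biproduct A X Y S i j p q \<Longrightarrow> exact_seq A (X, i, S, q, Y)"
  unfolding biproduct_def exact_seq_def split_by_def Z0_hom_def by auto


section \<open>Rank parity of the defining relations and of forms on cones\<close>

abbreviation "rank_weight \<equiv> (\<lambda>x. int (total_rank (fst x)))"

lemma gw_relators_rank_even:
  assumes two: "\<not> (1 + 1 :: 'a::{comm_ring, comm_monoid_mult}) dvd 1"
    and r: "r \<in> gw_relators (Cpx 0 :: ('a cpx, 'a gmap) dgcat) quis"
  shows "even (frag_weight rank_weight r)"
  using r
proof cases
  case (gw_sum X \<phi> Y \<psi> S i j p q \<omega>)
  then have o: "is_cpx X" "is_cpx S" "is_cpx Y" by (auto simp: biproduct_def Cpx_sel)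
  have "even (int (total_rank S) - int (total_rank X + total_rank Y))"
    by (rule nat_sum_eq2[OF two])
       (use total_rank_add[OF o exact_seq_rank[OF o biproduct_exact[OF gw_sum(4)]]] in \<open>simp add: eq2_refl\<close>)
  then show ?thesis by (simp add: gw_sum(1))
next
  case (gw_isometry Y \<psi> X g)
  then have o: "is_cpx X" "is_cpx Y" by (auto simp: sym_spaces_def Cpx_sel)
  have "even (int (total_rank X) - int (total_rank Y))"
    by (rule nat_sum_eq2[OF two total_rank_quis[OF o gw_isometry(5)]])
  then show ?thesis by (simp add: gw_isometry(1))
next
  case (gw_exact Em f E0 g Ep \<phi>m \<phi>0 \<phi>p S i j p q \<omega>)
  have o: "is_cpx Em" "is_cpx E0" "is_cpx Ep" "is_cpx S" using gw_exact(2,10) by (auto simp: biproduct_def exact_seq_def Cpx_sel)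
  have "(nat_sum (total_rank E0) :: 'a) = nat_sum (total_rank S)"
    unfolding total_rank_add[OF o(1,2,3) exact_seq_rank[OF o(1,2,3) gw_exact(2)]]
      total_rank_add[OF o(1,4,3) exact_seq_rank[OF o(1,4,3) biproduct_exact[OF gw_exact(10)]]] ..
  then have "even (int (total_rank E0) - int (total_rank S))" by (intro nat_sum_eq2[OF two]) (simp add: eq2_refl)
  then show ?thesis by (simp add: gw_exact(1))
qed

text \<open>A symmetric form on an arrow from X to Y consists of a map \<open>a\<close> from X to
  the dual of Y and a map \<open>b\<close> from Y to the dual of X, which symmetry makes the
  transpose of \<open>a\<close>. The form on the cone is antidiagonal with blocks \<open>a\<close>
  and, up to sign, \<open>b\<close>; in degree 0 there is no sign, and it has the shape B +
  B^T.\<close>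

lemma cone_form_rank_even:
  assumes two: "\<not> (1 + 1 :: 'a::{comm_ring, comm_monoid_mult}) dvd 1"
    and x: "x \<in> sym_spaces (Fun1 (Cpx (- 1)) :: ('a cpx \<times> 'a gmap \<times> 'a cpx, 'a gmap \<times> 'a gmap) dgcat) w_cone"
  shows "even (rank_weight (form_map (Cpx 0) cone_ob cone_hom (cone_phi (- 1)) x))"
proof -
  interpret cone: dg_form_functor "Fun1 (Cpx (- 1))" "Cpx 0 :: ('a cpx, 'a gmap) dgcat" cone_ob cone_hom cone_eta cone_eta "cone_phi (- 1)" w_cone quis
    by (rule cone_dg_form_functor)
  let ?A = "Fun1 (Cpx (- 1)) :: ('a cpx \<times> 'a gmap \<times> 'a cpx, 'a gmap \<times> 'a gmap) dgcat"
  obtain F \<phi> where F\<phi>: "x = (F, \<phi>)" by (cases x)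
  have F0: "F \<in> dg_ob ?A" and \<phi>: "\<phi> \<in> Z0_hom ?A F (dg_dual ?A F)" and s: "dg_comp ?A (dg_dual_hom ?A \<phi>) (dg_can ?A F) = \<phi>"
    using x by (auto simp: sym_spaces_def F\<phi>)
  obtain X f Y where F: "F = (X, (0, f), Y)" "is_cpx X" "is_cpx Y" "chain_map X Y f" using F0 by (rule Fun1_obE)
  obtain f' where D: "dg_dual ?A F = (dual_cpx (- 1) Y, (0, f'), dual_cpx (- 1) X)" by (simp add: F(1) Fun1_sel Cpx_sel)
  obtain a b where h: "\<phi> = ((0, a), (0, b))" "\<And>i. dim_row (a i) = rk (dual_cpx (- 1) Y) (i + 0)" "\<And>i. dim_col (a i) = rk X i"
      "\<And>i. dim_row (b i) = rk (dual_cpx (- 1) X) (i + 0)" "\<And>i. dim_col (b i) = rk Y i"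
    using cone.A.Z0_in[OF \<phi>] unfolding D unfolding F(1) by (rule Fun1_homE) blast
  have d: "dim_row (a i) = rk Y (1 - i)" "dim_col (a i) = rk X i" "dim_row (b i) = rk X (1 - i)" "dim_col (b i) = rk Y i" for i
    using h by (simp_all add: dual_cpx_def)
  \<comment> \<open>The canonical map of the duality of index -1 has sign exponent i (1 - i), which
    is even, so symmetry means transposition without a sign.\<close>
  have ba: "b i = transpose_mat (a (1 - i))" for i
  proof -
    have "(ksign (i * (1 - i)) :: 'a) = 1" for i by (simp add: ksign_def)
    then have "(\<lambda>i. transpose_mat (a (1 - i)) * 1\<^sub>m (rk Y i)) = b"
      using s by (simp add: h(1) F(1) Fun1_sel Cpx_sel minus_mats)
    from fun_cong[OF this, of i] show ?thesis by (simp add: mult_one d)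
  qed
  define q where "q i = (four_block_mat (0\<^sub>m (rk Y (- i)) (rk Y i)) (a (i + 1)) (ksign i \<cdot>\<^sub>m b i) (0\<^sub>m (rk X (1 - i)) (rk X (i + 1))))" for i
  have qe: "form_map (Cpx 0) cone_ob cone_hom (cone_phi (- 1)) x = (cone_ob F, (0, q))"
    by (simp add: form_map_def F\<phi> F(1) h(1) Cpx_sel q_def fun_eq_iff)
      (simp add: blk_mult d minus_mats mult_zero zero_mult add_zero one_mult smult_mult)
  have Zq: "(cone_ob F, (0, q)) \<in> sym_spaces (Cpx 0) quis" using cone.F_sym[OF x] unfolding qe .
  have Z: "is_cpx (cone_ob F)" by (rule is_cpx_cone[OF F0])
  have qs: "(0, q) \<in> quis (cone_ob F) (dual_cpx 0 (cone_ob F))"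
    and qsym: "dg_comp (Cpx 0) (dg_dual_hom (Cpx 0) (0, q)) (dg_can (Cpx 0) (cone_ob F)) = (0, q)"
    using Zq by (auto simp: sym_spaces_def Cpx_sel)
  \<comment> \<open>The upper right block of \<open>q 0\<close> alone; the lower left block is
    \<open>b 0\<close>, the transpose of \<open>a 1\<close>.\<close>
  define B where "B = four_block_mat (0\<^sub>m (rk Y 0) (rk Y 0)) (a 1) (0\<^sub>m (rk X 1) (rk Y 0)) (0\<^sub>m (rk X 1) (rk X 1))"
  have "eq2 (nat_sum (total_rank (cone_ob F)) :: 'a) 0"
  proof (rule total_rank_even_form[OF Z qs])
    fix i
    have "q i = transpose_mat (q (- i)) * (ksign (i * (- i)) \<cdot>\<^sub>m 1\<^sub>m (rk Y i + rk X (i + 1)))"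
      using qsym by (simp add: Cpx_sel F(1) minus_mats fun_eq_iff)
    moreover have "dim_row (q (- i)) = rk Y i + rk X (i + 1)" by (simp add: q_def d add.commute)
    moreover have "(ksign (i * (- i)) :: 'a) = ksign i" by (simp add: ksign_def)
    ultimately have e: "q i = ksign i \<cdot>\<^sub>m transpose_mat (q (- i))" by (simp add: smult_mult mult_one)
    show "transpose_mat (q (- i)) = ksign i \<cdot>\<^sub>m q i" unfolding e by (auto intro!: eq_matI simp: mult.assoc[symmetric])
  next
    show "B \<in> carrier_mat (rk (cone_ob F) 0) (rk (cone_ob F) 0)" by (intro carrier_matI) (simp_all add: B_def F(1) d)
    show "q 0 = B + transpose_mat B"
      by (simp add: q_def B_def blk_transpose blk_add d ba add_zero minus_mats)
  qed
  then show ?thesis unfolding qe using nat_sum_even[OF two] by simp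
qed

section \<open>The unit form on R\<close>

definition unit_cpx :: "'a::{comm_ring, comm_monoid_mult} cpx" where
  "unit_cpx = \<lparr>rk = (\<lambda>i. if i = 0 then 1 else 0), df = (\<lambda>i. 0\<^sub>m (if i + 1 = 0 then 1 else 0) (if i = 0 then 1 else 0))\<rparr>"

lemma unit_cpx_sym:
  "(unit_cpx, (0, \<lambda>i. 1\<^sub>m (rk (unit_cpx :: 'a cpx) i))) \<in> sym_spaces (Cpx 0 :: ('a::{comm_ring, comm_monoid_mult} cpx, 'a gmap) dgcat) quis"
    (is "(?R, ?\<phi>) \<in> _")
proof -
  have R: "is_cpx ?R" by (auto simp: is_cpx_def unit_cpx_def mult_zero)
  note D = is_cpx_dual[OF R, of 0]
  have c: "chain_map ?R (dual_cpx 0 ?R) (\<lambda>i. 1\<^sub>m (rk (unit_cpx :: 'a cpx) i))"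
    by (auto simp: chain_map_def unit_cpx_def dual_cpx_def intro!: carrier_matI eq_matI)
  have q: "?\<phi> \<in> quis ?R (dual_cpx 0 ?R)"
    by (rule quis_if_iso[OF R D c, of "\<lambda>i. 1\<^sub>m (rk (unit_cpx :: 'a cpx) i)"]) (auto simp: unit_cpx_def dual_cpx_def mult_one)
  have "dg_comp (Cpx 0) (dg_dual_hom (Cpx 0) ?\<phi>) (dg_can (Cpx 0) ?R) = ?\<phi>"
  proof -
    have "transpose_mat (1\<^sub>m (rk (unit_cpx :: 'a cpx) (- i))) * (ksign (i * (- i)) \<cdot>\<^sub>m 1\<^sub>m (rk (unit_cpx :: 'a cpx) i)) = (1\<^sub>m (rk (unit_cpx :: 'a cpx) i) :: 'a mat)" for i
    proof (cases "i = 0")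
      case True
      then show ?thesis by (simp add: mult_one minus_mats)
    next
      case False
      then show ?thesis by (intro eq_matI) (simp_all add: unit_cpx_def)
    qed
    then show ?thesis by (simp add: Cpx_sel minus_mats)
  qed
  with R q show ?thesis by (auto simp: sym_spaces_def Cpx_sel(1,11) quis_def)
qed

lemma total_rank_unit: "total_rank unit_cpx = 1"
proof -
  have "{i::int. rk unit_cpx i \<noteq> 0} = {0}" by (auto simp: unit_cpx_def)
  then show ?thesis unfolding total_rank_def by (simp add: unit_cpx_def)
qed

text \<open>The existence of an induced \<open>h\<close> is asserted separately, so that the
  quantification over \<open>h\<close> in the last clause is not vacuous. \<open>1 + 1\<close>
  dividing \<open>1\<close> expresses that 2 is a unit; in the zero ring this holds.\<close>

theorem proposition2p1:
  "let A = Fun1 (Cpx (- 1)) :: ('a::{comm_ring, comm_monoid_mult} cpx \<times> 'a gmap \<times> 'a cpx, 'a gmap \<times> 'a gmap) dgcat;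
       B = Cpx 0 :: ('a cpx, 'a gmap) dgcat
   in triangulated_equivalence (derived_cat A w_cone) (derived_cat B quis)
        cone_ob (loc_map (Z0 B) quis cone_ob (\<lambda>F G. cone_hom)) \<and>
      (\<exists>h. GW0_induced A w_cone B quis cone_ob cone_hom (cone_phi (- 1)) h) \<and>
      (\<not> (1 + 1 :: 'a) dvd 1 \<longrightarrow>
        (\<forall>h. GW0_induced A w_cone B quis cone_ob cone_hom (cone_phi (- 1)) h \<longrightarrow>
           h ` carrier (GW0 A w_cone) \<noteq> carrier (GW0 B quis)))"
proof -
  interpret cone: dg_form_equivalence "Fun1 (Cpx (- 1))" "Cpx 0 :: ('a cpx, 'a gmap) dgcat"
    cone_ob cone_hom cone_eta cone_eta "cone_phi (- 1)" w_cone quis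
    from_zero "\<lambda>Z Z'. from_zero_hom" cone_pushout "\<lambda>F G. cone_pushout_hom" cone_alpha cone_beta
    by (rule cone_dg_form_equivalence)
  show ?thesis
    unfolding Let_def
  proof (intro conjI impI allI)
    fix h
    assume two: "\<not> (1 + 1 :: 'a) dvd 1"
      and h: "GW0_induced (Fun1 (Cpx (- 1))) w_cone (Cpx 0 :: ('a cpx, 'a gmap) dgcat) quis cone_ob cone_hom (cone_phi (- 1)) h"
    show "h ` carrier (GW0 (Fun1 (Cpx (- 1)) :: ('a cpx \<times> 'a gmap \<times> 'a cpx, 'a gmap \<times> 'a gmap) dgcat) w_cone) \<noteq> carrier (GW0 (Cpx 0 :: ('a cpx, 'a gmap) dgcat) quis)"
      by (rule not_surj_if_even[OF h cone.F_sym gw_relators_rank_even[OF two] cone_form_rank_even[OF two] unit_cpx_sym])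
         (simp_all add: total_rank_unit)
  qed (rule cone.F_triangulated_equivalence cone.F_GW0_induced)+
qed

end
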